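(* Let $k\le n$ be natural numbers. Let $\tilde I\subset S_k$ be an initial ideal of $\tilde I_k^{hl}=\psi_{\mathcal C}^{-1}(I^{hl}_{P_k,<})$ such that the monomial ideal $\psi_{\mathcal C}^{-1}(I^m_{P_k,<})$ is an initial ideal of $\tilde I$. Then the zero set of $\tilde I$ in $\mathbb P(\wedge^k\mathbb C^n)$ is a flat degeneration of the Grassmannian $\mathrm{Gr}(k,n)$ such that all of its irreducible components are relative Hibi varieties of the form $H(P_k,<'',<)$.
   Context: $\mathrm{Gr}(k,n)$ is the Grassmannian of $k$-dimensional subspaces of $\mathbb C^n$. $S_k=\mathbb C[\{X_{a_1,\dots,a_k}\}_{1\le a_1<\dots<a_k\le n}]$ is the homogeneous coordinate ring of $\mathbb P(\wedge^k\mathbb C^n)$ (Plücker coordinates). For pairwise distinct $\alpha_1,\dots,\alpha_k\in[1,n]$ put $X_{\alpha_1,\dots,\alpha_k}=(-1)^\sigma X_{\alpha_{\sigma(1)},\dots,\alpha_{\sigma(k)}}$, where $\sigma$ is the permutation sorting the subscripts increasingly. $(P_k,<)$ is the poset of elements $p_{i,j}$, $1\le i\le k$, $k+1\le j\le n$, with $p_{i_1,j_1}\le p_{i_2,j_2}$ iff $i_1\le i_2$ and $j_1\le j_2$. $\mathcal J(P,<)$ is the set of order ideals (lower sets) of a finite poset; $\mathbb C[\mathcal J(P,<)]$ is the polynomial ring in variables $X_J$. $\max_<A$ is the set of $<$-maximal elements of $A$. $J_1*_{P,<}J_2$ is the order ideal of $(P,<)$ generated by $(J_1\cap J_2)\cap(\max_<J_1\cup\max_<J_2)$.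 $I^{hl}_{P,<}$ is generated by the binomials $X_{J_1}X_{J_2}-X_{J_1\cup J_2}X_{J_1*_{P,<}J_2}$, $J_1,J_2\in\mathcal J(P,<)$. $I^m_{P,<}$ is generated by the products $X_{J_1}X_{J_2}$ with $J_1,J_2\in\mathcal J(P,<)$ incomparable under inclusion. $\psi_{\mathcal C}:S_k\to\mathbb C[\mathcal J(P_k,<)]$ is the ring isomorphism defined as follows: for $J\in\mathcal J(P_k,<)$ with maximal elements $p_{i_1,j_1},\dots,p_{i_s,j_s}$ put $\alpha_{i_r}=j_r$ for $r\in[1,s]$ and $\alpha_i=i$ for all other $i\in[1,k]$; then $\psi_{\mathcal C}(X_{\alpha_1,\dots,\alpha_k})=X_J$. It is known that $\tilde I_k^{hl}$ is an initial ideal of the Plücker ideal of $\mathrm{Gr}(k,n)$. An order $<''$ is stronger than $<$ if $p<q$ implies $p<''q$ (equality allowed). For $<''$ stronger than $<$ such that $\mathcal J(P,<'')$ is closed under $*_{P,<}$, the relative Hibi variety $H(P,<'',<)\subset\mathbb P(\mathbb C^{\mathcal J(P,<'')})$ is the zero set of the kernel of $\mathbb C[\mathcal J(P,<'')]\to\mathbb C[\{z_p\}_{p\in P},t]$, $X_J\mapsto t\prod_{p\in\max_<J}z_p$. For $w\in\mathbb R^N$, $\mathrm{in}_wp$ is the sum of the terms of $p$ of minimal $w$-weight, and $\mathrm{in}_wI$ is the span of $\{\mathrm{in}_wp:p\in I\}$; ideals of this form are called initial ideals of $I$. A subvariety $Y\subset\mathbb P^{N-1}$ is a flat degeneration of $X\subset\mathbb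 P^{N-1}$ if there is a flat family $\mathcal X\subset\mathbb P^{N-1}\times\mathbb A^1$ over $\mathbb A^1$ with fibres over all $a\ne0$ isomorphic to $X$ and fibre over $0$ isomorphic to $Y$. *)

theory Defs
  imports
    "HOL-Library.Poly_Mapping"
    "HOL-Combinatorics.Permutations"
    "HOL-Algebra.Free_Abelian_Groups"
    "HOL-Algebra.QuotRing"
    "Jordan_Normal_Form.VS_Connect"
begin

section \<open>Polynomials in a set of variables\<close>

type_synonym ('v, 'a) mpoly = "('v \<Rightarrow>\<^sub>0 nat) \<Rightarrow>\<^sub>0 'a"

definition Const :: "'a::zero \<Rightarrow> ('v, 'a) mpoly" where
  "Const c = Poly_Mapping.single 0 c"

definition Var :: "'v \<Rightarrow> ('v, 'a::zero_neq_one) mpoly" where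
  "Var v = Poly_Mapping.single (Poly_Mapping.single v 1) 1"

definition mpoly_ring :: "'v set \<Rightarrow> ('v, 'a::comm_ring_1) mpoly ring" where
  "mpoly_ring V =
    \<lparr>carrier = {f. \<forall>m \<in> Poly_Mapping.keys f. Poly_Mapping.keys m \<subseteq> V},
     mult = (*), one = 1, zero = 0, add = (+)\<rparr>"

text \<open>The map that applies \<open>h\<close> to the coefficients and replaces each variable \<open>v\<close> by \<open>x v\<close>.\<close>

definition subst :: "('a::zero \<Rightarrow> 'b) \<Rightarrow> ('v \<Rightarrow> 'b) \<Rightarrow> ('v, 'a) mpoly \<Rightarrow> 'b::comm_ring_1" where
  "subst h x f = (\<Sum>m \<in> Poly_Mapping.keys f.
     h (Poly_Mapping.lookup f m) *
       (\<Prod>v \<in> Poly_Mapping.keys m. x v ^ Poly_Mapping.lookup m v))"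

abbreviation eval_at :: "('v \<Rightarrow> 'a) \<Rightarrow> ('v, 'a) mpoly \<Rightarrow> 'a::comm_ring_1" where
  "eval_at \<equiv> subst (\<lambda>c. c)"

definition homogeneous :: "nat \<Rightarrow> ('v, 'a::zero) mpoly \<Rightarrow> bool" where
  "homogeneous d f \<longleftrightarrow>
     (\<forall>m \<in> Poly_Mapping.keys f. (\<Sum>v \<in> Poly_Mapping.keys m. Poly_Mapping.lookup m v) = d)"

definition homogeneous_ideal :: "'v set \<Rightarrow> ('v, 'a::comm_ring_1) mpoly set \<Rightarrow> bool" where
  "homogeneous_ideal V I \<longleftrightarrow>
     (\<exists>S \<subseteq> carrier (mpoly_ring V).
        (\<forall>f \<in> S. \<exists>d. homogeneous d f) \<and> I = Idl\<^bsub>mpoly_ring V\<^esub> S)"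

section \<open>Initial ideals\<close>

definition monomial_weight :: "('v \<Rightarrow> real) \<Rightarrow> ('v \<Rightarrow>\<^sub>0 nat) \<Rightarrow> real" where
  "monomial_weight w m = (\<Sum>v \<in> Poly_Mapping.keys m. w v * real (Poly_Mapping.lookup m v))"

definition initial_form :: "('v \<Rightarrow> real) \<Rightarrow> ('v, 'a::comm_ring_1) mpoly \<Rightarrow> ('v, 'a) mpoly" where
  "initial_form w f =
     (\<Sum>m | m \<in> Poly_Mapping.keys f \<and>
            (\<forall>m' \<in> Poly_Mapping.keys f. monomial_weight w m \<le> monomial_weight w m').
        Poly_Mapping.single m (Poly_Mapping.lookup f m))"

definition is_initial_ideal :: "('v, complex) mpoly set \<Rightarrow> ('v, complex) mpoly set \<Rightarrow> bool" where
  "is_initial_ideal J I \<longleftrightarrow>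
     (\<exists>w. J = Modules.module.span (\<lambda>c f. Const c * f) (initial_form w ` I))"

section \<open>Projective varieties\<close>

text \<open>For a finite set \<open>V\<close> the vectors of $\mathbb C^V$ are the functions vanishing outside \<open>V\<close>,
  and a point of $\mathbb P(\mathbb C^V)$ is a one-dimensional subspace, given as a set of vectors.
  Hence for \<open>V \<subseteq> V'\<close> one has \<open>proj_space V \<subseteq> proj_space V'\<close>, the embedding
  as a coordinate subspace.\<close>

type_synonym 'v point = "('v \<Rightarrow> complex) set"

definition line :: "('v \<Rightarrow> complex) \<Rightarrow> 'v point" where
  "line x = {\<lambda>v. c * x v | c. True}"

definition proj_space :: "'v set \<Rightarrow> 'v point set" where
  "proj_space V = {line x | x. (\<forall>v. v \<notin> V \<longrightarrow> x v = 0) \<and> (\<exists>v. x v \<noteq> 0)}"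

definition zero_set :: "'v set \<Rightarrow> ('v, complex) mpoly set \<Rightarrow> 'v point set" where
  "zero_set V S = {L \<in> proj_space V. \<forall>f \<in> S. \<forall>x \<in> L. eval_at x f = 0}"

definition zariski_closed :: "'v set \<Rightarrow> 'v point set \<Rightarrow> bool" where
  "zariski_closed V X \<longleftrightarrow>
     (\<exists>S \<subseteq> carrier (mpoly_ring V). (\<forall>f \<in> S. \<exists>d. homogeneous d f) \<and> X = zero_set V S)"

definition zariski_irreducible :: "'v set \<Rightarrow> 'v point set \<Rightarrow> bool" where
  "zariski_irreducible V Z \<longleftrightarrow> Z \<noteq> {} \<and>
     (\<forall>A B. zariski_closed V A \<and> zariski_closed V B \<and> Z \<subseteq> A \<union> B \<longrightarrow> Z \<subseteq> A \<or> Z \<subseteq> B)"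

definition irreducible_components :: "'v set \<Rightarrow> 'v point set \<Rightarrow> 'v point set set" where
  "irreducible_components V X =
     {Z. Z \<subseteq> X \<and> zariski_irreducible V Z \<and>
         (\<forall>Z'. Z \<subseteq> Z' \<and> Z' \<subseteq> X \<and> zariski_irreducible V Z' \<longrightarrow> Z' = Z)}"

text \<open>Morphisms of projective varieties: maps that, on a Zariski neighbourhood (here \<open>X - A\<close>) of
  each point, are given by homogeneous polynomials of a common degree without common zeros.\<close>

definition regular_map ::
    "'v set \<Rightarrow> 'v point set \<Rightarrow> 'w set \<Rightarrow> 'w point set \<Rightarrow> ('v point \<Rightarrow> 'w point) \<Rightarrow> bool" where
  "regular_map V X W Y \<phi> \<longleftrightarrow> \<phi> ` X \<subseteq> Y \<and>
     (\<forall>L \<in> X. \<exists>A F d. zariski_closed V A \<and> L \<notin> A \<and>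
        (\<forall>w \<in> W. F w \<in> carrier (mpoly_ring V) \<and> homogeneous d (F w)) \<and>
        (\<forall>M \<in> X - A. \<forall>x \<in> M - {\<lambda>_. 0}.
           (\<exists>w \<in> W. eval_at x (F w) \<noteq> 0) \<and>
           \<phi> M = line (\<lambda>w. if w \<in> W then eval_at x (F w) else 0)))"

definition isomorphic_varieties ::
    "'v set \<Rightarrow> 'v point set \<Rightarrow> 'w set \<Rightarrow> 'w point set \<Rightarrow> bool" where
  "isomorphic_varieties V X W Y \<longleftrightarrow>
     (\<exists>\<phi> \<psi>. regular_map V X W Y \<phi> \<and> regular_map W Y V X \<psi> \<and>
        (\<forall>L \<in> X. \<psi> (\<phi> L) = L) \<and> (\<forall>M \<in> Y. \<phi> (\<psi> M) = M))"

section \<open>Flat modules\<close>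

text \<open>An \<open>A\<close>-module \<open>M\<close> is flat iff the canonical map $J \otimes_A M \to M$,
  $a \otimes m \mapsto am$, is injective for every ideal \<open>J\<close> of \<open>A\<close>. The tensor product is the
  free abelian group on \<open>J \<times> M\<close> modulo the bilinearity relations.\<close>

definition tensor_relations ::
    "('a, 'm) ring_scheme \<Rightarrow> 'a set \<Rightarrow> ('a, 'b, 'n) module_scheme \<Rightarrow> (('a \<times> 'b) \<Rightarrow>\<^sub>0 int) set" where
  "tensor_relations A J M =
     {frag_of (a \<oplus>\<^bsub>A\<^esub> b, m) - frag_of (a, m) - frag_of (b, m) | a b m.
        a \<in> J \<and> b \<in> J \<and> m \<in> carrier M} \<union>
     {frag_of (a, l \<oplus>\<^bsub>M\<^esub> m) - frag_of (a, l) - frag_of (a, m) | a l m.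
        a \<in> J \<and> l \<in> carrier M \<and> m \<in> carrier M} \<union>
     {frag_of (r \<otimes>\<^bsub>A\<^esub> a, m) - frag_of (a, r \<odot>\<^bsub>M\<^esub> m) | r a m.
        r \<in> carrier A \<and> a \<in> J \<and> m \<in> carrier M}"

definition ideal_tensor ::
    "('a, 'm) ring_scheme \<Rightarrow> 'a set \<Rightarrow> ('a, 'b, 'n) module_scheme \<Rightarrow> (('a \<times> 'b) \<Rightarrow>\<^sub>0 int) set monoid" where
  "ideal_tensor A J M =
     free_Abelian_group (J \<times> carrier M) Mod
       generate (free_Abelian_group (J \<times> carrier M)) (tensor_relations A J M)"

definition tensor_action :: "('a, 'b, 'n) module_scheme \<Rightarrow> (('a \<times> 'b) \<Rightarrow>\<^sub>0 int) \<Rightarrow> 'b" where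
  "tensor_action M z =
     (\<Oplus>\<^bsub>M\<^esub>p \<in> Poly_Mapping.keys z. [Poly_Mapping.lookup z p] \<cdot>\<^bsub>M\<^esub> (fst p \<odot>\<^bsub>M\<^esub> snd p))"

definition flat_module :: "('a, 'm) ring_scheme \<Rightarrow> ('a, 'b, 'n) module_scheme \<Rightarrow> bool" where
  "flat_module A M \<longleftrightarrow>
     (\<forall>J. ideal J A \<longrightarrow>
        inj_on (\<lambda>C. the_elem (tensor_action M ` C)) (carrier (ideal_tensor A J M)))"

section \<open>Flat families over the affine line\<close>

definition quotient_algebra ::
    "'v set \<Rightarrow> ('v, 'a::comm_ring_1) mpoly set \<Rightarrow> ('a, ('v, 'a) mpoly set) module" where
  "quotient_algebra V I = (let R = mpoly_ring V; Q = R Quot I in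
     \<lparr>carrier = carrier Q, mult = mult Q, one = one Q, zero = zero Q, add = add Q,
      smult = (\<lambda>c C. (I +>\<^bsub>R\<^esub> Const c) \<otimes>\<^bsub>Q\<^esub> C)\<rparr>)"

definition dehomogenize :: "'v \<Rightarrow> ('v, 'a::comm_ring_1) mpoly \<Rightarrow> ('v, 'a) mpoly" where
  "dehomogenize v = subst Const (Var(v := 1))"

text \<open>A closed subscheme of $\mathbb P(\mathbb C^V) \times \mathbb A^1$ is given by a homogeneous
  ideal of $\mathbb C[t][X_v]_{v \in V}$; the coefficient type \<^typ>\<open>complex poly\<close> is
  $\mathbb C[t]$. It is covered by the affine charts $X_v \neq 0$, and it is flat over
  $\mathbb A^1$ iff the coordinate ring of each chart is a flat $\mathbb C[t]$-module.\<close>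

definition flat_over_line :: "'v set \<Rightarrow> ('v, complex poly) mpoly set \<Rightarrow> bool" where
  "flat_over_line V I \<longleftrightarrow>
     (\<forall>v \<in> V. flat_module class_ring (quotient_algebra (V - {v}) (dehomogenize v ` I)))"

definition fibre_ideal :: "complex \<Rightarrow> ('v, complex poly) mpoly set \<Rightarrow> ('v, complex) mpoly set" where
  "fibre_ideal a I = subst (\<lambda>p. Const (poly p a)) Var ` I"

definition reduced_scheme :: "'v set \<Rightarrow> ('v, complex) mpoly set \<Rightarrow> bool" where
  "reduced_scheme V I \<longleftrightarrow>
     (\<forall>v \<in> V. \<forall>f \<in> carrier (mpoly_ring (V - {v})). \<forall>m.
        f ^ m \<in> dehomogenize v ` I \<longrightarrow> f \<in> dehomogenize v ` I)"

text \<open>The closed subscheme of $\mathbb P(\mathbb C^V)$ defined by \<open>I\<close> is isomorphic, as a scheme,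
  to the variety \<open>X\<close>: it is reduced, and its set of closed points is isomorphic to \<open>X\<close>.\<close>

definition scheme_isomorphic_to ::
    "'v set \<Rightarrow> ('v, complex) mpoly set \<Rightarrow> 'v point set \<Rightarrow> bool" where
  "scheme_isomorphic_to V I X \<longleftrightarrow>
     reduced_scheme V I \<and> isomorphic_varieties V (zero_set V I) V X"

definition flat_degeneration :: "'v set \<Rightarrow> 'v point set \<Rightarrow> 'v point set \<Rightarrow> bool" where
  "flat_degeneration V Y X \<longleftrightarrow> zariski_closed V X \<and> zariski_closed V Y \<and>
     (\<exists>I. homogeneous_ideal V I \<and> flat_over_line V I \<and>
        (\<forall>a. a \<noteq> 0 \<longrightarrow> scheme_isomorphic_to V (fibre_ideal a I) X) \<and>
        scheme_isomorphic_to V (fibre_ideal 0 I) Y)"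

section \<open>Posets and Hibi varieties\<close>

text \<open>A poset \<open>(P, <)\<close> is given by its strict order as a set of pairs.\<close>

definition strict_order_on :: "'p set \<Rightarrow> 'p rel \<Rightarrow> bool" where
  "strict_order_on P r \<longleftrightarrow> r \<subseteq> P \<times> P \<and> irrefl r \<and> trans r"

definition order_ideals :: "'p set \<Rightarrow> 'p rel \<Rightarrow> 'p set set" where
  "order_ideals P r = {J. J \<subseteq> P \<and> (\<forall>q \<in> J. \<forall>p. (p, q) \<in> r \<longrightarrow> p \<in> J)}"

definition max_elems :: "'p rel \<Rightarrow> 'p set \<Rightarrow> 'p set" where
  "max_elems r A = {p \<in> A. \<forall>q \<in> A. (p, q) \<notin> r}"

definition generated_order_ideal :: "'p rel \<Rightarrow> 'p set \<Rightarrow> 'p set" where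
  "generated_order_ideal r A = {p. \<exists>q \<in> A. p = q \<or> (p, q) \<in> r}"

definition star :: "'p rel \<Rightarrow> 'p set \<Rightarrow> 'p set \<Rightarrow> 'p set" where
  "star r J1 J2 =
     generated_order_ideal r ((J1 \<inter> J2) \<inter> (max_elems r J1 \<union> max_elems r J2))"

definition hibi_li_ideal :: "'p set \<Rightarrow> 'p rel \<Rightarrow> ('p set, complex) mpoly set" where
  "hibi_li_ideal P r = Idl\<^bsub>mpoly_ring (order_ideals P r)\<^esub>
     {Var J1 * Var J2 - Var (J1 \<union> J2) * Var (star r J1 J2) | J1 J2.
        J1 \<in> order_ideals P r \<and> J2 \<in> order_ideals P r}"

definition incomparable_ideal :: "'p set \<Rightarrow> 'p rel \<Rightarrow> ('p set, complex) mpoly set" where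
  "incomparable_ideal P r = Idl\<^bsub>mpoly_ring (order_ideals P r)\<^esub>
     {Var J1 * Var J2 | J1 J2.
        J1 \<in> order_ideals P r \<and> J2 \<in> order_ideals P r \<and> \<not> J1 \<subseteq> J2 \<and> \<not> J2 \<subseteq> J1}"

text \<open>\<open>star_closed_extension P r' r\<close> and \<open>relative_hibi_variety P r' r\<close>: here \<open>r'\<close> is the
  stronger order $<''$ and \<open>r\<close> is $<$. In the target ring of the monomial map, \<open>Var (Some p)\<close>
  is $z_p$ and \<open>Var None\<close> is $t$.\<close>

definition star_closed_extension :: "'p set \<Rightarrow> 'p rel \<Rightarrow> 'p rel \<Rightarrow> bool" where
  "star_closed_extension P r' r \<longleftrightarrow> strict_order_on P r' \<and> r \<subseteq> r' \<and>
     (\<forall>J1 \<in> order_ideals P r'. \<forall>J2 \<in> order_ideals P r'. star r J1 J2 \<in> order_ideals P r')"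

definition relative_hibi_map :: "'p rel \<Rightarrow> ('p set, complex) mpoly \<Rightarrow> ('p option, complex) mpoly" where
  "relative_hibi_map r = subst Const (\<lambda>J. Var None * (\<Prod>p \<in> max_elems r J. Var (Some p)))"

definition relative_hibi_variety :: "'p set \<Rightarrow> 'p rel \<Rightarrow> 'p rel \<Rightarrow> 'p set point set" where
  "relative_hibi_variety P r' r =
     zero_set (order_ideals P r')
       {f \<in> carrier (mpoly_ring (order_ideals P r')). relative_hibi_map r f = 0}"

section \<open>The Grassmannian\<close>

text \<open>The variable $X_{a_1,\dots,a_k}$, $a_1 < \dots < a_k$, is indexed by the set
  $\{a_1,\dots,a_k\}$.\<close>

definition pluecker_indices :: "nat \<Rightarrow> nat \<Rightarrow> nat set set" where
  "pluecker_indices k n = {a. a \<subseteq> {1..n} \<and> card a = k}"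

text \<open>$\mathrm{Gr}(k,n)$ as a set of subspaces of $\mathbb C^n$, and the Pluecker coordinates of the
  row space of a matrix. Rows and columns of \<^typ>\<open>complex mat\<close> are numbered from 0.\<close>

definition grassmannian :: "nat \<Rightarrow> nat \<Rightarrow> complex vec set set" where
  "grassmannian k n =
     {W. VectorSpace.subspace class_ring W (module_vec TYPE(complex) n) \<and>
         vectorspace.dim class_ring ((module_vec TYPE(complex) n)\<lparr>carrier := W\<rparr>) = k}"

definition pluecker_vector :: "nat \<Rightarrow> nat \<Rightarrow> complex mat \<Rightarrow> nat set \<Rightarrow> complex" where
  "pluecker_vector k n A a =
     (if a \<in> pluecker_indices k n
      then det (mat k k (\<lambda>(i, j). A $$ (i, sorted_list_of_set a ! j - 1))) else 0)"

definition grassmannian_variety :: "nat \<Rightarrow> nat \<Rightarrow> nat set point set" where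
  "grassmannian_variety k n =
     {line (pluecker_vector k n A) | A W.
        W \<in> grassmannian k n \<and> A \<in> carrier_mat k n \<and> vec_space.row_space n A = W}"

definition Pk :: "nat \<Rightarrow> nat \<Rightarrow> (nat \<times> nat) set" where
  "Pk k n = {1..k} \<times> {k + 1..n}"

definition Pk_less :: "nat \<Rightarrow> nat \<Rightarrow> (nat \<times> nat) rel" where
  "Pk_less k n =
     {(p, q). p \<in> Pk k n \<and> q \<in> Pk k n \<and> p \<noteq> q \<and> fst p \<le> fst q \<and> snd p \<le> snd q}"

text \<open>$X_{\alpha_1,\dots,\alpha_k}$ for pairwise distinct subscripts in arbitrary order.\<close>

definition pluecker_var :: "nat \<Rightarrow> (nat \<Rightarrow> nat) \<Rightarrow> (nat set, complex) mpoly" where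
  "pluecker_var k \<alpha> =
     Const (of_int (sign (THE \<sigma>. \<sigma> permutes {1..k} \<and> strict_mono_on {1..k} (\<alpha> \<circ> \<sigma>)))) *
       Var (\<alpha> ` {1..k})"

definition alpha :: "nat \<Rightarrow> nat \<Rightarrow> (nat \<times> nat) set \<Rightarrow> nat \<Rightarrow> nat" where
  "alpha k n J i =
     (if \<exists>j. (i, j) \<in> max_elems (Pk_less k n) J
      then THE j. (i, j) \<in> max_elems (Pk_less k n) J else i)"

text \<open>$\psi_{\mathcal C}^{-1}$: the ring homomorphism with $X_J \mapsto X_{\alpha_1,\dots,\alpha_k}$.
  As $\psi_{\mathcal C}$ is an isomorphism, preimages under it are images under \<open>psi_C_inv\<close>.\<close>

definition psi_C_inv :: "nat \<Rightarrow> nat \<Rightarrow> ((nat \<times> nat) set, complex) mpoly \<Rightarrow> (nat set, complex) mpoly" where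
  "psi_C_inv k n = subst Const (\<lambda>J. pluecker_var k (alpha k n J))"

text \<open>The identification of $\mathbb P(\wedge^k \mathbb C^n)$ with
  $\mathbb P(\mathbb C^{\mathcal J(P_k,<)})$ for which \<open>psi_C_inv\<close> is the pullback of
  homogeneous coordinates.\<close>

definition psi_C_point :: "nat \<Rightarrow> nat \<Rightarrow> nat set point \<Rightarrow> (nat \<times> nat) set point" where
  "psi_C_point k n L =
     (\<lambda>x J. if J \<in> order_ideals (Pk k n) (Pk_less k n)
            then eval_at x (psi_C_inv k n (Var J)) else 0) ` L"

end

theory Submission
  imports Defs "HOL-Analysis.Kronecker_Approximation_Theorem" "Jordan_Normal_Form.DL_Rank"
begin

text \<open>Write \<open>J * K\<close> for the star of two order ideals. Standard monomials (products along chains of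
  order ideals) are a basis modulo the Hibi-Li ideal. Hence an initial ideal of it that degenerates
  further to the ideal of incomparable products is generated by quadratic relations: for a
  supermodular weight \<open>w\<close>, an incomparable pair contributes
  $X_J X_K - X_{J \cup K} X_{J * K}$ if \<open>w\<close> is modular on the pair, and $X_J X_K$ otherwise.
  This is the vanishing ideal of the union of the toric varieties attached to the domains of
  linearity of \<open>w\<close> on the chain polytope. The order ideals in such a domain are those of a
  stronger order, so these toric varieties are relative Hibi varieties.

  On the side of the Grassmannian, products of two minors are spanned by standard ones, and the
  weight \<open>W0\<close> selects the antidiagonal term of each minor. Together these give, for every
  incomparable pair, a Pluecker relation with initial form $X_J X_K - X_{J \cup K} X_{J * K}$.
  A torus acting on the Grassmannian with integral weights approximating \<open>C * W0 + w\<close> then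
  has the limit defined by \<open>w\<close>. The total space is a closure of orbits, so the coordinate rings of its
  charts are torsion free over $\mathbb C[t]$, hence flat.\<close>

section \<open>Polynomial rings, ideals and initial forms\<close>

section \<open>Polynomials and substitution\<close>

text \<open>The hypothesis on the monomial ideal acts through one consequence: no nonzero
  combination of standard monomials lies in the given ideal. This forces the weight to be
  supermodular, since otherwise a standard monomial would be an initial form, and it leaves the
  quadratic relations as the whole ideal. The same independence principle recurs for functions on
  the Grassmannian and for the family over C[t].

  On the Grassmannian the obstacle is that minors straighten along one labelling of index sets by
  order ideals (lattice paths), while the variables use another (maximal elements). The two are
  never compared term by term: tableaux give a spanning family, the chain labelling an independent
  one, and a count of pairs makes the second family span too. Degree two suffices, because higher
  degrees follow from termination of the rewriting; hence an integral weight need only reproduce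
  finitely many comparisons of sums of two weights.

  Supermodularity makes the affine function of a cell lie above \<open>w\<close> everywhere. A cell
  is then the contact set of the two, which is why it is closed under union and star.\<close>

definition mono_eval :: "('v \<Rightarrow> 'b::comm_ring_1) \<Rightarrow> ('v \<Rightarrow>\<^sub>0 nat) \<Rightarrow> 'b" where
  "mono_eval x m = (\<Prod>v \<in> Poly_Mapping.keys m. x v ^ Poly_Mapping.lookup m v)"

lemma mono_eval_superset:
  assumes "finite S" "Poly_Mapping.keys m \<subseteq> S"
  shows "mono_eval x m = (\<Prod>v\<in>S. x v ^ Poly_Mapping.lookup m v)"
  unfolding mono_eval_def
  by (rule prod.mono_neutral_left) (use assms in \<open>auto simp: in_keys_iff\<close>)

lemma mono_eval_0 [simp]: "mono_eval x 0 = 1"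
  by (simp add: mono_eval_def)

lemma mono_eval_add: "mono_eval x (m + m') = mono_eval x m * mono_eval x m'"
proof -
  let ?S = "Poly_Mapping.keys m \<union> Poly_Mapping.keys m'"
  have "mono_eval x (m + m') = (\<Prod>v\<in>?S. x v ^ Poly_Mapping.lookup (m + m') v)"
    by (rule mono_eval_superset) (auto simp: in_keys_iff lookup_add)
  moreover have "mono_eval x m = (\<Prod>v\<in>?S. x v ^ Poly_Mapping.lookup m v)"
    by (rule mono_eval_superset) auto
  moreover have "mono_eval x m' = (\<Prod>v\<in>?S. x v ^ Poly_Mapping.lookup m' v)"
    by (rule mono_eval_superset) auto
  ultimately show ?thesis
    by (simp add: lookup_add power_add prod.distrib)
qed

lemma mono_eval_single [simp]: "mono_eval x (Poly_Mapping.single v n) = x v ^ n"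
  by (cases "n = 0") (auto simp: mono_eval_def)

lemma mono_eval_cong:
  "(\<And>v. v \<in> Poly_Mapping.keys m \<Longrightarrow> x v = y v) \<Longrightarrow> mono_eval x m = mono_eval y m"
  unfolding mono_eval_def by (rule prod.cong) auto

lemma mono_eval_scale:
  "mono_eval (\<lambda>v. c v * x v) m = mono_eval c m * mono_eval x m"
  by (simp add: mono_eval_def power_mult_distrib prod.distrib)

lemma mono_eval_eq_0_iff:
  fixes x :: "'v \<Rightarrow> 'a::idom"
  shows "mono_eval x m = 0 \<longleftrightarrow> (\<exists>v\<in>Poly_Mapping.keys m. x v = 0)"
  by (auto simp: mono_eval_def in_keys_iff)

lemma subst_superset:
  assumes "h 0 = 0" "finite S" "Poly_Mapping.keys f \<subseteq> S"
  shows "subst h x f = (\<Sum>m\<in>S. h (Poly_Mapping.lookup f m) * mono_eval x m)"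
  unfolding subst_def mono_eval_def[symmetric]
  by (rule sum.mono_neutral_left) (use assms in \<open>auto simp: in_keys_iff\<close>)

lemma subst_def': "subst h x f = (\<Sum>m\<in>Poly_Mapping.keys f. h (Poly_Mapping.lookup f m) * mono_eval x m)"
  by (simp add: subst_def mono_eval_def)

lemma poly_mapping_as_sum:
  "f = (\<Sum>m\<in>Poly_Mapping.keys f. Poly_Mapping.single m (Poly_Mapping.lookup f m))"
  by (rule poly_mapping_eqI)
    (auto simp: lookup_sum lookup_single when_def in_keys_iff if_distrib cong: if_cong)

lemma subst_single:
  assumes "h 0 = 0"
  shows "subst h x (Poly_Mapping.single m c) = h c * mono_eval x m"
  using subst_superset[of h "{m}" "Poly_Mapping.single m c" x] assms by auto

lemma subst_zero [simp]: "subst h x 0 = 0"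
  by (simp add: subst_def)

lemma subst_add:
  assumes "comm_ring_hom h"
  shows "subst h x (f + g) = subst h x f + subst h x g"
proof -
  interpret comm_ring_hom h by fact
  let ?S = "Poly_Mapping.keys f \<union> Poly_Mapping.keys g"
  have "subst h x (f + g) = (\<Sum>m\<in>?S. h (Poly_Mapping.lookup (f + g) m) * mono_eval x m)"
    by (rule subst_superset) (auto simp: in_keys_iff lookup_add)
  moreover have "subst h x f = (\<Sum>m\<in>?S. h (Poly_Mapping.lookup f m) * mono_eval x m)"
    by (rule subst_superset) auto
  moreover have "subst h x g = (\<Sum>m\<in>?S. h (Poly_Mapping.lookup g m) * mono_eval x m)"
    by (rule subst_superset) auto
  ultimately show ?thesis
    by (simp add: lookup_add hom_distribs sum.distrib algebra_simps)
qed

lemma subst_sum: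
  assumes "comm_ring_hom h"
  shows "subst h x (sum f A) = (\<Sum>a\<in>A. subst h x (f a))"
  by (induction A rule: infinite_finite_induct) (auto simp: subst_add[OF assms])

lemma subst_mult:
  assumes "comm_ring_hom h"
  shows "subst h x (f * g) = subst h x f * subst h x g"
proof -
  interpret comm_ring_hom h by fact
  let ?t = "\<lambda>f m. Poly_Mapping.single m (Poly_Mapping.lookup f m)"
  have "f * g = (\<Sum>m\<in>Poly_Mapping.keys f. \<Sum>m'\<in>Poly_Mapping.keys g. ?t f m * ?t g m')"
    by (subst poly_mapping_as_sum[of f], subst poly_mapping_as_sum[of g]) (rule sum_product)
  then have "subst h x (f * g) = (\<Sum>m\<in>Poly_Mapping.keys f. \<Sum>m'\<in>Poly_Mapping.keys g.
      subst h x (?t f m) * subst h x (?t g m'))"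
    by (simp add: subst_sum[OF assms] mult_single subst_single mono_eval_add hom_distribs mult_ac)
  also have "\<dots> = subst h x f * subst h x g"
  proof -
    have s: "subst h x (?t f m) = h (Poly_Mapping.lookup f m) * mono_eval x m" for f m
      by (simp add: subst_single)
    show ?thesis
      by (simp only: s sum_product subst_def'[of h x f] subst_def'[of h x g])
  qed
  finally show ?thesis .
qed

lemma subst_Const: "h 0 = 0 \<Longrightarrow> subst h x (Const c) = h c"
  by (simp add: Const_def subst_single)

lemma subst_Var: "h 0 = 0 \<Longrightarrow> h 1 = 1 \<Longrightarrow> subst h x (Var v) = x v"
  by (simp add: Var_def subst_single)

lemma Const_1: "Const 1 = 1" and Const_0 [simp]: "Const 0 = 0"
  by (simp_all add: Const_def)

lemma comm_ring_hom_subst: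
  assumes "comm_ring_hom h"
  shows "comm_ring_hom (subst h x)"
proof -
  interpret comm_ring_hom h by fact
  show ?thesis
    by unfold_locales
      (simp_all add: subst_add[OF assms] subst_mult[OF assms] Const_1[symmetric] subst_Const)
qed

lemma comm_ring_hom_id: "comm_ring_hom (\<lambda>c. c)"
  by unfold_locales auto

lemma comm_ring_hom_Const: "comm_ring_hom Const"
  by unfold_locales (auto simp: Const_def single_add mult_single)

lemma comm_ring_hom_comp: "comm_ring_hom g \<Longrightarrow> comm_ring_hom h \<Longrightarrow> comm_ring_hom (\<lambda>c. g (h c))"
proof -
  assume "comm_ring_hom g" "comm_ring_hom h"
  then interpret g: comm_ring_hom g + h: comm_ring_hom h by auto
  show ?thesis
    by unfold_locales (auto simp: hom_distribs)
qed

lemma comm_ring_hom_poly: "comm_ring_hom (\<lambda>p. poly p a)"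
  by unfold_locales auto

lemmas comm_ring_homs = comm_ring_hom_id comm_ring_hom_Const comm_ring_hom_poly
  comm_ring_hom_comp[OF comm_ring_hom_Const comm_ring_hom_poly]

lemma hom_mono_eval:
  assumes "comm_ring_hom g"
  shows "g (mono_eval x m) = mono_eval (\<lambda>v. g (x v)) m"
proof -
  interpret comm_ring_hom g by fact
  show ?thesis by (simp add: mono_eval_def hom_distribs)
qed

lemma hom_subst:
  assumes "comm_ring_hom g"
  shows "g (subst h x f) = subst (\<lambda>c. g (h c)) (\<lambda>v. g (x v)) f"
proof -
  interpret comm_ring_hom g by fact
  show ?thesis by (simp add: subst_def' hom_distribs hom_mono_eval[OF assms])
qed

lemma subst_subst_Const:
  assumes "comm_ring_hom h"
  shows "subst h x (subst Const y f) = subst h (\<lambda>v. subst h x (y v)) f"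
proof -
  interpret comm_ring_hom h by fact
  show ?thesis
    by (simp add: hom_subst[OF comm_ring_hom_subst[OF assms]] subst_Const)
qed

lemma mono_eval_Var: "mono_eval Var m = Poly_Mapping.single m (1 :: 'a::comm_ring_1)"
proof -
  have *: "(\<Prod>v\<in>S. Var v ^ Poly_Mapping.lookup m v)
      = Poly_Mapping.single (\<Sum>v\<in>S. Poly_Mapping.single v (Poly_Mapping.lookup m v)) (1::'a)"
    if "finite S" for S
    using that
  proof induction
    case (insert v S)
    have "(Var v :: ('b,'a) mpoly) ^ n = Poly_Mapping.single (Poly_Mapping.single v n) 1" for n
      by (induction n) (auto simp: Var_def mult_single simp flip: single_add)
    with insert show ?case by (simp add: mult_single)
  qed auto
  show ?thesis
    unfolding mono_eval_def *[OF finite_keys] poly_mapping_as_sum[symmetric] by simp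
qed

lemma single_Const:
  fixes c :: "'a::comm_ring_1"
  shows "Poly_Mapping.single m c = Const c * Poly_Mapping.single m 1"
  by (simp add: Const_def mult_single)

lemma subst_Const_Var: "subst Const Var f = f"
  by (subst (2) poly_mapping_as_sum)
    (simp add: subst_def' mono_eval_Var single_Const[symmetric])

lemma lookup_Const_mult: "Poly_Mapping.lookup (Const c * f) m = c * Poly_Mapping.lookup f m"
proof -
  have "Const c * f = (\<Sum>m\<in>Poly_Mapping.keys f. Poly_Mapping.single m (c * Poly_Mapping.lookup f m))"
    by (subst poly_mapping_as_sum[of f])
      (simp add: sum_distrib_left Const_def mult_single)
  then show ?thesis
    by (auto simp: lookup_sum lookup_single when_def in_keys_iff if_distrib cong: if_cong)
qed

lemma lookup_single_mult:
  fixes f :: "('v, 'a::comm_ring_1) mpoly"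
  shows "Poly_Mapping.lookup (Poly_Mapping.single m c * f) (m + m') = c * Poly_Mapping.lookup f m'"
proof -
  have "Poly_Mapping.single m c * f
      = (\<Sum>k\<in>Poly_Mapping.keys f. Poly_Mapping.single (m + k) (c * Poly_Mapping.lookup f k))"
    by (subst poly_mapping_as_sum[of f]) (simp add: sum_distrib_left mult_single)
  then show ?thesis
    by (auto simp: lookup_sum lookup_single when_def in_keys_iff if_distrib cong: if_cong)
qed

lemma keys_single_mult:
  fixes f :: "('v, 'a::comm_ring_1) mpoly"
  shows "Poly_Mapping.keys (Poly_Mapping.single m c * f) \<subseteq> (\<lambda>k. m + k) ` Poly_Mapping.keys f"
  using keys_mult[of "Poly_Mapping.single m c" f] by (auto split: if_splits)


section \<open>The ring of polynomials in a set of variables\<close>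

abbreviation "mpolys V \<equiv> carrier (mpoly_ring V)"

lemma mpolys_iff: "f \<in> mpolys V \<longleftrightarrow> (\<forall>m\<in>Poly_Mapping.keys f. Poly_Mapping.keys m \<subseteq> V)"
  by (simp add: mpoly_ring_def)

lemma mpoly_ring_simps [simp]:
  "f \<otimes>\<^bsub>mpoly_ring V\<^esub> g = f * g" "\<one>\<^bsub>mpoly_ring V\<^esub> = 1"
  "\<zero>\<^bsub>mpoly_ring V\<^esub> = 0" "f \<oplus>\<^bsub>mpoly_ring V\<^esub> g = f + g"
  by (simp_all add: mpoly_ring_def)

lemma mpolys_mono: "V \<subseteq> W \<Longrightarrow> f \<in> mpolys V \<Longrightarrow> f \<in> mpolys W"
  by (auto simp: mpolys_iff)

lemma mpolys_zero [simp]: "0 \<in> mpolys V"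
  and mpolys_Const [simp]: "Const c \<in> mpolys V"
  and mpolys_one [simp]: "1 \<in> mpolys V"
  by (auto simp: mpolys_iff Const_def)

lemma mpolys_single_iff: "Poly_Mapping.single m c \<in> mpolys V \<longleftrightarrow> c = 0 \<or> Poly_Mapping.keys m \<subseteq> V"
  by (auto simp: mpolys_iff)

lemma mpolys_Var [simp]: "v \<in> V \<Longrightarrow> Var v \<in> mpolys V"
  by (auto simp: Var_def mpolys_single_iff)

lemma mpolys_add [simp]: "f \<in> mpolys V \<Longrightarrow> g \<in> mpolys V \<Longrightarrow> f + g \<in> mpolys V"
  using keys_add[of f g] by (auto simp: mpolys_iff)

lemma mpolys_uminus [simp]: "f \<in> mpolys V \<Longrightarrow> - f \<in> mpolys V"
  by (auto simp: mpolys_iff in_keys_iff)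

lemma mpolys_diff [simp]: "f \<in> mpolys V \<Longrightarrow> g \<in> mpolys V \<Longrightarrow> f - g \<in> mpolys V"
  using mpolys_add[of f V "- g"] by simp

lemma mpolys_mult [simp]:
  assumes "f \<in> mpolys V" "g \<in> mpolys V"
  shows "f * g \<in> mpolys V"
proof -
  have "Poly_Mapping.keys k \<subseteq> V" if k: "k \<in> Poly_Mapping.keys (f * g)" for k
  proof -
    obtain m m' where "k = m + m'" "m \<in> Poly_Mapping.keys f" "m' \<in> Poly_Mapping.keys g"
      using k keys_mult[of f g] by blast
    then show ?thesis
      using assms keys_add[of m m'] unfolding mpolys_iff by blast
  qed
  then show ?thesis by (simp add: mpolys_iff)
qed

lemma mpolys_sum [simp]: "(\<And>a. a \<in> A \<Longrightarrow> f a \<in> mpolys V) \<Longrightarrow> sum f A \<in> mpolys V"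
  by (induction A rule: infinite_finite_induct) auto

lemma mpolys_prod [simp]: "(\<And>a. a \<in> A \<Longrightarrow> f a \<in> mpolys V) \<Longrightarrow> prod f A \<in> mpolys V"
  by (induction A rule: infinite_finite_induct) auto

lemma mpolys_power [simp]: "f \<in> mpolys V \<Longrightarrow> f ^ n \<in> mpolys V"
  by (induction n) auto

lemma mpolys_mono_eval:
  "(\<And>v. v \<in> Poly_Mapping.keys m \<Longrightarrow> x v \<in> mpolys W) \<Longrightarrow> mono_eval x m \<in> mpolys W"
  by (simp add: mono_eval_def)

lemma mpolys_subst:
  assumes "f \<in> mpolys V" "\<And>v. v \<in> V \<Longrightarrow> x v \<in> mpolys W" "\<And>c. h c \<in> mpolys W"
  shows "subst h x f \<in> mpolys W"
  unfolding subst_def'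
proof (intro mpolys_sum mpolys_mult mpolys_mono_eval assms(3))
  fix m v assume "m \<in> Poly_Mapping.keys f" "v \<in> Poly_Mapping.keys m"
  then have "v \<in> V" using assms(1) by (auto simp: mpolys_iff)
  then show "x v \<in> mpolys W" by (rule assms(2))
qed

lemma subst_cong:
  assumes "f \<in> mpolys V" "\<And>v. v \<in> V \<Longrightarrow> x v = y v"
  shows "subst h x f = subst h y f"
  unfolding subst_def' using assms
  by (intro sum.cong arg_cong2[of _ _ _ _ "(*)"] mono_eval_cong) (auto simp: mpolys_iff)

lemma cring_mpoly_ring: "cring (mpoly_ring V)"
proof (intro cringI abelian_groupI comm_monoidI)
  fix f assume "f \<in> mpolys V"
  then show "\<exists>g\<in>mpolys V. g \<oplus>\<^bsub>mpoly_ring V\<^esub> f = \<zero>\<^bsub>mpoly_ring V\<^esub>"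
    by (intro bexI[of _ "- f"]) auto
qed (auto simp: algebra_simps)

lemma a_inv_mpoly_ring: "f \<in> mpolys V \<Longrightarrow> \<ominus>\<^bsub>mpoly_ring V\<^esub> f = - f"
proof -
  interpret cring "mpoly_ring V" by (rule cring_mpoly_ring)
  assume "f \<in> mpolys V"
  then show ?thesis using minus_equality[of "- f" f] by simp
qed

lemma ideal_mpoly_ring_iff:
  "ideal I (mpoly_ring V) \<longleftrightarrow> I \<subseteq> mpolys V \<and> 0 \<in> I \<and>
     (\<forall>f\<in>I. \<forall>g\<in>I. f + g \<in> I) \<and> (\<forall>f\<in>I. \<forall>g\<in>mpolys V. g * f \<in> I)" (is "_ \<longleftrightarrow> ?R")
proof
  assume I: "ideal I (mpoly_ring V)"
  then interpret ideal I "mpoly_ring V" .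
  have "0 \<in> I" using additive_subgroup.zero_closed[OF ideal.axioms(1)[OF I]] by simp
  moreover have "f + g \<in> I" if "f \<in> I" "g \<in> I" for f g
    using additive_subgroup.a_closed[OF ideal.axioms(1)[OF I] that] by simp
  moreover have "g * f \<in> I" if "f \<in> I" "g \<in> mpolys V" for f g using I_l_closed[OF that] by simp
  ultimately show ?R using a_subset by blast
next
  assume R: ?R
  interpret cring "mpoly_ring V" by (rule cring_mpoly_ring)
  show "ideal I (mpoly_ring V)"
  proof (rule idealI)
    show "subgroup I (add_monoid (mpoly_ring V))"
    proof (rule group.subgroupI)
      show "group (add_monoid (mpoly_ring V))" using add.is_group .
      fix f assume f: "f \<in> I"
      then have "- 1 * f \<in> I" using R by (metis mpolys_one mpolys_uminus)
      then show "inv\<^bsub>add_monoid (mpoly_ring V)\<^esub> f \<in> I"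
        using f R a_inv_mpoly_ring[of f V] unfolding a_inv_def by auto
    qed (use R in auto)
  qed (use R ring_axioms in \<open>auto simp: mult.commute\<close>)
qed

lemma ideal_uminus: "ideal I (mpoly_ring V) \<Longrightarrow> f \<in> I \<Longrightarrow> - f \<in> I"
  unfolding ideal_mpoly_ring_iff by (metis mpolys_one mpolys_uminus mult_minus1)

lemma ideal_diff: "ideal I (mpoly_ring V) \<Longrightarrow> f \<in> I \<Longrightarrow> g \<in> I \<Longrightarrow> f - g \<in> I"
  using ideal_uminus[of I V g] unfolding ideal_mpoly_ring_iff
  by (metis uminus_add_conv_diff add.commute)

lemma ideal_sum:
  "ideal I (mpoly_ring V) \<Longrightarrow> (\<And>a. a \<in> A \<Longrightarrow> f a \<in> I) \<Longrightarrow> sum f A \<in> I"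
  by (induction A rule: infinite_finite_induct) (auto simp: ideal_mpoly_ring_iff)

lemma ideal_genideal: "S \<subseteq> mpolys V \<Longrightarrow> ideal (Idl\<^bsub>mpoly_ring V\<^esub> S) (mpoly_ring V)"
  by (rule ring.genideal_ideal[OF cring.axioms(1)[OF cring_mpoly_ring]])

lemma genideal_superset: "S \<subseteq> mpolys V \<Longrightarrow> S \<subseteq> Idl\<^bsub>mpoly_ring V\<^esub> S"
  by (rule ring.genideal_self[OF cring.axioms(1)[OF cring_mpoly_ring]])

lemma genideal_least: "ideal I (mpoly_ring V) \<Longrightarrow> S \<subseteq> I \<Longrightarrow> Idl\<^bsub>mpoly_ring V\<^esub> S \<subseteq> I"
  by (rule ring.genideal_minimal[OF cring.axioms(1)[OF cring_mpoly_ring]])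

lemma ideal_Const_mult: "ideal I (mpoly_ring V) \<Longrightarrow> f \<in> I \<Longrightarrow> Const c * f \<in> I"
  unfolding ideal_mpoly_ring_iff by simp

section \<open>Spans, degrees and initial forms\<close>

abbreviation mspan :: "('v, complex) mpoly set \<Rightarrow> ('v, complex) mpoly set" where
  "mspan \<equiv> Modules.module.span (\<lambda>c f. Const c * f)"

lemma module_mpoly: "Modules.module (\<lambda>c f. Const c * f :: ('v, 'a::comm_ring_1) mpoly)"
proof -
  interpret comm_ring_hom Const by (rule comm_ring_hom_Const)
  show ?thesis by unfold_locales (auto simp: hom_distribs algebra_simps)
qed

lemma mspan_least:
  assumes "S \<subseteq> U" "0 \<in> U" "\<And>f g. f \<in> U \<Longrightarrow> g \<in> U \<Longrightarrow> f + g \<in> U" "\<And>c f. f \<in> U \<Longrightarrow> Const c * f \<in> U"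
  shows "mspan S \<subseteq> U"
proof -
  interpret Modules.module "\<lambda>c f. Const c * f :: ('a, complex) mpoly" by (rule module_mpoly)
  show ?thesis
    by (rule span_minimal) (use assms in \<open>auto simp: subspace_def\<close>)
qed

lemma mspan_superset: "S \<subseteq> mspan S"
  and mspan_zero: "0 \<in> mspan S"
  and mspan_add: "f \<in> mspan S \<Longrightarrow> g \<in> mspan S \<Longrightarrow> f + g \<in> mspan S"
  and mspan_scale: "f \<in> mspan S \<Longrightarrow> Const c * f \<in> mspan S"
proof -
  interpret Modules.module "\<lambda>c f. Const c * f :: ('a, complex) mpoly" by (rule module_mpoly)
  show "S \<subseteq> mspan S" by (rule span_superset)
  show "0 \<in> mspan S" by (rule span_zero)
  show "f \<in> mspan S \<Longrightarrow> g \<in> mspan S \<Longrightarrow> f + g \<in> mspan S" by (rule span_add)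
  show "f \<in> mspan S \<Longrightarrow> Const c * f \<in> mspan S" by (rule span_scale)
qed

definition mdeg :: "('v \<Rightarrow>\<^sub>0 nat) \<Rightarrow> nat" where
  "mdeg m = (\<Sum>v\<in>Poly_Mapping.keys m. Poly_Mapping.lookup m v)"

lemma homogeneous_iff: "homogeneous d f \<longleftrightarrow> (\<forall>m\<in>Poly_Mapping.keys f. mdeg m = d)"
  by (simp add: homogeneous_def mdeg_def)

lemma mdeg_add [simp]: "mdeg (m + m') = mdeg m + mdeg m'"
  and mdeg_single [simp]: "mdeg (Poly_Mapping.single v n) = n"
  and mdeg_0 [simp]: "mdeg 0 = 0"
proof -
  have *: "mdeg m = (\<Sum>v\<in>S. Poly_Mapping.lookup m v)"
    if "finite S" "Poly_Mapping.keys m \<subseteq> S" for S and m :: "'a \<Rightarrow>\<^sub>0 nat"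
    unfolding mdeg_def by (rule sum.mono_neutral_left) (use that in \<open>auto simp: in_keys_iff\<close>)
  let ?S = "Poly_Mapping.keys m \<union> Poly_Mapping.keys m'"
  show "mdeg (m + m') = mdeg m + mdeg m'"
    using *[of ?S m] *[of ?S m'] *[of ?S "m + m'"] keys_add[of m m']
    by (simp add: lookup_add sum.distrib)
qed (cases "n = 0"; simp add: mdeg_def)+

lemma monomial_weight_superset:
  assumes "finite S" "Poly_Mapping.keys m \<subseteq> S"
  shows "monomial_weight w m = (\<Sum>v\<in>S. w v * real (Poly_Mapping.lookup m v))"
  unfolding monomial_weight_def
  by (rule sum.mono_neutral_left) (use assms in \<open>auto simp: in_keys_iff\<close>)

lemma monomial_weight_add [simp]:
  "monomial_weight w (m + m') = monomial_weight w m + monomial_weight w m'"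
proof -
  let ?S = "Poly_Mapping.keys m \<union> Poly_Mapping.keys m'"
  show ?thesis
    using monomial_weight_superset[of ?S m w] monomial_weight_superset[of ?S m' w]
      monomial_weight_superset[of ?S "m + m'" w] keys_add[of m m']
    by (simp add: lookup_add sum.distrib algebra_simps)
qed

lemma monomial_weight_single [simp]: "monomial_weight w (Poly_Mapping.single v n) = w v * n"
  by (cases "n = 0") (auto simp: monomial_weight_def)

lemma monomial_weight_0 [simp]: "monomial_weight w 0 = 0"
  by (simp add: monomial_weight_def)

lemma lookup_initial_form:
  "Poly_Mapping.lookup (initial_form w f) m =
     (if \<forall>m'\<in>Poly_Mapping.keys f. monomial_weight w m \<le> monomial_weight w m'
      then Poly_Mapping.lookup f m else 0)"
proof -
  have "finite {m \<in> Poly_Mapping.keys f. \<forall>m'\<in>Poly_Mapping.keys f. monomial_weight w m \<le> monomial_weight w m'}"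
    by simp
  then show ?thesis
    by (auto simp: initial_form_def lookup_sum lookup_single when_def in_keys_iff if_distrib cong: if_cong)
qed

lemma keys_initial_form:
  "Poly_Mapping.keys (initial_form w f) =
     {m\<in>Poly_Mapping.keys f. \<forall>m'\<in>Poly_Mapping.keys f. monomial_weight w m \<le> monomial_weight w m'}"
  by (auto simp: in_keys_iff lookup_initial_form split: if_splits)

lemma mpolys_initial_form: "f \<in> mpolys V \<Longrightarrow> initial_form w f \<in> mpolys V"
  by (auto simp: mpolys_iff keys_initial_form)

lemma initial_form_eq_0_iff: "initial_form w f = 0 \<longleftrightarrow> f = 0"
proof
  assume 0: "initial_form w f = 0"
  show "f = 0"
  proof (rule ccontr)
    assume "f \<noteq> 0"
    then have "Poly_Mapping.keys f \<noteq> {}" by simp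
    then obtain m where "is_arg_min (monomial_weight w) (\<lambda>m. m \<in> Poly_Mapping.keys f) m"
      using ex_is_arg_min_if_finite[OF finite_keys] by metis
    then have "m \<in> Poly_Mapping.keys (initial_form w f)"
      by (auto simp: keys_initial_form is_arg_min_linorder)
    with 0 show False by simp
  qed
qed (simp add: initial_form_def)

lemma initial_form_single_mult:
  "initial_form w (Poly_Mapping.single m 1 * f) = Poly_Mapping.single m 1 * initial_form w f"
proof (rule poly_mapping_eqI)
  fix n
  have k: "Poly_Mapping.keys (Poly_Mapping.single m 1 * f) = (\<lambda>k. m + k) ` Poly_Mapping.keys f"
    using keys_single_mult[of m 1 f] lookup_single_mult[of m 1 f] by (auto simp: in_keys_iff)
  show "Poly_Mapping.lookup (initial_form w (Poly_Mapping.single m 1 * f)) n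
      = Poly_Mapping.lookup (Poly_Mapping.single m 1 * initial_form w f) n"
  proof (cases "\<exists>n'. n = m + n'")
    case True
    then obtain n' where "n = m + n'" ..
    then show ?thesis
      unfolding lookup_initial_form k by (auto simp: lookup_single_mult lookup_initial_form)
  next
    case False
    then have "n \<notin> Poly_Mapping.keys (Poly_Mapping.single m 1 * f)"
      "n \<notin> Poly_Mapping.keys (Poly_Mapping.single m 1 * initial_form w f)"
      using keys_single_mult by fast+
    then show ?thesis by (auto simp: in_keys_iff lookup_initial_form)
  qed
qed

text \<open>Taking initial forms commutes with multiplication by a monomial, so the span absorbs
  monomials in \<open>V\<close> and, being a subspace, all polynomials in \<open>V\<close>.\<close>

lemma ideal_mspan_initial_forms:
  fixes I :: "('v, complex) mpoly set"
  assumes "ideal I (mpoly_ring V)"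
  shows "ideal (mspan (initial_form w ` I)) (mpoly_ring V)"
  unfolding ideal_mpoly_ring_iff
proof (intro conjI ballI)
  let ?U = "mspan (initial_form w ` I)"
  have I: "I \<subseteq> mpolys V" "\<And>f g. f \<in> I \<Longrightarrow> g \<in> mpolys V \<Longrightarrow> g * f \<in> I"
    using assms by (auto simp: ideal_mpoly_ring_iff)
  show "?U \<subseteq> mpolys V"
    by (rule mspan_least) (use I in \<open>auto intro: mpolys_initial_form\<close>)
  fix f assume f: "f \<in> ?U"
  have mono: "Poly_Mapping.single m 1 * f \<in> ?U" if m: "Poly_Mapping.keys m \<subseteq> V" for m
  proof -
    have "?U \<subseteq> {f. Poly_Mapping.single m 1 * f \<in> ?U}"
    proof (rule mspan_least)
      show "initial_form w ` I \<subseteq> {f. Poly_Mapping.single m 1 * f \<in> ?U}"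
      proof clarsimp
        fix g assume "g \<in> I"
        then have "Poly_Mapping.single m 1 * g \<in> I" using I m by (simp add: mpolys_single_iff)
        then show "Poly_Mapping.single m 1 * initial_form w g \<in> ?U"
          using mspan_superset[of "initial_form w ` I"] by (auto simp flip: initial_form_single_mult)
      qed
    qed (auto simp: mspan_zero distrib_left mspan_add mult.left_commute mspan_scale)
    with f show ?thesis by blast
  qed
  fix g :: "('v, complex) mpoly" assume g: "g \<in> mpolys V"
  have "g * f = (\<Sum>m\<in>Poly_Mapping.keys g. Const (Poly_Mapping.lookup g m) * (Poly_Mapping.single m 1 * f))"
    by (subst poly_mapping_as_sum[of g])
      (simp add: sum_distrib_right single_Const[of _ "Poly_Mapping.lookup g _"] mult.assoc)
  moreover have "(\<Sum>m\<in>S. Const (Poly_Mapping.lookup g m) * (Poly_Mapping.single m 1 * f)) \<in> ?U"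
    if "finite S" "S \<subseteq> Poly_Mapping.keys g" for S
    using that
  proof induction
    case (insert m S)
    then show ?case using g by (auto intro!: mspan_add mspan_scale mono simp: mpolys_iff)
  qed (simp add: mspan_zero)
  ultimately show "g * f \<in> ?U" by simp
qed (auto intro: mspan_zero mspan_add)

section \<open>Points at which polynomials do not vanish\<close>

text \<open>Weights \<open>B ^ idx v\<close> work for all but finitely many \<open>B\<close>: for
  two distinct exponent vectors the difference of their weights is a nonzero polynomial in
  \<open>B\<close>.\<close>

lemma ex_separating_weight:
  fixes M :: "('v \<Rightarrow>\<^sub>0 nat) set"
  assumes "finite M"
  obtains e :: "'v \<Rightarrow> nat" where "inj_on (\<lambda>m. \<Sum>v\<in>Poly_Mapping.keys m. e v * Poly_Mapping.lookup m v) M"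
proof -
  define V where "V = (\<Union>m\<in>M. Poly_Mapping.keys m)"
  have V: "finite V" using assms by (auto simp: V_def)
  obtain idx :: "'v \<Rightarrow> nat" where idx: "inj_on idx V"
    using finite_imp_inj_to_nat_seg[OF V] by auto
  define q :: "('v \<Rightarrow>\<^sub>0 nat) \<times> ('v \<Rightarrow>\<^sub>0 nat) \<Rightarrow> int poly" where
    "q = (\<lambda>(m, m'). \<Sum>v\<in>V. monom (int (Poly_Mapping.lookup m v) - int (Poly_Mapping.lookup m' v)) (idx v))"
  have q: "q (m, m') \<noteq> 0" if m: "m \<in> M" "m' \<in> M" "m \<noteq> m'" for m m'
  proof -
    obtain v where v: "Poly_Mapping.lookup m v \<noteq> Poly_Mapping.lookup m' v"
      using m(3) by (metis poly_mapping_eqI)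
    then have "v \<in> Poly_Mapping.keys m \<union> Poly_Mapping.keys m'" by (auto simp: in_keys_iff)
    then have vV: "v \<in> V" using m by (auto simp: V_def)
    have "coeff (q (m, m')) (idx v)
        = (\<Sum>u\<in>V. if u = v then int (Poly_Mapping.lookup m u) - int (Poly_Mapping.lookup m' u) else 0)"
      unfolding q_def by (auto simp: coeff_sum inj_on_eq_iff[OF idx] vV intro!: sum.cong)
    also have "\<dots> \<noteq> 0" using v vV V by (simp add: sum.delta)
    finally show ?thesis by auto
  qed
  \<comment> \<open>The bases at which some pair of distinct exponent vectors in \<open>M\<close>
    receives equal weights.\<close>
  define bad where "bad = (\<Union>z\<in>{z\<in>M \<times> M. fst z \<noteq> snd z}. {b::int. poly (q z) b = 0})"
  have "finite bad"
    unfolding bad_def using assms q by (auto intro!: finite_UN_I poly_roots_finite)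
  then have "finite (int -` bad)" by (simp add: finite_vimageI inj_on_def)
  then obtain B :: nat where B: "int B \<notin> bad" using ex_new_if_finite[of "int -` bad"] by auto
  show ?thesis
  proof
    show "inj_on (\<lambda>m. \<Sum>v\<in>Poly_Mapping.keys m. B ^ idx v * Poly_Mapping.lookup m v) M"
    proof (rule inj_onI, rule ccontr)
      fix m m' assume m: "m \<in> M" "m' \<in> M" "m \<noteq> m'"
        and eq: "(\<Sum>v\<in>Poly_Mapping.keys m. B ^ idx v * Poly_Mapping.lookup m v)
          = (\<Sum>v\<in>Poly_Mapping.keys m'. B ^ idx v * Poly_Mapping.lookup m' v)"
      have *: "(\<Sum>v\<in>Poly_Mapping.keys k. B ^ idx v * Poly_Mapping.lookup k v)
          = (\<Sum>v\<in>V. B ^ idx v * Poly_Mapping.lookup k v)" if "k \<in> M" for k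
        by (rule sum.mono_neutral_left) (use V that in \<open>auto simp: V_def in_keys_iff\<close>)
      have "poly (q (m, m')) (int B)
          = int (\<Sum>v\<in>V. B ^ idx v * Poly_Mapping.lookup m v) - int (\<Sum>v\<in>V. B ^ idx v * Poly_Mapping.lookup m' v)"
        by (simp add: q_def poly_sum poly_monom algebra_simps sum_subtractf)
      also have "\<dots> = 0" using eq *[OF m(1)] *[OF m(2)] by simp
      finally show False using B m by (auto simp: bad_def)
    qed
  qed
qed

text \<open>On the curve \<open>c ^ e v\<close> with separating exponents no two terms cancel, so
  both polynomials become nonzero polynomials in \<open>c\<close>. A common point for two
  polynomials is what the irreducibility argument needs; nonzero coordinates keep the point in the
  torus.\<close>

lemma ex_common_nonvanishing_point:
  fixes f g :: "('v, complex) mpoly"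
  assumes "f \<noteq> 0" "g \<noteq> 0"
  obtains x where "\<And>v. x v \<noteq> 0" "eval_at x f \<noteq> 0" "eval_at x g \<noteq> 0"
proof -
  obtain e :: "'v \<Rightarrow> nat" where
    e: "inj_on (\<lambda>m. \<Sum>v\<in>Poly_Mapping.keys m. e v * Poly_Mapping.lookup m v) (Poly_Mapping.keys f \<union> Poly_Mapping.keys g)"
    using ex_separating_weight[of "Poly_Mapping.keys f \<union> Poly_Mapping.keys g"] by auto
  define wt where "wt m = (\<Sum>v\<in>Poly_Mapping.keys m. e v * Poly_Mapping.lookup m v)" for m
  define Q where "Q h = (\<Sum>m\<in>Poly_Mapping.keys h. monom (Poly_Mapping.lookup h m) (wt m))"
    for h :: "('v, complex) mpoly"
  have Q0: "Q h \<noteq> 0" if "h \<noteq> 0" "Poly_Mapping.keys h \<subseteq> Poly_Mapping.keys f \<union> Poly_Mapping.keys g" for h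
  proof -
    obtain m where m: "m \<in> Poly_Mapping.keys h" using \<open>h \<noteq> 0\<close> by fastforce
    have "inj_on wt (Poly_Mapping.keys h)" using inj_on_subset[OF e that(2)] by (simp add: wt_def[abs_def])
    then have "coeff (Q h) (wt m) = (\<Sum>k\<in>Poly_Mapping.keys h. if k = m then Poly_Mapping.lookup h k else 0)"
      unfolding Q_def by (auto simp: coeff_sum inj_on_eq_iff m intro!: sum.cong)
    also have "\<dots> \<noteq> 0" using m by (simp add: sum.delta in_keys_iff)
    finally show ?thesis by auto
  qed
  have Qe: "eval_at (\<lambda>v. c ^ e v) h = poly (Q h) c" for h c
    by (simp add: subst_def' Q_def poly_sum poly_monom mono_eval_def wt_def power_sum
        flip: power_mult)
  have "finite ({c. poly (Q f) c = 0} \<union> {c. poly (Q g) c = 0} \<union> {0})"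
    using Q0[OF assms(1)] Q0[OF assms(2)] by (auto intro: poly_roots_finite)
  then obtain c where c: "c \<notin> {c. poly (Q f) c = 0} \<union> {c. poly (Q g) c = 0} \<union> {0}"
    using ex_new_if_finite[OF infinite_UNIV_char_0] by metis
  show ?thesis
    by (rule that[of "\<lambda>v. c ^ e v"]) (use c in \<open>auto simp: Qe\<close>)
qed

lemma eval_all_0_imp_0:
  fixes f :: "('v, complex) mpoly"
  assumes "\<And>x. eval_at x f = 0"
  shows "f = 0"
  using ex_common_nonvanishing_point[of f f] assms by metis

section \<open>Cones, their vanishing ideals and flat families over the line\<close>

section \<open>Vanishing ideals of cones\<close>

lemma mono_eval_const: "mono_eval (\<lambda>_. c) m = c ^ mdeg m"
  by (simp add: mono_eval_def mdeg_def power_sum)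

lemma mono_eval_const_mult: "mono_eval (\<lambda>v. c * x v) m = c ^ mdeg m * mono_eval x m"
  by (simp add: mono_eval_scale[of "\<lambda>_. c" x m] mono_eval_const)

lemma subst_homogeneous_scale:
  "homogeneous d f \<Longrightarrow> subst h (\<lambda>v. c * x v) f = c ^ d * subst h x f"
  by (auto simp: subst_def' homogeneous_iff mono_eval_const_mult sum_distrib_left mult_ac intro!: sum.cong)

definition hcomp :: "nat \<Rightarrow> ('v, 'a::comm_ring_1) mpoly \<Rightarrow> ('v, 'a) mpoly" where
  "hcomp d f = (\<Sum>m | m \<in> Poly_Mapping.keys f \<and> mdeg m = d. Poly_Mapping.single m (Poly_Mapping.lookup f m))"

lemma lookup_hcomp: "Poly_Mapping.lookup (hcomp d f) m = (if mdeg m = d then Poly_Mapping.lookup f m else 0)"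
proof -
  have "finite {m \<in> Poly_Mapping.keys f. mdeg m = d}" by simp
  then show ?thesis
    by (auto simp: hcomp_def lookup_sum lookup_single when_def in_keys_iff if_distrib cong: if_cong)
qed

lemma keys_hcomp: "Poly_Mapping.keys (hcomp d f) = {m\<in>Poly_Mapping.keys f. mdeg m = d}"
  by (auto simp: in_keys_iff lookup_hcomp split: if_splits)

lemma homogeneous_hcomp: "homogeneous d (hcomp d f)"
  by (simp add: homogeneous_iff keys_hcomp)

lemma sum_hcomp: "f = (\<Sum>d\<in>mdeg ` Poly_Mapping.keys f. hcomp d f)"
proof (rule poly_mapping_eqI)
  fix m
  show "Poly_Mapping.lookup f m = Poly_Mapping.lookup (\<Sum>d\<in>mdeg ` Poly_Mapping.keys f. hcomp d f) m"
    by (cases "m \<in> Poly_Mapping.keys f") (auto simp: lookup_sum lookup_hcomp in_keys_iff sum.delta)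
qed

text \<open>A point is a pair of a specialization of the coefficients and a vector: this covers the
  vanishing ideals of both sets of vectors (identity specialization) and families over the line
  (evaluation at the parameter).\<close>

definition vanishing_ideal ::
    "'v set \<Rightarrow> (('a::comm_ring_1 \<Rightarrow> complex) \<times> ('v \<Rightarrow> complex)) set \<Rightarrow> ('v, 'a) mpoly set" where
  "vanishing_ideal V Y = {f \<in> mpolys V. \<forall>(h, x) \<in> Y. subst h x f = 0}"

definition cone :: "(('a::comm_ring_1 \<Rightarrow> complex) \<times> ('v \<Rightarrow> complex)) set \<Rightarrow> bool" where
  "cone Y \<longleftrightarrow> (\<forall>(h, x) \<in> Y. comm_ring_hom h \<and> (\<forall>c. (h, \<lambda>v. c * x v) \<in> Y))"

lemma vanishing_idealI:
  "f \<in> mpolys V \<Longrightarrow> (\<And>h x. (h, x) \<in> Y \<Longrightarrow> subst h x f = 0) \<Longrightarrow> f \<in> vanishing_ideal V Y"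
  by (auto simp: vanishing_ideal_def)

lemma vanishing_idealD: "f \<in> vanishing_ideal V Y \<Longrightarrow> (h, x) \<in> Y \<Longrightarrow> subst h x f = 0"
  and vanishing_ideal_mpolys: "f \<in> vanishing_ideal V Y \<Longrightarrow> f \<in> mpolys V"
  by (auto simp: vanishing_ideal_def)

lemma ideal_vanishing_ideal:
  assumes "\<And>h x. (h, x) \<in> Y \<Longrightarrow> comm_ring_hom h"
  shows "ideal (vanishing_ideal V Y) (mpoly_ring V)"
  unfolding ideal_mpoly_ring_iff
proof (intro conjI ballI)
  fix f g assume f: "f \<in> vanishing_ideal V Y"
  show "f + g \<in> vanishing_ideal V Y" if "g \<in> vanishing_ideal V Y"
    using f that by (intro vanishing_idealI)
      (simp_all add: vanishing_ideal_mpolys subst_add[OF assms] vanishing_idealD)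
  show "g * f \<in> vanishing_ideal V Y" if "g \<in> mpolys V"
    using f that by (intro vanishing_idealI)
      (simp_all add: vanishing_ideal_mpolys subst_mult[OF assms] vanishing_idealD)
qed (auto simp: vanishing_ideal_def)

lemma cone_hom: "cone Y \<Longrightarrow> (h, x) \<in> Y \<Longrightarrow> comm_ring_hom h"
  and cone_scale: "cone Y \<Longrightarrow> (h, x) \<in> Y \<Longrightarrow> (h, \<lambda>v. c * x v) \<in> Y"
  by (auto simp: cone_def)

text \<open>Along the line through a point of the cone, \<open>f\<close> becomes a polynomial in the
  scaling factor that vanishes at every complex number. Its coefficients are the values of the
  homogeneous components.\<close>

lemma hcomp_in_vanishing_ideal:
  assumes Y: "cone Y" and f: "f \<in> vanishing_ideal V Y"
  shows "hcomp d f \<in> vanishing_ideal V Y"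
proof (rule vanishing_idealI)
  show "hcomp d f \<in> mpolys V"
    using f by (auto simp: vanishing_ideal_def mpolys_iff keys_hcomp)
  fix h x assume hx: "(h, x) \<in> Y"
  interpret comm_ring_hom h using cone_hom[OF Y hx] .
  define q where "q = (\<Sum>m\<in>Poly_Mapping.keys f. monom (h (Poly_Mapping.lookup f m) * mono_eval x m) (mdeg m))"
  have "poly q c = 0" for c
  proof -
    have "poly q c = subst h (\<lambda>v. c * x v) f"
      by (simp add: q_def poly_sum poly_monom subst_def' mono_eval_const_mult mult_ac)
    then show ?thesis
      using f cone_scale[OF Y hx, of c] by (auto simp: vanishing_ideal_def)
  qed
  then have "q = 0" using poly_all_0_iff_0 by blast
  then have "0 = coeff q d" by simp
  also have "\<dots> = (\<Sum>m\<in>Poly_Mapping.keys f. if mdeg m = d then h (Poly_Mapping.lookup f m) * mono_eval x m else 0)"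
    by (auto simp: q_def coeff_sum intro!: sum.cong)
  also have "\<dots> = subst h x (hcomp d f)"
    unfolding subst_def' keys_hcomp by (auto simp: lookup_hcomp sum.inter_filter intro!: sum.cong)
  finally show "subst h x (hcomp d f) = 0" by simp
qed

lemma homogeneous_ideal_vanishing_ideal:
  assumes Y: "cone Y"
  shows "homogeneous_ideal V (vanishing_ideal V Y)"
proof -
  let ?I = "vanishing_ideal V Y" and ?S = "{f \<in> vanishing_ideal V Y. \<exists>d. homogeneous d f}"
  have I: "ideal ?I (mpoly_ring V)" using ideal_vanishing_ideal cone_hom[OF Y] by blast
  have sub: "?S \<subseteq> mpolys V" by (auto simp: vanishing_ideal_def)
  have "?I \<subseteq> Idl\<^bsub>mpoly_ring V\<^esub> ?S"
  proof
    fix f assume f: "f \<in> ?I"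
    have "(\<Sum>d\<in>mdeg ` Poly_Mapping.keys f. hcomp d f) \<in> Idl\<^bsub>mpoly_ring V\<^esub> ?S"
      by (rule ideal_sum[OF ideal_genideal[OF sub]])
        (use genideal_superset[OF sub] hcomp_in_vanishing_ideal[OF Y f] homogeneous_hcomp in blast)
    then show "f \<in> Idl\<^bsub>mpoly_ring V\<^esub> ?S" using sum_hcomp[of f] by simp
  qed
  moreover have "Idl\<^bsub>mpoly_ring V\<^esub> ?S \<subseteq> ?I" by (rule genideal_least[OF I]) auto
  ultimately show ?thesis unfolding homogeneous_ideal_def using sub by (intro exI[of _ ?S]) auto
qed

text \<open>The subtraction is truncated, so this is homogeneous of degree \<open>N\<close> only if
  \<open>N\<close> bounds the degrees of all terms of \<open>f\<close>.\<close>

definition homogenize :: "'v \<Rightarrow> nat \<Rightarrow> ('v, 'a::comm_ring_1) mpoly \<Rightarrow> ('v, 'a) mpoly" where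
  "homogenize v N f = (\<Sum>m\<in>Poly_Mapping.keys f.
     Poly_Mapping.single (m + Poly_Mapping.single v (N - mdeg m)) (Poly_Mapping.lookup f m))"

lemma homogenize_in_mpolys:
  assumes "f \<in> mpolys (V - {v})" "v \<in> V"
  shows "homogenize v N f \<in> mpolys V"
  unfolding homogenize_def
proof (rule mpolys_sum)
  fix m assume "m \<in> Poly_Mapping.keys f"
  then have "Poly_Mapping.keys m \<subseteq> V" using assms(1) by (auto simp: mpolys_iff)
  then show "Poly_Mapping.single (m + Poly_Mapping.single v (N - mdeg m)) (Poly_Mapping.lookup f m) \<in> mpolys V"
    using keys_add[of m "Poly_Mapping.single v (N - mdeg m)"] assms(2)
    by (auto simp: mpolys_single_iff split: if_splits)
qed

lemma subst_homogenize:
  assumes h: "comm_ring_hom h" and N: "\<And>m. m \<in> Poly_Mapping.keys f \<Longrightarrow> mdeg m \<le> N"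
    and x: "x v \<noteq> (0::complex)"
  shows "subst h x (homogenize v N f) = x v ^ N * subst h (\<lambda>u. x u / x v) f"
proof -
  interpret comm_ring_hom h by fact
  have "mono_eval x m * x v ^ (N - mdeg m) = x v ^ N * mono_eval (\<lambda>u. x u / x v) m"
    if "m \<in> Poly_Mapping.keys f" for m
    using mono_eval_const_mult[of "inverse (x v)" x m] N[OF that] x
    by (simp add: field_simps power_diff power_inverse)
  then have "h c * (mono_eval x m * x v ^ (N - mdeg m)) = x v ^ N * (h c * mono_eval (\<lambda>u. x u / x v) m)"
    if "m \<in> Poly_Mapping.keys f" for m c
    using that by (simp only: mult.left_commute)
  then have "(\<Sum>m\<in>Poly_Mapping.keys f. h (Poly_Mapping.lookup f m) * (mono_eval x m * x v ^ (N - mdeg m)))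
      = x v ^ N * subst h (\<lambda>u. x u / x v) f"
    unfolding subst_def' sum_distrib_left by (intro sum.cong refl) blast
  then show ?thesis
    by (simp add: homogenize_def subst_sum[OF h] subst_single mono_eval_add)
qed

lemma dehomogenize_homogenize:
  assumes "f \<in> mpolys (V - {v})"
  shows "dehomogenize v (homogenize v N f) = f"
proof -
  have "mono_eval (Var(v := 1)) m = mono_eval Var m" if "m \<in> Poly_Mapping.keys f" for m
    using that assms by (intro mono_eval_cong) (auto simp: mpolys_iff)
  then have "(\<Sum>m\<in>Poly_Mapping.keys f. Const (Poly_Mapping.lookup f m) * mono_eval (Var(v := 1)) m) = f"
    using subst_Const_Var[of f] unfolding subst_def' by (metis (no_types, lifting) sum.cong)
  then show ?thesis
    by (simp add: dehomogenize_def homogenize_def subst_sum[OF comm_ring_hom_Const] subst_single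
        mono_eval_add)
qed

lemma dehomogenize_in_mpolys: "f \<in> mpolys V \<Longrightarrow> dehomogenize v f \<in> mpolys (V - {v})"
  unfolding dehomogenize_def by (rule mpolys_subst) auto

definition chart :: "'v \<Rightarrow> (('a \<Rightarrow> complex) \<times> ('v \<Rightarrow> complex)) set \<Rightarrow> (('a \<Rightarrow> complex) \<times> ('v \<Rightarrow> complex)) set" where
  "chart v Y = {(h, \<lambda>u. x u / x v) | h x. (h, x) \<in> Y \<and> x v \<noteq> 0}"

text \<open>The extra factor \<open>Var v\<close> makes the homogenization vanish at infinity.\<close>

lemma homogenize_in_vanishing_ideal:
  assumes Y: "cone Y" and f: "f \<in> vanishing_ideal (V - {v}) (chart v Y)" and v: "v \<in> V"
    and N: "\<And>m. m \<in> Poly_Mapping.keys f \<Longrightarrow> mdeg m \<le> N"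
  shows "Var v * homogenize v N f \<in> vanishing_ideal V Y"
proof (rule vanishing_idealI)
  show "Var v * homogenize v N f \<in> mpolys V"
    using f v by (intro mpolys_mult mpolys_Var homogenize_in_mpolys) (auto simp: vanishing_ideal_mpolys)
  fix h x assume hx: "(h, x) \<in> Y"
  have h: "comm_ring_hom h" using cone_hom[OF Y hx] .
  interpret comm_ring_hom h by (rule h)
  show "subst h x (Var v * homogenize v N f) = 0"
  proof (cases "x v = 0")
    case False
    then have "(h, \<lambda>u. x u / x v) \<in> chart v Y" using hx by (auto simp: chart_def)
    then have "subst h (\<lambda>u. x u / x v) f = 0" using f by (auto simp: vanishing_ideal_def)
    moreover have "subst h x (homogenize v N f) = x v ^ N * subst h (\<lambda>u. x u / x v) f"
      by (rule subst_homogenize[OF h]) (use N False in auto)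
    ultimately show ?thesis by (simp add: subst_mult[OF h])
  qed (simp add: subst_mult[OF h] subst_Var)
qed

text \<open>One inclusion rescales a point of the cone to have coordinate 1 at \<open>v\<close>; the
  other homogenizes and multiplies by \<open>Var v\<close>.\<close>

lemma dehomogenize_vanishing_ideal:
  assumes Y: "cone Y" and v: "v \<in> V"
  shows "dehomogenize v ` vanishing_ideal V Y = vanishing_ideal (V - {v}) (chart v Y)"
proof (intro equalityI subsetI)
  fix g assume "g \<in> dehomogenize v ` vanishing_ideal V Y"
  then obtain f where f: "f \<in> vanishing_ideal V Y" "g = dehomogenize v f" by auto
  have "subst h (\<lambda>u. x u / x v) g = 0" if hx: "(h, x) \<in> Y" "x v \<noteq> 0" for h x
  proof -
    have h: "comm_ring_hom h" using cone_hom[OF Y hx(1)] .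
    interpret comm_ring_hom h by (rule h)
    have "subst h (\<lambda>u. x u / x v) g = subst h (\<lambda>u. subst h (\<lambda>u. x u / x v) ((Var(v := 1)) u)) f"
      unfolding f(2) dehomogenize_def by (rule subst_subst_Const[OF h])
    also have "(\<lambda>u. subst h (\<lambda>u. x u / x v) ((Var(v := 1)) u)) = (\<lambda>u. inverse (x v) * x u)"
      using hx(2) comm_ring_hom_subst[OF h]
      by (auto simp: fun_eq_iff subst_Var field_simps Const_1[symmetric] subst_Const)
    also have "subst h \<dots> f = 0"
      using f(1) cone_scale[OF Y hx(1), of "inverse (x v)"] by (auto simp: vanishing_ideal_def)
    finally show ?thesis .
  qed
  then show "g \<in> vanishing_ideal (V - {v}) (chart v Y)"
    using f dehomogenize_in_mpolys[of f V v] by (auto simp: vanishing_ideal_def chart_def)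
next
  fix g assume g: "g \<in> vanishing_ideal (V - {v}) (chart v Y)"
  \<comment> \<open>For \<open>g = 0\<close> this is the maximum of an empty set; the value is
    harmless because \<open>N\<close> is only compared with degrees of terms of
    \<open>g\<close>.\<close>
  define N where "N = Max (mdeg ` Poly_Mapping.keys g)"
  have N: "mdeg m \<le> N" if "m \<in> Poly_Mapping.keys g" for m
    using that by (auto simp: N_def)
  have "dehomogenize v (Var v * homogenize v N g) = g"
    using dehomogenize_homogenize[of g V v N] g
    by (simp add: vanishing_ideal_def dehomogenize_def subst_mult[OF comm_ring_hom_Const] subst_Var Const_1)
  then show "g \<in> dehomogenize v ` vanishing_ideal V Y"
    using homogenize_in_vanishing_ideal[OF Y g v N] by (metis imageI)
qed

text \<open>Membership is tested by values in the field of complex numbers, where a power vanishes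
  only if its base does.\<close>

lemma reduced_scheme_vanishing_ideal:
  assumes Y: "cone Y"
  shows "reduced_scheme V (vanishing_ideal V Y)"
  unfolding reduced_scheme_def
proof (intro ballI allI impI)
  fix v f m
  assume v: "v \<in> V" and f: "f \<in> mpolys (V - {v})" "f ^ m \<in> dehomogenize v ` vanishing_ideal V Y"
  have "subst h x f = 0" if "(h, x) \<in> chart v Y" for h x
  proof -
    have "comm_ring_hom h" using that cone_hom[OF Y] by (auto simp: chart_def)
    then interpret s: comm_ring_hom "subst h x" by (rule comm_ring_hom_subst)
    have "subst h x (f ^ m) = 0"
      using f(2) that unfolding dehomogenize_vanishing_ideal[OF Y v] by (auto simp: vanishing_ideal_def)
    then show ?thesis by (simp add: s.hom_power)
  qed
  then show "f \<in> dehomogenize v ` vanishing_ideal V Y"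
    using f(1) unfolding dehomogenize_vanishing_ideal[OF Y v] by (auto simp: vanishing_ideal_def)
qed

abbreviation van :: "'v set \<Rightarrow> ('v \<Rightarrow> complex) set \<Rightarrow> ('v, complex) mpoly set" where
  "van V \<Omega> \<equiv> vanishing_ideal V ((\<lambda>x. (\<lambda>c. c, x)) ` \<Omega>)"

definition vcone :: "('v \<Rightarrow> complex) set \<Rightarrow> bool" where
  "vcone \<Omega> \<longleftrightarrow> (\<forall>x\<in>\<Omega>. \<forall>c. (\<lambda>v. c * x v) \<in> \<Omega>)"

lemma cone_vcone: "vcone \<Omega> \<Longrightarrow> cone ((\<lambda>x. (\<lambda>c. c, x)) ` \<Omega>)"
  by (auto simp: cone_def vcone_def comm_ring_hom_id)

lemma van_iff: "f \<in> van V \<Omega> \<longleftrightarrow> f \<in> mpolys V \<and> (\<forall>x\<in>\<Omega>. eval_at x f = 0)"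
  by (auto simp: vanishing_ideal_def)

lemma mem_line: "x \<in> line x"
  by (force simp: line_def intro: exI[of _ 1])

lemma line_scale:
  assumes "(c::complex) \<noteq> 0"
  shows "line (\<lambda>v. c * x v) = line x"
proof -
  have "(\<lambda>v. d * x v) \<in> line (\<lambda>v. c * x v)" for d
    unfolding line_def using assms by (auto intro!: exI[of _ "d / c"])
  moreover have "(\<lambda>v. d * (c * x v)) \<in> line x" for d
    unfolding line_def by (auto simp: mult.assoc intro!: exI[of _ "d * c"])
  ultimately show ?thesis by (auto simp: line_def)
qed

definition lines :: "('v \<Rightarrow> complex) set \<Rightarrow> 'v point set" where
  "lines \<Omega> = {line x | x. x \<in> \<Omega> \<and> (\<exists>v. x v \<noteq> 0)}"

text \<open>Since the vanishing ideal of a cone contains the homogeneous components of its elements,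
  vanishing at one representative of a line implies vanishing on the whole line.\<close>

lemma zero_set_vanishing_ideal:
  assumes "vcone \<Omega>"
  shows "zero_set V (van V \<Omega>) = {line x | x. (\<forall>v. v \<notin> V \<longrightarrow> x v = 0) \<and> (\<exists>v. x v \<noteq> 0) \<and>
    (\<forall>f\<in>van V \<Omega>. eval_at x f = 0)}" (is "_ = ?R")
proof (intro equalityI subsetI)
  fix L assume "L \<in> zero_set V (van V \<Omega>)"
  then show "L \<in> ?R"
    unfolding zero_set_def proj_space_def using mem_line by (auto 4 4)
next
  fix L assume "L \<in> ?R"
  then obtain x where x: "L = line x" "\<And>v. v \<notin> V \<Longrightarrow> x v = 0" "\<exists>v. x v \<noteq> 0"
    "\<And>f. f \<in> van V \<Omega> \<Longrightarrow> eval_at x f = 0" by auto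
  have "eval_at (\<lambda>v. c * x v) f = 0" if f: "f \<in> van V \<Omega>" for c f
  proof -
    have "eval_at (\<lambda>v. c * x v) f = (\<Sum>d\<in>mdeg ` Poly_Mapping.keys f. eval_at (\<lambda>v. c * x v) (hcomp d f))"
      by (subst sum_hcomp[of f]) (rule subst_sum[OF comm_ring_hom_id])
    also have "\<dots> = (\<Sum>d\<in>mdeg ` Poly_Mapping.keys f. c ^ d * eval_at x (hcomp d f))"
      by (simp add: subst_homogeneous_scale[OF homogeneous_hcomp])
    also have "\<dots> = 0"
      using hcomp_in_vanishing_ideal[OF cone_vcone[OF assms] f] x(4) by simp
    finally show ?thesis .
  qed
  then show "L \<in> zero_set V (van V \<Omega>)"
    using x by (auto simp: zero_set_def proj_space_def line_def)
qed

lemma line_in_zero_set_van: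
  "vcone \<Omega> \<Longrightarrow> (\<And>v. v \<notin> V \<Longrightarrow> x v = 0) \<Longrightarrow> x u \<noteq> 0 \<Longrightarrow> (\<And>f. f \<in> van V \<Omega> \<Longrightarrow> eval_at x f = 0) \<Longrightarrow>
    line x \<in> zero_set V (van V \<Omega>)"
  unfolding zero_set_vanishing_ideal by blast

lemma proj_space_support: "L \<in> proj_space V \<Longrightarrow> x \<in> L \<Longrightarrow> v \<notin> V \<Longrightarrow> x v = 0"
  by (auto simp: proj_space_def line_def)

lemma line_in_proj_space: "(\<And>v. v \<notin> V \<Longrightarrow> x v = 0) \<Longrightarrow> x u \<noteq> 0 \<Longrightarrow> line x \<in> proj_space V"
  by (auto simp: proj_space_def)

lemma zariski_closed_zero_set_van:
  assumes "vcone \<Omega>"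
  shows "zariski_closed V (zero_set V (van V \<Omega>))"
proof -
  let ?S = "{f \<in> van V \<Omega>. \<exists>d. homogeneous d f}"
  have "zero_set V ?S \<subseteq> zero_set V (van V \<Omega>)"
  proof
    fix L assume L: "L \<in> zero_set V ?S"
    have "eval_at x f = 0" if f: "f \<in> van V \<Omega>" and x: "x \<in> L" for f x
    proof -
      have "eval_at x f = (\<Sum>d\<in>mdeg ` Poly_Mapping.keys f. eval_at x (hcomp d f))"
        by (subst sum_hcomp[of f]) (rule subst_sum[OF comm_ring_hom_id])
      also have "\<dots> = 0"
        using hcomp_in_vanishing_ideal[OF cone_vcone[OF assms] f] homogeneous_hcomp[of _ f] L x
        unfolding zero_set_def by (intro sum.neutral) blast
      finally show ?thesis .
    qed
    with L show "L \<in> zero_set V (van V \<Omega>)" by (auto simp: zero_set_def)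
  qed
  moreover have "zero_set V (van V \<Omega>) \<subseteq> zero_set V ?S" by (auto simp: zero_set_def)
  ultimately have "zero_set V (van V \<Omega>) = zero_set V ?S" by auto
  then show ?thesis unfolding zariski_closed_def
    by (intro exI[of _ ?S]) (auto simp: vanishing_ideal_def)
qed

section \<open>Weight families\<close>

definition weight_points :: "('v \<Rightarrow> complex) set \<Rightarrow> ('v \<Rightarrow> nat) \<Rightarrow> ((complex poly \<Rightarrow> complex) \<times> ('v \<Rightarrow> complex)) set" where
  "weight_points \<Omega> u = {(\<lambda>p. poly p a, \<lambda>v. a ^ u v * x v) | a x. x \<in> \<Omega>}"

text \<open>The family whose fibre over \<open>a \<noteq> 0\<close> is the set \<open>\<Omega>\<close> acted upon by the
  diagonal matrix with entries \<open>a ^ u v\<close>.\<close>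

abbreviation weight_family :: "'v set \<Rightarrow> ('v \<Rightarrow> complex) set \<Rightarrow> ('v \<Rightarrow> nat) \<Rightarrow> ('v, complex poly) mpoly set" where
  "weight_family V \<Omega> u \<equiv> vanishing_ideal V (weight_points \<Omega> u)"

lemma weight_pointsI: "x \<in> \<Omega> \<Longrightarrow> (\<lambda>p. poly p a, \<lambda>v. a ^ u v * x v) \<in> weight_points \<Omega> u"
  by (auto simp: weight_points_def)

lemma cone_weight_points: "vcone \<Omega> \<Longrightarrow> cone (weight_points \<Omega> u)"
  unfolding cone_def
proof (safe)
  fix h and y :: "'a \<Rightarrow> complex" and c assume \<Omega>: "vcone \<Omega>" and "(h, y) \<in> weight_points \<Omega> u"
  then obtain a x where x: "h = (\<lambda>p. poly p a)" "y = (\<lambda>v. a ^ u v * x v)" "x \<in> \<Omega>"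
    by (auto simp: weight_points_def)
  show "comm_ring_hom h" unfolding x by (rule comm_ring_hom_poly)
  have "(\<lambda>v. c * y v) = (\<lambda>v. a ^ u v * (c * x v))" by (simp add: x mult.left_commute)
  moreover have "(\<lambda>v. c * x v) \<in> \<Omega>" using \<Omega> x by (auto simp: vcone_def)
  ultimately show "(h, \<lambda>v. c * y v) \<in> weight_points \<Omega> u"
    unfolding x(1) using weight_pointsI by metis
qed

lemma poly_subst_monom:
  "poly (subst (\<lambda>p. p) (\<lambda>v. monom (x v) (u v)) F) a = subst (\<lambda>p. poly p a) (\<lambda>v. a ^ u v * x v) F"
  using hom_subst[OF comm_ring_hom_poly[of a], of "\<lambda>p. p" "\<lambda>v. monom (x v) (u v)" F]
  by (simp add: poly_monom mult.commute)

text \<open>Vanishing for every parameter value is an identity of polynomials in the parameter,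
  because the field is infinite. The value now lies in C[t], an integral domain, from which
  torsion-freeness follows.\<close>

lemma weight_family_iff:
  "F \<in> weight_family V \<Omega> u \<longleftrightarrow> F \<in> mpolys V \<and> (\<forall>x\<in>\<Omega>. subst (\<lambda>p. p) (\<lambda>v. monom (x v) (u v)) F = 0)"
proof -
  have "(\<forall>a. subst (\<lambda>p. poly p a) (\<lambda>v. a ^ u v * x v) F = 0) \<longleftrightarrow>
      subst (\<lambda>p. p) (\<lambda>v. monom (x v) (u v)) F = 0" for x
    by (simp add: poly_all_0_iff_0 flip: poly_subst_monom)
  moreover have "F \<in> weight_family V \<Omega> u \<longleftrightarrow>
      F \<in> mpolys V \<and> (\<forall>x\<in>\<Omega>. \<forall>a. subst (\<lambda>p. poly p a) (\<lambda>v. a ^ u v * x v) F = 0)"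
  proof (intro iffI conjI ballI allI)
    assume F: "F \<in> weight_family V \<Omega> u"
    show "F \<in> mpolys V" using F by (rule vanishing_ideal_mpolys)
    show "subst (\<lambda>p. poly p a) (\<lambda>v. a ^ u v * x v) F = 0" if "x \<in> \<Omega>" for x a
      by (rule vanishing_idealD[OF F weight_pointsI[OF that]])
  qed (auto intro!: vanishing_idealI simp: weight_points_def)
  ultimately show ?thesis by simp
qed

lemma Const_mult_single: "Const c * Poly_Mapping.single m d = Poly_Mapping.single m (c * d :: 'a::comm_ring_1)"
  by (simp add: Const_def mult_single)

lemma weight_family_torsion_free:
  assumes "Const g * F \<in> weight_family V \<Omega> u" "F \<in> mpolys V" "g \<noteq> 0"
  shows "F \<in> weight_family V \<Omega> u"
  using assms by (auto simp: weight_family_iff subst_mult[OF comm_ring_hom_id] subst_Const)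

text \<open>Homogenizing commutes with the scalar \<open>g\<close>, so \<open>g\<close> can be
  cancelled in the homogeneous family, after which setting the coordinate \<open>v\<close> to 1
  returns to the chart.\<close>

lemma chart_torsion_free:
  assumes \<Omega>: "vcone \<Omega>" and v: "v \<in> V" and g: "g \<noteq> 0" and f: "f \<in> mpolys (V - {v})"
    and gf: "Const g * f \<in> dehomogenize v ` weight_family V \<Omega> u"
  shows "f \<in> dehomogenize v ` weight_family V \<Omega> u"
proof -
  let ?Y = "weight_points \<Omega> u"
  have Y: "cone ?Y" by (rule cone_weight_points[OF \<Omega>])
  define N where "N = Max (mdeg ` Poly_Mapping.keys f)"
  have N: "mdeg m \<le> N" if "m \<in> Poly_Mapping.keys f" for m
    using that by (auto simp: N_def)
  have keys: "Poly_Mapping.keys (Const g * f) = Poly_Mapping.keys f"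
    using g by (auto simp: in_keys_iff lookup_Const_mult)
  have hc: "homogenize v N (Const g * f) = Const g * homogenize v N f"
    unfolding homogenize_def keys by (simp add: lookup_Const_mult sum_distrib_left Const_mult_single)
  have "Var v * homogenize v N (Const g * f) \<in> vanishing_ideal V ?Y"
    using gf by (intro homogenize_in_vanishing_ideal[OF Y _ v])
      (auto simp: dehomogenize_vanishing_ideal[OF Y v] keys N)
  then have "Const g * (Var v * homogenize v N f) \<in> vanishing_ideal V ?Y"
    by (simp only: hc mult.left_commute[of "Var v"])
  then have "Var v * homogenize v N f \<in> vanishing_ideal V ?Y"
    by (rule weight_family_torsion_free[OF _ mpolys_mult[OF mpolys_Var[OF v] homogenize_in_mpolys[OF f v]] g])
  moreover have "dehomogenize v (Var v * homogenize v N f) = f"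
    using dehomogenize_homogenize[OF f, of N]
    by (simp add: dehomogenize_def subst_mult[OF comm_ring_hom_Const] subst_Var Const_1)
  ultimately show ?thesis by (metis imageI)
qed

lemma eval_fibre:
  "eval_at x (subst (\<lambda>p. Const (poly p a)) Var F) = subst (\<lambda>p. poly p a) x F"
  using hom_subst[OF comm_ring_hom_subst[OF comm_ring_hom_id, of x], of "\<lambda>p. Const (poly p a)" Var F]
  by (simp add: subst_Const subst_Var)

lemma fibre_ideal_weight_family:
  assumes a: "a \<noteq> 0"
  shows "fibre_ideal a (weight_family V \<Omega> u) = van V ((\<lambda>x v. a ^ u v * x v) ` \<Omega>)"
proof (intro equalityI subsetI)
  fix f assume "f \<in> fibre_ideal a (weight_family V \<Omega> u)"
  then obtain F where F: "F \<in> weight_family V \<Omega> u" "f = subst (\<lambda>p. Const (poly p a)) Var F"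
    by (auto simp: fibre_ideal_def)
  have "f \<in> mpolys V" unfolding F by (rule mpolys_subst[OF vanishing_ideal_mpolys[OF F(1)]]) auto
  moreover have "eval_at (\<lambda>v. a ^ u v * x v) f = 0" if "x \<in> \<Omega>" for x
    unfolding F(2) eval_fibre by (rule vanishing_idealD[OF F(1)]) (use that in \<open>auto simp: weight_points_def\<close>)
  ultimately show "f \<in> van V ((\<lambda>x v. a ^ u v * x v) ` \<Omega>)" by (auto simp: van_iff)
next
  fix f assume f: "f \<in> van V ((\<lambda>x v. a ^ u v * x v) ` \<Omega>)"
  define wt where "wt m = (\<Sum>v\<in>Poly_Mapping.keys m. u v * Poly_Mapping.lookup m v)" for m
  define U where "U = Max (wt ` Poly_Mapping.keys f)"
  have U: "wt m \<le> U" if "m \<in> Poly_Mapping.keys f" for m using that by (auto simp: U_def)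
  have wt: "mono_eval (\<lambda>v. c ^ u v * x v) m = c ^ wt m * mono_eval x m" for c and x :: "'a \<Rightarrow> complex" and m
    by (simp add: mono_eval_scale[of "\<lambda>v. c ^ u v"] wt_def power_sum mono_eval_def[of "\<lambda>v. c ^ u v"] flip: power_mult)
  \<comment> \<open>Each term is multiplied by (t/a)^(U - weight). At t = a this is
    \<open>f\<close>; at t = b, on a point moved by the powers of b, it is (b/a)^U times the value
    of \<open>f\<close> on the point moved by the powers of a.\<close>
  define F where "F = (\<Sum>m\<in>Poly_Mapping.keys f.
    Poly_Mapping.single m (monom (Poly_Mapping.lookup f m / a ^ (U - wt m)) (U - wt m)))"
  have "subst (\<lambda>p. Const (poly p a)) Var F
      = (\<Sum>m\<in>Poly_Mapping.keys f. Const (Poly_Mapping.lookup f m) * mono_eval Var m)"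
    using a by (auto simp: F_def subst_sum[OF comm_ring_homs(4)] subst_single poly_monom intro!: sum.cong)
  then have fib: "subst (\<lambda>p. Const (poly p a)) Var F = f"
    by (simp flip: subst_def' add: subst_Const_Var)
  have "F \<in> mpolys V"
    using f by (auto simp: F_def van_iff mpolys_iff dest!: subsetD[OF keys_sum] split: if_splits)
  moreover have "subst (\<lambda>p. poly p b) (\<lambda>v. b ^ u v * x v) F = 0" if "x \<in> \<Omega>" for b x
  proof -
    have "subst (\<lambda>p. poly p b) (\<lambda>v. b ^ u v * x v) F
      = (\<Sum>m\<in>Poly_Mapping.keys f. (b / a) ^ U * (Poly_Mapping.lookup f m * mono_eval (\<lambda>v. a ^ u v * x v) m))"
      unfolding F_def subst_sum[OF comm_ring_hom_poly]
    proof (rule sum.cong[OF refl])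
      fix m assume m: "m \<in> Poly_Mapping.keys f"
      have "(b / a) ^ U * (Poly_Mapping.lookup f m * (a ^ wt m * mono_eval x m))
          = (b / a) ^ (U - wt m) * (b / a) ^ wt m * (Poly_Mapping.lookup f m * (a ^ wt m * mono_eval x m))"
        using U[OF m] by (simp flip: power_add)
      also have "\<dots> = Poly_Mapping.lookup f m / a ^ (U - wt m) * b ^ (U - wt m) * (b ^ wt m * mono_eval x m)"
        using a by (simp add: power_divide field_simps)
      finally show "subst (\<lambda>p. poly p b) (\<lambda>v. b ^ u v * x v)
          (Poly_Mapping.single m (monom (Poly_Mapping.lookup f m / a ^ (U - wt m)) (U - wt m)))
        = (b / a) ^ U * (Poly_Mapping.lookup f m * mono_eval (\<lambda>v. a ^ u v * x v) m)"
        by (simp add: subst_single poly_monom wt)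
    qed
    also have "\<dots> = (b / a) ^ U * eval_at (\<lambda>v. a ^ u v * x v) f"
      by (simp add: subst_def' sum_distrib_left)
    also have "\<dots> = 0" using f that by (auto simp: van_iff)
    finally show ?thesis .
  qed
  ultimately have "F \<in> weight_family V \<Omega> u"
    by (auto simp: vanishing_ideal_def weight_points_def)
  then show "f \<in> fibre_ideal a (weight_family V \<Omega> u)"
    unfolding fibre_ideal_def using fib by (metis imageI)
qed

section \<open>Diagonal isomorphisms\<close>

lemma image_diag_line: "(\<lambda>x v. b v * x v) ` line x = line (\<lambda>v. b v * (x v :: complex))"
  by (simp add: line_def full_SetCompr_eq image_image mult.left_commute)

lemma zariski_closed_empty: "zariski_closed V {}"
proof -
  have "zero_set V {1} = {}"
    using comm_ring_hom_subst[OF comm_ring_hom_id]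
    by (auto simp: zero_set_def proj_space_def Const_1[symmetric] subst_Const intro: mem_line)
  then show ?thesis unfolding zariski_closed_def
    by (intro exI[of _ "{1}"]) (auto simp: homogeneous_iff)
qed

text \<open>Linear forms describe the map everywhere at once, so the excluded closed set is empty
  and the common degree is 1.\<close>

lemma regular_map_diag:
  fixes b :: "'v \<Rightarrow> complex"
  assumes b: "\<And>v. b v \<noteq> 0" and X: "X \<subseteq> proj_space V" and XY: "(\<lambda>L. (\<lambda>x v. b v * x v) ` L) ` X \<subseteq> Y"
  shows "regular_map V X V Y (\<lambda>L. (\<lambda>x v. b v * x v) ` L)"
  unfolding regular_map_def
proof (intro conjI XY ballI)
  fix L assume "L \<in> X"
  let ?F = "\<lambda>w. Const (b w) * Var w :: ('v, complex) mpoly"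
  have ev: "eval_at x (?F w) = b w * x w" for x w
    by (simp add: subst_mult[OF comm_ring_hom_id] subst_Const subst_Var)
  have hom: "homogeneous 1 (?F w)" for w
    by (auto simp: homogeneous_iff Const_def Var_def mult_single)
  show "\<exists>A F d. zariski_closed V A \<and> L \<notin> A \<and>
        (\<forall>w \<in> V. F w \<in> carrier (mpoly_ring V) \<and> homogeneous d (F w)) \<and>
        (\<forall>M \<in> X - A. \<forall>x \<in> M - {\<lambda>_. 0}.
           (\<exists>w \<in> V. eval_at x (F w) \<noteq> 0) \<and>
           (\<lambda>x v. b v * x v) ` M = line (\<lambda>w. if w \<in> V then eval_at x (F w) else 0))"
  proof (intro exI[of _ "{}"] exI[of _ ?F] exI[of _ 1] conjI zariski_closed_empty ballI hom)
    fix M x assume M: "M \<in> X - {}" and x: "x \<in> M - {\<lambda>_. 0}"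
    then obtain y where y: "M = line y" "\<And>v. v \<notin> V \<Longrightarrow> y v = 0" using X by (auto simp: proj_space_def)
    then obtain c where c: "x = (\<lambda>v. c * y v)" using x by (auto simp: line_def)
    with x have c0: "c \<noteq> 0" by auto
    from x obtain w where w: "x w \<noteq> 0" by fastforce
    with y c have "w \<in> V" by auto
    with w b show "\<exists>w\<in>V. eval_at x (?F w) \<noteq> 0" by (auto simp: ev)
    have "(\<lambda>w. if w \<in> V then eval_at x (?F w) else 0) = (\<lambda>v. c * (b v * y v))"
      using y by (auto simp: fun_eq_iff ev c)
    then show "(\<lambda>x v. b v * x v) ` M = line (\<lambda>w. if w \<in> V then eval_at x (?F w) else 0)"
      by (simp add: y image_diag_line line_scale[OF c0])
  qed auto
qed

lemma isomorphic_varieties_diag: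
  fixes b :: "'v \<Rightarrow> complex"
  assumes b: "\<And>v. b v \<noteq> 0" and X: "X \<subseteq> proj_space V"
    and Y: "Y = (\<lambda>L. (\<lambda>x v. b v * x v) ` L) ` X"
  shows "isomorphic_varieties V Y V X"
proof -
  let ?f = "\<lambda>b L. (\<lambda>x v. b v * x v) ` L :: 'v point" and ?c = "\<lambda>v. inverse (b v)"
  have inv: "?f ?c (?f b L) = L" "?f b (?f ?c L) = L" for L
    using b by (simp_all add: image_image mult.assoc[symmetric])
  have "Y \<subseteq> proj_space V"
  proof
    fix M assume "M \<in> Y"
    then obtain L where L: "L \<in> proj_space V" "M = ?f b L" using X by (auto simp: Y)
    then obtain x w where x: "L = line x" "\<And>v. v \<notin> V \<Longrightarrow> x v = 0" "x w \<noteq> 0"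
      by (auto simp: proj_space_def)
    show "M \<in> proj_space V"
      unfolding L x image_diag_line by (rule line_in_proj_space[of _ _ w]) (use b x in auto)
  qed
  then have "regular_map V Y V X (?f ?c)"
    using b inv by (intro regular_map_diag) (auto simp: Y)
  moreover have "regular_map V X V Y (?f b)"
    using b X by (intro regular_map_diag) (auto simp: Y)
  ultimately show ?thesis unfolding isomorphic_varieties_def
    using inv by (intro exI[of _ "?f ?c"] exI[of _ "?f b"]) auto
qed

lemma proj_space_zero_set: "zero_set V S \<subseteq> proj_space V"
  by (auto simp: zero_set_def)

lemma isomorphic_varieties_refl: "X \<subseteq> proj_space V \<Longrightarrow> isomorphic_varieties V X V X"
  by (rule isomorphic_varieties_diag[of "\<lambda>_. 1"]) auto

text \<open>The fibre is the translate of \<Omega> by an invertible diagonal matrix. The hypothesis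
  \<open>X\<close> says that the lines of \<Omega> already form a closed set, which the diagonal
  isomorphism carries to the fibre.\<close>

lemma scheme_isomorphic_fibre:
  assumes \<Omega>: "vcone \<Omega>" and X: "zero_set V (van V \<Omega>) = lines \<Omega>" and a: "a \<noteq> 0"
  shows "scheme_isomorphic_to V (fibre_ideal a (weight_family V \<Omega> u)) (lines \<Omega>)"
proof -
  let ?b = "\<lambda>v. a ^ u v" and ?\<Omega> = "(\<lambda>x v. a ^ u v * x v) ` \<Omega>"
  have \<Omega>': "vcone ?\<Omega>"
    using \<Omega> by (auto simp: vcone_def image_iff mult.left_commute intro!: bexI[of _ "\<lambda>v. _ * _ v"])
  have "zero_set V (van V ?\<Omega>) = (\<lambda>L. (\<lambda>x v. ?b v * x v) ` L) ` lines \<Omega>" (is "?l = ?r")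
  proof (intro equalityI subsetI)
    fix L assume "L \<in> ?l"
    then obtain y where y: "L = line y" "\<And>v. v \<notin> V \<Longrightarrow> y v = 0" "\<exists>v. y v \<noteq> 0"
      "\<And>f. f \<in> van V ?\<Omega> \<Longrightarrow> eval_at y f = 0"
      unfolding zero_set_vanishing_ideal[OF \<Omega>'] by auto
    let ?x = "\<lambda>v. inverse (?b v) * y v"
    have "eval_at ?x g = 0" if g: "g \<in> van V \<Omega>" for g
    proof -
      let ?g = "subst Const (\<lambda>v. Const (inverse (?b v)) * Var v) g"
      have ev: "eval_at z ?g = eval_at (\<lambda>v. inverse (?b v) * z v) g" for z
        by (simp add: subst_subst_Const[OF comm_ring_hom_id] subst_mult[OF comm_ring_hom_id] subst_Const subst_Var)
      have "?g \<in> van V ?\<Omega>"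
        using g a by (auto simp: van_iff ev mult.assoc[symmetric] intro!: mpolys_subst)
      then show ?thesis using y(4) ev[of y] by simp
    qed
    moreover obtain w where "y w \<noteq> 0" using y(3) by auto
    ultimately have "line ?x \<in> zero_set V (van V \<Omega>)"
      by (intro line_in_zero_set_van[OF \<Omega>, of _ _ w]) (use y a in auto)
    then have "line ?x \<in> lines \<Omega>" by (simp add: X)
    moreover have "L = (\<lambda>x v. ?b v * x v) ` line ?x"
      using a by (simp add: y(1) image_diag_line mult.assoc[symmetric])
    ultimately show "L \<in> ?r" by blast
  next
    fix L assume "L \<in> ?r"
    then obtain x w where x: "x \<in> \<Omega>" "x w \<noteq> 0" "L = line (\<lambda>v. ?b v * x v)"
      unfolding lines_def using image_diag_line[of ?b] by auto
    have "line x \<in> zero_set V (van V \<Omega>)" using x by (auto simp: X lines_def)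
    then have "x v = 0" if "v \<notin> V" for v
      using proj_space_support[OF _ mem_line that] proj_space_zero_set by blast
    then show "L \<in> ?l"
      unfolding x(3) using x a by (intro line_in_zero_set_van[OF \<Omega>', of _ _ w]) (auto simp: van_iff)
  qed
  moreover have "lines \<Omega> \<subseteq> proj_space V" using X proj_space_zero_set by metis
  ultimately have "isomorphic_varieties V (zero_set V (van V ?\<Omega>)) V (lines \<Omega>)"
    using a by (intro isomorphic_varieties_diag[of ?b]) auto
  then show ?thesis
    unfolding scheme_isomorphic_to_def fibre_ideal_weight_family[OF a]
    using reduced_scheme_vanishing_ideal[OF cone_vcone[OF \<Omega>']] by simp
qed

section \<open>Torsion-free modules over the affine line\<close>

text \<open>Division with remainder by a nonzero element of least degree.\<close>

lemma poly_ideal_principal: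
  assumes "ideal J (class_ring :: complex poly ring)"
  obtains g where "g \<in> J" "\<And>a. a \<in> J \<Longrightarrow> \<exists>p. a = p * g"
proof -
  interpret ideal J "class_ring :: complex poly ring" by fact
  have 0: "0 \<in> J" using additive_subgroup.zero_closed[OF ideal.axioms(1)[OF assms]] by simp
  have add: "a + b \<in> J" if "a \<in> J" "b \<in> J" for a b
    using additive_subgroup.a_closed[OF ideal.axioms(1)[OF assms] that] by simp
  have mult: "p * a \<in> J" if "a \<in> J" for a p using I_l_closed[OF that, of p] by simp
  show ?thesis
  proof (cases "J = {0}")
    case True
    then show ?thesis using that[of 0] by auto
  next
    case False
    define P where "P g \<longleftrightarrow> g \<in> J \<and> g \<noteq> 0" for g :: "complex poly"
    have "\<exists>g. P g" using False 0 by (auto simp: P_def)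
    then obtain g where g: "P g" and min: "\<And>f. P f \<Longrightarrow> degree g \<le> degree f"
      using ex_has_least_nat[of P _ degree] by blast
    show ?thesis
    proof (rule that)
      show "g \<in> J" using g by (simp add: P_def)
      fix a assume "a \<in> J"
      have "a mod g = a + (- (a div g)) * g"
        by (simp add: minus_div_mult_eq_mod[symmetric])
      then have "a mod g \<in> J" using add[OF \<open>a \<in> J\<close> mult[OF \<open>g \<in> J\<close>]] by metis
      moreover have "a mod g \<noteq> 0 \<Longrightarrow> degree (a mod g) < degree g"
        using g degree_mod_less[of g a] by (auto simp: P_def)
      ultimately have "a mod g = 0" using min[of "a mod g"] unfolding P_def by linarith
      then have "a = (a div g) * g" by (metis div_mult_mod_eq add.right_neutral)
      then show "\<exists>p. a = p * g" by blast
    qed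
  qed
qed

lemma tensor_action_hom:
  assumes "Module.module A M" "ideal J A"
  shows "group_hom (free_Abelian_group (J \<times> carrier M)) (add_monoid M) (tensor_action M)"
    and "\<And>a m. a \<in> J \<Longrightarrow> m \<in> carrier M \<Longrightarrow> tensor_action M (frag_of (a, m)) = a \<odot>\<^bsub>M\<^esub> m"
proof -
  interpret Module.module A M by fact
  interpret J: ideal J A by fact
  let ?F = "free_Abelian_group (J \<times> carrier M)"
  let ?t = "\<lambda>p. fst p \<odot>\<^bsub>M\<^esub> snd p"
  have t: "?t p \<in> carrier M" if "p \<in> J \<times> carrier M" for p
    using that J.Icarr by auto
  have pc: "[k] \<cdot>\<^bsub>M\<^esub> (a \<odot>\<^bsub>M\<^esub> m) \<in> carrier M" if "(a, m) \<in> J \<times> carrier M" for k :: int and a m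
    using M.add.int_pow_closed[OF t[OF that]] by simp
  have z0: "[(0::int)] \<cdot>\<^bsub>M\<^esub> x = \<zero>\<^bsub>M\<^esub>" for x by (simp add: add_pow_def)
  have super: "tensor_action M z = (\<Oplus>\<^bsub>M\<^esub>p\<in>S. [Poly_Mapping.lookup z p] \<cdot>\<^bsub>M\<^esub> ?t p)"
    if "finite S" "Poly_Mapping.keys z \<subseteq> S" "S \<subseteq> J \<times> carrier M" for S z
    unfolding tensor_action_def
    by (rule M.add.finprod_mono_neutral_cong_left)
      (use that pc z0 in \<open>auto simp: in_keys_iff\<close>)
  have closed: "tensor_action M z \<in> carrier M" if "z \<in> carrier ?F" for z
    unfolding tensor_action_def
    by (rule M.finsum_closed) (use that t in \<open>auto intro!: M.add.int_pow_closed\<close>)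
  show "group_hom ?F (add_monoid M) (tensor_action M)"
  proof (rule group_hom.intro)
    show "group ?F" by simp
    show "Group.group (add_monoid M)" using M.add.is_group .
    show "group_hom_axioms ?F (add_monoid M) (tensor_action M)"
    proof (rule group_hom_axioms.intro, rule homI)
      fix y z assume yz: "y \<in> carrier ?F" "z \<in> carrier ?F"
      let ?S = "Poly_Mapping.keys y \<union> Poly_Mapping.keys z"
      have S: "finite ?S" "?S \<subseteq> J \<times> carrier M" using yz by auto
      have c: "(\<lambda>p. [k p] \<cdot>\<^bsub>M\<^esub> ?t p) \<in> ?S \<rightarrow> carrier M" for k :: "_ \<Rightarrow> int"
        using S(2) t by (intro Pi_I M.add.int_pow_closed) blast
      have "tensor_action M (y + z) = (\<Oplus>\<^bsub>M\<^esub>p\<in>?S. [Poly_Mapping.lookup (y + z) p] \<cdot>\<^bsub>M\<^esub> ?t p)"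
        by (rule super[OF S(1) _ S(2)]) (rule keys_add)
      also have "\<dots> = (\<Oplus>\<^bsub>M\<^esub>p\<in>?S. [Poly_Mapping.lookup y p] \<cdot>\<^bsub>M\<^esub> ?t p \<oplus>\<^bsub>M\<^esub> [Poly_Mapping.lookup z p] \<cdot>\<^bsub>M\<^esub> ?t p)"
      proof (rule M.add.finprod_cong')
        fix p assume "p \<in> ?S"
        then have "?t p \<in> carrier M" using S(2) t by blast
        then show "[Poly_Mapping.lookup (y + z) p] \<cdot>\<^bsub>M\<^esub> ?t p =
          [Poly_Mapping.lookup y p] \<cdot>\<^bsub>M\<^esub> ?t p \<oplus>\<^bsub>M\<^esub> [Poly_Mapping.lookup z p] \<cdot>\<^bsub>M\<^esub> ?t p"
          by (simp add: lookup_add M.add.int_pow_mult)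
      qed (use c[of "Poly_Mapping.lookup y"] c[of "Poly_Mapping.lookup z"] in \<open>auto\<close>)
      also have "\<dots> = tensor_action M y \<oplus>\<^bsub>M\<^esub> tensor_action M z"
        using M.finsum_addf[OF c[of "Poly_Mapping.lookup y"] c[of "Poly_Mapping.lookup z"]] super[OF S(1) _ S(2), of y] super[OF S(1) _ S(2), of z] by simp
      finally show "tensor_action M (y \<otimes>\<^bsub>?F\<^esub> z) = tensor_action M y \<otimes>\<^bsub>add_monoid M\<^esub> tensor_action M z"
        by simp
    qed (use closed in simp)
  qed
  show "tensor_action M (frag_of (a, m)) = a \<odot>\<^bsub>M\<^esub> m" if "a \<in> J" "m \<in> carrier M" for a m
    unfolding tensor_action_def keys_frag_of using t[of "(a, m)"] that by simp
qed

text \<open>An ideal of C[t] is generated by one \<open>g\<close>, so every tensor collapses to a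
  single \<open>g \<otimes> m\<close>. If its image \<open>g m\<close> is zero, torsion-freeness
  gives \<open>g = 0\<close> or \<open>m = 0\<close>, and either makes the tensor zero.\<close>

lemma torsion_free_imp_flat:
  fixes M :: "(complex poly, 'b, 'n) module_scheme"
  assumes M: "Module.module class_ring M"
    and tf: "\<And>g m. g \<noteq> 0 \<Longrightarrow> m \<in> carrier M \<Longrightarrow> g \<odot>\<^bsub>M\<^esub> m = \<zero>\<^bsub>M\<^esub> \<Longrightarrow> m = \<zero>\<^bsub>M\<^esub>"
  shows "flat_module class_ring M"
  unfolding flat_module_def
proof (intro allI impI)
  fix J :: "complex poly set" assume J: "ideal J class_ring"
  interpret Module.module class_ring M by (rule M)
  let ?F = "free_Abelian_group (J \<times> carrier M)"
  let ?\<phi> = "tensor_action M"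
  let ?rel = "tensor_relations class_ring J M"
  define H where "H = generate ?F ?rel"
  interpret h: group_hom ?F "add_monoid M" ?\<phi> by (rule tensor_action_hom(1)[OF M J])
  note frag = tensor_action_hom(2)[OF M J]
  obtain g where g: "g \<in> J" "\<And>a. a \<in> J \<Longrightarrow> \<exists>p. a = p * g" using poly_ideal_principal[OF J] by blast
  have J0: "0 \<in> J" using additive_subgroup.zero_closed[OF ideal.axioms(1)[OF J]] by simp
  have Jadd: "a + b \<in> J" if "a \<in> J" "b \<in> J" for a b
    using additive_subgroup.a_closed[OF ideal.axioms(1)[OF J] that] by simp
  have Jmult: "p * a \<in> J" if "a \<in> J" for a p using ideal.I_l_closed[OF J that, of p] by simp
  have fc: "frag_of (a, m) \<in> carrier ?F" if "a \<in> J" "m \<in> carrier M" for a m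
    using that by (simp add: keys_frag_of)
  have minus: "x - y \<in> carrier ?F" if "x \<in> carrier ?F" "y \<in> carrier ?F" for x y
    using that keys_diff[of x y] by auto
  have \<phi>minus: "?\<phi> (x - y) = ?\<phi> x \<ominus>\<^bsub>M\<^esub> ?\<phi> y" if "x \<in> carrier ?F" "y \<in> carrier ?F" for x y
  proof -
    have "?\<phi> x = ?\<phi> (x - y) \<oplus>\<^bsub>M\<^esub> ?\<phi> y"
      using h.hom_mult[OF minus[OF that] that(2)] by simp
    moreover have "?\<phi> (x - y) \<in> carrier M" "?\<phi> y \<in> carrier M"
      using h.hom_closed[OF minus[OF that]] h.hom_closed[OF that(2)] by auto
    ultimately show ?thesis by (simp add: a_minus_def M.a_assoc M.r_neg)
  qed
  have rel_carrier: "?rel \<subseteq> carrier ?F"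
    unfolding tensor_relations_def using Jadd Jmult
    by (auto intro!: minus fc simp del: carrier_free_Abelian_group_iff)
  have "?\<phi> z = \<zero>\<^bsub>M\<^esub>" if "z \<in> ?rel" for z
    using that unfolding tensor_relations_def
  proof (elim UnE CollectE exE conjE)
    fix a b m assume *: "z = frag_of (a \<oplus>\<^bsub>class_ring\<^esub> b, m) - frag_of (a, m) - frag_of (b, m)"
      "a \<in> J" "b \<in> J" "m \<in> carrier M"
    have c: "a \<odot>\<^bsub>M\<^esub> m \<in> carrier M" "b \<odot>\<^bsub>M\<^esub> m \<in> carrier M" using * by simp_all
    have "?\<phi> z = (a + b) \<odot>\<^bsub>M\<^esub> m \<ominus>\<^bsub>M\<^esub> a \<odot>\<^bsub>M\<^esub> m \<ominus>\<^bsub>M\<^esub> b \<odot>\<^bsub>M\<^esub> m"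
      using * by (simp add: \<phi>minus minus fc frag Jadd del: carrier_free_Abelian_group_iff)
    also have "(a + b) \<odot>\<^bsub>M\<^esub> m = a \<odot>\<^bsub>M\<^esub> m \<oplus>\<^bsub>M\<^esub> b \<odot>\<^bsub>M\<^esub> m"
      using smult_l_distr[of a b m] * by simp
    finally show ?thesis using c
      by (metis (no_types, lifting) M.a_comm M.add.inv_closed M.add.inv_solve_right M.add.m_closed M.minus_eq M.r_neg)
  next
    fix a l m assume *: "z = frag_of (a, l \<oplus>\<^bsub>M\<^esub> m) - frag_of (a, l) - frag_of (a, m)"
      "a \<in> J" "l \<in> carrier M" "m \<in> carrier M"
    have c: "a \<odot>\<^bsub>M\<^esub> l \<in> carrier M" "a \<odot>\<^bsub>M\<^esub> m \<in> carrier M" using * by simp_all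
    have "?\<phi> z = a \<odot>\<^bsub>M\<^esub> (l \<oplus>\<^bsub>M\<^esub> m) \<ominus>\<^bsub>M\<^esub> a \<odot>\<^bsub>M\<^esub> l \<ominus>\<^bsub>M\<^esub> a \<odot>\<^bsub>M\<^esub> m"
      using * by (simp add: \<phi>minus minus fc frag del: carrier_free_Abelian_group_iff)
    also have "a \<odot>\<^bsub>M\<^esub> (l \<oplus>\<^bsub>M\<^esub> m) = a \<odot>\<^bsub>M\<^esub> l \<oplus>\<^bsub>M\<^esub> a \<odot>\<^bsub>M\<^esub> m"
      using smult_r_distr[of a l m] * by simp
    finally show ?thesis using c
      by (metis (no_types, lifting) M.a_comm M.add.inv_closed M.add.inv_solve_right M.add.m_closed M.minus_eq M.r_neg)
  next
    fix r a m assume *: "z = frag_of (r \<otimes>\<^bsub>class_ring\<^esub> a, m) - frag_of (a, r \<odot>\<^bsub>M\<^esub> m)"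
      "r \<in> carrier class_ring" "a \<in> J" "m \<in> carrier M"
    have "?\<phi> z = (r * a) \<odot>\<^bsub>M\<^esub> m \<ominus>\<^bsub>M\<^esub> a \<odot>\<^bsub>M\<^esub> (r \<odot>\<^bsub>M\<^esub> m)"
      using * by (simp add: \<phi>minus fc frag Jmult del: carrier_free_Abelian_group_iff)
    also have "(r * a) \<odot>\<^bsub>M\<^esub> m = a \<odot>\<^bsub>M\<^esub> (r \<odot>\<^bsub>M\<^esub> m)"
      using smult_assoc1[of a r m] * by (simp add: mult.commute)
    finally show ?thesis using * by (simp add: M.minus_eq M.r_neg)
  qed
  then have "?rel \<subseteq> kernel ?F (add_monoid M) ?\<phi>"
    using rel_carrier unfolding kernel_def by (simp only: monoid.simps) blast
  then have Hker: "H \<subseteq> kernel ?F (add_monoid M) ?\<phi>"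
    unfolding H_def by (rule h.G.generate_subgroup_incl[OF _ h.subgroup_kernel])
  have H: "subgroup H ?F" unfolding H_def by (rule h.G.generate_is_subgroup[OF rel_carrier])
  have relH: "z \<in> H" if "z \<in> ?rel" for z
    unfolding H_def using that by (rule generate.incl)
  have Hadd: "x + y \<in> H" if "x \<in> H" "y \<in> H" for x y
    using subgroup.m_closed[OF H that] by simp
  have Hcarr: "x \<in> carrier ?F" if "x \<in> H" for x using subgroup.mem_carrier[OF H that] .
  have Huminus: "- x \<in> H" if "x \<in> H" for x
    using subgroup.m_inv_closed[OF H that] Hcarr[OF that] by simp
  have Hdiff: "x - y \<in> H" if "x \<in> H" "y \<in> H" for x y
    using Hadd[OF that(1) Huminus[OF that(2)]] by simp
  have zero_r: "frag_of (a, \<zero>\<^bsub>M\<^esub>) \<in> H" if "a \<in> J" for a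
  proof -
    have "frag_of (a, \<zero>\<^bsub>M\<^esub> \<oplus>\<^bsub>M\<^esub> \<zero>\<^bsub>M\<^esub>) - frag_of (a, \<zero>\<^bsub>M\<^esub>) - frag_of (a, \<zero>\<^bsub>M\<^esub>) \<in> H"
      by (rule relH) (use that in \<open>unfold tensor_relations_def, blast intro: M.zero_closed\<close>)
    then show ?thesis using Huminus by fastforce
  qed
  have zero_l: "frag_of (0, m) \<in> H" if "m \<in> carrier M" for m
  proof -
    have "frag_of (0 \<oplus>\<^bsub>class_ring\<^esub> 0, m) - frag_of (0, m) - frag_of (0, m) \<in> H"
      by (rule relH) (use that J0 in \<open>unfold tensor_relations_def, blast\<close>)
    then show ?thesis using Huminus by fastforce
  qed
  \<comment> \<open>Collapse to one tensor: a generator \<open>p g \<otimes> m\<close> becomes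
    \<open>g \<otimes> p m\<close>, and differences are combined by additivity in the second
    factor.\<close>
  have red: "\<exists>m\<in>carrier M. w - frag_of (g, m) \<in> H" if "w \<in> carrier ?F" for w
  proof -
    have "Poly_Mapping.keys w \<subseteq> J \<times> carrier M" using that by simp
    then show ?thesis
    proof (induction rule: frag_induction)
      case zero
      show ?case using Huminus[OF zero_r[OF g(1)]] by (intro bexI[of _ "\<zero>\<^bsub>M\<^esub>"]) auto
    next
      case (one x)
      then obtain a m where x: "x = (a, m)" "a \<in> J" "m \<in> carrier M" by auto
      then obtain p where p: "a = p * g" using g(2) by blast
      have "frag_of (p \<otimes>\<^bsub>class_ring\<^esub> g, m) - frag_of (g, p \<odot>\<^bsub>M\<^esub> m) \<in> H"
        by (rule relH) (use x g(1) in \<open>unfold tensor_relations_def, fastforce\<close>)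
      then show ?case using x p by (intro bexI[of _ "p \<odot>\<^bsub>M\<^esub> m"]) auto
    next
      case (diff a b)
      then obtain l m where *: "l \<in> carrier M" "a - frag_of (g, l) \<in> H" "m \<in> carrier M" "b - frag_of (g, m) \<in> H"
        by auto
      have "frag_of (g, (l \<ominus>\<^bsub>M\<^esub> m) \<oplus>\<^bsub>M\<^esub> m) - frag_of (g, l \<ominus>\<^bsub>M\<^esub> m) - frag_of (g, m) \<in> H"
        by (rule relH) (use * g(1) in \<open>unfold tensor_relations_def, blast intro: M.minus_closed\<close>)
      note r = this
      have lm: "(l \<ominus>\<^bsub>M\<^esub> m) \<oplus>\<^bsub>M\<^esub> m = l" using * by (simp add: M.minus_eq M.a_assoc M.l_neg)
      have "(a - frag_of (g, l)) - (b - frag_of (g, m)) +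
          (frag_of (g, l) - frag_of (g, l \<ominus>\<^bsub>M\<^esub> m) - frag_of (g, m)) \<in> H"
        by (rule Hadd[OF Hdiff[OF *(2,4)] r[unfolded lm]])
      then show ?case using * by (intro bexI[of _ "l \<ominus>\<^bsub>M\<^esub> m"]) (auto simp: algebra_simps)
    qed
  qed
  have ker: "w \<in> H" if w: "w \<in> carrier ?F" "?\<phi> w = \<zero>\<^bsub>M\<^esub>" for w
  proof -
    obtain m where m: "m \<in> carrier M" "w - frag_of (g, m) \<in> H" using red[OF w(1)] by auto
    have "\<zero>\<^bsub>M\<^esub> = ?\<phi> (w - frag_of (g, m))" using m(2) Hker by (auto simp: kernel_def)
    also have "\<dots> = \<zero>\<^bsub>M\<^esub> \<ominus>\<^bsub>M\<^esub> g \<odot>\<^bsub>M\<^esub> m"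
      using w m g(1) by (simp only: \<phi>minus fc frag)
    finally have "g \<odot>\<^bsub>M\<^esub> m = \<zero>\<^bsub>M\<^esub>" using m
      by (metis M.add.inv_eq_1_iff M.l_zero M.minus_eq M.add.inv_closed smult_closed UNIV_I class_ring_simps(1))
    then have "g = 0 \<or> m = \<zero>\<^bsub>M\<^esub>" using tf m by blast
    then have "frag_of (g, m) \<in> H" using zero_l zero_r g(1) m by auto
    then show ?thesis using Hadd[OF m(2), of "frag_of (g, m)"] by simp
  qed
  show "inj_on (\<lambda>C. the_elem (?\<phi> ` C)) (carrier (ideal_tensor class_ring J M))"
  proof (rule inj_onI)
    fix C D assume C: "C \<in> carrier (ideal_tensor class_ring J M)" and D: "D \<in> carrier (ideal_tensor class_ring J M)"
      and eq: "the_elem (?\<phi> ` C) = the_elem (?\<phi> ` D)"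
    \<comment> \<open>The action is constant on a coset, so \<open>the_elem\<close> returns its
      value at any representative.\<close>
    have *: "\<exists>z\<in>carrier ?F. E = H #>\<^bsub>?F\<^esub> z \<and> the_elem (?\<phi> ` E) = ?\<phi> z"
      if E: "E \<in> carrier (ideal_tensor class_ring J M)" for E
    proof -
      obtain z where z: "z \<in> carrier ?F" "E = H #>\<^bsub>?F\<^esub> z"
        using E unfolding ideal_tensor_def H_def FactGroup_def RCOSETS_def by auto
      have "?\<phi> y = ?\<phi> z" if y: "y \<in> E" for y
      proof -
        obtain x where x: "x \<in> H" "y = x \<otimes>\<^bsub>?F\<^esub> z" using y unfolding z r_coset_def by auto
        have "x \<in> kernel ?F (add_monoid M) ?\<phi>" using x(1) Hker by blast
        then have "?\<phi> x = \<zero>\<^bsub>M\<^esub>" "x \<in> carrier ?F" unfolding kernel_def by simp_all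
        have "?\<phi> y = ?\<phi> x \<otimes>\<^bsub>add_monoid M\<^esub> ?\<phi> z"
          unfolding x(2) by (rule h.hom_mult[OF \<open>x \<in> carrier ?F\<close> z(1)])
        also have "\<dots> = ?\<phi> z"
          unfolding \<open>?\<phi> x = \<zero>\<^bsub>M\<^esub>\<close> using M.l_zero h.hom_closed[OF z(1)] by simp
        finally show ?thesis .
      qed
      moreover have "z \<in> E" unfolding z by (rule h.G.rcos_self[OF z(1) H])
      ultimately have "?\<phi> ` E = {?\<phi> z}" by blast
      then have "the_elem (?\<phi> ` E) = ?\<phi> z" by simp
      with z show ?thesis by blast
    qed
    obtain y z where y: "y \<in> carrier ?F" "C = H #>\<^bsub>?F\<^esub> y" "the_elem (?\<phi> ` C) = ?\<phi> y"
      and z: "z \<in> carrier ?F" "D = H #>\<^bsub>?F\<^esub> z" "the_elem (?\<phi> ` D) = ?\<phi> z"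
      using *[OF C] *[OF D] by blast
    have "?\<phi> (y - z) = \<zero>\<^bsub>M\<^esub>"
      using eq y z h.hom_closed[OF z(1)] by (simp add: \<phi>minus M.minus_eq M.r_neg del: carrier_free_Abelian_group_iff)
    then have "y - z \<in> H" by (intro ker minus y z)
    then have "(y - z) \<otimes>\<^bsub>?F\<^esub> z \<in> H #>\<^bsub>?F\<^esub> z" unfolding r_coset_def by blast
    then have "y \<in> H #>\<^bsub>?F\<^esub> z" by simp
    then show "C = D" using h.G.repr_independence[OF _ z(1) H] y z by metis
  qed
qed

lemma quotient_algebra_flat:
  fixes I :: "('v, complex poly) mpoly set"
  assumes I: "ideal I (mpoly_ring W)"
    and tf: "\<And>g f. g \<noteq> 0 \<Longrightarrow> f \<in> mpolys W \<Longrightarrow> Const g * f \<in> I \<Longrightarrow> f \<in> I"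
  shows "flat_module class_ring (quotient_algebra W I)"
proof -
  let ?R = "mpoly_ring W :: ('v, complex poly) mpoly ring"
  let ?Q = "?R Quot I" and ?M = "quotient_algebra W I"
  interpret R: cring ?R by (rule cring_mpoly_ring)
  interpret I: ideal I ?R by (rule I)
  interpret Q: cring ?Q by (rule I.quotient_is_cring[OF R.is_cring])
  have M: "carrier ?M = carrier ?Q" "\<zero>\<^bsub>?M\<^esub> = \<zero>\<^bsub>?Q\<^esub>" "x \<oplus>\<^bsub>?M\<^esub> y = x \<oplus>\<^bsub>?Q\<^esub> y"
    "c \<odot>\<^bsub>?M\<^esub> x = (I +>\<^bsub>?R\<^esub> Const c) \<otimes>\<^bsub>?Q\<^esub> x" for x y c
    by (simp_all add: quotient_algebra_def Let_def)
  have hom: "(+>\<^bsub>?R\<^esub>) I \<in> Ring.ring_hom ?R ?Q" using I.rcos_ring_hom .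
  interpret C: comm_ring_hom "Const :: complex poly \<Rightarrow> ('v, complex poly) mpoly" by (rule comm_ring_hom_Const)
  have cc: "I +>\<^bsub>?R\<^esub> Const c \<in> carrier ?Q" for c
    using ring_hom_closed[OF hom] by simp
  have cadd: "I +>\<^bsub>?R\<^esub> Const (c + d) = (I +>\<^bsub>?R\<^esub> Const c) \<oplus>\<^bsub>?Q\<^esub> (I +>\<^bsub>?R\<^esub> Const d)" for c d
    using ring_hom_add[OF hom, of "Const c" "Const d"] by (simp add: C.hom_add)
  have cmult: "I +>\<^bsub>?R\<^esub> Const (c * d) = (I +>\<^bsub>?R\<^esub> Const c) \<otimes>\<^bsub>?Q\<^esub> (I +>\<^bsub>?R\<^esub> Const d)" for c d
    using ring_hom_mult[OF hom, of "Const c" "Const d"] by (simp add: C.hom_mult)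
  have cone: "I +>\<^bsub>?R\<^esub> 1 = \<one>\<^bsub>?Q\<^esub>" using ring_hom_one[OF hom] by simp
  have "Module.module class_ring ?M"
  proof (rule Module.moduleI)
    show "cring (class_ring :: complex poly ring)"
      by (intro cringI abelian_groupI comm_monoidI) (auto simp: algebra_simps intro: exI[of _ "- _"])
    show "abelian_group ?M"
    proof (rule abelian_groupI, unfold M)
      fix x y z assume x: "x \<in> carrier ?Q"
      show "\<exists>y\<in>carrier ?Q. y \<oplus>\<^bsub>?Q\<^esub> x = \<zero>\<^bsub>?Q\<^esub>"
        using x Q.l_neg[OF x] by (intro bexI[of _ "\<ominus>\<^bsub>?Q\<^esub> x"]) auto
      assume y: "y \<in> carrier ?Q"
      show "x \<oplus>\<^bsub>?Q\<^esub> y = y \<oplus>\<^bsub>?Q\<^esub> x" by (rule Q.a_comm[OF x y])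
      assume "z \<in> carrier ?Q"
      then show "x \<oplus>\<^bsub>?Q\<^esub> y \<oplus>\<^bsub>?Q\<^esub> z = x \<oplus>\<^bsub>?Q\<^esub> (y \<oplus>\<^bsub>?Q\<^esub> z)" by (rule Q.a_assoc[OF x y])
    qed auto
  qed (auto simp: M cc cadd cmult cone Q.l_distr Q.r_distr Q.m_assoc)
  moreover have "m = \<zero>\<^bsub>?M\<^esub>" if gm: "g \<noteq> 0" "m \<in> carrier ?M" "g \<odot>\<^bsub>?M\<^esub> m = \<zero>\<^bsub>?M\<^esub>" for g m
  proof -
    obtain f where f: "f \<in> mpolys W" "m = I +>\<^bsub>?R\<^esub> f"
      using gm(2) by (auto simp: M FactRing_def A_RCOSETS_def')
    have zero: "I +>\<^bsub>?R\<^esub> h = \<zero>\<^bsub>?Q\<^esub> \<longleftrightarrow> h \<in> I" if "h \<in> mpolys W" for h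
    proof -
      have "\<zero>\<^bsub>?Q\<^esub> = I +>\<^bsub>?R\<^esub> 0"
        using ring_hom_zero[OF hom R.ring_axioms Q.ring_axioms] by simp
      then show ?thesis using R.quotient_eq_iff_same_a_r_cos[OF I, of h 0] that
        by (simp add: a_minus_def a_inv_mpoly_ring)
    qed
    have "I +>\<^bsub>?R\<^esub> (Const g * f) = \<zero>\<^bsub>?Q\<^esub>"
      using gm(3) ring_hom_mult[OF hom, of "Const g" f] f by (simp add: M)
    then have "Const g * f \<in> I" using zero f by simp
    then have "f \<in> I" using tf gm(1) f by blast
    then show ?thesis using zero f by (simp add: M)
  qed
  ultimately show ?thesis by (rule torsion_free_imp_flat)
qed

text \<open>Nonzero fibres are diagonal translates and flatness is torsion-freeness of the charts,
  so only the fibre over 0 has to be identified. Its ideal being a vanishing ideal makes that fibre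
  reduced.\<close>

lemma flat_degenerationI:
  assumes \<Omega>: "vcone \<Omega>" and X: "zero_set V (van V \<Omega>) = lines \<Omega>"
    and fib: "fibre_ideal 0 (weight_family V \<Omega> u) = van V Y" and Y: "vcone Y"
  shows "flat_degeneration V (zero_set V (van V Y)) (lines \<Omega>)"
  unfolding flat_degeneration_def
proof (intro conjI exI[of _ "weight_family V \<Omega> u"] allI impI)
  have c: "cone (weight_points \<Omega> u)" by (rule cone_weight_points[OF \<Omega>])
  show "zariski_closed V (lines \<Omega>)" using zariski_closed_zero_set_van[OF \<Omega>] X by metis
  show "zariski_closed V (zero_set V (van V Y))" by (rule zariski_closed_zero_set_van[OF Y])
  show "homogeneous_ideal V (weight_family V \<Omega> u)" by (rule homogeneous_ideal_vanishing_ideal[OF c])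
  show "scheme_isomorphic_to V (fibre_ideal a (weight_family V \<Omega> u)) (lines \<Omega>)" if "a \<noteq> 0" for a
    by (rule scheme_isomorphic_fibre[OF \<Omega> X that])
  show "scheme_isomorphic_to V (fibre_ideal 0 (weight_family V \<Omega> u)) (zero_set V (van V Y))"
    unfolding scheme_isomorphic_to_def fib
    using reduced_scheme_vanishing_ideal[OF cone_vcone[OF Y]] isomorphic_varieties_refl[OF proj_space_zero_set]
    by blast
  show "flat_over_line V (weight_family V \<Omega> u)"
    unfolding flat_over_line_def
  proof
    fix v assume v: "v \<in> V"
    show "flat_module class_ring (quotient_algebra (V - {v}) (dehomogenize v ` weight_family V \<Omega> u))"
    proof (rule quotient_algebra_flat)
      show "ideal (dehomogenize v ` weight_family V \<Omega> u) (mpoly_ring (V - {v}))"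
        unfolding dehomogenize_vanishing_ideal[OF c v]
        by (rule ideal_vanishing_ideal) (use cone_hom[OF c] in \<open>auto simp: chart_def\<close>)
    qed (rule chart_torsion_free[OF \<Omega> v])
  qed
qed

declare One_nat_def [simp del]

section \<open>Hibi-Li relations and standard monomials in a finite poset\<close>

section \<open>Order ideals and the Hibi-Li relations\<close>


lemma sum_lessThan_add_const:
  "(\<Sum>i<a + b. c) = (\<Sum>i<a. c) + (\<Sum>i<(b::nat). (c::'a::comm_monoid_add))"
  by (induction b) (auto simp: add.assoc)

lemma split_monomial:
  fixes m :: "'v \<Rightarrow>\<^sub>0 nat"
  assumes "v \<in> Poly_Mapping.keys m"
  obtains m' where "m = Poly_Mapping.single v 1 + m'" "Poly_Mapping.keys m' \<subseteq> Poly_Mapping.keys m"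
    "\<And>u. u \<noteq> v \<Longrightarrow> Poly_Mapping.lookup m' u = Poly_Mapping.lookup m u"
proof
  let ?m' = "m - Poly_Mapping.single v 1"
  show "m = Poly_Mapping.single v 1 + ?m'"
    by (rule poly_mapping_eqI) (use assms in \<open>auto simp: lookup_add lookup_minus lookup_single when_def in_keys_iff\<close>)
  show "Poly_Mapping.keys ?m' \<subseteq> Poly_Mapping.keys m"
    by (auto simp: lookup_minus in_keys_iff)
  show "Poly_Mapping.lookup ?m' u = Poly_Mapping.lookup m u" if "u \<noteq> v" for u
    using that by (simp add: lookup_minus lookup_single)
qed

lemma mdeg_eq_0_iff: "mdeg m = 0 \<longleftrightarrow> m = 0"
proof
  assume "mdeg m = 0"
  then have "Poly_Mapping.lookup m v = 0" for v
    by (cases "v \<in> Poly_Mapping.keys m") (auto simp: mdeg_def in_keys_iff)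
  then show "m = 0" by (auto intro: poly_mapping_eqI)
qed simp

locale finite_poset =
  fixes P :: "'p set" and r :: "'p rel"
  assumes finP: "finite P" and order: "strict_order_on P r"
begin

abbreviation "ideals \<equiv> order_ideals P r"
abbreviation "mx \<equiv> max_elems r"
abbreviation "st \<equiv> star r"

lemma ideal_sub: "J \<in> ideals \<Longrightarrow> J \<subseteq> P"
  and ideal_down: "J \<in> ideals \<Longrightarrow> q \<in> J \<Longrightarrow> (p, q) \<in> r \<Longrightarrow> p \<in> J"
  by (auto simp: order_ideals_def)

lemma finite_ideals: "finite ideals"
  by (rule finite_subset[of _ "Pow P"]) (use finP in \<open>auto simp: order_ideals_def\<close>)

lemma finite_ideal: "J \<in> ideals \<Longrightarrow> finite J"
  using ideal_sub finP finite_subset by blast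

lemma r_trans: "(p, q) \<in> r \<Longrightarrow> (q, s) \<in> r \<Longrightarrow> (p, s) \<in> r"
  using order unfolding strict_order_on_def trans_def by blast

lemma r_irrefl: "(p, p) \<notin> r"
  using order unfolding strict_order_on_def irrefl_def by blast

lemma r_sub: "(p, q) \<in> r \<Longrightarrow> p \<in> P \<and> q \<in> P"
  using order unfolding strict_order_on_def by blast

lemma ideals_un: "J \<in> ideals \<Longrightarrow> K \<in> ideals \<Longrightarrow> J \<union> K \<in> ideals"
  and ideals_int: "J \<in> ideals \<Longrightarrow> K \<in> ideals \<Longrightarrow> J \<inter> K \<in> ideals"
  and ideals_empty: "{} \<in> ideals"
  and ideals_P: "P \<in> ideals"
  using r_sub by (auto simp: order_ideals_def)

lemma generated_in_ideals: "A \<subseteq> P \<Longrightarrow> generated_order_ideal r A \<in> ideals"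
  unfolding order_ideals_def generated_order_ideal_def using r_trans r_sub by blast

lemma st_in_ideals: "J \<in> ideals \<Longrightarrow> K \<in> ideals \<Longrightarrow> st J K \<in> ideals"
  unfolding star_def by (rule generated_in_ideals) (auto dest: ideal_sub)

lemma st_sub: "J \<in> ideals \<Longrightarrow> K \<in> ideals \<Longrightarrow> st J K \<subseteq> J \<inter> K"
  unfolding star_def generated_order_ideal_def using ideal_down by fast

lemma mem_stI: "p \<in> J \<Longrightarrow> p \<in> K \<Longrightarrow> p \<in> mx J \<or> p \<in> mx K \<Longrightarrow> p \<in> st J K"
  unfolding star_def generated_order_ideal_def by blast

lemma mx_sub: "mx J \<subseteq> J"
  by (auto simp: max_elems_def)

text \<open>The number of elements strictly below grows strictly along the order, so an element
  above \<open>p\<close> maximizing it is maximal in \<open>J\<close>.\<close>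

lemma ex_mx_above:
  assumes J: "J \<in> ideals" and p: "p \<in> J"
  shows "\<exists>q\<in>mx J. p = q \<or> (p, q) \<in> r"
proof -
  let ?A = "{q\<in>J. p = q \<or> (p, q) \<in> r}" and ?f = "\<lambda>q. card {x\<in>P. (x, q) \<in> r}"
  have fin: "finite ?A" using finite_ideal[OF J] by simp
  have "p \<in> ?A" using p by simp
  then have "Max (?f ` ?A) \<in> ?f ` ?A" using fin by (intro Max_in) auto
  then obtain q where q: "q \<in> ?A" "Max (?f ` ?A) = ?f q" by blast
  have "(q, s) \<notin> r" if s: "s \<in> J" for s
  proof
    assume qs: "(q, s) \<in> r"
    then have "s \<in> ?A" using q(1) s r_trans by blast
    then have "?f s \<le> ?f q" unfolding q(2)[symmetric] using fin by (intro Max_ge) auto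
    moreover have "{x\<in>P. (x, q) \<in> r} \<subset> {x\<in>P. (x, s) \<in> r}"
      using qs r_trans r_irrefl r_sub by blast
    then have "?f q < ?f s" using finP by (intro psubset_card_mono) auto
    ultimately show False by simp
  qed
  with q(1) show ?thesis unfolding max_elems_def by blast
qed

lemma generated_mx: "J \<in> ideals \<Longrightarrow> generated_order_ideal r (mx J) = J"
  unfolding generated_order_ideal_def using ex_mx_above mx_sub ideal_down by blast

lemma mx_un: "J \<in> ideals \<Longrightarrow> K \<in> ideals \<Longrightarrow> mx (J \<union> K) = (mx J - (K - mx K)) \<union> (mx K - (J - mx J))"
  unfolding max_elems_def using ideal_down by blast

text \<open>The generators of the star form an antichain: each is maximal in \<open>J\<close> or in
  \<open>K\<close>, and the star lies in both.\<close>

lemma mx_st: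
  assumes J: "J \<in> ideals" and K: "K \<in> ideals"
  shows "mx (st J K) = J \<inter> K \<inter> (mx J \<union> mx K)"
proof (intro equalityI subsetI)
  fix p assume "p \<in> mx (st J K)"
  then show "p \<in> J \<inter> K \<inter> (mx J \<union> mx K)"
    unfolding max_elems_def star_def generated_order_ideal_def by blast
next
  fix p assume p: "p \<in> J \<inter> K \<inter> (mx J \<union> mx K)"
  have "(p, q) \<notin> r" if "q \<in> st J K" for q
    using p that st_sub[OF J K] by (auto simp: max_elems_def)
  with p show "p \<in> mx (st J K)" using mem_stI[of p J K] by (auto simp: max_elems_def)
qed

text \<open>As multisets, the maximal elements of \<open>J \<union> K\<close> and of the star are
  together those of \<open>J\<close> and \<open>K\<close>. This identity puts the Hibi-Li binomials
  into the kernel of the monomial map and makes affine functions on the chain polytope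
  modular.\<close>

lemma sum_mx:
  fixes g :: "'p \<Rightarrow> 'a::comm_monoid_add"
  assumes J: "J \<in> ideals" and K: "K \<in> ideals"
  shows "sum g (mx (J \<union> K)) + sum g (mx (st J K)) = sum g (mx J) + sum g (mx K)"
proof -
  have fin: "finite (mx J)" "finite (mx K)" using finite_ideal[OF J] finite_ideal[OF K] mx_sub finite_subset by metis+
  have un: "mx (J \<union> K) \<union> mx (st J K) = mx J \<union> mx K" "mx (J \<union> K) \<inter> mx (st J K) = mx J \<inter> mx K"
    unfolding mx_un[OF J K] mx_st[OF J K] using mx_sub by blast+
  have fin': "finite (mx (J \<union> K))" "finite (mx (st J K))" using fin un(1) by (metis finite_Un)+
  show ?thesis
    using sum.union_inter[OF fin', of g] sum.union_inter[OF fin, of g] un by simp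
qed

text \<open>For comparable ideals the relation is trivial, so only incomparable pairs matter
  below.\<close>

lemma st_absorb:
  assumes J: "J \<in> ideals" and K: "K \<in> ideals" and "J \<subseteq> K"
  shows "st J K = J" "st K J = J"
proof -
  have "J \<inter> K \<inter> (mx J \<union> mx K) = mx J" "K \<inter> J \<inter> (mx K \<union> mx J) = mx J"
    using \<open>J \<subseteq> K\<close> by (auto simp: max_elems_def)
  then show "st J K = J" "st K J = J" unfolding star_def using generated_mx[OF J] by simp_all
qed

text \<open>The exponent of the monomial to which \<open>relative_hibi_map\<close> sends the
  variable of \<open>J\<close>.\<close>

definition hm :: "'p set \<Rightarrow> ('p option \<Rightarrow>\<^sub>0 nat)" where
  "hm J = Poly_Mapping.single None 1 + (\<Sum>p\<in>mx J. Poly_Mapping.single (Some p) 1)"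

text \<open>\<open>relative_hibi_map\<close> on exponents. The inner sum multiplies
  \<open>hm J\<close> by the multiplicity of \<open>J\<close>.\<close>

definition \<Phi> :: "('p set \<Rightarrow>\<^sub>0 nat) \<Rightarrow> ('p option \<Rightarrow>\<^sub>0 nat)" where
  "\<Phi> m = (\<Sum>J\<in>Poly_Mapping.keys m. \<Sum>i<Poly_Mapping.lookup m J. hm J)"

lemma \<Phi>_superset:
  "finite S \<Longrightarrow> Poly_Mapping.keys m \<subseteq> S \<Longrightarrow> \<Phi> m = (\<Sum>J\<in>S. \<Sum>i<Poly_Mapping.lookup m J. hm J)"
  unfolding \<Phi>_def by (rule sum.mono_neutral_left) (auto simp: in_keys_iff)

lemma \<Phi>_add: "\<Phi> (m + m') = \<Phi> m + \<Phi> m'"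
proof -
  let ?S = "Poly_Mapping.keys m \<union> Poly_Mapping.keys m'"
  show ?thesis
    using \<Phi>_superset[of ?S m] \<Phi>_superset[of ?S m'] \<Phi>_superset[of ?S "m + m'"] keys_add[of m m']
    by (simp add: lookup_add sum_lessThan_add_const sum.distrib)
qed

lemma \<Phi>_single: "\<Phi> (Poly_Mapping.single J 1) = hm J"
  by (simp add: \<Phi>_def One_nat_def)

lemma \<Phi>_0 [simp]: "\<Phi> 0 = 0"
  by (simp add: \<Phi>_def)

lemma hm_un_st:
  "J \<in> ideals \<Longrightarrow> K \<in> ideals \<Longrightarrow> hm (J \<union> K) + hm (st J K) = hm J + hm K"
  unfolding hm_def using sum_mx[of J K "\<lambda>p. Poly_Mapping.single (Some p) (1::nat)"]
  by (simp add: algebra_simps)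

lemma lookup_hm: "Poly_Mapping.lookup (hm J) None = 1"
  "finite J \<Longrightarrow> Poly_Mapping.lookup (hm J) (Some p) = (if p \<in> mx J then 1 else 0)"
proof -
  assume "finite J"
  then have "finite (mx J)" using mx_sub finite_subset by metis
  then show "Poly_Mapping.lookup (hm J) (Some p) = (if p \<in> mx J then 1 else 0)"
    by (auto simp: hm_def lookup_add lookup_sum lookup_single when_def)
qed (simp add: hm_def lookup_add lookup_sum lookup_single when_def)

lemma lookup_\<Phi>_None: "Poly_Mapping.lookup (\<Phi> m) None = mdeg m"
  by (simp add: \<Phi>_def lookup_sum lookup_hm mdeg_def)

lemma relative_hibi_map_single:
  "relative_hibi_map r (Poly_Mapping.single m c) = Poly_Mapping.single (\<Phi> m) (c :: complex)"
proof -
  have y: "Var None * (\<Prod>p\<in>mx J. Var (Some p)) = Poly_Mapping.single (hm J) (1::complex)" for J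
  proof -
    have "(\<Prod>p\<in>A. Var (Some p)) = Poly_Mapping.single (\<Sum>p\<in>A. Poly_Mapping.single (Some p) 1) (1::complex)" for A :: "'p set"
      by (induction A rule: infinite_finite_induct) (auto simp: Var_def mult_single)
    then show ?thesis by (simp add: hm_def Var_def mult_single)
  qed
  have pow: "Poly_Mapping.single k (1::complex) ^ n = Poly_Mapping.single (\<Sum>i<n. k) 1" for k :: "'p option \<Rightarrow>\<^sub>0 nat" and n
    by (induction n) (auto simp: mult_single add.commute)
  have "(\<Prod>J\<in>A. Poly_Mapping.single (hm J) (1::complex) ^ f J) = Poly_Mapping.single (\<Sum>J\<in>A. \<Sum>i<f J. hm J) 1"
    for A and f :: "'p set \<Rightarrow> nat"
    by (induction A rule: infinite_finite_induct) (auto simp: mult_single pow)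
  then have "mono_eval (\<lambda>J. Var None * (\<Prod>p\<in>mx J. Var (Some p))) m = Poly_Mapping.single (\<Phi> m) (1::complex)"
    unfolding y mono_eval_def \<Phi>_def by simp
  then show ?thesis
    unfolding relative_hibi_map_def by (simp add: subst_single single_Const[symmetric])
qed

lemma comm_ring_hom_rhm: "comm_ring_hom (relative_hibi_map r)"
  unfolding relative_hibi_map_def by (rule comm_ring_hom_subst[OF comm_ring_hom_Const])

sublocale rhm: comm_ring_hom "relative_hibi_map r" by (rule comm_ring_hom_rhm)

lemma relative_hibi_map_sum:
  "relative_hibi_map r f = (\<Sum>m\<in>Poly_Mapping.keys f. Poly_Mapping.single (\<Phi> m) (Poly_Mapping.lookup f m))"
  by (subst poly_mapping_as_sum[of f]) (simp only: rhm.hom_sum relative_hibi_map_single)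

section \<open>Standard monomials\<close>

definition std :: "('p set \<Rightarrow>\<^sub>0 nat) \<Rightarrow> bool" where
  "std m \<longleftrightarrow> Poly_Mapping.keys m \<subseteq> ideals \<and>
     (\<forall>J\<in>Poly_Mapping.keys m. \<forall>K\<in>Poly_Mapping.keys m. J \<subseteq> K \<or> K \<subseteq> J)"

lemma std_ideals: "std m \<Longrightarrow> J \<in> Poly_Mapping.keys m \<Longrightarrow> J \<in> ideals"
  by (auto simp: std_def)

lemma std_subset:
  assumes "std m" "Poly_Mapping.keys m' \<subseteq> Poly_Mapping.keys m"
  shows "std m'"
  unfolding std_def
proof (intro conjI ballI)
  show "Poly_Mapping.keys m' \<subseteq> ideals" using assms by (auto simp: std_def)
  show "J \<subseteq> K \<or> K \<subseteq> J" if "J \<in> Poly_Mapping.keys m'" "K \<in> Poly_Mapping.keys m'" for J K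
    using assms(1) that[THEN subsetD[OF assms(2)]] by (simp add: std_def)
qed

lemma std_add: "std (m + m') \<Longrightarrow> std m'"
  by (erule std_subset) (auto simp: in_keys_iff lookup_add)

lemma chain_Union_mem: "finite C \<Longrightarrow> C \<noteq> {} \<Longrightarrow> (\<And>J K. J \<in> C \<Longrightarrow> K \<in> C \<Longrightarrow> J \<subseteq> K \<or> K \<subseteq> J) \<Longrightarrow> \<Union>C \<in> C"
proof (induction rule: finite_ne_induct)
  case (insert J C)
  then have "\<Union>C \<in> C" by simp
  with insert.prems[of J "\<Union>C"] have "J \<subseteq> \<Union>C \<or> \<Union>C \<subseteq> J" by blast
  then have "\<Union>(insert J C) = \<Union>C \<or> \<Union>(insert J C) = J" by blast
  then show ?case using \<open>\<Union>C \<in> C\<close> by auto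
qed simp

text \<open>The image of a standard monomial determines its largest factor, which can then be divided off.\<close>

lemma std_top:
  assumes m: "std m" and "m \<noteq> 0"
  shows "generated_order_ideal r {p. Poly_Mapping.lookup (\<Phi> m) (Some p) \<noteq> 0} \<in> Poly_Mapping.keys m" (is "?T \<in> _")
proof -
  let ?C = "Poly_Mapping.keys m"
  have U: "\<Union>?C \<in> ?C" using assms by (intro chain_Union_mem) (auto simp: std_def)
  have supp: "Poly_Mapping.lookup (\<Phi> m) (Some p) \<noteq> 0 \<longleftrightarrow> (\<exists>J\<in>?C. p \<in> mx J)" for p
  proof -
    have "Poly_Mapping.lookup (\<Phi> m) (Some p) =
        (\<Sum>J\<in>?C. Poly_Mapping.lookup m J * (if p \<in> mx J then 1 else 0))"
      unfolding \<Phi>_def lookup_sum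
      by (intro sum.cong refl) (simp add: lookup_hm(2) finite_ideal[OF std_ideals[OF m]])
    then show ?thesis by (auto simp: in_keys_iff)
  qed
  have "?T = \<Union>?C"
  proof
    show "?T \<subseteq> \<Union>?C"
      unfolding generated_order_ideal_def supp using mx_sub ideal_down std_ideals[OF m] by blast
    have "generated_order_ideal r (mx (\<Union>?C)) \<subseteq> ?T"
      unfolding generated_order_ideal_def supp using U by blast
    then show "\<Union>?C \<subseteq> ?T" using generated_mx[OF std_ideals[OF m U]] by simp
  qed
  with U show ?thesis by simp
qed

text \<open>The exponent of \<open>None\<close> recovers the degree, on which the induction runs;
  the common largest factor is removed at each step.\<close>

lemma \<Phi>_inj_std: "std m \<Longrightarrow> std m' \<Longrightarrow> \<Phi> m = \<Phi> m' \<Longrightarrow> m = m'"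
proof (induction "mdeg m" arbitrary: m m')
  case 0
  then show ?case by (metis lookup_\<Phi>_None mdeg_eq_0_iff)
next
  case (Suc d)
  have ne: "m \<noteq> 0" "m' \<noteq> 0" using Suc by (auto simp: mdeg_eq_0_iff[symmetric] simp flip: lookup_\<Phi>_None)
  define T where "T = generated_order_ideal r {p. Poly_Mapping.lookup (\<Phi> m) (Some p) \<noteq> 0}"
  have "T \<in> Poly_Mapping.keys m" "T \<in> Poly_Mapping.keys m'"
    using std_top[OF Suc.prems(1) ne(1)] std_top[OF Suc.prems(2) ne(2)] Suc.prems(3) by (auto simp: T_def)
  then obtain n n' where n: "m = Poly_Mapping.single T 1 + n" "m' = Poly_Mapping.single T 1 + n'"
    using split_monomial by metis
  have "\<Phi> n = \<Phi> n'" using Suc.prems(3) by (simp add: n \<Phi>_add)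
  moreover have "d = mdeg n" using Suc.hyps(2) by (simp add: n)
  ultimately show ?case using Suc.hyps(1) Suc.prems std_add n by metis
qed

text \<open>Distinct standard monomials have distinct monomial images, so their terms cannot cancel.
  This is the linear independence behind every later reduction.\<close>

lemma relative_hibi_map_std_inj:
  assumes "\<And>m. m \<in> Poly_Mapping.keys s \<Longrightarrow> std m" and "relative_hibi_map r s = 0"
  shows "s = 0"
proof (rule poly_mapping_eqI)
  fix m
  show "Poly_Mapping.lookup s m = Poly_Mapping.lookup 0 m"
  proof (cases "m \<in> Poly_Mapping.keys s")
    case True
    have "0 = Poly_Mapping.lookup (relative_hibi_map r s) (\<Phi> m)" using assms by simp
    also have "\<dots> = (\<Sum>n\<in>Poly_Mapping.keys s. if n = m then Poly_Mapping.lookup s n else 0)"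
      unfolding relative_hibi_map_sum lookup_sum
    proof (rule sum.cong[OF refl])
      fix n assume "n \<in> Poly_Mapping.keys s"
      then have "\<Phi> n = \<Phi> m \<longleftrightarrow> n = m" using \<Phi>_inj_std assms(1) True by blast
      then show "Poly_Mapping.lookup (Poly_Mapping.single (\<Phi> n) (Poly_Mapping.lookup s n)) (\<Phi> m) =
        (if n = m then Poly_Mapping.lookup s n else 0)" by (simp add: lookup_single when_def)
    qed
    also have "\<dots> = Poly_Mapping.lookup s m" using True by (simp add: sum.delta)
    finally show ?thesis by simp
  qed (simp add: in_keys_iff)
qed

section \<open>Straightening\<close>

abbreviation mono2 :: "'p set \<Rightarrow> 'p set \<Rightarrow> ('p set \<Rightarrow>\<^sub>0 nat)" where
  "mono2 J K \<equiv> Poly_Mapping.single J 1 + Poly_Mapping.single K 1"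

lemma Var_mult_Var: "Var J * Var K = (Poly_Mapping.single (mono2 J K) 1 :: ('p set, 'a::comm_ring_1) mpoly)"
  by (simp add: Var_def mult_single)

definition incomp :: "'p set \<Rightarrow> 'p set \<Rightarrow> bool" where
  "incomp J K \<longleftrightarrow> J \<in> ideals \<and> K \<in> ideals \<and> \<not> J \<subseteq> K \<and> \<not> K \<subseteq> J"

lemma keys_mono2: "Poly_Mapping.keys (mono2 J K) = {J, K}"
  by (auto simp: in_keys_iff lookup_add lookup_single when_def split: if_splits)

lemma std_mono2_iff: "J \<in> ideals \<Longrightarrow> K \<in> ideals \<Longrightarrow> std (mono2 J K) \<longleftrightarrow> \<not> incomp J K"
  by (auto simp: std_def keys_mono2 incomp_def)

lemma std_un_st: "J \<in> ideals \<Longrightarrow> K \<in> ideals \<Longrightarrow> std (mono2 (J \<union> K) (st J K))"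
  using st_sub[of J K] by (auto simp: std_def keys_mono2 ideals_un st_in_ideals)

lemma \<Phi>_un_st: "J \<in> ideals \<Longrightarrow> K \<in> ideals \<Longrightarrow> \<Phi> (mono2 (J \<union> K) (st J K)) = \<Phi> (mono2 J K)"
  by (simp add: \<Phi>_add \<Phi>_single hm_un_st)

lemma nonstd_split:
  assumes "Poly_Mapping.keys m \<subseteq> ideals" "\<not> std m"
  obtains J K m' where "incomp J K" "m = mono2 J K + m'" "Poly_Mapping.keys m' \<subseteq> ideals"
proof -
  obtain J K where JK: "J \<in> Poly_Mapping.keys m" "K \<in> Poly_Mapping.keys m" "\<not> J \<subseteq> K" "\<not> K \<subseteq> J"
    using assms unfolding std_def by blast
  obtain m1 where m1: "m = Poly_Mapping.single J 1 + m1" "Poly_Mapping.keys m1 \<subseteq> Poly_Mapping.keys m"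
    "\<And>u. u \<noteq> J \<Longrightarrow> Poly_Mapping.lookup m1 u = Poly_Mapping.lookup m u"
    using split_monomial[OF JK(1)] by blast
  have "K \<in> Poly_Mapping.keys m1" using JK m1(3)[of K] by (auto simp: in_keys_iff)
  then obtain m2 where m2: "m1 = Poly_Mapping.single K 1 + m2" "Poly_Mapping.keys m2 \<subseteq> Poly_Mapping.keys m1"
    using split_monomial by metis
  show ?thesis
    by (rule that[of J K m2]) (use JK m1 m2 assms in \<open>auto simp: incomp_def add.assoc\<close>)
qed

text \<open>A termination measure for rewriting. Base 3 makes the summand of
  \<open>J \<union> K\<close> alone exceed the summands of \<open>J\<close> and \<open>K\<close>
  together, as both are strictly smaller sets.\<close>

definition energy :: "('p set \<Rightarrow>\<^sub>0 nat) \<Rightarrow> nat" where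
  "energy m = (\<Sum>J\<in>Poly_Mapping.keys m. Poly_Mapping.lookup m J * 3 ^ card J)"

lemma energy_add: "energy (m + m') = energy m + energy m'"
proof -
  have *: "energy m = (\<Sum>J\<in>S. Poly_Mapping.lookup m J * 3 ^ card J)"
    if "finite S" "Poly_Mapping.keys m \<subseteq> S" for S m
    unfolding energy_def by (rule sum.mono_neutral_left) (use that in \<open>auto simp: in_keys_iff\<close>)
  let ?S = "Poly_Mapping.keys m \<union> Poly_Mapping.keys m'"
  show ?thesis
    using *[of ?S m] *[of ?S m'] *[of ?S "m + m'"] keys_add[of m m']
    by (simp add: lookup_add sum.distrib algebra_simps)
qed

lemma energy_single: "energy (Poly_Mapping.single J n) = n * 3 ^ card J"
  by (cases "n = 0") (auto simp: energy_def)

lemma energy_bound: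
  assumes "Poly_Mapping.keys m \<subseteq> ideals"
  shows "energy m \<le> mdeg m * 3 ^ card P"
proof -
  have "energy m \<le> (\<Sum>J\<in>Poly_Mapping.keys m. Poly_Mapping.lookup m J * 3 ^ card P)"
    unfolding energy_def
    by (intro sum_mono mult_left_mono power_increasing card_mono finP)
      (use assms ideal_sub in auto)
  then show ?thesis by (simp add: mdeg_def sum_distrib_right)
qed

lemma energy_un_st:
  assumes "incomp J K"
  shows "energy (mono2 J K) < energy (mono2 (J \<union> K) (st J K))"
proof -
  have JK: "J \<in> ideals" "K \<in> ideals" using assms by (auto simp: incomp_def)
  have fin: "finite (J \<union> K)" using JK finite_ideal by auto
  have "card J < card (J \<union> K)" "card K < card (J \<union> K)"
    using assms by (auto simp: incomp_def intro!: psubset_card_mono fin)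
  then have "3 * 3 ^ card J \<le> (3::nat) ^ card (J \<union> K)" "3 * 3 ^ card K \<le> (3::nat) ^ card (J \<union> K)"
    using power_increasing[of "Suc (card J)" "card (J \<union> K)" "3::nat"]
      power_increasing[of "Suc (card K)" "card (J \<union> K)" "3::nat"] by simp_all
  moreover have "(0::nat) < 3 ^ card J" "(0::nat) < 3 ^ card K" by simp_all
  ultimately show ?thesis unfolding energy_add energy_single mult_1 by linarith
qed

text \<open>The star takes the place that intersection has in ordinary supermodularity.\<close>

definition supermodular :: "('p set \<Rightarrow> real) \<Rightarrow> bool" where
  "supermodular w \<longleftrightarrow> (\<forall>J K. incomp J K \<longrightarrow> w J + w K \<le> w (J \<union> K) + w (st J K))"

text \<open>For supermodular \<open>w\<close> and an incomparable pair, the initial form of the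
  Hibi-Li binomial: minimal weight is retained, so the second term survives only in case of
  equality.\<close>

definition rel_poly :: "('p set \<Rightarrow> real) \<Rightarrow> 'p set \<Rightarrow> 'p set \<Rightarrow> ('p set, complex) mpoly" where
  "rel_poly w J K = Var J * Var K -
     (if w J + w K = w (J \<union> K) + w (st J K) then Var (J \<union> K) * Var (st J K) else 0)"

text \<open>For \<open>w = 0\<close> this is the Hibi-Li ideal.\<close>

definition rel_ideal :: "('p set \<Rightarrow> real) \<Rightarrow> ('p set, complex) mpoly set" where
  "rel_ideal w = Idl\<^bsub>mpoly_ring ideals\<^esub> {rel_poly w J K | J K. incomp J K}"

lemma rel_poly_mpolys: "J \<in> ideals \<Longrightarrow> K \<in> ideals \<Longrightarrow> rel_poly w J K \<in> mpolys ideals"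
  by (auto simp: rel_poly_def ideals_un st_in_ideals)

lemma rel_gens_mpolys: "{rel_poly w J K | J K. incomp J K} \<subseteq> mpolys ideals"
  using rel_poly_mpolys unfolding incomp_def by blast

lemma ideal_rel_ideal: "ideal (rel_ideal w) (mpoly_ring ideals)"
  unfolding rel_ideal_def by (rule ideal_genideal[OF rel_gens_mpolys])

lemma rel_ideal_mpolys: "f \<in> rel_ideal w \<Longrightarrow> f \<in> mpolys ideals"
  using ideal_rel_ideal[of w] unfolding ideal_mpoly_ring_iff by blast

lemma rel_poly_in: "incomp J K \<Longrightarrow> rel_poly w J K \<in> rel_ideal w"
  unfolding rel_ideal_def using genideal_superset[OF rel_gens_mpolys] by blast

abbreviation "wt \<equiv> monomial_weight"

text \<open>Replacing an incomparable pair by union and star preserves \<Phi> and the degree, does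
  not lower the weight, and raises the energy, which is bounded in a fixed degree. If the weight
  jumps at some step, the relation used there is a monomial, and the original monomial lies in the
  ideal.\<close>

lemma straighten_monomial:
  assumes w: "supermodular w" and m: "Poly_Mapping.keys m \<subseteq> ideals"
  shows "\<exists>s. std s \<and> \<Phi> s = \<Phi> m \<and> wt w m \<le> wt w s \<and>
    (wt w m < wt w s \<longrightarrow> Poly_Mapping.single m 1 \<in> rel_ideal w) \<and>
    (wt w m = wt w s \<longrightarrow> Poly_Mapping.single m 1 - Poly_Mapping.single s 1 \<in> rel_ideal w)"
  using m
proof (induction "mdeg m * 3 ^ card P - energy m" arbitrary: m rule: less_induct)
  case less
  have I: "ideal (rel_ideal w) (mpoly_ring ideals)" by (rule ideal_rel_ideal)
  then have zero: "0 \<in> rel_ideal w" unfolding ideal_mpoly_ring_iff by blast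
  show ?case
  proof (cases "std m")
    case True
    with zero show ?thesis by (intro exI[of _ m]) auto
  next
    case False
    then obtain J K m' where m: "incomp J K" "m = mono2 J K + m'" "Poly_Mapping.keys m' \<subseteq> ideals"
      using nonstd_split less.prems by metis
    have JK: "J \<in> ideals" "K \<in> ideals" using m(1) by (auto simp: incomp_def)
    define n where "n = mono2 (J \<union> K) (st J K) + m'"
    have nI: "Poly_Mapping.keys n \<subseteq> ideals"
      using keys_add[of "mono2 (J \<union> K) (st J K)" m'] m(3) JK unfolding n_def keys_mono2
      by (auto simp: ideals_un st_in_ideals)
    have "energy m < energy n" using energy_un_st[OF m(1)] by (simp add: m n_def energy_add)
    moreover have deg: "mdeg n = mdeg m" by (simp add: m n_def)
    ultimately have "mdeg n * 3 ^ card P - energy n < mdeg m * 3 ^ card P - energy m"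
      using energy_bound[OF nI] unfolding deg by linarith
    from less.hyps[OF this nI] obtain s where s: "std s" "\<Phi> s = \<Phi> n" "wt w n \<le> wt w s"
      "wt w n < wt w s \<Longrightarrow> Poly_Mapping.single n 1 \<in> rel_ideal w"
      "wt w n = wt w s \<Longrightarrow> Poly_Mapping.single n 1 - Poly_Mapping.single s 1 \<in> rel_ideal w" by blast
    have \<Phi>: "\<Phi> n = \<Phi> m" using \<Phi>_un_st[OF JK] by (simp add: m n_def \<Phi>_add)
    have le: "wt w m \<le> wt w n" using w m(1) by (auto simp: m(2) n_def supermodular_def)
    have eq_iff: "w J + w K = w (J \<union> K) + w (st J K) \<longleftrightarrow> wt w m = wt w n" by (auto simp: m(2) n_def)
    have "Poly_Mapping.single m' 1 * rel_poly w J K \<in> rel_ideal w"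
      using I rel_poly_in[OF m(1)] m(3) unfolding ideal_mpoly_ring_iff by (simp add: mpolys_single_iff)
    moreover have "Poly_Mapping.single m' 1 * rel_poly w J K =
        Poly_Mapping.single m 1 - (if wt w m = wt w n then Poly_Mapping.single n 1 else 0)"
      unfolding rel_poly_def eq_iff Var_mult_Var
      by (simp add: right_diff_distrib mult_single m(2) n_def add.commute)
    ultimately have R: "Poly_Mapping.single m 1 - (if wt w m = wt w n then Poly_Mapping.single n 1 else 0) \<in> rel_ideal w"
      by simp
    show ?thesis
    proof (cases "wt w m = wt w n")
      case True
      then have R': "Poly_Mapping.single m 1 - Poly_Mapping.single n 1 \<in> rel_ideal w" using R by simp
      have "Poly_Mapping.single m 1 \<in> rel_ideal w" if "wt w m < wt w s"
      proof -
        have "Poly_Mapping.single m 1 - Poly_Mapping.single n 1 + Poly_Mapping.single n 1 \<in> rel_ideal w"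
          using I R' s(4) True that unfolding ideal_mpoly_ring_iff by metis
        then show ?thesis by simp
      qed
      moreover have "Poly_Mapping.single m 1 - Poly_Mapping.single s 1 \<in> rel_ideal w" if "wt w m = wt w s"
      proof -
        have "(Poly_Mapping.single m 1 - Poly_Mapping.single n 1) + (Poly_Mapping.single n 1 - Poly_Mapping.single s 1) \<in> rel_ideal w"
          using I R' s(5) True that unfolding ideal_mpoly_ring_iff by metis
        then show ?thesis by simp
      qed
      ultimately show ?thesis using s \<Phi> le by (intro exI[of _ s]) auto
    next
      case False
      then show ?thesis using s \<Phi> le R by (intro exI[of _ s]) auto
    qed
  qed
qed

lemma straighten:
  assumes w: "supermodular w" and f: "f \<in> mpolys ideals"
  obtains s where "\<And>m. m \<in> Poly_Mapping.keys s \<Longrightarrow> std m" "f - s \<in> rel_ideal w"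
proof -
  have "\<exists>s. (\<forall>k\<in>Poly_Mapping.keys s. std k) \<and> Poly_Mapping.single m 1 - s \<in> rel_ideal w"
    if "m \<in> Poly_Mapping.keys f" for m
  proof -
    have "Poly_Mapping.keys m \<subseteq> ideals" using that f by (auto simp: mpolys_iff)
    then obtain s where s: "std s" "wt w m \<le> wt w s"
      "wt w m < wt w s \<Longrightarrow> Poly_Mapping.single m 1 \<in> rel_ideal w"
      "wt w m = wt w s \<Longrightarrow> Poly_Mapping.single m 1 - Poly_Mapping.single s 1 \<in> rel_ideal w"
      using straighten_monomial[OF w] by blast
    show ?thesis
    proof (cases "wt w m < wt w s")
      case True
      then show ?thesis using s by (intro exI[of _ 0]) auto
    next
      case False
      then show ?thesis using s by (intro exI[of _ "Poly_Mapping.single s 1"]) auto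
    qed
  qed
  then obtain S where S: "\<And>m. m \<in> Poly_Mapping.keys f \<Longrightarrow> \<forall>k\<in>Poly_Mapping.keys (S m). std k"
    "\<And>m. m \<in> Poly_Mapping.keys f \<Longrightarrow> Poly_Mapping.single m 1 - S m \<in> rel_ideal w" by metis
  define s where "s = (\<Sum>m\<in>Poly_Mapping.keys f. Const (Poly_Mapping.lookup f m) * S m)"
  show ?thesis
  proof
    fix k assume "k \<in> Poly_Mapping.keys s"
    then obtain m where "m \<in> Poly_Mapping.keys f" "k \<in> Poly_Mapping.keys (Const (Poly_Mapping.lookup f m) * S m)"
      unfolding s_def using keys_sum by fastforce
    then show "std k" using S(1) by (auto simp: in_keys_iff lookup_Const_mult)
    have "f - s = (\<Sum>m\<in>Poly_Mapping.keys f. Const (Poly_Mapping.lookup f m) * (Poly_Mapping.single m 1 - S m))"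
      by (subst poly_mapping_as_sum[of f])
        (simp add: s_def sum_subtractf right_diff_distrib single_Const[of _ "Poly_Mapping.lookup f _"])
  next
    have "f - s = (\<Sum>m\<in>Poly_Mapping.keys f. Const (Poly_Mapping.lookup f m) * (Poly_Mapping.single m 1 - S m))"
      by (subst poly_mapping_as_sum[of f])
        (simp add: s_def sum_subtractf right_diff_distrib single_Const[of _ "Poly_Mapping.lookup f _"])
    also have "\<dots> \<in> rel_ideal w"
      by (intro ideal_sum[OF ideal_rel_ideal] ideal_Const_mult[OF ideal_rel_ideal] S(2))
    finally show "f - s \<in> rel_ideal w" .
  qed
qed

section \<open>Initial ideals of the Hibi-Li ideal\<close>

lemma hibi_li_gens: "{Var J1 * Var J2 - Var (J1 \<union> J2) * Var (st J1 J2) | J1 J2.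
        J1 \<in> ideals \<and> J2 \<in> ideals} \<subseteq> mpolys ideals"
  using ideals_un st_in_ideals by auto

lemma ideal_hibi_li: "ideal (hibi_li_ideal P r) (mpoly_ring ideals)"
  unfolding hibi_li_ideal_def by (rule ideal_genideal[OF hibi_li_gens])

text \<open>A divisor of a standard monomial is standard, so the polynomials without standard terms
  form an ideal; it contains the generators.\<close>

lemma incomparable_ideal_nonstd:
  assumes "f \<in> incomparable_ideal P r" "m \<in> Poly_Mapping.keys f"
  shows "\<not> std m"
proof -
  let ?U = "{f \<in> mpolys ideals. \<forall>m\<in>Poly_Mapping.keys f. \<not> std m}"
  have "ideal ?U (mpoly_ring ideals)"
    unfolding ideal_mpoly_ring_iff
  proof (intro conjI ballI)
    fix f g assume f: "f \<in> ?U"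
    show "f + g \<in> ?U" if "g \<in> ?U"
      using f that keys_add[of f g] by auto
    show "g * f \<in> ?U" if "g \<in> mpolys ideals"
      using f that keys_mult[of g f] std_add by fastforce
  qed auto
  then have "incomparable_ideal P r \<subseteq> ?U"
    unfolding incomparable_ideal_def
    by (rule genideal_least) (auto simp: Var_mult_Var keys_mono2 std_def mpolys_single_iff)
  with assms show ?thesis by blast
qed

text \<open>The weight \<open>w\<close> is the one that defines \<open>I\<close>. The hypothesis
  \<open>m\<close> enters only through the fact \<open>stdI\<close>, which controls both the sign of
  the modular defect and the size of \<open>I\<close>.\<close>

lemma initial_ideal_eq_rel_ideal:
  assumes I: "is_initial_ideal I (hibi_li_ideal P r)"
    and m: "is_initial_ideal (incomparable_ideal P r) I"
  obtains w where "supermodular w" "I = rel_ideal w"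
proof -
  obtain w where w: "I = mspan (initial_form w ` hibi_li_ideal P r)"
    using I by (auto simp: is_initial_ideal_def)
  obtain w2 where w2: "incomparable_ideal P r = mspan (initial_form w2 ` I)"
    using m by (auto simp: is_initial_ideal_def)
  have idI: "ideal I (mpoly_ring ideals)"
    unfolding w by (rule ideal_mspan_initial_forms[OF ideal_hibi_li])
  \<comment> \<open>Otherwise the initial form of \<open>f\<close> for the second weight would be a
    nonzero standard combination inside the ideal of incomparable products.\<close>
  have stdI: "f = 0" if f: "f \<in> I" "\<And>m. m \<in> Poly_Mapping.keys f \<Longrightarrow> std m" for f
  proof -
    have i: "initial_form w2 f \<in> incomparable_ideal P r"
      unfolding w2 by (rule subsetD[OF mspan_superset imageI[OF f(1)]])
    have "m \<notin> Poly_Mapping.keys (initial_form w2 f)" for m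
    proof
      assume m: "m \<in> Poly_Mapping.keys (initial_form w2 f)"
      then have "m \<in> Poly_Mapping.keys f" by (simp add: keys_initial_form)
      then show False using f(2) incomparable_ideal_nonstd[OF i m] by blast
    qed
    then have "initial_form w2 f = 0" by (metis all_not_in_conv keys_eq_empty)
    then show ?thesis by (simp only: initial_form_eq_0_iff)
  qed
  have gen: "w J + w K \<le> w (J \<union> K) + w (st J K) \<and> rel_poly w J K \<in> I" if JK: "incomp J K" for J K
  proof -
    let ?m = "mono2 J K" and ?s = "mono2 (J \<union> K) (st J K)"
    have ideals: "J \<in> ideals" "K \<in> ideals" using JK by (auto simp: incomp_def)
    have s: "std ?s" using std_un_st[OF ideals] .
    have ne: "?m \<noteq> ?s" using s std_mono2_iff[OF ideals] JK by auto
    define b where "b = (Poly_Mapping.single ?m 1 - Poly_Mapping.single ?s 1 :: ('p set, complex) mpoly)"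
    have keys: "Poly_Mapping.keys b = {?m, ?s}"
      using ne by (auto simp: b_def in_keys_iff lookup_minus lookup_single when_def split: if_splits)
    have "b \<in> hibi_li_ideal P r"
      unfolding hibi_li_ideal_def b_def Var_mult_Var[symmetric]
      by (rule subsetD[OF genideal_superset[OF hibi_li_gens]]) (use ideals in blast)
    then have inI: "initial_form w b \<in> I" unfolding w by (intro subsetD[OF mspan_superset] imageI)
    have "initial_form w b \<noteq> 0" using keys by (auto simp: initial_form_eq_0_iff)
    \<comment> \<open>If the weight of union and star were smaller, the initial form of the binomial
      would be a standard term in \<open>I\<close>.\<close>
    have le: "w J + w K \<le> w (J \<union> K) + w (st J K)"
    proof (rule ccontr)
      assume "\<not> ?thesis"
      then have "std m" if "m \<in> Poly_Mapping.keys (initial_form w b)" for m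
        using that s by (auto simp: keys_initial_form keys)
      with stdI[OF inI] \<open>initial_form w b \<noteq> 0\<close> show False by blast
    qed
    have "initial_form w b = rel_poly w J K"
    proof (rule poly_mapping_eqI)
      fix m
      show "Poly_Mapping.lookup (initial_form w b) m = Poly_Mapping.lookup (rel_poly w J K) m"
        using le ne unfolding lookup_initial_form keys rel_poly_def Var_mult_Var
        by (auto simp: b_def lookup_minus lookup_single when_def)
    qed
    with inI le show ?thesis by simp
  qed
  then have sup: "supermodular w" by (auto simp: supermodular_def)
  have sub: "rel_ideal w \<subseteq> I"
    unfolding rel_ideal_def by (rule genideal_least[OF idI]) (use gen in auto)
  \<comment> \<open>Straightening leaves a standard remainder that still lies in \<open>I\<close>,
    hence is zero.\<close>
  have "I \<subseteq> rel_ideal w"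
  proof
    fix f assume f: "f \<in> I"
    then have "f \<in> mpolys ideals" using idI unfolding ideal_mpoly_ring_iff by blast
    then obtain s where s: "\<And>m. m \<in> Poly_Mapping.keys s \<Longrightarrow> std m" "f - s \<in> rel_ideal w"
      using straighten[OF sup] by blast
    have "f - (f - s) \<in> I" using ideal_diff[OF idI f] s(2) sub by blast
    then have "s = 0" using stdI s(1) by simp
    with s show "f \<in> rel_ideal w" by simp
  qed
  with sub sup that show ?thesis by blast
qed

end

context finite_poset
begin

section \<open>The toric pieces: domains of linearity of a supermodular weight\<close>

section \<open>Cells of the degeneration\<close>

text \<open>A linear extension of the poset; its prefixes form a maximal chain of order
  ideals.\<close>

definition maxchain :: "'p list \<Rightarrow> bool" where
  "maxchain ps \<longleftrightarrow> distinct ps \<and> set ps = P \<and> (\<forall>i \<le> length ps. set (take i ps) \<in> ideals)"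

text \<open>\<open>aff l0 l\<close> is an affine function on the chain polytope, whose vertices are the
  indicator functions of the sets \<open>mx J\<close>.\<close>

definition aff :: "real \<Rightarrow> ('p \<Rightarrow> real) \<Rightarrow> 'p set \<Rightarrow> real" where
  "aff l0 l J = l0 + (\<Sum>p\<in>mx J. l p)"

text \<open>A cell is a domain of linearity of \<open>w\<close>, recorded together with a maximal chain inside it.\<close>

definition cell :: "('p set \<Rightarrow> real) \<Rightarrow> 'p list \<Rightarrow> 'p set set \<Rightarrow> bool" where
  "cell w ps \<sigma> \<longleftrightarrow> maxchain ps \<and> (\<exists>l0 l. (\<forall>i \<le> length ps. w (set (take i ps)) = aff l0 l (set (take i ps))) \<and>
     \<sigma> = {J \<in> ideals. w J = aff l0 l J})"

text \<open>The system is triangular: the last element of each prefix is maximal in it and absent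
  from shorter prefixes, so its coefficient can be solved for. Geometrically the prefixes are
  vertices of a simplex.\<close>

lemma ex_affine:
  assumes "maxchain ps"
  shows "\<exists>l0 l. \<forall>i \<le> length ps. w (set (take i ps)) = aff l0 l (set (take i ps))"
proof -
  have ps: "distinct ps" "\<And>i. i \<le> length ps \<Longrightarrow> set (take i ps) \<in> ideals"
    using assms by (auto simp: maxchain_def)
  have "\<exists>l. \<forall>i \<le> n. w (set (take i ps)) = aff (w {}) l (set (take i ps))" if "n \<le> length ps" for n
    using that
  proof (induction n)
    case 0
    show ?case by (auto simp: aff_def max_elems_def)
  next
    case (Suc n)
    then obtain l where l: "\<forall>i \<le> n. w (set (take i ps)) = aff (w {}) l (set (take i ps))" by auto
    let ?p = "ps ! n" and ?J = "set (take (Suc n) ps)"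
    have n: "n < length ps" using Suc by simp
    have J: "?J = insert ?p (set (take n ps))" using n by (simp add: take_Suc_conv_app_nth)
    have p: "?p \<notin> set (take i ps)" if "i \<le> n" for i
      using ps(1) n that by (auto simp: in_set_conv_nth nth_eq_iff_index_eq)
    have JI: "?J \<in> ideals" "set (take n ps) \<in> ideals" using ps(2) Suc.prems by auto
    have mp: "?p \<in> mx ?J"
      using ideal_down[OF JI(2)] p[of n] r_irrefl unfolding J max_elems_def by blast
    have fin: "finite (mx ?J)" using mx_sub finite_ideal[OF JI(1)] finite_subset by metis
    define l' where "l' = l(?p := w ?J - w {} - (\<Sum>q\<in>mx ?J - {?p}. l q))"
    have "w (set (take i ps)) = aff (w {}) l' (set (take i ps))" if "i \<le> Suc n" for i
    proof (cases "i = Suc n")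
      case True
      have "(\<Sum>q\<in>mx ?J. l' q) = l' ?p + (\<Sum>q\<in>mx ?J - {?p}. l' q)"
        by (rule sum.remove[OF fin mp])
      also have "(\<Sum>q\<in>mx ?J - {?p}. l' q) = (\<Sum>q\<in>mx ?J - {?p}. l q)"
        by (rule sum.cong) (auto simp: l'_def)
      finally show ?thesis unfolding True by (simp add: aff_def l'_def)
    next
      case False
      with that have i: "i \<le> n" by simp
      have "(\<Sum>q\<in>mx (set (take i ps)). l' q) = (\<Sum>q\<in>mx (set (take i ps)). l q)"
        by (rule sum.cong) (use p[OF i] mx_sub in \<open>auto simp: l'_def\<close>)
      with l i show ?thesis by (simp add: aff_def)
    qed
    then show ?case by blast
  qed
  then show ?thesis by blast
qed

lemma aff_un_st:
  "J \<in> ideals \<Longrightarrow> K \<in> ideals \<Longrightarrow> aff l0 l (J \<union> K) + aff l0 l (st J K) = aff l0 l J + aff l0 l K"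
  unfolding aff_def using sum_mx[of J K l] by simp

lemma supermodularD:
  assumes w: "supermodular w" and JK: "J \<in> ideals" "K \<in> ideals"
  shows "w J + w K \<le> w (J \<union> K) + w (st J K)"
proof (cases "incomp J K")
  case True
  then show ?thesis using w by (simp add: supermodular_def)
next
  case False
  then consider "J \<subseteq> K" | "K \<subseteq> J" using JK by (auto simp: incomp_def)
  then show ?thesis
  proof cases
    case 1
    then have "J \<union> K = K" by auto
    then show ?thesis using st_absorb(1)[OF JK 1] by simp
  next
    case 2
    then have "J \<union> K = J" by auto
    then show ?thesis using st_absorb(2)[OF JK(2,1) 2] by simp
  qed
qed

text \<open>\<open>v\<close> is the gap between \<open>w\<close> and the affine function of the
  cell. It has the same modular pairs as \<open>w\<close>, is nowhere positive, and is zero exactly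
  on the cell.\<close>

definition slack :: "('p set \<Rightarrow> real) \<Rightarrow> 'p list \<Rightarrow> 'p set set \<Rightarrow> ('p set \<Rightarrow> real) \<Rightarrow> bool" where
  "slack w ps \<sigma> v \<longleftrightarrow> \<sigma> = {J \<in> ideals. v J = 0} \<and> (\<forall>J\<in>ideals. v J \<le> 0) \<and>
    (\<forall>J\<in>ideals. \<forall>K\<in>ideals. v J + v K \<le> v (J \<union> K) + v (st J K)) \<and>
    (\<forall>J\<in>ideals. \<forall>K\<in>ideals.
      w J + w K = w (J \<union> K) + w (st J K) \<longleftrightarrow> v J + v K = v (J \<union> K) + v (st J K)) \<and>
    (\<forall>i \<le> length ps. set (take i ps) \<in> \<sigma>) \<and> (\<exists>l0 l. v = (\<lambda>J. w J - aff l0 l J))"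

lemma slackD:
  assumes "slack w ps \<sigma> v"
  shows "\<sigma> = {J \<in> ideals. v J = 0}" "\<And>J. J \<in> ideals \<Longrightarrow> v J \<le> 0"
    "\<And>J K. J \<in> ideals \<Longrightarrow> K \<in> ideals \<Longrightarrow> v J + v K \<le> v (J \<union> K) + v (st J K)"
    "\<And>J K. J \<in> ideals \<Longrightarrow> K \<in> ideals \<Longrightarrow>
      w J + w K = w (J \<union> K) + w (st J K) \<longleftrightarrow> v J + v K = v (J \<union> K) + v (st J K)"
    "\<And>i. i \<le> length ps \<Longrightarrow> set (take i ps) \<in> \<sigma>"
    "\<exists>l0 l. v = (\<lambda>J. w J - aff l0 l J)"
  using assms unfolding slack_def by blast+

lemma ex_slack:
  assumes w: "supermodular w" and \<sigma>: "cell w ps \<sigma>"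
  shows "\<exists>v. slack w ps \<sigma> v"
proof -
  obtain l0 l where l: "\<And>i. i \<le> length ps \<Longrightarrow> w (set (take i ps)) = aff l0 l (set (take i ps))"
    and \<sigma>_def: "\<sigma> = {J \<in> ideals. w J = aff l0 l J}" and mc: "maxchain ps"
    using \<sigma> by (auto simp: cell_def)
  define v where "v = (\<lambda>J. w J - aff l0 l J)"
  have chain: "set (take i ps) \<in> ideals" "v (set (take i ps)) = 0" if "i \<le> length ps" for i
    using l[OF that] mc that by (auto simp: v_def maxchain_def)
  have sup: "v J + v K \<le> v (J \<union> K) + v (st J K)" if "J \<in> ideals" "K \<in> ideals" for J K
    using supermodularD[OF w that] aff_un_st[OF that, of l0 l] by (simp add: v_def)
  \<comment> \<open>Induction along the chain: if \<open>J\<close> contains the newest element, its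
    union with the previous prefix is the next prefix, of gap 0, and the star lies in the previous
    prefix. Supermodularity then bounds \<open>v J\<close> by the gap of the star.\<close>
  have "v J \<le> 0" if "J \<in> ideals" "J \<subseteq> set (take n ps)" "n \<le> length ps" for J n
    using that
  proof (induction n arbitrary: J)
    case 0
    then show ?case using chain(2)[of 0] by simp
  next
    case (Suc n)
    let ?K = "set (take n ps)"
    have S: "set (take (Suc n) ps) = insert (ps ! n) ?K" using Suc.prems by (simp add: take_Suc_conv_app_nth)
    have K: "?K \<in> ideals" "v ?K = 0" using chain[of n] Suc.prems by auto
    show ?case
    proof (cases "ps ! n \<in> J")
      case True
      then have "J \<union> ?K = set (take (Suc n) ps)" using S Suc.prems by auto
      then have "v (J \<union> ?K) = 0" using chain(2)[of "Suc n"] Suc.prems by simp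
      moreover have "v (st J ?K) \<le> 0"
        by (rule Suc.IH) (use st_in_ideals[OF Suc.prems(1) K(1)] st_sub[OF Suc.prems(1) K(1)] Suc.prems in auto)
      ultimately show ?thesis using sup[OF Suc.prems(1) K(1)] K(2) by simp
    next
      case False
      then show ?thesis using Suc S by auto
    qed
  qed
  from this[of _ "length ps"] have neg: "v J \<le> 0" if "J \<in> ideals" for J
    using that mc ideal_sub by (simp add: maxchain_def)
  show ?thesis
    unfolding slack_def
  proof (intro exI[of _ v] conjI ballI allI impI)
    show "\<sigma> = {J \<in> ideals. v J = 0}" by (auto simp: \<sigma>_def v_def)
    show "set (take i ps) \<in> \<sigma>" if "i \<le> length ps" for i using chain[OF that] by (auto simp: \<sigma>_def v_def)
    show "w J + w K = w (J \<union> K) + w (st J K) \<longleftrightarrow> v J + v K = v (J \<union> K) + v (st J K)"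
      if "J \<in> ideals" "K \<in> ideals" for J K
      using aff_un_st[OF that, of l0 l] by (auto simp: v_def)
    show "\<exists>l0 l. v = (\<lambda>J. w J - aff l0 l J)" by (auto simp: v_def)
  qed (use sup neg in auto)
qed

text \<open>For union and star, a sum of two nonpositive gaps is bounded below by 0. Closure under
  intersection does not come from supermodularity directly; it is built up along the maximal chain
  by unions and stars.\<close>

lemma cell_closed:
  assumes w: "supermodular w" and \<sigma>: "cell w ps \<sigma>" and JK: "J \<in> \<sigma>" "K \<in> \<sigma>"
  shows "J \<union> K \<in> \<sigma>" "st J K \<in> \<sigma>" "J \<inter> K \<in> \<sigma>"
proof -
  obtain v where s: "slack w ps \<sigma> v" using ex_slack[OF w \<sigma>] by blast
  note v = slackD(1,2,3,5)[OF s]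
  have ps: "distinct ps" "set ps = P" using \<sigma> by (auto simp: cell_def maxchain_def)
  have un: "J \<union> K \<in> \<sigma>" and st: "st J K \<in> \<sigma>" if "J \<in> \<sigma>" "K \<in> \<sigma>" for J K
  proof -
    have I: "J \<in> ideals" "K \<in> ideals" using that v(1) by auto
    have "v J = 0" "v K = 0" using that v(1) by auto
    note le = this v(3)[OF I] v(2)[OF ideals_un[OF I]] v(2)[OF st_in_ideals[OF I]]
    have "v (J \<union> K) = 0" "v (st J K) = 0" using le by linarith (use le in linarith)
    then show "J \<union> K \<in> \<sigma>" "st J K \<in> \<sigma>"
      using ideals_un[OF I] st_in_ideals[OF I] unfolding v(1) by auto
  qed
  show "J \<union> K \<in> \<sigma>" "st J K \<in> \<sigma>" using un st JK by auto
  have I: "J \<in> ideals" if "J \<in> \<sigma>" for J using that v(1) by auto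
  have S: "set (take (Suc n) ps) = insert (ps ! n) (set (take n ps))" if "Suc n \<le> length ps" for n
    using that by (simp add: take_Suc_conv_app_nth)
  have max: "ps ! n \<in> mx (set (take (Suc n) ps))" if "Suc n \<le> length ps" for n
  proof -
    have "set (take n ps) \<in> ideals" using v(4)[of n] I that by simp
    moreover have "ps ! n \<notin> set (take n ps)"
      using ps(1) that by (auto simp: in_set_conv_nth nth_eq_iff_index_eq)
    ultimately show ?thesis
      unfolding S[OF that] max_elems_def using ideal_down r_irrefl by blast
  qed
  \<comment> \<open>The newest element is maximal in its prefix, so it belongs to the star of
    \<open>J\<close> with that prefix; a union with the previous stage completes the
    intersection.\<close>
  have prefix: "J \<inter> set (take n ps) \<in> \<sigma>" if J: "J \<in> \<sigma>" and n: "n \<le> length ps" for J n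
    using n
  proof (induction n)
    case 0
    then show ?case using v(4)[of 0] by simp
  next
    case (Suc n)
    let ?K = "set (take (Suc n) ps)"
    show ?case
    proof (cases "ps ! n \<in> J")
      case True
      have K: "?K \<in> \<sigma>" using v(4) Suc.prems by blast
      have "ps ! n \<in> st J ?K" using mem_stI[of "ps ! n" J ?K] max[OF Suc.prems] True mx_sub by blast
      then have "J \<inter> ?K = (J \<inter> set (take n ps)) \<union> st J ?K"
        using st_sub[OF I[OF J] I[OF K]] S[OF Suc.prems] by auto
      then show ?thesis using un[OF Suc.IH st[OF J K]] Suc.prems by simp
    next
      case False
      then have "J \<inter> ?K = J \<inter> set (take n ps)" using S[OF Suc.prems] by auto
      then show ?thesis using Suc by simp
    qed
  qed
  \<comment> \<open>The same argument with \<open>J\<close> cut down to the prefix, where the newest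
    element is maximal, and starred with \<open>K\<close>.\<close>
  have "J \<inter> K \<inter> set (take n ps) \<in> \<sigma>" if n: "n \<le> length ps" for n
    using n
  proof (induction n)
    case 0
    then show ?case using v(4)[of 0] by simp
  next
    case (Suc n)
    let ?M = "set (take (Suc n) ps)"
    show ?case
    proof (cases "ps ! n \<in> J \<inter> K")
      case True
      have JM: "J \<inter> ?M \<in> \<sigma>" using prefix[OF JK(1) Suc.prems] .
      have "ps ! n \<in> mx (J \<inter> ?M)" using max[OF Suc.prems] True by (auto simp: max_elems_def)
      then have "ps ! n \<in> st (J \<inter> ?M) K" using mem_stI[of "ps ! n" "J \<inter> ?M" K] True mx_sub by blast
      then have "J \<inter> K \<inter> ?M = (J \<inter> K \<inter> set (take n ps)) \<union> st (J \<inter> ?M) K"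
        using st_sub[OF I[OF JM] I[OF JK(2)]] S[OF Suc.prems] by auto
      then show ?thesis using un[OF Suc.IH st[OF JM JK(2)]] Suc.prems by simp
    next
      case False
      then have "J \<inter> K \<inter> ?M = J \<inter> K \<inter> set (take n ps)" using S[OF Suc.prems] by auto
      then show ?thesis using Suc by simp
    qed
  qed
  from this[of "length ps"] have "J \<inter> K \<inter> P \<in> \<sigma>" using ps by simp
  moreover have "J \<inter> K \<inter> P = J \<inter> K" using ideal_sub[OF I[OF JK(1)]] by auto
  ultimately show "J \<inter> K \<in> \<sigma>" by simp
qed

text \<open>The specialization order of the family \<sigma>, regarded as the lower sets of a finite
  topology.\<close>

definition cell_order :: "'p set set \<Rightarrow> 'p rel" where
  "cell_order \<sigma> = {(p, q). p \<in> P \<and> q \<in> P \<and> p \<noteq> q \<and> (\<forall>J\<in>\<sigma>. q \<in> J \<longrightarrow> p \<in> J)}"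

text \<open>Birkhoff correspondence: a family containing the empty set and \<open>P\<close> and
  closed under union and intersection consists of the lower sets of its specialization preorder. The
  prefixes of the maximal chain make that preorder antisymmetric.\<close>

lemma cell_order_props:
  assumes w: "supermodular w" and \<sigma>: "cell w ps \<sigma>"
  shows "order_ideals P (cell_order \<sigma>) = \<sigma>" "star_closed_extension P (cell_order \<sigma>) r"
proof -
  have I: "J \<in> ideals" if "J \<in> \<sigma>" for J using that \<sigma> by (auto simp: cell_def)
  have pre: "set (take i ps) \<in> \<sigma>" if "i \<le> length ps" for i
    using ex_slack[OF w \<sigma>] slackD(5) that by blast
  have ps: "distinct ps" "set ps = P" using \<sigma> by (auto simp: cell_def maxchain_def)
  have fin: "finite \<sigma>" using finite_ideals I by (meson finite_subset subsetI)
  have empty: "{} \<in> \<sigma>" using pre[of 0] by simp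
  have P: "P \<in> \<sigma>" using pre[of "length ps"] ps by simp
  have Inter: "\<Inter>C \<in> \<sigma>" if "finite C" "C \<noteq> {}" "C \<subseteq> \<sigma>" for C
    using that by (induction rule: finite_ne_induct) (auto intro: cell_closed[OF w \<sigma>])
  have Union: "\<Union>C \<in> \<sigma>" if "finite C" "C \<subseteq> \<sigma>" for C
    using that by (induction rule: finite_induct) (auto intro: cell_closed[OF w \<sigma>] empty)
  show eq: "order_ideals P (cell_order \<sigma>) = \<sigma>"
  proof (intro equalityI subsetI)
    fix J assume "J \<in> \<sigma>"
    then show "J \<in> order_ideals P (cell_order \<sigma>)"
      using ideal_sub[OF I] unfolding order_ideals_def cell_order_def by blast
  next
    fix J assume J: "J \<in> order_ideals P (cell_order \<sigma>)"
    then have JP: "J \<subseteq> P" by (simp add: order_ideals_def)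
    \<comment> \<open>The smallest member of the cell containing \<open>q\<close>; for
      \<open>q\<close> in \<open>J\<close> it is the principal lower set, and \<open>J\<close> is
      the union of these.\<close>
    define M where "M q = \<Inter>{K\<in>\<sigma>. q \<in> K}" for q
    have M: "M q \<in> \<sigma>" if "q \<in> J" for q
      unfolding M_def by (rule Inter) (use fin P JP that in auto)
    have "M q \<subseteq> J" if q: "q \<in> J" for q
    proof
      fix p assume p: "p \<in> M q"
      show "p \<in> J"
      proof (cases "p = q")
        case False
        have "p \<in> P" using p P q JP unfolding M_def by blast
        then have "(p, q) \<in> cell_order \<sigma>" using False p q JP unfolding cell_order_def M_def by blast
        then show ?thesis using J q unfolding order_ideals_def by blast
      qed (use q in simp)
    qed
    moreover have "q \<in> M q" for q by (simp add: M_def)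
    ultimately have "J = \<Union>(M ` J)" by blast
    moreover have "\<Union>(M ` J) \<in> \<sigma>"
      by (rule Union) (use M finite_subset[OF JP finP] in auto)
    ultimately show "J \<in> \<sigma>" by simp
  qed
  \<comment> \<open>Of two distinct elements, the prefix ending in the earlier one contains only
    that one.\<close>
  have sep: "(q, p) \<notin> cell_order \<sigma>" if pq: "(p, q) \<in> cell_order \<sigma>" for p q
  proof
    assume qp: "(q, p) \<in> cell_order \<sigma>"
    obtain a b where ab: "a < length ps" "p = ps ! a" "b < length ps" "q = ps ! b"
    proof -
      have "p \<in> set ps" "q \<in> set ps" using pq ps(2) by (auto simp: cell_order_def)
      then show ?thesis using that by (metis in_set_conv_nth)
    qed
    have "a \<noteq> b" using pq ab by (auto simp: cell_order_def)
    have mem: "ps ! i \<in> set (take (Suc j) ps) \<longleftrightarrow> i \<le> j" if ij: "i < length ps" "j < length ps" for i j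
    proof
      assume "ps ! i \<in> set (take (Suc j) ps)"
      then obtain l where "l < Suc j" "l < length ps" "ps ! l = ps ! i" by (auto simp: in_set_conv_nth)
      then show "i \<le> j" using nth_eq_iff_index_eq[OF ps(1), of l i] ij by auto
    next
      assume "i \<le> j"
      then show "ps ! i \<in> set (take (Suc j) ps)"
        unfolding in_set_conv_nth using ij by (intro exI[of _ i]) auto
    qed
    have "p \<in> set (take (Suc j) ps) \<longleftrightarrow> q \<in> set (take (Suc j) ps)" if "j < length ps" for j
    proof -
      have "set (take (Suc j) ps) \<in> \<sigma>" using pre[of "Suc j"] that by simp
      then show ?thesis using pq qp by (auto simp: cell_order_def)
    qed
    from this[of a] this[of b] show False using \<open>a \<noteq> b\<close> ab mem by auto
  qed
  have "trans (cell_order \<sigma>)"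
  proof (rule transI)
    fix x y z assume xy: "(x, y) \<in> cell_order \<sigma>" and yz: "(y, z) \<in> cell_order \<sigma>"
    then have "x \<noteq> z" using sep by blast
    with xy yz show "(x, z) \<in> cell_order \<sigma>" unfolding cell_order_def by blast
  qed
  then have "strict_order_on P (cell_order \<sigma>)"
    unfolding strict_order_on_def irrefl_def by (auto simp: cell_order_def)
  moreover have "r \<subseteq> cell_order \<sigma>"
  proof
    fix z assume "z \<in> r"
    then obtain p q where "z = (p, q)" "(p, q) \<in> r" by (cases z) auto
    then show "z \<in> cell_order \<sigma>"
      using r_sub r_irrefl ideal_down[OF I] unfolding cell_order_def by blast
  qed
  ultimately show "star_closed_extension P (cell_order \<sigma>) r"
    unfolding star_closed_extension_def eq using cell_closed(2)[OF w \<sigma>] by blast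
qed

text \<open>Elements are removed from the top so that no chain member is skipped: the removed
  maximal element lies outside the largest chain member strictly below the current ideal.\<close>

lemma ex_maxchain:
  assumes C: "\<And>J. J \<in> C \<Longrightarrow> J \<in> ideals" "\<And>J K. J \<in> C \<Longrightarrow> K \<in> C \<Longrightarrow> J \<subseteq> K \<or> K \<subseteq> J"
  obtains ps where "maxchain ps" "\<And>J. J \<in> C \<Longrightarrow> \<exists>i \<le> length ps. J = set (take i ps)"
proof -
  have finC: "finite C" using C(1) finite_ideals by (meson finite_subset subsetI)
  have "\<exists>ps. distinct ps \<and> set ps = Q \<and> (\<forall>i \<le> length ps. set (take i ps) \<in> ideals) \<and>
      (\<forall>J\<in>C. J \<subseteq> Q \<longrightarrow> (\<exists>i \<le> length ps. J = set (take i ps)))"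
    if "Q \<in> ideals" for Q
    using that
  proof (induction "card Q" arbitrary: Q)
    case 0
    then have "Q = {}" using finite_ideal by auto
    then show ?case using ideals_empty by (intro exI[of _ "[]"]) auto
  next
    case (Suc d)
    \<comment> \<open>The largest chain member properly inside \<open>Q\<close>, or the empty set if
      there is none.\<close>
    define U where "U = \<Union>{J\<in>C. J \<subset> Q}"
    have UQ: "U \<subset> Q"
    proof (cases "{J\<in>C. J \<subset> Q} = {}")
      case True
      then have "U = {}" unfolding U_def True by simp
      then show ?thesis using Suc by force
    next
      case False
      then have "U \<in> {J\<in>C. J \<subset> Q}" unfolding U_def using finC C(2) by (intro chain_Union_mem) auto
      then show ?thesis by simp
    qed
    have U: "q \<in> U" if "p \<in> U" "(q, p) \<in> r" for p q
      using that ideal_down C(1) unfolding U_def by blast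
    obtain p0 where p0: "p0 \<in> Q" "p0 \<notin> U" using UQ by blast
    obtain p where p: "p \<in> mx Q" "p0 = p \<or> (p0, p) \<in> r" using ex_mx_above[OF Suc.prems p0(1)] by blast
    have pU: "p \<notin> U" using p(2) p0(2) U by blast
    have pQ: "p \<in> Q" using p mx_sub by blast
    let ?Q = "Q - {p}"
    have Q': "?Q \<in> ideals"
      using Suc.prems p(1) unfolding order_ideals_def max_elems_def by blast
    have "d = card ?Q" using Suc.hyps(2) pQ finite_ideal[OF Suc.prems] by simp
    from Suc.hyps(1)[OF this Q'] obtain ps where ps: "distinct ps" "set ps = ?Q"
      "\<forall>i \<le> length ps. set (take i ps) \<in> ideals"
      "\<forall>J\<in>C. J \<subseteq> ?Q \<longrightarrow> (\<exists>i \<le> length ps. J = set (take i ps))" by blast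
    have full: "set (take (length (ps @ [p])) (ps @ [p])) = Q" using ps(2) pQ by auto
    have pre: "set (take i (ps @ [p])) = set (take i ps)" if "i \<le> length ps" for i using that by simp
    show ?case
    proof (intro exI[of _ "ps @ [p]"] conjI allI impI ballI)
      show "distinct (ps @ [p])" "set (ps @ [p]) = Q" using ps pQ by auto
      fix i assume i: "i \<le> length (ps @ [p])"
      show "set (take i (ps @ [p])) \<in> ideals"
      proof (cases "i = length (ps @ [p])")
        case True
        show ?thesis unfolding True full using Suc.prems .
      next
        case False
        then show ?thesis using ps(3) pre[of i] i by simp
      qed
    next
      fix J assume J: "J \<in> C" "J \<subseteq> Q"
      show "\<exists>i \<le> length (ps @ [p]). J = set (take i (ps @ [p]))"
      proof (cases "J = Q")
        case True
        then show ?thesis using full by blast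
      next
        case False
        then have "J \<subseteq> U" using J unfolding U_def by blast
        then have "J \<subseteq> ?Q" using UQ pU by blast
        then obtain i where "i \<le> length ps" "J = set (take i ps)" using ps(4) J by blast
        then show ?thesis using pre[of i] by (intro exI[of _ i]) auto
      qed
    qed
  qed
  from this[OF ideals_P] obtain ps where "distinct ps" "set ps = P"
    "\<forall>i \<le> length ps. set (take i ps) \<in> ideals"
    "\<forall>J\<in>C. J \<subseteq> P \<longrightarrow> (\<exists>i \<le> length ps. J = set (take i ps))" by blast
  then show ?thesis using that[of ps] C(1) ideal_sub by (auto simp: maxchain_def)
qed

lemma ex_cell:
  assumes w: "supermodular w" and C: "\<And>J. J \<in> C \<Longrightarrow> J \<in> ideals" "\<And>J K. J \<in> C \<Longrightarrow> K \<in> C \<Longrightarrow> J \<subseteq> K \<or> K \<subseteq> J"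
  obtains ps \<sigma> where "cell w ps \<sigma>" "C \<subseteq> \<sigma>"
proof -
  obtain ps where ps: "maxchain ps" "\<And>J. J \<in> C \<Longrightarrow> \<exists>i \<le> length ps. J = set (take i ps)"
    using ex_maxchain[of C] C by blast
  obtain l0 l where l: "\<forall>i \<le> length ps. w (set (take i ps)) = aff l0 l (set (take i ps))"
    using ex_affine[OF ps(1)] by blast
  define \<sigma> where "\<sigma> = {J \<in> ideals. w J = aff l0 l J}"
  have "cell w ps \<sigma>" unfolding cell_def \<sigma>_def using ps(1) l by blast
  moreover have "C \<subseteq> \<sigma>" using ps(2) l C(1) unfolding \<sigma>_def by blast
  ultimately show ?thesis by (rule that)
qed

lemma ex_cell_std:
  assumes "supermodular w" "std m"
  shows "\<exists>ps \<sigma>. cell w ps \<sigma> \<and> Poly_Mapping.keys m \<subseteq> \<sigma>"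
proof -
  obtain ps \<sigma> where "cell w ps \<sigma>" "Poly_Mapping.keys m \<subseteq> \<sigma>"
    by (rule ex_cell[OF assms(1), of "Poly_Mapping.keys m"]) (use assms(2) in \<open>auto simp: std_def\<close>)
  then show ?thesis by blast
qed

section \<open>Points of the cells\<close>

definition kernel_on :: "'p set set \<Rightarrow> ('p set, complex) mpoly set" where
  "kernel_on \<sigma> = {f \<in> mpolys \<sigma>. relative_hibi_map r f = 0}"

text \<open>Check on generators. If both ideals are in the cell, so are union and star, and the
  binomial is in the kernel. Otherwise the product vanishes; if equality of weights adds the second
  term, its total gap is negative too, so it also has a factor outside the cell.\<close>

lemma vanishing_on_cell:
  assumes w: "supermodular w" and \<sigma>: "cell w ps \<sigma>"
    and x: "\<And>J. J \<notin> \<sigma> \<Longrightarrow> x J = 0" "\<And>f. f \<in> kernel_on \<sigma> \<Longrightarrow> eval_at x f = 0" and f: "f \<in> rel_ideal w"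
  shows "eval_at x f = 0"
proof -
  interpret e: comm_ring_hom "eval_at x" by (rule comm_ring_hom_subst[OF comm_ring_hom_id])
  obtain v where s: "slack w ps \<sigma> v" using ex_slack[OF w \<sigma>] by blast
  note v = slackD(1,2,4)[OF s]
  have "eval_at x (rel_poly w J K) = 0" if JK: "incomp J K" for J K
  proof (cases "J \<in> \<sigma> \<and> K \<in> \<sigma>")
    case True
    have I: "J \<in> ideals" "K \<in> ideals" using JK by (auto simp: incomp_def)
    have US: "J \<union> K \<in> \<sigma>" "st J K \<in> \<sigma>" using cell_closed[OF w \<sigma>] True by auto
    then have eq: "w J + w K = w (J \<union> K) + w (st J K)"
      using True unfolding v(3)[OF I] by (simp add: v(1))
    have "rel_poly w J K \<in> mpolys \<sigma>" using True US by (simp add: rel_poly_def)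
    moreover have "relative_hibi_map r (rel_poly w J K) = 0"
      using \<Phi>_un_st[OF I] eq by (simp add: rel_poly_def rhm.hom_minus Var_mult_Var relative_hibi_map_single)
    ultimately have "rel_poly w J K \<in> kernel_on \<sigma>" by (simp add: kernel_on_def)
    then show ?thesis using x(2) by blast
  next
    case False
    have I: "J \<in> ideals" "K \<in> ideals" using JK by (auto simp: incomp_def)
    have "v J \<noteq> 0 \<or> v K \<noteq> 0" using False I by (auto simp: v(1))
    then have neg: "v J + v K < 0" using v(2)[OF I(1)] v(2)[OF I(2)] by (smt (verit))
    have "x (J \<union> K) * x (st J K) = 0" if "w J + w K = w (J \<union> K) + w (st J K)"
    proof -
      have "J \<union> K \<notin> \<sigma> \<or> st J K \<notin> \<sigma>" using that neg unfolding v(3)[OF I] by (auto simp: v(1))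
      then show ?thesis using x(1) by auto
    qed
    then have "eval_at x (if w J + w K = w (J \<union> K) + w (st J K) then Var (J \<union> K) * Var (st J K) else 0) = 0"
      by (simp add: e.hom_mult subst_Var)
    moreover have "eval_at x (Var J * Var K) = 0" using False x(1) by (auto simp: e.hom_mult subst_Var)
    ultimately show ?thesis by (simp only: rel_poly_def e.hom_minus diff_self)
  qed
  then have "rel_ideal w \<subseteq> vanishing_ideal ideals {(\<lambda>c. c, x)}"
    unfolding rel_ideal_def
    by (intro genideal_least ideal_vanishing_ideal)
      (auto intro!: vanishing_idealI simp: comm_ring_hom_id rel_poly_mpolys incomp_def)
  with f show ?thesis using vanishing_idealD[of f ideals "{(\<lambda>c. c, x)}"] by blast
qed

definition torus_point :: "'p set set \<Rightarrow> ('p option \<Rightarrow> complex) \<Rightarrow> 'p set \<Rightarrow> complex" where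
  "torus_point \<sigma> z J = (if J \<in> \<sigma> then z None * (\<Prod>p\<in>mx J. z (Some p)) else 0)"

definition restrict_vars :: "'p set set \<Rightarrow> ('p set, complex) mpoly \<Rightarrow> ('p set, complex) mpoly" where
  "restrict_vars \<sigma> f = subst Const (\<lambda>J. if J \<in> \<sigma> then Var J else 0) f"

lemma restrict_vars_mpolys: "restrict_vars \<sigma> f \<in> mpolys \<sigma>"
  unfolding restrict_vars_def by (rule mpolys_subst[of _ UNIV]) (auto simp: mpolys_iff[of _ UNIV])

lemma eval_restrict_vars: "eval_at x (restrict_vars \<sigma> f) = eval_at (\<lambda>J. if J \<in> \<sigma> then x J else 0) f"
  unfolding restrict_vars_def subst_subst_Const[OF comm_ring_hom_id]
  by (rule arg_cong[where f="\<lambda>x. eval_at x f"]) (auto simp: subst_Var)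

lemma lookup_restrict_vars:
  "Poly_Mapping.lookup (restrict_vars \<sigma> f) m = (if Poly_Mapping.keys m \<subseteq> \<sigma> then Poly_Mapping.lookup f m else 0)"
proof -
  have me: "mono_eval (\<lambda>J. if J \<in> \<sigma> then Var J else 0) k = (if Poly_Mapping.keys k \<subseteq> \<sigma> then Poly_Mapping.single k (1::complex) else 0)" for k
  proof (cases "Poly_Mapping.keys k \<subseteq> \<sigma>")
    case True
    then have "mono_eval (\<lambda>J. if J \<in> \<sigma> then Var J else 0) k = mono_eval Var k"
      by (intro mono_eval_cong) auto
    with True show ?thesis by (simp add: mono_eval_Var)
  next
    case False
    then obtain J where J: "J \<in> Poly_Mapping.keys k" "J \<notin> \<sigma>" by blast
    then have "(if J \<in> \<sigma> then Var J else 0) ^ Poly_Mapping.lookup k J = (0 :: ('p set, complex) mpoly)"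
      by (simp add: in_keys_iff power_0_left)
    then have "mono_eval (\<lambda>J. if J \<in> \<sigma> then Var J else 0) k = (0 :: ('p set, complex) mpoly)"
      unfolding mono_eval_def using J(1) by (intro prod_zero bexI[of _ J]) simp_all
    with False show ?thesis by simp
  qed
  have "restrict_vars \<sigma> f = (\<Sum>k\<in>Poly_Mapping.keys f. if Poly_Mapping.keys k \<subseteq> \<sigma> then Poly_Mapping.single k (Poly_Mapping.lookup f k) else 0)"
    unfolding restrict_vars_def subst_def' me by (auto simp: single_Const[symmetric] intro!: sum.cong)
  moreover have "Poly_Mapping.lookup (if Poly_Mapping.keys k \<subseteq> \<sigma> then Poly_Mapping.single k (Poly_Mapping.lookup f k) else 0) m
      = (if k = m then (if Poly_Mapping.keys m \<subseteq> \<sigma> then Poly_Mapping.lookup f m else 0) else 0)" for k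
    by (simp add: lookup_single when_def)
  ultimately have "Poly_Mapping.lookup (restrict_vars \<sigma> f) m
      = (\<Sum>k\<in>Poly_Mapping.keys f. if k = m then (if Poly_Mapping.keys m \<subseteq> \<sigma> then Poly_Mapping.lookup f m else 0) else 0)"
    by (simp only: lookup_sum)
  then show ?thesis by (simp add: sum.delta in_keys_iff)
qed

lemma eval_torus_point: "eval_at (torus_point \<sigma> z) f = eval_at z (relative_hibi_map r (restrict_vars \<sigma> f))"
proof -
  interpret e: comm_ring_hom "eval_at z" by (rule comm_ring_hom_subst[OF comm_ring_hom_id])
  have "eval_at z (relative_hibi_map r (restrict_vars \<sigma> f))
      = eval_at (\<lambda>J. z None * (\<Prod>p\<in>mx J. z (Some p))) (restrict_vars \<sigma> f)"
    unfolding relative_hibi_map_def subst_subst_Const[OF comm_ring_hom_id]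
    by (simp add: e.hom_mult e.hom_prod subst_Var)
  then show ?thesis by (simp add: eval_restrict_vars torus_point_def[abs_def])
qed

lemma restrict_vars_id: "f \<in> mpolys \<sigma> \<Longrightarrow> restrict_vars \<sigma> f = f"
  by (rule poly_mapping_eqI) (auto simp: lookup_restrict_vars mpolys_iff in_keys_iff)

definition cell_points :: "('p set \<Rightarrow> real) \<Rightarrow> ('p set \<Rightarrow> complex) set" where
  "cell_points w = {torus_point \<sigma> z | \<sigma> z. \<exists>ps. cell w ps \<sigma>}"

lemma vcone_cell_points: "vcone (cell_points w)"
  unfolding vcone_def
proof (intro ballI allI)
  fix x c assume "x \<in> cell_points w"
  then obtain \<sigma> ps z where x: "x = torus_point \<sigma> z" "cell w ps \<sigma>" by (auto simp: cell_points_def)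
  have "(\<lambda>J. c * x J) = torus_point \<sigma> (z(None := c * z None))"
    by (auto simp: x torus_point_def fun_eq_iff)
  then show "(\<lambda>J. c * x J) \<in> cell_points w" using x(2) unfolding cell_points_def by blast
qed

text \<open>Reduce a vanishing polynomial to a standard one. Each of its monomials is supported in
  some cell; setting the other variables to 0 gives a standard polynomial in the kernel of the
  monomial map, hence 0. In particular the ideal is radical.\<close>

lemma rel_ideal_eq_van:
  assumes w: "supermodular w"
  shows "rel_ideal w = van ideals (cell_points w)"
proof (intro equalityI subsetI)
  fix f assume f: "f \<in> rel_ideal w"
  have "eval_at (torus_point \<sigma> z) f = 0" if \<sigma>: "cell w ps \<sigma>" for ps \<sigma> z
  proof (rule vanishing_on_cell[OF w \<sigma> _ _ f])
    fix g assume "g \<in> kernel_on \<sigma>"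
    then show "eval_at (torus_point \<sigma> z) g = 0"
      by (simp add: eval_torus_point kernel_on_def restrict_vars_id)
  qed (simp add: torus_point_def)
  then show "f \<in> van ideals (cell_points w)"
    using rel_ideal_mpolys[OF f] by (auto simp: van_iff cell_points_def)
next
  fix f assume f: "f \<in> van ideals (cell_points w)"
  then have fI: "f \<in> mpolys ideals" by (auto simp: van_iff)
  obtain s where s: "\<And>m. m \<in> Poly_Mapping.keys s \<Longrightarrow> std m" "f - s \<in> rel_ideal w"
    using straighten[OF w fI] by blast
  have "m \<notin> Poly_Mapping.keys s" for m
  proof
    assume m: "m \<in> Poly_Mapping.keys s"
    obtain ps \<sigma> where \<sigma>: "cell w ps \<sigma>" "Poly_Mapping.keys m \<subseteq> \<sigma>"
      using ex_cell_std[OF w s(1)[OF m]] by blast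
    have "eval_at z (relative_hibi_map r (restrict_vars \<sigma> s)) = 0" for z
    proof -
      interpret e: comm_ring_hom "eval_at (torus_point \<sigma> z)" by (rule comm_ring_hom_subst[OF comm_ring_hom_id])
      have "eval_at (torus_point \<sigma> z) (f - s) = 0"
      proof (rule vanishing_on_cell[OF w \<sigma>(1) _ _ s(2)])
        fix g assume "g \<in> kernel_on \<sigma>"
        then show "eval_at (torus_point \<sigma> z) g = 0"
          by (simp add: eval_torus_point kernel_on_def restrict_vars_id)
      qed (simp add: torus_point_def)
      moreover have "eval_at (torus_point \<sigma> z) f = 0"
        using f \<sigma>(1) by (auto simp: van_iff cell_points_def)
      ultimately show ?thesis by (simp add: e.hom_minus eval_torus_point[symmetric])
    qed
    then have "relative_hibi_map r (restrict_vars \<sigma> s) = 0" by (rule eval_all_0_imp_0)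
    moreover have "std k" if "k \<in> Poly_Mapping.keys (restrict_vars \<sigma> s)" for k
      using that s(1) by (auto simp: in_keys_iff lookup_restrict_vars split: if_splits)
    ultimately have "restrict_vars \<sigma> s = 0" using relative_hibi_map_std_inj by blast
    then have "Poly_Mapping.lookup (restrict_vars \<sigma> s) m = 0" by simp
    then show False using m \<sigma>(2) by (simp add: lookup_restrict_vars in_keys_iff)
  qed
  then have "s = 0" by (metis all_not_in_conv keys_eq_empty)
  with s show "f \<in> rel_ideal w" by simp
qed

text \<open>An affine weight depends only on the image under \<Phi>. Thus straightening changes the
  weight for \<open>w\<close> and for its gap function by the same amount.\<close>

lemma wt_aff: "wt (aff l0 l) m = wt (case_option l0 l) (\<Phi> m)"
proof -
  have add: "wt u (\<Sum>x\<in>A. f x) = (\<Sum>x\<in>A. wt u (f x))" for u :: "'b \<Rightarrow> real" and A :: "'c set" and f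
    by (induction A rule: infinite_finite_induct) auto
  have "wt (case_option l0 l) (hm J) = aff l0 l J" for J
    by (simp add: hm_def add aff_def)
  then have "wt (case_option l0 l) (\<Phi> m) = (\<Sum>J\<in>Poly_Mapping.keys m. aff l0 l J * Poly_Mapping.lookup m J)"
    by (simp add: \<Phi>_def add mult.commute)
  then show ?thesis by (simp add: monomial_weight_def)
qed

lemma wt_diff: "wt (\<lambda>J. w J - u J) m = wt w m - wt u m"
  by (simp add: monomial_weight_def left_diff_distrib sum_subtractf)

lemma wt_nonpos: "(\<And>J. J \<in> Poly_Mapping.keys m \<Longrightarrow> v J \<le> 0) \<Longrightarrow> wt v m \<le> 0"
  unfolding monomial_weight_def by (intro sum_nonpos mult_nonpos_nonneg) auto

text \<open>Straighten the product of all nonvanishing coordinates. Since it is nonzero at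
  \<open>x\<close>, the weight cannot rise and the standard result is also nonzero there. In a cell
  containing that result its gap weight is 0, so the gaps over the whole support of \<open>x\<close>
  sum to 0; being nonpositive, they all vanish.\<close>

lemma zero_set_rel_ideal_in_cell:
  assumes w: "supermodular w" and x: "\<And>f. f \<in> rel_ideal w \<Longrightarrow> eval_at x f = 0" "\<And>J. J \<notin> ideals \<Longrightarrow> x J = 0"
  obtains ps \<sigma> where "cell w ps \<sigma>" "\<And>J. J \<notin> \<sigma> \<Longrightarrow> x J = 0"
proof -
  interpret e: comm_ring_hom "eval_at x" by (rule comm_ring_hom_subst[OF comm_ring_hom_id])
  define T where "T = {J. x J \<noteq> 0}"
  have T: "T \<subseteq> ideals" using x(2) by (auto simp: T_def)
  then have finT: "finite T" using finite_ideals finite_subset by blast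
  \<comment> \<open>The squarefree monomial on the support of \<open>x\<close>.\<close>
  define m where "m = (\<Sum>J\<in>T. Poly_Mapping.single J (1::nat))"
  have lm: "Poly_Mapping.lookup m J = (if J \<in> T then 1 else 0)" for J
    using finT by (auto simp: m_def lookup_sum lookup_single when_def)
  have km: "Poly_Mapping.keys m = T" by (auto simp: in_keys_iff lm split: if_splits)
  have ev: "eval_at x (Poly_Mapping.single k 1) = mono_eval x k" for k by (simp add: subst_single)
  have xm: "mono_eval x m \<noteq> 0" by (simp add: mono_eval_eq_0_iff km) (simp add: T_def)
  obtain s where s: "std s" "\<Phi> s = \<Phi> m" "wt w m \<le> wt w s"
    "wt w m < wt w s \<Longrightarrow> Poly_Mapping.single m 1 \<in> rel_ideal w"
    "wt w m = wt w s \<Longrightarrow> Poly_Mapping.single m 1 - Poly_Mapping.single s 1 \<in> rel_ideal w"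
    using straighten_monomial[OF w, of m] T km by blast
  have eq: "wt w m = wt w s" using s(3,4) x(1) ev xm by fastforce
  then have "mono_eval x s = mono_eval x m" using x(1)[OF s(5)[OF eq]] by (simp add: e.hom_minus ev)
  with xm have "mono_eval x s \<noteq> 0" by simp
  then have ks: "Poly_Mapping.keys s \<subseteq> T" by (auto simp: mono_eval_eq_0_iff T_def)
  obtain ps \<sigma> where \<sigma>: "cell w ps \<sigma>" "Poly_Mapping.keys s \<subseteq> \<sigma>"
    using ex_cell_std[OF w s(1)] by blast
  obtain v where sl: "slack w ps \<sigma> v" using ex_slack[OF w \<sigma>(1)] by blast
  note v = slackD(1,2,6)[OF sl]
  have "wt v m = wt v s" using v(3) eq s(2) by (auto simp: wt_diff wt_aff)
  also have "\<dots> = 0" using \<sigma>(2) v(1) by (auto simp: monomial_weight_def intro!: sum.neutral)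
  finally have "(\<Sum>J\<in>T. - v J) = 0" by (simp add: monomial_weight_def km lm sum_negf)
  then have "\<forall>J\<in>T. - v J = 0"
    using finT T v(2) by (subst (asm) sum_nonneg_eq_0_iff) auto
  then have "T \<subseteq> \<sigma>" using T v(1) by auto
  then show ?thesis using that[OF \<sigma>(1)] by (auto simp: T_def)
qed

text \<open>A monomial in the cell has gap weight 0, the largest possible, so straightening keeps
  its weight and replaces it by a congruent standard monomial with the same image. The resulting
  standard polynomial is in the kernel, hence 0.\<close>

lemma kernel_on_cell_sub:
  assumes w: "supermodular w" and \<sigma>: "cell w ps \<sigma>"
  shows "kernel_on \<sigma> \<subseteq> rel_ideal w"
proof
  fix f assume f: "f \<in> kernel_on \<sigma>"
  obtain v where sl: "slack w ps \<sigma> v" using ex_slack[OF w \<sigma>] by blast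
  note v = slackD(1,2,6)[OF sl]
  have "\<exists>s. std s \<and> \<Phi> s = \<Phi> m \<and> Poly_Mapping.single m 1 - Poly_Mapping.single s 1 \<in> rel_ideal w"
    if m: "m \<in> Poly_Mapping.keys f" for m
  proof -
    have km: "Poly_Mapping.keys m \<subseteq> \<sigma>" using m f by (auto simp: kernel_on_def mpolys_iff)
    then have "Poly_Mapping.keys m \<subseteq> ideals" using v(1) by blast
    then obtain s where s: "std s" "\<Phi> s = \<Phi> m" "wt w m \<le> wt w s"
      "wt w m = wt w s \<Longrightarrow> Poly_Mapping.single m 1 - Poly_Mapping.single s 1 \<in> rel_ideal w"
      using straighten_monomial[OF w, of m] by blast
    have "wt v m = 0" using km v(1) by (auto simp: monomial_weight_def intro!: sum.neutral)
    moreover have "wt v s \<le> 0" using v(2) s(1) by (intro wt_nonpos) (auto simp: std_def)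
    ultimately have "wt w m = wt w s" using s(2,3) v(3) by (auto simp: wt_diff wt_aff)
    with s show ?thesis by blast
  qed
  then obtain S where S: "\<And>m. m \<in> Poly_Mapping.keys f \<Longrightarrow> std (S m)" "\<And>m. m \<in> Poly_Mapping.keys f \<Longrightarrow> \<Phi> (S m) = \<Phi> m"
    "\<And>m. m \<in> Poly_Mapping.keys f \<Longrightarrow> Poly_Mapping.single m 1 - Poly_Mapping.single (S m) 1 \<in> rel_ideal w"
    by metis
  define s where "s = (\<Sum>m\<in>Poly_Mapping.keys f. Poly_Mapping.single (S m) (Poly_Mapping.lookup f m))"
  have "relative_hibi_map r s = (\<Sum>m\<in>Poly_Mapping.keys f. Poly_Mapping.single (\<Phi> m) (Poly_Mapping.lookup f m))"
    by (simp add: s_def rhm.hom_sum relative_hibi_map_single S(2))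
  also have "\<dots> = 0" using f by (simp add: kernel_on_def relative_hibi_map_sum[symmetric])
  finally have "relative_hibi_map r s = 0" .
  moreover have "std k" if "k \<in> Poly_Mapping.keys s" for k
  proof -
    have "k \<in> (\<Union>m\<in>Poly_Mapping.keys f. Poly_Mapping.keys (Poly_Mapping.single (S m) (Poly_Mapping.lookup f m)))"
      using subsetD[OF keys_sum that[unfolded s_def]] .
    then show ?thesis using S(1) by (auto split: if_splits)
  qed
  ultimately have "s = 0" using relative_hibi_map_std_inj by blast
  have "f - s = (\<Sum>m\<in>Poly_Mapping.keys f. Const (Poly_Mapping.lookup f m) * (Poly_Mapping.single m 1 - Poly_Mapping.single (S m) 1))"
    by (subst poly_mapping_as_sum[of f])
      (simp add: s_def sum_subtractf right_diff_distrib single_Const[of _ "Poly_Mapping.lookup f _"])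
  also have "\<dots> \<in> rel_ideal w"
    by (intro ideal_sum[OF ideal_rel_ideal] ideal_Const_mult[OF ideal_rel_ideal] S(3))
  finally show "f \<in> rel_ideal w" using \<open>s = 0\<close> by simp
qed

lemma relative_hibi_variety_cell:
  assumes w: "supermodular w" and \<sigma>: "cell w ps \<sigma>"
  shows "relative_hibi_variety P (cell_order \<sigma>) r = zero_set \<sigma> (kernel_on \<sigma>)"
  unfolding relative_hibi_variety_def cell_order_props(1)[OF w \<sigma>] kernel_on_def ..

lemma cell_sub_ideals: "cell w ps \<sigma> \<Longrightarrow> \<sigma> \<subseteq> ideals"
  by (auto simp: cell_def)

lemma zero_set_rel_ideal:
  assumes w: "supermodular w"
  shows "zero_set ideals (rel_ideal w) = (\<Union>\<sigma>\<in>{\<sigma>. \<exists>ps. cell w ps \<sigma>}. zero_set \<sigma> (kernel_on \<sigma>))"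
proof (intro equalityI subsetI)
  fix L assume L: "L \<in> zero_set ideals (rel_ideal w)"
  then obtain x u where x: "L = line x" "\<And>J. J \<notin> ideals \<Longrightarrow> x J = 0" "x u \<noteq> 0"
    by (auto simp: zero_set_def proj_space_def)
  have van: "eval_at y f = 0" if "y \<in> L" "f \<in> rel_ideal w" for y f using L that by (auto simp: zero_set_def)
  obtain ps \<sigma> where \<sigma>: "cell w ps \<sigma>" "\<And>J. J \<notin> \<sigma> \<Longrightarrow> x J = 0"
    using zero_set_rel_ideal_in_cell[OF w, of x] van mem_line x by metis
  have "L \<in> zero_set \<sigma> (kernel_on \<sigma>)"
    unfolding zero_set_def using line_in_proj_space[of \<sigma> x u] \<sigma>(2) x van kernel_on_cell_sub[OF w \<sigma>(1)] by blast
  with \<sigma>(1) show "L \<in> (\<Union>\<sigma>\<in>{\<sigma>. \<exists>ps. cell w ps \<sigma>}. zero_set \<sigma> (kernel_on \<sigma>))" by blast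
next
  fix L assume "L \<in> (\<Union>\<sigma>\<in>{\<sigma>. \<exists>ps. cell w ps \<sigma>}. zero_set \<sigma> (kernel_on \<sigma>))"
  then obtain ps \<sigma> where \<sigma>: "cell w ps \<sigma>" "L \<in> zero_set \<sigma> (kernel_on \<sigma>)" by blast
  then have Lp: "L \<in> proj_space \<sigma>" by (simp add: zero_set_def)
  then obtain x u where x: "L = line x" "\<And>J. J \<notin> \<sigma> \<Longrightarrow> x J = 0" "x u \<noteq> 0" by (auto simp: proj_space_def)
  have "L \<in> proj_space ideals"
    unfolding x(1) by (rule line_in_proj_space[of _ _ u]) (use x cell_sub_ideals[OF \<sigma>(1)] in auto)
  moreover have "eval_at y f = 0" if "y \<in> L" "f \<in> rel_ideal w" for y f
    by (rule vanishing_on_cell[OF w \<sigma>(1) _ _ that(2)])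
      (use proj_space_support[OF Lp that(1)] \<sigma>(2) that(1) in \<open>auto simp: zero_set_def\<close>)
  ultimately show "L \<in> zero_set ideals (rel_ideal w)" by (auto simp: zero_set_def)
qed

text \<open>Two closed sets, each missing a point of the variety, give two nonzero polynomials on
  the parametrizing torus. A common nonvanishing point maps to a point outside both sets.\<close>

lemma zariski_irreducible_cell:
  assumes w: "supermodular w" and \<sigma>: "cell w ps \<sigma>"
  shows "zariski_irreducible ideals (zero_set \<sigma> (kernel_on \<sigma>))"
proof -
  let ?H = "zero_set \<sigma> (kernel_on \<sigma>)"
  have pt: "line (torus_point \<sigma> z) \<in> ?H" if z: "\<And>p. z p \<noteq> 0" for z
  proof -
    have "set (take 0 ps) \<in> \<sigma>" using ex_slack[OF w \<sigma>] slackD(5) by blast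
    then have "{} \<in> \<sigma>" by simp
    then have ne: "torus_point \<sigma> z {} \<noteq> 0" using z by (auto simp: torus_point_def max_elems_def)
    have "eval_at y f = 0" if y: "y \<in> line (torus_point \<sigma> z)" and f: "f \<in> kernel_on \<sigma>" for y f
    proof -
      obtain c where "y = (\<lambda>J. c * torus_point \<sigma> z J)" using y by (auto simp: line_def)
      then have "y = torus_point \<sigma> (z(None := c * z None))" by (auto simp: torus_point_def fun_eq_iff)
      then show ?thesis using f by (simp add: eval_torus_point restrict_vars_id kernel_on_def)
    qed
    moreover have "line (torus_point \<sigma> z) \<in> proj_space \<sigma>"
      by (rule line_in_proj_space[where u="{}"]) (use ne in \<open>auto simp: torus_point_def\<close>)
    ultimately show ?thesis by (auto simp: zero_set_def)
  qed
  have nz: "\<exists>f\<in>S. relative_hibi_map r (restrict_vars \<sigma> f) \<noteq> 0" if L: "L \<in> ?H" "L \<notin> zero_set ideals S" for L S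
  proof -
    have Lp: "L \<in> proj_space \<sigma>" using L by (simp add: zero_set_def)
    then obtain x u where x: "L = line x" "\<And>J. J \<notin> \<sigma> \<Longrightarrow> x J = 0" "x u \<noteq> 0" by (auto simp: proj_space_def)
    have "L \<in> proj_space ideals"
      unfolding x(1) by (rule line_in_proj_space[of _ _ u]) (use x cell_sub_ideals[OF \<sigma>] in auto)
    then obtain y f where yf: "y \<in> L" "f \<in> S" "eval_at y f \<noteq> 0" using L(2) by (auto simp: zero_set_def)
    have "(\<lambda>J. if J \<in> \<sigma> then y J else 0) = y" using proj_space_support[OF Lp yf(1)] by auto
    then have "eval_at y (restrict_vars \<sigma> f) \<noteq> 0" using yf(3) by (simp add: eval_restrict_vars)
    then have "restrict_vars \<sigma> f \<notin> kernel_on \<sigma>" using L(1) yf(1) by (auto simp: zero_set_def)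
    then show ?thesis using yf(2) restrict_vars_mpolys by (auto simp: kernel_on_def)
  qed
  have "?H \<subseteq> A \<or> ?H \<subseteq> B" if A: "zariski_closed ideals A" and B: "zariski_closed ideals B" and H: "?H \<subseteq> A \<union> B" for A B
  proof (rule ccontr)
    assume "\<not> ?thesis"
    then obtain L M where LM: "L \<in> ?H" "L \<notin> A" "M \<in> ?H" "M \<notin> B" by blast
    obtain S T where S: "A = zero_set ideals S" and T: "B = zero_set ideals T"
      using A B by (auto simp: zariski_closed_def)
    obtain f g where f: "f \<in> S" "relative_hibi_map r (restrict_vars \<sigma> f) \<noteq> 0"
      and g: "g \<in> T" "relative_hibi_map r (restrict_vars \<sigma> g) \<noteq> 0"
      using nz[OF LM(1)] nz[OF LM(3)] LM(2,4) S T by metis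
    obtain z where z: "\<And>p. z p \<noteq> 0" "eval_at z (relative_hibi_map r (restrict_vars \<sigma> f)) \<noteq> 0"
      "eval_at z (relative_hibi_map r (restrict_vars \<sigma> g)) \<noteq> 0"
      using ex_common_nonvanishing_point[OF f(2) g(2)] by blast
    then have "line (torus_point \<sigma> z) \<notin> A \<union> B"
      unfolding S T zero_set_def eval_torus_point[symmetric] using f(1) g(1) mem_line by blast
    then show False using H pt[of z] z(1) by blast
  qed
  then show ?thesis unfolding zariski_irreducible_def using pt[of "\<lambda>_. 1"] by auto
qed

end

section \<open>Classical straightening of products of maximal minors\<close>

section \<open>Determinants over index sets\<close>


text \<open>The index set is arbitrary because the exchange relation uses positions in a disjoint
  sum.\<close>

definition ldet :: "'s set \<Rightarrow> ('s \<Rightarrow> 's \<Rightarrow> 'a::comm_ring_1) \<Rightarrow> 'a" where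
  "ldet S f = (\<Sum>\<pi> | \<pi> permutes S. of_int (sign \<pi>) * (\<Prod>j\<in>S. f (\<pi> j) j))"

lemma ldet_cong: "(\<And>i j. i \<in> S \<Longrightarrow> j \<in> S \<Longrightarrow> f i j = g i j) \<Longrightarrow> ldet S f = ldet S g"
  unfolding ldet_def by (intro sum.cong refl arg_cong2[of _ _ _ _ "(*)"] prod.cong) (auto simp: permutes_in_image)

lemma ldet_permute_cols:
  assumes "finite S" "\<rho> permutes S"
  shows "ldet S (\<lambda>i j. f i (\<rho> j)) = of_int (sign \<rho>) * ldet S f"
proof -
  have perm: "permutation \<pi>" if "\<pi> permutes S" for \<pi>
    using that assms(1) permutation_permutes by blast
  have "ldet S f = (\<Sum>\<pi> | \<pi> permutes S. of_int (sign (\<pi> \<circ> \<rho>)) * (\<Prod>j\<in>S. f ((\<pi> \<circ> \<rho>) j) j))" for f :: "'a \<Rightarrow> 'a \<Rightarrow> 'b"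
    unfolding ldet_def by (rule sum_permutations_compose_right[OF assms(2)])
  then have "ldet S (\<lambda>i j. f i (\<rho> j))
      = (\<Sum>\<pi> | \<pi> permutes S. of_int (sign (\<pi> \<circ> \<rho>)) * (\<Prod>j\<in>S. f ((\<pi> \<circ> \<rho>) j) (\<rho> j)))" .
  also have "\<dots> = (\<Sum>\<pi> | \<pi> permutes S. of_int (sign \<rho>) * (of_int (sign \<pi>) * (\<Prod>j\<in>S. f (\<pi> j) j)))"
  proof (rule sum.cong[OF refl])
    fix \<pi> assume "\<pi> \<in> {\<pi>. \<pi> permutes S}"
    then have "sign (\<pi> \<circ> \<rho>) = sign \<pi> * sign \<rho>" using perm assms(2) by (simp add: sign_compose)
    moreover have "(\<Prod>j\<in>S. f ((\<pi> \<circ> \<rho>) j) (\<rho> j)) = (\<Prod>j\<in>S. f (\<pi> j) j)"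
      using prod.permute[OF assms(2), of "\<lambda>j. f (\<pi> j) j"] by (simp add: o_def)
    ultimately show "of_int (sign (\<pi> \<circ> \<rho>)) * (\<Prod>j\<in>S. f ((\<pi> \<circ> \<rho>) j) (\<rho> j))
        = of_int (sign \<rho>) * (of_int (sign \<pi>) * (\<Prod>j\<in>S. f (\<pi> j) j))"
      by (simp add: mult_ac)
  qed
  finally show ?thesis by (simp add: ldet_def sum_distrib_left)
qed

lemma ldet_eq_cols:
  fixes f :: "'s \<Rightarrow> 's \<Rightarrow> complex"
  assumes S: "finite S" and ab: "a \<in> S" "b \<in> S" "a \<noteq> b" and eq: "\<And>i. i \<in> S \<Longrightarrow> f i a = f i b"
  shows "ldet S f = 0"
proof -
  let ?\<tau> = "Transposition.transpose a b"
  have "ldet S f = ldet S (\<lambda>i j. f i (?\<tau> j))"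
    by (rule ldet_cong) (use eq in \<open>auto simp: Transposition.transpose_def\<close>)
  also have "\<dots> = of_int (sign ?\<tau>) * ldet S f"
    by (rule ldet_permute_cols[OF S permutes_swap_id[OF ab(1,2)]])
  also have "\<dots> = - ldet S f" using ab by (simp add: sign_swap_id)
  finally show ?thesis by simp
qed

abbreviation minor :: "nat \<Rightarrow> (nat \<Rightarrow> nat \<Rightarrow> complex) \<Rightarrow> (nat \<Rightarrow> nat) \<Rightarrow> complex" where
  "minor k A c \<equiv> ldet {1..k} (\<lambda>i q. A i (c q))"

lemma minor_not_inj:
  assumes "\<not> inj_on c {1..k}"
  shows "minor k A c = 0"
proof -
  obtain a b where "a \<in> {1..k}" "b \<in> {1..k}" "a \<noteq> b" "c a = c b" using assms unfolding inj_on_def by blast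
  then show ?thesis by (intro ldet_eq_cols[of _ a b]) auto
qed

text \<open>Positions are numbered from 1.\<close>

definition enum :: "nat set \<Rightarrow> nat \<Rightarrow> nat" where
  "enum X q = sorted_list_of_set X ! (q - 1)"

lemma enum_bij: "finite X \<Longrightarrow> bij_betw (enum X) {1..card X} X"
proof -
  assume X: "finite X"
  have "bij_betw (\<lambda>i. sorted_list_of_set X ! i) {..<card X} X"
    using bij_betw_nth[of "sorted_list_of_set X" "{..<card X}" X] X by simp
  moreover have "bij_betw (\<lambda>q. q - 1) {1..card X} {..<card X}"
    by (rule bij_betw_byWitness[where f'=Suc]) auto
  ultimately have "bij_betw ((\<lambda>i. sorted_list_of_set X ! i) \<circ> (\<lambda>q. q - 1)) {1..card X} X"
    by (rule bij_betw_trans[rotated])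
  then show ?thesis by (simp add: o_def enum_def[abs_def])
qed

lemma enum_less: "finite X \<Longrightarrow> 1 \<le> p \<Longrightarrow> p < q \<Longrightarrow> q \<le> card X \<Longrightarrow> enum X p < enum X q"
  unfolding enum_def using sorted_wrt_nth_less[of "(<)" "sorted_list_of_set X" "p - 1" "q - 1"] by auto

definition pl :: "nat \<Rightarrow> (nat \<Rightarrow> nat \<Rightarrow> complex) \<Rightarrow> nat set \<Rightarrow> complex" where
  "pl k A X = minor k A (enum X)"

text \<open>The permutation that sorts the columns depends only on \<open>c\<close>, so one sign
  serves all matrices.\<close>

lemma minor_eq_pl:
  assumes c: "inj_on c {1..k}"
  shows "\<exists>e::int. \<forall>A. minor k A c = of_int e * pl k A (c ` {1..k})"
proof -
  let ?X = "c ` {1..k}"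
  have card: "card ?X = k" using c by (simp add: card_image)
  have e: "bij_betw (enum ?X) {1..k} ?X" using enum_bij[of ?X] card by simp
  define \<rho> where "\<rho> q = (if q \<in> {1..k} then inv_into {1..k} (enum ?X) (c q) else q)" for q
  have "bij_betw (inv_into {1..k} (enum ?X)) ?X {1..k}" by (rule bij_betw_inv_into[OF e])
  moreover have "bij_betw c {1..k} ?X" using c by (simp add: bij_betw_def)
  ultimately have "bij_betw (inv_into {1..k} (enum ?X) \<circ> c) {1..k} {1..k}" by (rule bij_betw_trans[rotated])
  then have "bij_betw \<rho> {1..k} {1..k}" by (rule bij_betw_cong[THEN iffD1, rotated]) (simp add: \<rho>_def)
  then have \<rho>: "\<rho> permutes {1..k}" by (intro bij_imp_permutes) (auto simp: \<rho>_def)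
  have cq: "c q = enum ?X (\<rho> q)" if "q \<in> {1..k}" for q
  proof -
    have "c q \<in> enum ?X ` {1..k}" using e that by (auto simp: bij_betw_def)
    then show ?thesis using that by (simp add: \<rho>_def f_inv_into_f)
  qed
  have "minor k A c = of_int (sign \<rho>) * pl k A ?X" for A
  proof -
    have "minor k A c = ldet {1..k} (\<lambda>i q. A i (enum ?X (\<rho> q)))"
      by (rule ldet_cong) (simp add: cq)
    also have "\<dots> = of_int (sign \<rho>) * pl k A ?X"
      unfolding pl_def using ldet_permute_cols[OF _ \<rho>, of "\<lambda>i q. A i (enum ?X q)"] by simp
    finally show ?thesis .
  qed
  then show ?thesis by (intro exI[of _ "sign \<rho>"] allI)
qed

section \<open>Straightening products of two minors\<close>

text \<open>The transpose of a determinant with two equal columns.\<close>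

lemma sum_permutations_rows_eq:
  fixes B :: "'t \<Rightarrow> 's \<Rightarrow> complex" and rw :: "'s \<Rightarrow> 't"
  assumes "finite S" "\<not> inj_on rw S"
  shows "(\<Sum>\<sigma> | \<sigma> permutes S. of_int (sign \<sigma>) * (\<Prod>x\<in>S. B (rw x) (\<sigma> x))) = 0"
proof -
  obtain a b where ab: "a \<in> S" "b \<in> S" "a \<noteq> b" "rw a = rw b" using assms(2) unfolding inj_on_def by blast
  have "ldet S (\<lambda>i j. B (rw j) i) = 0" by (rule ldet_eq_cols[OF assms(1) ab(1-3)]) (simp add: ab(4))
  then show ?thesis by (simp add: ldet_def)
qed

text \<open>Exchange of the positions \<open>r, \<dots>, k\<close> of \<open>a\<close> with the positions
  \<open>1, \<dots>, r\<close> of \<open>b\<close>. The alternating sum below is, for any choice of rows for all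
  positions, a determinant of size \<open>k + 1\<close> with two equal columns.\<close>

definition slots :: "nat \<Rightarrow> nat \<Rightarrow> (nat + nat) set" where
  "slots k r = Inl ` {1..r} \<union> Inr ` {r..k}"

definition upper_tuple :: "nat \<Rightarrow> (nat \<Rightarrow> nat) \<Rightarrow> (nat \<Rightarrow> nat) \<Rightarrow> (nat + nat \<Rightarrow> nat + nat) \<Rightarrow> nat \<Rightarrow> nat" where
  "upper_tuple r a b \<sigma> q = (if q < r then a q else case_sum b a (\<sigma> (Inr q)))"

definition lower_tuple :: "nat \<Rightarrow> (nat \<Rightarrow> nat) \<Rightarrow> (nat \<Rightarrow> nat) \<Rightarrow> (nat + nat \<Rightarrow> nat + nat) \<Rightarrow> nat \<Rightarrow> nat" where
  "lower_tuple r a b \<sigma> q = (if q \<le> r then case_sum b a (\<sigma> (Inl q)) else b q)"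

lemma finite_slots: "finite (slots k r)"
  by (simp add: slots_def)

lemma garnir:
  assumes r: "1 \<le> r" "r \<le> k"
  shows "(\<Sum>\<sigma> | \<sigma> permutes slots k r. of_int (sign \<sigma>) *
     (minor k A (upper_tuple r a b \<sigma>) * minor k A (lower_tuple r a b \<sigma>))) = 0"
proof -
  let ?K = "{1..k}" and ?s = "case_sum b a"
  define rw where "rw \<pi> \<rho> = case_sum \<rho> \<pi>" for \<pi> \<rho> :: "nat \<Rightarrow> nat"
  define rest where "rest \<pi> \<rho> = (\<Prod>q\<in>{1..<r}. A (\<pi> q) (a q)) * (\<Prod>q\<in>{r<..k}. A (\<rho> q) (b q))" for \<pi> \<rho>
  have P: "(\<Prod>q\<in>?K. A (\<pi> q) (upper_tuple r a b \<sigma> q)) * (\<Prod>q\<in>?K. A (\<rho> q) (lower_tuple r a b \<sigma> q))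
      = rest \<pi> \<rho> * (\<Prod>x\<in>slots k r. A (rw \<pi> \<rho> x) (?s (\<sigma> x)))" for \<pi> \<rho> \<sigma>
  proof -
    have K1: "?K = {1..<r} \<union> {r..k}" and K2: "?K = {1..r} \<union> {r<..k}" using r by auto
    have "(\<Prod>q\<in>?K. A (\<pi> q) (upper_tuple r a b \<sigma> q))
        = (\<Prod>q\<in>{1..<r}. A (\<pi> q) (a q)) * (\<Prod>q\<in>{r..k}. A (\<pi> q) (?s (\<sigma> (Inr q))))"
      unfolding K1 by (subst prod.union_disjoint) (auto simp: upper_tuple_def)
    moreover have "(\<Prod>q\<in>?K. A (\<rho> q) (lower_tuple r a b \<sigma> q))
        = (\<Prod>q\<in>{1..r}. A (\<rho> q) (?s (\<sigma> (Inl q)))) * (\<Prod>q\<in>{r<..k}. A (\<rho> q) (b q))"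
      unfolding K2 by (subst prod.union_disjoint) (auto simp: lower_tuple_def)
    moreover have "(\<Prod>x\<in>slots k r. A (rw \<pi> \<rho> x) (?s (\<sigma> x)))
        = (\<Prod>q\<in>{1..r}. A (\<rho> q) (?s (\<sigma> (Inl q)))) * (\<Prod>q\<in>{r..k}. A (\<pi> q) (?s (\<sigma> (Inr q))))"
      unfolding slots_def rw_def by (subst prod.union_disjoint) (auto simp: prod.reindex)
    ultimately show ?thesis by (simp add: rest_def)
  qed
  \<comment> \<open>Pigeonhole: there are k + 1 slots but only k rows.\<close>
  have ninj: "\<not> inj_on (rw \<pi> \<rho>) (slots k r)" if "\<pi> permutes ?K" "\<rho> permutes ?K" for \<pi> \<rho>
  proof
    assume "inj_on (rw \<pi> \<rho>) (slots k r)"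
    moreover have "rw \<pi> \<rho> ` slots k r \<subseteq> ?K"
      using permutes_in_image[OF that(1)] permutes_in_image[OF that(2)] r unfolding slots_def rw_def by fastforce
    ultimately have "card (slots k r) \<le> card ?K" using card_inj_on_le by blast
    moreover have "card (slots k r) = Suc k"
      unfolding slots_def using r by (subst card_Un_disjoint) (auto simp: card_image)
    ultimately show False by simp
  qed
  have M: "of_int (sign \<sigma>) * (minor k A (upper_tuple r a b \<sigma>) * minor k A (lower_tuple r a b \<sigma>))
    = (\<Sum>\<pi> | \<pi> permutes ?K. \<Sum>\<rho> | \<rho> permutes ?K. of_int (sign \<pi>) * of_int (sign \<rho>) * rest \<pi> \<rho> *
        (of_int (sign \<sigma>) * (\<Prod>x\<in>slots k r. A (rw \<pi> \<rho> x) (?s (\<sigma> x)))))" for \<sigma>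
  proof -
    have "minor k A (upper_tuple r a b \<sigma>) * minor k A (lower_tuple r a b \<sigma>)
      = (\<Sum>\<pi> | \<pi> permutes ?K. \<Sum>\<rho> | \<rho> permutes ?K. (of_int (sign \<pi>) * of_int (sign \<rho>)) *
         ((\<Prod>q\<in>?K. A (\<pi> q) (upper_tuple r a b \<sigma> q)) * (\<Prod>q\<in>?K. A (\<rho> q) (lower_tuple r a b \<sigma> q))))"
      unfolding ldet_def sum_product by (intro sum.cong refl) (simp only: mult_ac)
    then have "of_int (sign \<sigma>) * (minor k A (upper_tuple r a b \<sigma>) * minor k A (lower_tuple r a b \<sigma>))
      = of_int (sign \<sigma>) * (\<Sum>\<pi> | \<pi> permutes ?K. \<Sum>\<rho> | \<rho> permutes ?K. (of_int (sign \<pi>) * of_int (sign \<rho>)) *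
         (rest \<pi> \<rho> * (\<Prod>x\<in>slots k r. A (rw \<pi> \<rho> x) (?s (\<sigma> x)))))"
      unfolding P by (rule arg_cong)
    also have "\<dots> = (\<Sum>\<pi> | \<pi> permutes ?K. \<Sum>\<rho> | \<rho> permutes ?K. of_int (sign \<pi>) * of_int (sign \<rho>) * rest \<pi> \<rho> *
        (of_int (sign \<sigma>) * (\<Prod>x\<in>slots k r. A (rw \<pi> \<rho> x) (?s (\<sigma> x)))))"
      unfolding sum_distrib_left by (intro sum.cong refl) (simp only: mult_ac)
    finally show ?thesis .
  qed
  have "(\<Sum>\<sigma> | \<sigma> permutes slots k r. of_int (sign \<sigma>) *
     (minor k A (upper_tuple r a b \<sigma>) * minor k A (lower_tuple r a b \<sigma>)))
    = (\<Sum>\<pi> | \<pi> permutes ?K. \<Sum>\<sigma> | \<sigma> permutes slots k r. \<Sum>\<rho> | \<rho> permutes ?K. of_int (sign \<pi>) * of_int (sign \<rho>) * rest \<pi> \<rho> *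
        (of_int (sign \<sigma>) * (\<Prod>x\<in>slots k r. A (rw \<pi> \<rho> x) (?s (\<sigma> x)))))"
    unfolding M by (rule sum.swap)
  also have "\<dots> = (\<Sum>\<pi> | \<pi> permutes ?K. \<Sum>\<rho> | \<rho> permutes ?K. of_int (sign \<pi>) * of_int (sign \<rho>) * rest \<pi> \<rho> *
        (\<Sum>\<sigma> | \<sigma> permutes slots k r. of_int (sign \<sigma>) * (\<Prod>x\<in>slots k r. A (rw \<pi> \<rho> x) (?s (\<sigma> x)))))"
    unfolding sum_distrib_left by (intro sum.cong refl sum.swap)
  also have "\<dots> = 0"
  proof (intro sum.neutral ballI)
    fix \<pi> \<rho> assume "\<pi> \<in> {\<pi>. \<pi> permutes ?K}" "\<rho> \<in> {\<pi>. \<pi> permutes ?K}"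
    then have "(\<Sum>\<sigma> | \<sigma> permutes slots k r. of_int (sign \<sigma>) * (\<Prod>x\<in>slots k r. A (rw \<pi> \<rho> x) (?s (\<sigma> x)))) = 0"
      using sum_permutations_rows_eq[OF finite_slots ninj, of \<pi> \<rho> "\<lambda>i x. A i (?s x)"] by simp
    then show "of_int (sign \<pi>) * of_int (sign \<rho>) * rest \<pi> \<rho> *
        (\<Sum>\<sigma> | \<sigma> permutes slots k r. of_int (sign \<sigma>) * (\<Prod>x\<in>slots k r. A (rw \<pi> \<rho> x) (?s (\<sigma> x)))) = 0"
      by (simp only: mult_zero_right)
  qed
  finally show ?thesis .
qed

text \<open>Such a permutation splits into one of the upper and one of the lower positions. The sign
  of each occurs twice, once in the sign of \<sigma> and once from permuting columns, and squares to
  1.\<close>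

lemma garnir_stable_term:
  assumes r: "1 \<le> r" "r \<le> k" and \<sigma>: "\<sigma> permutes slots k r" "\<sigma> ` Inr ` {r..k} = Inr ` {r..k}"
  shows "of_int (sign \<sigma>) * (minor k A (upper_tuple r a b \<sigma>) * minor k A (lower_tuple r a b \<sigma>))
    = minor k A a * minor k A b"
proof -
  have inj: "inj \<sigma>" using \<sigma>(1) permutes_inj by blast
  have "\<sigma> ` slots k r = slots k r" using \<sigma>(1) permutes_image by blast
  moreover have "Inl ` {1..r} = slots k r - Inr ` {r..k}" by (auto simp: slots_def)
  ultimately have low: "\<sigma> ` Inl ` {1..r} = Inl ` {1..r}"
    using \<sigma>(2) image_set_diff[OF inj] by metis
  define \<rho>1 where "\<rho>1 q = (if q \<in> {r..k} then projr (\<sigma> (Inr q)) else q)" for q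
  define \<rho>2 where "\<rho>2 q = (if q \<in> {1..r} then projl (\<sigma> (Inl q)) else q)" for q
  have s1: "\<sigma> (Inr q) = Inr (\<rho>1 q) \<and> \<rho>1 q \<in> {r..k}" if "q \<in> {r..k}" for q
  proof -
    have "\<sigma> (Inr q) \<in> Inr ` {r..k}" using \<sigma>(2) that by blast
    then show ?thesis using that by (auto simp: \<rho>1_def)
  qed
  have s2: "\<sigma> (Inl q) = Inl (\<rho>2 q) \<and> \<rho>2 q \<in> {1..r}" if "q \<in> {1..r}" for q
  proof -
    have "\<sigma> (Inl q) \<in> Inl ` {1..r}" using low that by blast
    then show ?thesis using that by (auto simp: \<rho>2_def)
  qed
  have "inj_on \<rho>1 {r..k}"
    by (rule inj_onI) (metis s1 inj injD sum.inject(2))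
  moreover have "\<rho>1 ` {r..k} \<subseteq> {r..k}" using s1 by blast
  ultimately have "bij_betw \<rho>1 {r..k} {r..k}" by (simp add: bij_betw_def endo_inj_surj)
  then have p1: "\<rho>1 permutes {r..k}" by (rule bij_imp_permutes) (auto simp: \<rho>1_def)
  have "inj_on \<rho>2 {1..r}"
    by (rule inj_onI) (metis s2 inj injD sum.inject(1))
  moreover have "\<rho>2 ` {1..r} \<subseteq> {1..r}" using s2 by blast
  ultimately have "bij_betw \<rho>2 {1..r} {1..r}" by (simp add: bij_betw_def endo_inj_surj)
  then have p2: "\<rho>2 permutes {1..r}" by (rule bij_imp_permutes) (auto simp: \<rho>2_def)
  have P1: "\<rho>1 permutes {1..k}" and P2: "\<rho>2 permutes {1..k}"
    using r by (auto intro: permutes_subset[OF p1] permutes_subset[OF p2])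
  let ?m1 = "map_permutation {r..k} (Inr :: nat \<Rightarrow> nat + nat) \<rho>1" and ?m2 = "map_permutation {1..r} (Inl :: nat \<Rightarrow> nat + nat) \<rho>2"
  have m: "?m1 permutes Inr ` {r..k}" "?m2 permutes Inl ` {1..r}"
    by (intro map_permutation_permutes p1 p2; simp add: bij_betw_def)+
  have comp: "\<sigma> = ?m1 \<circ> ?m2"
  proof
    fix x
    consider q where "x = Inr q" "q \<in> {r..k}" | q where "x = Inl q" "q \<in> {1..r}" | "x \<notin> slots k r"
      by (cases x; cases "x \<in> slots k r") (auto simp: slots_def)
    then show "\<sigma> x = (?m1 \<circ> ?m2) x"
    proof cases
      case 1
      then have "?m2 x = x" using permutes_not_in[OF m(2)] by auto
      moreover have "?m1 (Inr q) = Inr (\<rho>1 q)" using 1 by (intro map_permutation_apply) auto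
      ultimately show ?thesis using s1[of q] 1 by simp
    next
      case 2
      have "?m2 (Inl q) = Inl (\<rho>2 q)" using 2 by (intro map_permutation_apply) auto
      moreover have "?m1 (Inl (\<rho>2 q)) = Inl (\<rho>2 q)" using permutes_not_in[OF m(1)] by auto
      ultimately show ?thesis using s2[of q] 2 by simp
    next
      case 3
      then have "?m2 x = x" "?m1 x = x" using permutes_not_in[OF m(2)] permutes_not_in[OF m(1)] by (auto simp: slots_def)
      then show ?thesis using permutes_not_in[OF \<sigma>(1) 3] by simp
    qed
  qed
  have "sign ?m1 = sign \<rho>1" "sign ?m2 = sign \<rho>2"
    by (intro sign_map_permutation p1 p2; simp)+
  moreover have "permutation ?m1" "permutation ?m2"
    using m by (auto simp: permutation_permutes intro: exI[of _ "Inr ` {r..k}"] exI[of _ "Inl ` {1..r}"])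
  ultimately have sgn: "sign \<sigma> = sign \<rho>1 * sign \<rho>2" unfolding comp by (simp add: sign_compose)
  have "minor k A (upper_tuple r a b \<sigma>) = minor k A (a \<circ> \<rho>1)"
  proof (intro ldet_cong)
    fix i q assume "q \<in> {1..k}"
    then have "upper_tuple r a b \<sigma> q = a (\<rho>1 q)"
      using s1[of q] by (cases "q < r") (simp_all add: upper_tuple_def, simp add: \<rho>1_def)
    then show "A i (upper_tuple r a b \<sigma> q) = A i ((a \<circ> \<rho>1) q)" by simp
  qed
  also have "\<dots> = of_int (sign \<rho>1) * minor k A a"
    using ldet_permute_cols[OF _ P1, of "\<lambda>i q. A i (a q)"] by simp
  finally have 1: "minor k A (upper_tuple r a b \<sigma>) = of_int (sign \<rho>1) * minor k A a" .
  have "minor k A (lower_tuple r a b \<sigma>) = minor k A (b \<circ> \<rho>2)"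
  proof (intro ldet_cong)
    fix i q assume "q \<in> {1..k}"
    then have "lower_tuple r a b \<sigma> q = b (\<rho>2 q)"
      using s2[of q] by (cases "q \<le> r") (simp_all add: lower_tuple_def, simp add: \<rho>2_def)
    then show "A i (lower_tuple r a b \<sigma> q) = A i ((b \<circ> \<rho>2) q)" by simp
  qed
  also have "\<dots> = of_int (sign \<rho>2) * minor k A b"
    using ldet_permute_cols[OF _ P2, of "\<lambda>i q. A i (b q)"] by simp
  finally have 2: "minor k A (lower_tuple r a b \<sigma>) = of_int (sign \<rho>2) * minor k A b" .
  have sq: "(of_int (sign \<rho>1) :: complex) * of_int (sign \<rho>1) = 1" "(of_int (sign \<rho>2) :: complex) * of_int (sign \<rho>2) = 1"
    by (metis of_int_1 of_int_mult sign_idempotent)+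
  have "of_int (sign \<sigma>) * (minor k A (upper_tuple r a b \<sigma>) * minor k A (lower_tuple r a b \<sigma>))
    = (of_int (sign \<rho>1) * of_int (sign \<rho>1)) * (of_int (sign \<rho>2) * of_int (sign \<rho>2)) * (minor k A a * minor k A b)"
    unfolding 1 2 sgn of_int_mult by (simp only: mult_ac)
  also have "\<dots> = minor k A a * minor k A b" unfolding sq by simp
  finally show ?thesis .
qed

definition tab_le :: "nat \<Rightarrow> nat set \<Rightarrow> nat set \<Rightarrow> bool" where
  "tab_le k X Y \<longleftrightarrow> (\<forall>q\<in>{1..k}. enum X q \<le> enum Y q)"

definition std_pairs :: "nat \<Rightarrow> nat \<Rightarrow> (nat set \<times> nat set) set" where
  "std_pairs k n = {(X, Y). X \<in> pluecker_indices k n \<and> Y \<in> pluecker_indices k n \<and> tab_le k X Y}"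

lemma finite_pluecker_indices: "finite (pluecker_indices k n)"
  by (rule finite_subset[of _ "Pow {1..n}"]) (auto simp: pluecker_indices_def)

lemma finite_std_pairs: "finite (std_pairs k n)"
  by (rule finite_subset[of _ "pluecker_indices k n \<times> pluecker_indices k n"])
    (auto simp: std_pairs_def finite_pluecker_indices)

text \<open>The coefficients must not depend on the matrix.\<close>

definition in_std_span :: "nat \<Rightarrow> nat \<Rightarrow> ((nat \<Rightarrow> nat \<Rightarrow> complex) \<Rightarrow> complex) \<Rightarrow> bool" where
  "in_std_span k n g \<longleftrightarrow> (\<exists>c. \<forall>A. g A = (\<Sum>z\<in>std_pairs k n. c z * (pl k A (fst z) * pl k A (snd z))))"

lemma in_std_span_zero: "in_std_span k n (\<lambda>_. 0)"
  unfolding in_std_span_def by (intro exI[of _ "\<lambda>_. 0"]) simp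

lemma in_std_span_add: "in_std_span k n f \<Longrightarrow> in_std_span k n g \<Longrightarrow> in_std_span k n (\<lambda>A. f A + g A)"
proof -
  assume "in_std_span k n f" "in_std_span k n g"
  then obtain c d where "\<forall>A. f A = (\<Sum>z\<in>std_pairs k n. c z * (pl k A (fst z) * pl k A (snd z)))"
    "\<forall>A. g A = (\<Sum>z\<in>std_pairs k n. d z * (pl k A (fst z) * pl k A (snd z)))"
    by (auto simp: in_std_span_def)
  then show ?thesis unfolding in_std_span_def
    by (intro exI[of _ "\<lambda>z. c z + d z"]) (simp add: distrib_right sum.distrib)
qed

lemma in_std_span_scale: "in_std_span k n f \<Longrightarrow> in_std_span k n (\<lambda>A. e * f A)"
proof -
  assume "in_std_span k n f"
  then obtain c where "\<forall>A. f A = (\<Sum>z\<in>std_pairs k n. c z * (pl k A (fst z) * pl k A (snd z)))"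
    by (auto simp: in_std_span_def)
  then show ?thesis unfolding in_std_span_def
    by (intro exI[of _ "\<lambda>z. e * c z"]) (simp add: sum_distrib_left mult.assoc)
qed

lemma in_std_span_sum: "(\<And>x. x \<in> T \<Longrightarrow> in_std_span k n (f x)) \<Longrightarrow> in_std_span k n (\<lambda>A. \<Sum>x\<in>T. f x A)"
  by (induction T rule: infinite_finite_induct) (auto intro: in_std_span_zero in_std_span_add)

lemma in_std_span_std:
  assumes "(X, Y) \<in> std_pairs k n"
  shows "in_std_span k n (\<lambda>A. pl k A X * pl k A Y)"
  unfolding in_std_span_def
proof (intro exI[of _ "\<lambda>z. if z = (X, Y) then 1 else 0"] allI)
  fix A
  have "(\<Sum>z\<in>std_pairs k n. (if z = (X, Y) then 1 else 0) * (pl k A (fst z) * pl k A (snd z)))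
    = (\<Sum>z\<in>std_pairs k n. if z = (X, Y) then pl k A X * pl k A Y else 0)"
    by (rule sum.cong) auto
  then show "pl k A X * pl k A Y = (\<Sum>z\<in>std_pairs k n. (if z = (X, Y) then 1 else 0) * (pl k A (fst z) * pl k A (snd z)))"
    using assms finite_std_pairs by (simp add: sum.delta)
qed

text \<open>At least one entry that is at least \<open>a r\<close> is traded for one that is at most
  \<open>b r\<close>, which is smaller. The drop in the column sum is the termination measure of
  straightening.\<close>

lemma garnir_unstable_sum:
  assumes r: "1 \<le> r" "r \<le> k" and \<sigma>: "\<sigma> permutes slots k r" "\<sigma> ` Inr ` {r..k} \<noteq> Inr ` {r..k}"
    and a: "\<And>q. r \<le> q \<Longrightarrow> q \<le> k \<Longrightarrow> a r \<le> a q" and b: "\<And>q. 1 \<le> q \<Longrightarrow> q \<le> r \<Longrightarrow> b q \<le> b r" and ab: "b r < a r"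
  shows "(\<Sum>q\<in>{1..k}. upper_tuple r a b \<sigma> q) < (\<Sum>q\<in>{1..k}. a q)"
proof -
  let ?U = "Inr ` {r..k} :: (nat + nat) set" and ?s = "case_sum b a"
  have fin: "finite ?U" "finite (\<sigma> ` ?U)" by simp_all
  have inj: "inj_on \<sigma> ?U" using permutes_inj[OF \<sigma>(1)] by (rule inj_on_subset) simp
  have card: "card (\<sigma> ` ?U) = card ?U" using inj by (rule card_image)
  have cardD: "card (\<sigma> ` ?U - ?U) = card (?U - \<sigma> ` ?U)"
    using card card_Diff_subset_Int[of "\<sigma> ` ?U" ?U] card_Diff_subset_Int[of ?U "\<sigma> ` ?U"] by (simp add: Int_commute)
  have ne: "?U - \<sigma> ` ?U \<noteq> {}"
    using \<sigma>(2) card_subset_eq[OF fin(2), of ?U] card by auto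
  have "\<sigma> ` ?U \<subseteq> slots k r" using permutes_in_image[OF \<sigma>(1)] by (auto simp: slots_def)
  then have low: "?s x \<le> b r" if x: "x \<in> \<sigma> ` ?U - ?U" for x
  proof -
    have "x \<in> slots k r - ?U" using x \<open>\<sigma> ` ?U \<subseteq> slots k r\<close> by blast
    then obtain q where "x = Inl q" "q \<in> {1..r}" unfolding slots_def by blast
    then show ?thesis using b[of q] by simp
  qed
  have up: "a r \<le> ?s x" if "x \<in> ?U - \<sigma> ` ?U" for x
    using that a by auto
  have "(\<Sum>x\<in>\<sigma> ` ?U - ?U. ?s x) \<le> card (\<sigma> ` ?U - ?U) * b r"
    using sum_bounded_above[of "\<sigma> ` ?U - ?U" ?s "b r"] low by simp
  also have "\<dots> < card (?U - \<sigma> ` ?U) * a r"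
    using cardD ne ab fin by (simp add: card_gt_0_iff)
  also have "\<dots> \<le> (\<Sum>x\<in>?U - \<sigma> ` ?U. ?s x)"
    using sum_bounded_below[of "?U - \<sigma> ` ?U" "a r" ?s] up by simp
  finally have "(\<Sum>x\<in>\<sigma> ` ?U. ?s x) < (\<Sum>x\<in>?U. ?s x)"
    using sum.Int_Diff[OF fin(2), of ?s ?U] sum.Int_Diff[OF fin(1), of ?s "\<sigma> ` ?U"] by (simp add: Int_commute)
  moreover have "(\<Sum>x\<in>\<sigma> ` ?U. ?s x) = (\<Sum>q\<in>{r..k}. ?s (\<sigma> (Inr q)))"
    using inj by (simp add: sum.reindex)
  moreover have "(\<Sum>x\<in>?U. ?s x) = (\<Sum>q\<in>{r..k}. a q)" by (simp add: sum.reindex)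
  ultimately have *: "(\<Sum>q\<in>{r..k}. ?s (\<sigma> (Inr q))) < (\<Sum>q\<in>{r..k}. a q)" by simp
  have K: "{1..k} = {1..<r} \<union> {r..k}" using r by auto
  have "(\<Sum>q\<in>{1..k}. upper_tuple r a b \<sigma> q) = (\<Sum>q\<in>{1..<r}. a q) + (\<Sum>q\<in>{r..k}. ?s (\<sigma> (Inr q)))"
    unfolding K by (subst sum.union_disjoint) (auto simp: upper_tuple_def)
  moreover have "(\<Sum>q\<in>{1..k}. a q) = (\<Sum>q\<in>{1..<r}. a q) + (\<Sum>q\<in>{r..k}. a q)"
    unfolding K by (subst sum.union_disjoint) auto
  ultimately show ?thesis using * by simp
qed

lemma tuples_range:
  assumes r: "1 \<le> r" "r \<le> k" and \<sigma>: "\<sigma> permutes slots k r"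
    and a: "a ` {1..k} \<subseteq> V" and b: "b ` {1..k} \<subseteq> V"
  shows "upper_tuple r a b \<sigma> ` {1..k} \<subseteq> V" "lower_tuple r a b \<sigma> ` {1..k} \<subseteq> V"
proof -
  have s: "case_sum b a x \<in> V" if "x \<in> slots k r" for x
    using that a b r by (fastforce simp: slots_def)
  have "case_sum b a (\<sigma> x) \<in> V" if "x \<in> slots k r" for x
    using s permutes_in_image[OF \<sigma>] that by blast
  then show "upper_tuple r a b \<sigma> ` {1..k} \<subseteq> V" "lower_tuple r a b \<sigma> ` {1..k} \<subseteq> V"
    using a b by (auto simp: upper_tuple_def lower_tuple_def slots_def image_subset_iff)
qed

text \<open>At any violated position \<open>r\<close> the exchange relation contains the product
  itself once for each stable permutation; every other term has a first factor with smaller column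
  sum or is zero.\<close>

lemma straighten_minors:
  assumes "X \<in> pluecker_indices k n" "Y \<in> pluecker_indices k n"
  shows "in_std_span k n (\<lambda>A. pl k A X * pl k A Y)"
  using assms
proof (induction "\<Sum>X" arbitrary: X Y rule: less_induct)
  case less
  have X: "finite X" "card X = k" "X \<subseteq> {1..n}" and Y: "finite Y" "card Y = k" "Y \<subseteq> {1..n}"
    using less.prems finite_subset[of _ "{1..n}"] by (auto simp: pluecker_indices_def)
  show ?case
  proof (cases "tab_le k X Y")
    case True
    then show ?thesis using less.prems by (intro in_std_span_std) (auto simp: std_pairs_def)
  next
    case False
    then obtain r where r: "1 \<le> r" "r \<le> k" "enum Y r < enum X r" by (force simp: tab_le_def)
    let ?a = "enum X" and ?b = "enum Y"
    have a: "bij_betw ?a {1..k} X" and b: "bij_betw ?b {1..k} Y"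
      using enum_bij[OF X(1)] enum_bij[OF Y(1)] X(2) Y(2) by simp_all
    define tm where "tm \<sigma> A = of_int (sign \<sigma>) *
      (minor k A (upper_tuple r ?a ?b \<sigma>) * minor k A (lower_tuple r ?a ?b \<sigma>))" for \<sigma> A
    let ?G = "{\<sigma>. \<sigma> permutes slots k r}"
    define G1 where "G1 = {\<sigma>\<in>?G. \<sigma> ` Inr ` {r..k} = Inr ` {r..k}}"
    define G2 where "G2 = {\<sigma>\<in>?G. \<sigma> ` Inr ` {r..k} \<noteq> Inr ` {r..k}}"
    have fin: "finite ?G" by (rule finite_permutations[OF finite_slots])
    have un: "?G = G1 \<union> G2" "G1 \<inter> G2 = {}" "finite G1" "finite G2" using fin by (auto simp: G1_def G2_def)
    \<comment> \<open>The identity is stable, so the multiplicity of the product is nonzero and can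
      be divided out.\<close>
    have id: "id \<in> G1" by (simp add: G1_def permutes_id)
    then have N: "card G1 \<noteq> 0" using un(3) by auto
    have t1: "tm \<sigma> A = pl k A X * pl k A Y" if "\<sigma> \<in> G1" for \<sigma> A
      unfolding tm_def pl_def using that by (intro garnir_stable_term[OF r(1,2)]) (auto simp: G1_def)
    have t2: "in_std_span k n (tm \<sigma>)" if \<sigma>: "\<sigma> \<in> G2" for \<sigma>
    proof -
      let ?u = "upper_tuple r ?a ?b \<sigma>" and ?l = "lower_tuple r ?a ?b \<sigma>"
      have p: "\<sigma> permutes slots k r" "\<sigma> ` Inr ` {r..k} \<noteq> Inr ` {r..k}" using \<sigma> by (auto simp: G2_def)
      show ?thesis
      proof (cases "inj_on ?u {1..k} \<and> inj_on ?l {1..k}")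
        case False
        then have "minor k A ?u = 0 \<or> minor k A ?l = 0" for A using minor_not_inj by blast
        then have "tm \<sigma> = (\<lambda>_. 0)" by (auto simp: tm_def fun_eq_iff)
        then show ?thesis by (simp add: in_std_span_zero)
      next
        case True
        obtain e1 :: int where "\<forall>A. minor k A ?u = of_int e1 * pl k A (?u ` {1..k})"
          using minor_eq_pl[OF conjunct1[OF True]] by (rule exE)
        note 1 = this[rule_format]
        obtain e2 :: int where "\<forall>A. minor k A ?l = of_int e2 * pl k A (?l ` {1..k})"
          using minor_eq_pl[OF conjunct2[OF True]] by (rule exE)
        note 2 = this[rule_format]
        have "?a ` {1..k} \<subseteq> {1..n}" "?b ` {1..k} \<subseteq> {1..n}"
          using a b X Y by (auto simp: bij_betw_def)
        note rng = tuples_range[OF r(1,2) p(1) this]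
        have ind: "?u ` {1..k} \<in> pluecker_indices k n" "?l ` {1..k} \<in> pluecker_indices k n"
          using rng True by (auto simp: pluecker_indices_def card_image)
        have "(\<Sum>q\<in>{1..k}. ?u q) < (\<Sum>q\<in>{1..k}. ?a q)"
        proof (rule garnir_unstable_sum[OF r(1,2) p])
          show "?a r \<le> ?a q" if "r \<le> q" "q \<le> k" for q
            using enum_less[OF X(1), of r q] r that X(2) by (cases "r = q") auto
          show "?b q \<le> ?b r" if "1 \<le> q" "q \<le> r" for q
            using enum_less[OF Y(1), of q r] r that Y(2) by (cases "r = q") auto
        qed (rule r(3))
        moreover have "(\<Sum>q\<in>{1..k}. ?u q) = \<Sum>(?u ` {1..k})" using True by (simp add: sum.reindex)
        moreover have "(\<Sum>q\<in>{1..k}. ?a q) = \<Sum>X"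
          using sum.reindex_bij_betw[OF a, of "\<lambda>x. x"] by simp
        ultimately have "\<Sum>(?u ` {1..k}) < \<Sum>X" by simp
        from less.hyps[OF this ind]
        have "in_std_span k n (\<lambda>A. (of_int (sign \<sigma>) * of_int e1 * of_int e2) *
            (pl k A (?u ` {1..k}) * pl k A (?l ` {1..k})))" by (rule in_std_span_scale)
        moreover have "tm \<sigma> = (\<lambda>A. (of_int (sign \<sigma>) * of_int e1 * of_int e2) *
            (pl k A (?u ` {1..k}) * pl k A (?l ` {1..k})))"
          unfolding tm_def 1 2 by (simp only: mult_ac)
        ultimately show ?thesis by simp
      qed
    qed
    have "in_std_span k n (\<lambda>A. (- 1 / of_nat (card G1)) * (\<Sum>\<sigma>\<in>G2. tm \<sigma> A))"
      by (intro in_std_span_scale in_std_span_sum t2)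
    moreover have "pl k A X * pl k A Y = (- 1 / of_nat (card G1)) * (\<Sum>\<sigma>\<in>G2. tm \<sigma> A)" for A
    proof -
      have "0 = (\<Sum>\<sigma>\<in>?G. tm \<sigma> A)" unfolding tm_def using garnir[OF r(1,2)] by metis
      also have "\<dots> = (\<Sum>\<sigma>\<in>G1. tm \<sigma> A) + (\<Sum>\<sigma>\<in>G2. tm \<sigma> A)"
        unfolding un(1) by (rule sum.union_disjoint[OF un(3,4,2)])
      also have "(\<Sum>\<sigma>\<in>G1. tm \<sigma> A) = of_nat (card G1) * (pl k A X * pl k A Y)"
        using t1 by simp
      finally have "of_nat (card G1) * (pl k A X * pl k A Y) = - (\<Sum>\<sigma>\<in>G2. tm \<sigma> A)"
        by (metis add.commute add_eq_0_iff)
      then show ?thesis using N by (simp add: field_simps)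
    qed
    ultimately show ?thesis by simp
  qed
qed

section \<open>Exchange of spanning and independent families\<close>

text \<open>Steinitz exchange, carried out on formal linear forms in variables indexed by
  \<open>T\<close>: a relation among the forms evaluates to one among the functions
  \<open>E\<close>, so the forms are independent, and there are enough of them to span.\<close>

lemma independent_family_spans:
  fixes E :: "'s \<Rightarrow> 'x \<Rightarrow> complex" and B :: "'b \<Rightarrow> 'x \<Rightarrow> complex"
  assumes S: "finite S" and T: "finite T" and card: "card T \<le> card S"
    and ES: "\<And>s. s \<in> S \<Longrightarrow> \<exists>c. \<forall>x. E s x = (\<Sum>b\<in>T. c b * B b x)"
    and indep: "\<And>l. (\<forall>x. (\<Sum>s\<in>S. l s * E s x) = 0) \<Longrightarrow> \<forall>s\<in>S. l s = 0"
    and g: "\<exists>c. \<forall>x. g x = (\<Sum>b\<in>T. c b * B b x)"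
  obtains l where "\<And>x. g x = (\<Sum>s\<in>S. l s * E s x)"
proof -
  let ?sc = "\<lambda>c f. Const c * f :: ('b, complex) mpoly"
  interpret comm_ring_hom "Const :: complex \<Rightarrow> ('b, complex) mpoly" by (rule comm_ring_hom_Const)
  interpret vs: vector_space ?sc
    by unfold_locales (auto simp: hom_distribs algebra_simps Const_1)
  obtain c where c: "\<And>s x. s \<in> S \<Longrightarrow> E s x = (\<Sum>b\<in>T. c s b * B b x)" using ES by metis
  obtain d where d: "\<And>x. g x = (\<Sum>b\<in>T. d b * B b x)" using g by blast
  define V where "V s = (\<Sum>b\<in>T. Const (c s b) * Var b)" for s
  define G where "G = (\<Sum>b\<in>T. Const (d b) * Var b)"
  have ev: "eval_at (\<lambda>b. B b x) (\<Sum>b\<in>T. Const (e b) * Var b) = (\<Sum>b\<in>T. e b * B b x)" for e x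
    by (simp add: subst_sum[OF comm_ring_hom_id] subst_mult[OF comm_ring_hom_id] subst_Const subst_Var)
  have evV: "eval_at (\<lambda>b. B b x) (V s) = E s x" if "s \<in> S" for s x using c[OF that] by (simp add: V_def ev)
  have evG: "eval_at (\<lambda>b. B b x) G = g x" for x using d by (simp add: G_def ev)
  have comb: "eval_at (\<lambda>b. B b x) (\<Sum>s\<in>S. Const (l s) * V s) = (\<Sum>s\<in>S. l s * E s x)" for l x
    by (simp add: subst_sum[OF comm_ring_hom_id] subst_mult[OF comm_ring_hom_id] subst_Const evV)
  have V0: "l s = 0" if "(\<Sum>s\<in>S. Const (l s) * V s) = 0" "s \<in> S" for l s
  proof -
    have "(\<Sum>s\<in>S. l s * E s x) = 0" for x using comb[of x l] unfolding that(1) by simp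
    then show ?thesis using indep[of l] that(2) by blast
  qed
  have inj: "inj_on V S"
  proof (rule inj_onI, rule ccontr)
    fix s t assume st: "s \<in> S" "t \<in> S" "V s = V t" "s \<noteq> t"
    define l where "l u = (if u = s then 1 else if u = t then -1 else (0::complex))" for u
    have "(\<Sum>u\<in>S. Const (l u) * V u) = (\<Sum>u\<in>{s, t}. Const (l u) * V u)"
      by (rule sum.mono_neutral_right) (use S st in \<open>auto simp: l_def\<close>)
    also have "\<dots> = 0" using st by (simp add: l_def hom_uminus Const_1)
    finally have "l s = 0" using V0 st by blast
    then show False by (simp add: l_def)
  qed
  have ind: "vs.independent (V ` S)"
  proof
    assume "vs.dependent (V ` S)"
    then obtain u where u: "\<exists>v\<in>V ` S. u v \<noteq> 0" "(\<Sum>v\<in>V ` S. Const (u v) * v) = 0"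
      using vs.dependent_finite[OF finite_imageI[OF S]] by blast
    then have "(\<Sum>s\<in>S. Const (u (V s)) * V s) = 0" by (simp add: sum.reindex[OF inj])
    then have "\<forall>s\<in>S. u (V s) = 0" using V0[of "\<lambda>s. u (V s)"] by blast
    then show False using u(1) by blast
  qed
  have span: "(\<Sum>b\<in>T. Const (e b) * Var b) \<in> vs.span (Var ` T)" for e
    by (intro vs.span_sum vs.span_scale vs.span_base) auto
  have "G \<in> vs.span (V ` S)"
  proof (rule ccontr)
    assume G: "G \<notin> vs.span (V ` S)"
    then have "vs.independent (insert G (V ` S))" using ind by (simp add: vs.independent_insertI)
    moreover have "insert G (V ` S) \<subseteq> vs.span (Var ` T)" using span by (auto simp: V_def G_def)
    ultimately have "card (insert G (V ` S)) \<le> card (Var ` T :: ('b, complex) mpoly set)"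
      using vs.independent_span_bound[of "Var ` T"] T by auto
    also have "\<dots> \<le> card T" by (rule card_image_le[OF T])
    finally show False
      using G vs.span_base[of G] card_image[OF inj] S card by (auto simp: card_insert_if split: if_splits)
  qed
  then obtain u where "G = (\<Sum>v\<in>V ` S. Const (u v) * v)"
    unfolding vs.span_finite[OF finite_imageI[OF S]] by blast
  then have "G = (\<Sum>s\<in>S. Const (u (V s)) * V s)" by (simp add: sum.reindex[OF inj])
  then have "g x = (\<Sum>s\<in>S. u (V s) * E s x)" for x
    using evG[of x] comb[of x "\<lambda>s. u (V s)"] by simp
  then show ?thesis by (rule that)
qed

section \<open>Order ideals of \<open>Pk k n\<close>, Pluecker indices and leading terms of
  minors\<close>

section \<open>The poset of the Grassmannian\<close>

locale grassmann_poset =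
  fixes k n :: nat
begin

sublocale finite_poset "Pk k n" "Pk_less k n"
proof
  show "finite (Pk k n)" by (simp add: Pk_def)
  show "strict_order_on (Pk k n) (Pk_less k n)"
    unfolding strict_order_on_def
  proof (intro conjI)
    show "trans (Pk_less k n)"
      by (rule transI) (auto simp: Pk_less_def)
  qed (auto simp: Pk_less_def irrefl_def)
qed

lemma mx_decr:
  assumes J: "J \<in> ideals" and p: "(i, j) \<in> mx J" "(i', j') \<in> mx J" and "i < i'"
  shows "j' < j"
proof (rule ccontr)
  assume "\<not> ?thesis"
  moreover have "(i, j) \<in> Pk k n" "(i', j') \<in> Pk k n" using p mx_sub ideal_sub[OF J] by blast+
  ultimately have "((i, j), (i', j')) \<in> Pk_less k n" using \<open>i < i'\<close> by (auto simp: Pk_less_def)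
  then show False using p by (auto simp: max_elems_def)
qed

lemma mx_unique:
  assumes J: "J \<in> ideals" and p: "(i, j) \<in> mx J" "(i, j') \<in> mx J"
  shows "j = j'"
proof (rule ccontr)
  assume "j \<noteq> j'"
  moreover have "(i, j) \<in> Pk k n" "(i, j') \<in> Pk k n" using p mx_sub ideal_sub[OF J] by blast+
  ultimately have "((i, j), (i, j')) \<in> Pk_less k n \<or> ((i, j'), (i, j)) \<in> Pk_less k n"
    by (auto simp: Pk_less_def)
  then show False using p by (auto simp: max_elems_def)
qed

lemma mx_Pk: "J \<in> ideals \<Longrightarrow> (i, j) \<in> mx J \<Longrightarrow> 1 \<le> i \<and> i \<le> k \<and> k < j \<and> j \<le> n"
  using mx_sub ideal_sub by (fastforce simp: Pk_def)

lemma alpha_mx: "J \<in> ideals \<Longrightarrow> (i, j) \<in> mx J \<Longrightarrow> alpha k n J i = j"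
  unfolding alpha_def using mx_unique by (auto intro!: the_equality)

lemma alpha_not_mx: "(\<And>j. (i, j) \<notin> mx J) \<Longrightarrow> alpha k n J i = i"
  by (simp add: alpha_def)

definition rows :: "(nat \<times> nat) set \<Rightarrow> nat set" where
  "rows J = {i\<in>{1..k}. k < alpha k n J i}"

lemma mx_eq: "J \<in> ideals \<Longrightarrow> mx J = (\<lambda>i. (i, alpha k n J i)) ` rows J"
proof (intro equalityI subsetI)
  assume J: "J \<in> ideals"
  fix p assume p: "p \<in> mx J"
  then obtain i j where ij: "p = (i, j)" "(i, j) \<in> mx J" by (cases p) auto
  have "alpha k n J i = j" by (rule alpha_mx[OF J ij(2)])
  then show "p \<in> (\<lambda>i. (i, alpha k n J i)) ` rows J"
    using mx_Pk[OF J ij(2)] ij(1) by (auto simp: rows_def)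
next
  assume J: "J \<in> ideals"
  fix p assume "p \<in> (\<lambda>i. (i, alpha k n J i)) ` rows J"
  then obtain i where i: "i \<in> rows J" "p = (i, alpha k n J i)" by auto
  then have "alpha k n J i \<noteq> i" by (auto simp: rows_def)
  then obtain j where "(i, j) \<in> mx J" using alpha_not_mx by blast
  then show "p \<in> mx J" using alpha_mx[OF J] i by auto
qed

lemma alpha_not_row: "J \<in> ideals \<Longrightarrow> i \<in> {1..k} \<Longrightarrow> i \<notin> rows J \<Longrightarrow> alpha k n J i = i"
  using alpha_not_mx[of i J] mx_Pk alpha_mx unfolding rows_def by fastforce

lemma alpha_row: "J \<in> ideals \<Longrightarrow> i \<in> rows J \<Longrightarrow> k < alpha k n J i \<and> alpha k n J i \<le> n"
  using mx_Pk mx_eq by blast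

lemma alpha_decr: "J \<in> ideals \<Longrightarrow> i \<in> rows J \<Longrightarrow> i' \<in> rows J \<Longrightarrow> i < i' \<Longrightarrow> alpha k n J i' < alpha k n J i"
  using mx_decr mx_eq by blast

lemma rows_sub: "rows J \<subseteq> {1..k}"
  by (auto simp: rows_def)

lemma finite_rows: "finite (rows J)"
  by (simp add: rows_def)

lemma alpha_inj:
  assumes J: "J \<in> ideals"
  shows "inj_on (alpha k n J) {1..k}"
proof (rule linorder_inj_onI')
  fix i i' assume i: "i \<in> {1..k}" "i' \<in> {1..k}" "i < i'"
  show "alpha k n J i \<noteq> alpha k n J i'"
    using alpha_not_row[OF J i(1)] alpha_not_row[OF J i(2)] alpha_row[OF J, of i] alpha_row[OF J, of i']
      alpha_decr[OF J, of i i'] i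
    by (cases "i \<in> rows J"; cases "i' \<in> rows J") auto
qed

definition aset :: "(nat \<times> nat) set \<Rightarrow> nat set" where
  "aset J = alpha k n J ` {1..k}"

lemma aset_index:
  assumes "k \<le> n" "J \<in> ideals"
  shows "aset J \<in> pluecker_indices k n"
proof -
  have "alpha k n J i \<in> {1..n}" if "i \<in> {1..k}" for i
    using alpha_not_row[OF assms(2) that] alpha_row[OF assms(2), of i] that assms(1)
    by (cases "i \<in> rows J") auto
  then show ?thesis
    using card_image[OF alpha_inj[OF assms(2)]] by (auto simp: aset_def pluecker_indices_def)
qed

text \<open>A strictly decreasing bijection is determined by its domain and range, because it
  determines how many elements of the range are above each value.\<close>

lemma decreasing_bij_unique:
  fixes f g :: "nat \<Rightarrow> nat"
  assumes R: "finite R" and img: "f ` R = g ` R"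
    and f: "\<And>i j. i \<in> R \<Longrightarrow> j \<in> R \<Longrightarrow> i < j \<Longrightarrow> f j < f i"
    and g: "\<And>i j. i \<in> R \<Longrightarrow> j \<in> R \<Longrightarrow> i < j \<Longrightarrow> g j < g i" and i: "i \<in> R"
  shows "f i = g i"
proof -
  have cnt: "card {c\<in>h ` R. h i < c} = card {j\<in>R. j < i}"
    if h: "\<And>i j. i \<in> R \<Longrightarrow> j \<in> R \<Longrightarrow> i < j \<Longrightarrow> h j < h i" for h :: "nat \<Rightarrow> nat"
  proof -
    have iff: "h i < h j \<longleftrightarrow> j < i" if "j \<in> R" for j
      using h[OF i that] h[OF that i] by (cases i j rule: linorder_cases) auto
    have "{c\<in>h ` R. h i < c} = h ` {j\<in>R. j < i}" using iff by auto
    moreover have "inj_on h {j\<in>R. j < i}"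
    proof (rule linorder_inj_onI')
      fix a b assume "a \<in> {j\<in>R. j < i}" "b \<in> {j\<in>R. j < i}" "a < b"
      then show "h a \<noteq> h b" using h[of a b] by auto
    qed
    ultimately show ?thesis by (simp add: card_image)
  qed
  have eq: "card {c\<in>f ` R. f i < c} = card {c\<in>f ` R. g i < c}"
  proof -
    have "card {c\<in>f ` R. f i < c} = card {j\<in>R. j < i}" by (rule cnt[of f]) (rule f)
    moreover have "card {c\<in>g ` R. g i < c} = card {j\<in>R. j < i}" by (rule cnt[of g]) (rule g)
    ultimately show ?thesis unfolding img by simp
  qed
  have no: "\<not> x < y" if "x \<in> f ` R" "y \<in> f ` R" "card {c\<in>f ` R. x < c} = card {c\<in>f ` R. y < c}" for x y
  proof
    assume "x < y"
    then have "{c\<in>f ` R. y < c} \<subset> {c\<in>f ` R. x < c}" using that by auto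
    then have "card {c\<in>f ` R. y < c} < card {c\<in>f ` R. x < c}" using R by (intro psubset_card_mono) auto
    then show False using that by simp
  qed
  have "f i \<in> f ` R" "g i \<in> f ` R" using i img by auto
  then show ?thesis using no[of "f i" "g i"] no[of "g i" "f i"] eq by auto
qed

text \<open>The entries up to \<open>k\<close> determine which rows are moved; the larger entries
  are assigned to those rows in decreasing order. Together they recover the maximal elements and
  thus the ideal.\<close>

lemma aset_inj: "inj_on aset ideals"
proof (rule inj_onI)
  fix J K assume J: "J \<in> ideals" and K: "K \<in> ideals" and eq: "aset J = aset K"
  have small: "aset J \<inter> {1..k} = {1..k} - rows J" if J: "J \<in> ideals" for J
  proof (intro equalityI subsetI)
    fix x assume "x \<in> aset J \<inter> {1..k}"
    then obtain i where i: "i \<in> {1..k}" "x = alpha k n J i" "x \<le> k" by (auto simp: aset_def)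
    then have "i \<notin> rows J" using alpha_row[OF J, of i] by auto
    then show "x \<in> {1..k} - rows J" using alpha_not_row[OF J i(1)] i by simp
  next
    fix x assume x: "x \<in> {1..k} - rows J"
    then have "alpha k n J x = x" using alpha_not_row[OF J, of x] by simp
    then show "x \<in> aset J \<inter> {1..k}" using x unfolding aset_def by (metis DiffD1 IntI imageI)
  qed
  have big: "aset J - {1..k} = alpha k n J ` rows J" if J: "J \<in> ideals" for J
  proof (intro equalityI subsetI)
    fix x assume x: "x \<in> aset J - {1..k}"
    then obtain i where i: "i \<in> {1..k}" "x = alpha k n J i" by (auto simp: aset_def)
    then have "i \<in> rows J" using alpha_not_row[OF J i(1)] x by (metis DiffD2)
    then show "x \<in> alpha k n J ` rows J" using i by blast
  next
    fix x assume "x \<in> alpha k n J ` rows J"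
    then obtain i where i: "i \<in> rows J" "x = alpha k n J i" by blast
    then show "x \<in> aset J - {1..k}" using alpha_row[OF J i(1)] rows_sub[of J] unfolding aset_def by auto
  qed
  have R: "rows J = rows K" using small[OF J] small[OF K] eq rows_sub by blast
  have "alpha k n J ` rows J = alpha k n K ` rows J" using big[OF J] big[OF K] eq R by simp
  then have "alpha k n J i = alpha k n K i" if "i \<in> rows J" for i
    by (rule decreasing_bij_unique[OF finite_rows _ _ _ that])
      (use alpha_decr[OF J] alpha_decr[OF K] R in auto)
  then have "(\<lambda>i. (i, alpha k n J i)) ` rows J = (\<lambda>i. (i, alpha k n K i)) ` rows J"
    by (intro image_cong refl) simp
  then have "mx J = mx K" unfolding mx_eq[OF J] mx_eq[OF K] R .
  then show "J = K" using generated_mx[OF J] generated_mx[OF K] by metis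
qed

lemma enum_gap: "finite X \<Longrightarrow> 1 \<le> p \<Longrightarrow> p \<le> q \<Longrightarrow> q \<le> card X \<Longrightarrow> enum X p + (q - p) \<le> enum X q"
proof (induction "q - p" arbitrary: q)
  case (Suc d)
  then have "enum X p + (q - 1 - p) \<le> enum X (q - 1)" by (intro Suc.hyps) auto
  moreover have "enum X (q - 1) < enum X q" using Suc by (intro enum_less) auto
  ultimately show ?case using Suc by linarith
qed simp

lemma pluecker_finite: "X \<in> pluecker_indices k n \<Longrightarrow> finite X \<and> card X = k \<and> X \<subseteq> {1..n}"
  using finite_subset[of X "{1..n}"] by (auto simp: pluecker_indices_def)

lemma enum_bounds:
  assumes X: "X \<in> pluecker_indices k n" and q: "1 \<le> q" "q \<le> k"
  shows "q \<le> enum X q" "enum X q + (k - q) \<le> n"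
proof -
  have fX: "finite X" "card X = k" "X \<subseteq> {1..n}" using pluecker_finite[OF X] by auto
  then have "enum X ` {1..k} = X" using enum_bij[of X] by (auto simp: bij_betw_def)
  moreover have "1 \<in> {1..k}" "k \<in> {1..k}" using q by auto
  ultimately have "enum X 1 \<in> {1..n}" "enum X k \<in> {1..n}" using fX(3) by blast+
  then have "1 \<le> enum X 1" "enum X k \<le> n" by auto
  then show "q \<le> enum X q" "enum X q + (k - q) \<le> n"
    using enum_gap[of X 1 q] enum_gap[of X q k] fX q by auto
qed

text \<open>The lattice path of a subset: row \<open>i\<close> contains \<open>enum X q - q\<close> boxes, where \<open>q = k + 1 - i\<close>.\<close>

definition tab_ideal :: "nat set \<Rightarrow> (nat \<times> nat) set" where
  "tab_ideal X = {(i, j) \<in> Pk k n. j + (k + 1 - i) \<le> k + enum X (k + 1 - i)}"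

lemma tab_ideal_in: 
  assumes X: "X \<in> pluecker_indices k n"
  shows "tab_ideal X \<in> ideals"
proof -
  have fX: "finite X" "card X = k" using pluecker_finite[OF X] by auto
  have "(i', j') \<in> tab_ideal X" if ij: "(i, j) \<in> tab_ideal X" and l: "((i', j'), (i, j)) \<in> Pk_less k n" for i j i' j'
  proof -
    have b: "1 \<le> i'" "i' \<le> i" "i \<le> k" "j' \<le> j" "(i', j') \<in> Pk k n" using l by (auto simp: Pk_less_def Pk_def)
    then have "enum X (k + 1 - i) + ((k + 1 - i') - (k + 1 - i)) \<le> enum X (k + 1 - i')"
      using fX by (intro enum_gap) auto
    then show ?thesis using ij b by (auto simp: tab_ideal_def)
  qed
  moreover have "tab_ideal X \<subseteq> Pk k n" by (auto simp: tab_ideal_def)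
  ultimately show ?thesis unfolding order_ideals_def by (clarify) blast
qed

lemma tab_ideal_mono: "tab_le k X Y \<Longrightarrow> tab_ideal X \<subseteq> tab_ideal Y"
proof (rule subsetI)
  fix p assume le: "tab_le k X Y" and p: "p \<in> tab_ideal X"
  obtain i j where ij: "p = (i, j)" by (cases p)
  have "k + 1 - i \<in> {1..k}" using p by (auto simp: ij tab_ideal_def Pk_def)
  then have "enum X (k + 1 - i) \<le> enum Y (k + 1 - i)" using le by (auto simp: tab_le_def)
  then show "p \<in> tab_ideal Y" using p by (auto simp: ij tab_ideal_def)
qed

lemma tab_ideal_sub_imp:
  assumes X: "X \<in> pluecker_indices k n" and Y: "Y \<in> pluecker_indices k n"
    and sub: "tab_ideal X \<subseteq> tab_ideal Y" and q: "1 \<le> q" "q \<le> k"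
  shows "enum X q \<le> enum Y q"
proof (rule ccontr)
  assume "\<not> ?thesis"
  then have lt: "enum Y q < enum X q" by simp
  \<comment> \<open>The last box of the row belonging to position \<open>q\<close> in the path of
    \<open>X\<close>; the shorter row of \<open>Y\<close> misses it.\<close>
  define i j where "i = k + 1 - q" and "j = k + enum X q - q"
  have b: "q \<le> enum Y q" "q \<le> enum X q" "enum X q + (k - q) \<le> n"
    using enum_bounds[OF Y q] enum_bounds[OF X q] by auto
  then have "(i, j) \<in> Pk k n" using q lt by (auto simp: i_def j_def Pk_def)
  moreover have "k + 1 - i = q" using q by (simp add: i_def)
  ultimately have "(i, j) \<in> tab_ideal X" "(i, j) \<notin> tab_ideal Y" using lt b by (auto simp: tab_ideal_def j_def)
  with sub show False by blast
qed

lemma tab_ideal_inj: "inj_on tab_ideal (pluecker_indices k n)"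
proof (rule inj_onI)
  fix X Y assume X: "X \<in> pluecker_indices k n" and Y: "Y \<in> pluecker_indices k n" and eq: "tab_ideal X = tab_ideal Y"
  have "enum X q = enum Y q" if "q \<in> {1..k}" for q
    using tab_ideal_sub_imp[OF X Y, of q] tab_ideal_sub_imp[OF Y X, of q] eq that by auto
  then have "enum X ` {1..k} = enum Y ` {1..k}" by auto
  moreover have "enum X ` {1..k} = X" "enum Y ` {1..k} = Y"
    using enum_bij[of X] enum_bij[of Y] pluecker_finite[OF X] pluecker_finite[OF Y] by (auto simp: bij_betw_def)
  ultimately show "X = Y" by simp
qed

text \<open>Surjectivity by counting: the lattice-path labelling injects the Pluecker indices into
  the order ideals.\<close>

lemma aset_bij:
  assumes "k \<le> n"
  shows "bij_betw aset ideals (pluecker_indices k n)"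
proof -
  have sub: "aset ` ideals \<subseteq> pluecker_indices k n" using aset_index[OF assms] by auto
  have "card (pluecker_indices k n) \<le> card ideals"
    by (rule card_inj_on_le[OF tab_ideal_inj _ finite_ideals]) (auto simp: tab_ideal_in)
  also have "\<dots> = card (aset ` ideals)" by (simp add: card_image[OF aset_inj])
  finally have "aset ` ideals = pluecker_indices k n"
    using card_seteq[OF finite_pluecker_indices sub] by simp
  with aset_inj show ?thesis by (simp add: bij_betw_def)
qed

definition ideal_pairs :: "((nat \<times> nat) set \<times> (nat \<times> nat) set) set" where
  "ideal_pairs = {(J, K). J \<in> ideals \<and> K \<in> ideals \<and> J \<subseteq> K}"

lemma finite_ideal_pairs: "finite ideal_pairs"
  by (rule finite_subset[of _ "ideals \<times> ideals"]) (auto simp: ideal_pairs_def finite_ideals)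

text \<open>Unlike \<open>aset\<close>, the lattice-path labelling turns the tableau order into
  inclusion. This count is the only link needed between tableaux and pairs of nested ideals.\<close>

lemma card_std_pairs_le: "card (std_pairs k n) \<le> card ideal_pairs"
proof (rule card_inj_on_le[OF _ _ finite_ideal_pairs])
  show "inj_on (map_prod tab_ideal tab_ideal) (std_pairs k n)"
    by (rule inj_on_subset[OF map_prod_inj_on[OF tab_ideal_inj tab_ideal_inj]]) (auto simp: std_pairs_def)
  show "map_prod tab_ideal tab_ideal ` std_pairs k n \<subseteq> ideal_pairs"
    using tab_ideal_in tab_ideal_mono by (auto simp: std_pairs_def ideal_pairs_def)
qed

section \<open>Antidiagonal initial terms\<close>

lemma base_expansion_bound:
  fixes a :: "nat \<Rightarrow> nat"
  assumes "finite R" "\<And>i. i \<in> R \<Longrightarrow> a i \<le> b"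
  shows "(\<Sum>i\<in>{i\<in>R. i < m}. (b + 1) ^ i * a i) < (b + 1) ^ m"
proof -
  have "(\<Sum>i\<in>{i\<in>R. i < m}. (b + 1) ^ i * a i) \<le> (\<Sum>i\<in>{i\<in>R. i < m}. (b + 1) ^ i * b)"
    using assms by (intro sum_mono mult_left_mono) auto
  also have "\<dots> \<le> (\<Sum>i<m. (b + 1) ^ i * b)"
    by (rule sum_mono2) auto
  also have "\<dots> < (b + 1) ^ m"
    by (induction m) (auto simp: algebra_simps)
  finally show ?thesis .
qed

text \<open>The base exceeds all entries, so the largest index moved by \<open>\<pi>\<close> decides the comparison.\<close>

lemma rearrangement:
  fixes a :: "nat \<Rightarrow> nat"
  assumes R: "finite R" and a: "\<And>i j. i \<in> R \<Longrightarrow> j \<in> R \<Longrightarrow> i < j \<Longrightarrow> a j < a i"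
    and b: "\<And>i. i \<in> R \<Longrightarrow> a i \<le> b" and \<pi>: "\<pi> permutes R" "\<pi> \<noteq> id"
  shows "(\<Sum>i\<in>R. (b + 1) ^ i * a i) < (\<Sum>i\<in>R. (b + 1) ^ \<pi> i * a i)"
proof -
  define \<tau> where "\<tau> = Hilbert_Choice.inv \<pi>"
  have \<tau>: "\<tau> permutes R" unfolding \<tau>_def by (rule permutes_inv[OF \<pi>(1)])
  have \<tau>R: "\<tau> i \<in> R" if "i \<in> R" for i using permutes_in_image[OF \<tau>] that by simp
  have "(\<Sum>i\<in>R. (b + 1) ^ \<pi> i * a i) = (\<Sum>i\<in>R. (b + 1) ^ \<pi> (\<tau> i) * a (\<tau> i))"
    using sum.permute[OF \<tau>, of "\<lambda>i. (b + 1) ^ \<pi> i * a i"] by (simp add: o_def)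
  then have re: "(\<Sum>i\<in>R. (b + 1) ^ \<pi> i * a i) = (\<Sum>i\<in>R. (b + 1) ^ i * a (\<tau> i))"
    unfolding \<tau>_def using permutes_inverses(1)[OF \<pi>(1)] by simp
  define D where "D = {i\<in>R. \<tau> i \<noteq> i}"
  have "D \<noteq> {}"
  proof
    assume "D = {}"
    then have "\<tau> i = i" for i using permutes_not_in[OF \<tau>] by (cases "i \<in> R") (auto simp: D_def)
    then have "\<tau> = id" by auto
    then show False using \<pi> permutes_inv_inv[OF \<pi>(1)] inv_id unfolding \<tau>_def by metis
  qed
  moreover have finD: "finite D" using R by (simp add: D_def)
  ultimately have m: "Max D \<in> D" by (rule Max_in[rotated])
  define m where "m = Max D"
  have mD: "m \<in> R" "\<tau> m \<noteq> m" using m by (auto simp: D_def m_def)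
  have fixed: "\<tau> i = i" if "i \<in> R" "m < i" for i
  proof (rule ccontr)
    assume "\<tau> i \<noteq> i"
    then have "i \<le> m" unfolding m_def using that finD by (intro Max_ge) (auto simp: D_def)
    with that show False by simp
  qed
  have "\<tau> m < m"
  proof (rule ccontr)
    assume "\<not> ?thesis"
    then have "m < \<tau> m" using mD by simp
    then have "\<tau> (\<tau> m) = \<tau> m" using fixed \<tau>R mD by blast
    then show False using permutes_inj[OF \<tau>] mD by (metis injD)
  qed
  then have am: "a m + 1 \<le> a (\<tau> m)" using a[OF \<tau>R[OF mD(1)] mD(1)] by simp
  have split: "(\<Sum>i\<in>R. g i) = (\<Sum>i\<in>{i\<in>R. i < m}. g i) + (g m + (\<Sum>i\<in>{i\<in>R. m < i}. g i))" for g :: "nat \<Rightarrow> nat"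
  proof -
    have eq: "R = {i\<in>R. i < m} \<union> insert m {i\<in>R. m < i}" using mD by auto
    have "sum g ({i\<in>R. i < m} \<union> insert m {i\<in>R. m < i}) = (\<Sum>i\<in>{i\<in>R. i < m}. g i) + (\<Sum>i\<in>insert m {i\<in>R. m < i}. g i)"
    proof (rule sum.union_disjoint)
      show "finite {i\<in>R. i < m}" "finite (insert m {i\<in>R. m < i})" using R by simp_all
      show "{i\<in>R. i < m} \<inter> insert m {i\<in>R. m < i} = {}"
        unfolding disjoint_iff by simp
    qed
    then have "(\<Sum>i\<in>R. g i) = (\<Sum>i\<in>{i\<in>R. i < m}. g i) + (\<Sum>i\<in>insert m {i\<in>R. m < i}. g i)"
      unfolding eq[symmetric] .
    also have "(\<Sum>i\<in>insert m {i\<in>R. m < i}. g i) = g m + (\<Sum>i\<in>{i\<in>R. m < i}. g i)"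
      using R by simp
    finally show ?thesis .
  qed
  have "(\<Sum>i\<in>R. (b + 1) ^ i * a i) <
      (b + 1) ^ m + ((b + 1) ^ m * a m + (\<Sum>i\<in>{i\<in>R. m < i}. (b + 1) ^ i * a i))"
    unfolding split[of "\<lambda>i. (b + 1) ^ i * a i"] using base_expansion_bound[OF R b, where m = m] by simp
  also have "\<dots> = (b + 1) ^ m * (a m + 1) + (\<Sum>i\<in>{i\<in>R. m < i}. (b + 1) ^ i * a (\<tau> i))"
    using fixed by (simp add: distrib_left)
  also have "\<dots> \<le> (b + 1) ^ m * a (\<tau> m) + (\<Sum>i\<in>{i\<in>R. m < i}. (b + 1) ^ i * a (\<tau> i))"
    using am by (intro add_mono mult_left_mono) auto
  also have "\<dots> \<le> (\<Sum>i\<in>R. (b + 1) ^ i * a (\<tau> i))"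
    unfolding split[of "\<lambda>i. (b + 1) ^ i * a (\<tau> i)"] by simp
  finally show ?thesis unfolding re .
qed

text \<open>The matrix entry (i, c) gets weight \<open>(n + 1) ^ i * c\<close>, and the term of the
  minor that pairs each moved row with its own column is weighed. The base exceeds every column
  index. As a sum over maximal elements it is modular for union and star.\<close>

definition W0 :: "(nat \<times> nat) set \<Rightarrow> nat" where
  "W0 J = (\<Sum>p\<in>mx J. (n + 1) ^ fst p * snd p)"

definition phat :: "(nat \<Rightarrow> nat \<Rightarrow> complex) \<Rightarrow> (nat \<times> nat) set \<Rightarrow> complex" where
  "phat A J = minor k A (alpha k n J)"

lemma sum_mx_rows: "J \<in> ideals \<Longrightarrow> sum g (mx J) = (\<Sum>i\<in>rows J. g (i, alpha k n J i))"
  unfolding mx_eq by (subst sum.reindex) (auto simp: inj_on_def)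

lemma prod_mx_rows: "J \<in> ideals \<Longrightarrow> prod g (mx J) = (\<Prod>i\<in>rows J. g (i, alpha k n J i))"
  unfolding mx_eq by (subst prod.reindex) (auto simp: inj_on_def)

text \<open>The matrix has an identity block in the first \<open>k\<close> columns and entries
  scaled by powers of \<tau> in the others. Among the permutations that contribute, the identity has
  strictly least exponent, so its product is the lowest-order coefficient.\<close>

lemma phat_leading:
  assumes J: "J \<in> ideals"
  shows "\<exists>g. poly g 0 = (\<Prod>p\<in>mx J. y p) \<and>
    (\<forall>\<tau>. phat (\<lambda>i c. if c \<le> k then (if i = c then 1 else 0) else \<tau> ^ ((n + 1) ^ i * c) * y (i, c)) J
      = \<tau> ^ W0 J * poly g \<tau>)"
proof -
  let ?R = "rows J" and ?a = "alpha k n J"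
  let ?A = "\<lambda>\<tau> i c. if c \<le> k then (if i = c then 1 else 0) else \<tau> ^ ((n + 1) ^ i * c) * y (i, c) :: complex"
  define e where "e \<pi> = (\<Sum>q\<in>?R. (n + 1) ^ \<pi> q * ?a q)" for \<pi> :: "nat \<Rightarrow> nat"
  define Y where "Y \<pi> = (\<Prod>q\<in>?R. y (\<pi> q, ?a q))" for \<pi>
  have W0: "W0 J = e id" by (simp add: W0_def e_def sum_mx_rows[OF J])
  have less: "e id < e \<pi>" if "\<pi> permutes ?R" "\<pi> \<noteq> id" for \<pi>
    unfolding e_def id_apply
    by (rule rearrangement[OF finite_rows _ _ that]) (use alpha_decr[OF J] alpha_row[OF J] in auto)
  then have le: "e id \<le> e \<pi>" if "\<pi> permutes ?R" for \<pi> using that by (cases "\<pi> = id") (auto intro: less_imp_le)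
  have fin: "finite {\<pi>. \<pi> permutes ?R}" by (rule finite_permutations[OF finite_rows])
  define g where "g = (\<Sum>\<pi> | \<pi> permutes ?R. monom (of_int (sign \<pi>) * Y \<pi>) (e \<pi> - e id))"
  have "phat (?A \<tau>) J = \<tau> ^ W0 J * poly g \<tau>" for \<tau>
  proof -
    have T: "(\<Prod>j\<in>{1..k}. ?A \<tau> (\<pi> j) (?a j)) = \<tau> ^ e \<pi> * Y \<pi>" if \<pi>: "\<pi> permutes ?R" for \<pi>
    proof -
      have "(\<Prod>j\<in>{1..k}. ?A \<tau> (\<pi> j) (?a j)) = (\<Prod>j\<in>{1..k} - ?R. ?A \<tau> (\<pi> j) (?a j)) * (\<Prod>j\<in>?R. ?A \<tau> (\<pi> j) (?a j))"
        by (rule prod.subset_diff[OF rows_sub]) simp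
      also have "(\<Prod>j\<in>{1..k} - ?R. ?A \<tau> (\<pi> j) (?a j)) = 1"
        using alpha_not_row[OF J] permutes_not_in[OF \<pi>] by (intro prod.neutral) auto
      also have "(\<Prod>j\<in>?R. ?A \<tau> (\<pi> j) (?a j)) = (\<Prod>j\<in>?R. \<tau> ^ ((n + 1) ^ \<pi> j * ?a j) * y (\<pi> j, ?a j))"
      proof (rule prod.cong[OF refl])
        fix j assume "j \<in> ?R"
        then have "\<not> ?a j \<le> k" using alpha_row[OF J, of j] by simp
        then show "?A \<tau> (\<pi> j) (?a j) = \<tau> ^ ((n + 1) ^ \<pi> j * ?a j) * y (\<pi> j, ?a j)" by simp
      qed
      also have "\<dots> = \<tau> ^ e \<pi> * Y \<pi>" by (simp add: prod.distrib e_def Y_def power_sum)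
      finally show ?thesis by simp
    qed
    \<comment> \<open>A row outside \<open>rows J\<close> labels a unit column, so a permutation
      moving it picks an entry 0.\<close>
    have Z: "(\<Prod>j\<in>{1..k}. ?A \<tau> (\<pi> j) (?a j)) = 0" if \<pi>: "\<pi> permutes {1..k}" "\<not> \<pi> permutes ?R" for \<pi>
    proof -
      obtain j where j: "j \<in> {1..k} - ?R" "\<pi> j \<noteq> j" using permutes_superset[OF \<pi>(1)] \<pi>(2) by blast
      then have "?A \<tau> (\<pi> j) (?a j) = 0" using alpha_not_row[OF J, of j] by auto
      moreover have "j \<in> {1..k}" using j by blast
      ultimately show ?thesis by (intro prod_zero bexI[of _ j]) simp_all
    qed
    have "phat (?A \<tau>) J = (\<Sum>\<pi> | \<pi> permutes {1..k}. of_int (sign \<pi>) * (\<Prod>j\<in>{1..k}. ?A \<tau> (\<pi> j) (?a j)))"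
      unfolding phat_def ldet_def ..
    also have "\<dots> = (\<Sum>\<pi> | \<pi> permutes ?R. of_int (sign \<pi>) * (\<Prod>j\<in>{1..k}. ?A \<tau> (\<pi> j) (?a j)))"
    proof (rule sum.mono_neutral_right)
      show "finite {\<pi>. \<pi> permutes {1..k}}" by (rule finite_permutations) simp
      show "{\<pi>. \<pi> permutes ?R} \<subseteq> {\<pi>. \<pi> permutes {1..k}}" using permutes_subset[OF _ rows_sub] by blast
    qed (use Z in auto)
    also have "\<dots> = (\<Sum>\<pi> | \<pi> permutes ?R. of_int (sign \<pi>) * (\<tau> ^ e \<pi> * Y \<pi>))"
      by (intro sum.cong refl arg_cong2[of _ _ _ _ "(*)"] T) simp
    also have "\<dots> = (\<Sum>\<pi> | \<pi> permutes ?R. \<tau> ^ e id * (of_int (sign \<pi>) * Y \<pi> * \<tau> ^ (e \<pi> - e id)))"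
    proof (rule sum.cong[OF refl])
      fix \<pi> assume "\<pi> \<in> {\<pi>. \<pi> permutes ?R}"
      then have "\<tau> ^ e \<pi> = \<tau> ^ e id * \<tau> ^ (e \<pi> - e id)" using le by (simp flip: power_add)
      then show "of_int (sign \<pi>) * (\<tau> ^ e \<pi> * Y \<pi>) = \<tau> ^ e id * (of_int (sign \<pi>) * Y \<pi> * \<tau> ^ (e \<pi> - e id))"
        by (simp only: mult_ac)
    qed
    also have "\<dots> = \<tau> ^ W0 J * poly g \<tau>"
      unfolding W0 g_def poly_sum poly_monom sum_distrib_left ..
    finally show ?thesis .
  qed
  moreover have "poly g 0 = (\<Prod>p\<in>mx J. y p)"
  proof -
    have "poly g 0 = (\<Sum>\<pi> | \<pi> permutes ?R. if \<pi> = id then Y id else 0)"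
      unfolding g_def poly_sum poly_monom
    proof (rule sum.cong[OF refl])
      fix \<pi> assume "\<pi> \<in> {\<pi>. \<pi> permutes ?R}"
      then show "of_int (sign \<pi>) * Y \<pi> * 0 ^ (e \<pi> - e id) = (if \<pi> = id then Y id else 0)"
        using less[of \<pi>] by (auto simp: power_0_left)
    qed
    also have "\<dots> = Y id" using fin by (simp add: sum.delta permutes_id)
    finally show ?thesis by (simp add: Y_def prod_mx_rows[OF J])
  qed
  ultimately show ?thesis by blast
qed

definition gr_points :: "((nat \<times> nat) set \<Rightarrow> complex) set" where
  "gr_points = {(\<lambda>J. if J \<in> ideals then c * phat A J else 0) | c A. True}"

text \<open>Along the curve of matrices of \<open>phat_leading\<close>, the lowest-order coefficient
  of \<open>f\<close> is its initial form at the point of the torus parametrization given by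
  \<open>z\<close>. Since \<open>f\<close> vanishes on the curve, so does this coefficient, for
  every \<open>z\<close>.\<close>

lemma initial_form_gr_kernel:
  assumes f: "f \<in> van ideals gr_points"
  shows "relative_hibi_map (Pk_less k n) (initial_form (\<lambda>J. real (W0 J)) f) = 0"
proof (rule eval_all_0_imp_0)
  fix z :: "(nat \<times> nat) option \<Rightarrow> complex"
  let ?y = "\<lambda>p. z (Some p)" and ?c = "z None" and ?w = "\<lambda>J. real (W0 J)"
  let ?A = "\<lambda>\<tau> i c. if c \<le> k then (if i = c then 1 else 0) else \<tau> ^ ((n + 1) ^ i * c) * ?y (i, c) :: complex"
  have fI: "f \<in> mpolys ideals" using f by (simp add: van_iff)
  have "\<forall>J\<in>ideals. \<exists>g. poly g 0 = (\<Prod>p\<in>mx J. ?y p) \<and> (\<forall>\<tau>. phat (?A \<tau>) J = \<tau> ^ W0 J * poly g \<tau>)"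
    using phat_leading[of _ ?y] by blast
  then obtain g where g': "\<forall>J\<in>ideals. poly (g J) 0 = (\<Prod>p\<in>mx J. ?y p) \<and> (\<forall>\<tau>. phat (?A \<tau>) J = \<tau> ^ W0 J * poly (g J) \<tau>)"
    by (rule bchoice[THEN exE])
  have g: "poly (g J) 0 = (\<Prod>p\<in>mx J. ?y p)" "phat (?A \<tau>) J = \<tau> ^ W0 J * poly (g J) \<tau>" if "J \<in> ideals" for J \<tau>
    using g' that by blast+
  define W where "W m = (\<Sum>J\<in>Poly_Mapping.keys m. W0 J * Poly_Mapping.lookup m J)" for m
  have W: "wt ?w m = real (W m)" for m by (simp add: monomial_weight_def W_def)
  \<comment> \<open>The lowest order in \<tau>; for \<open>f = 0\<close> there is no minimum and 0
    serves as a default.\<close>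
  define a where "a = (if f = 0 then 0 else Min (W ` Poly_Mapping.keys f))"
  have a: "a \<le> W m" if "m \<in> Poly_Mapping.keys f" for m using that by (auto simp: a_def)
  have am: "a = W m \<longleftrightarrow> (\<forall>m'\<in>Poly_Mapping.keys f. wt ?w m \<le> wt ?w m')" if m: "m \<in> Poly_Mapping.keys f" for m
  proof
    assume "a = W m"
    then show "\<forall>m'\<in>Poly_Mapping.keys f. wt ?w m \<le> wt ?w m'" using a by (simp add: W)
  next
    assume *: "\<forall>m'\<in>Poly_Mapping.keys f. wt ?w m \<le> wt ?w m'"
    have "a \<in> W ` Poly_Mapping.keys f" using m unfolding a_def by (auto intro!: Min_in)
    then show "a = W m" using * a[OF m] by (auto simp: W)
  qed
  \<comment> \<open>The value of \<open>f\<close> along the curve with the factor of lowest order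
    divided out, as a polynomial in \<tau>; its value at 0 is the coefficient sought.\<close>
  define Q where "Q = (\<Sum>m\<in>Poly_Mapping.keys f. monom (Poly_Mapping.lookup f m) (W m - a) * mono_eval (\<lambda>J. Polynomial.smult ?c (g J)) m)"
  have mev: "poly (mono_eval (\<lambda>J. Polynomial.smult ?c (g J)) m) \<tau> = mono_eval (\<lambda>J. ?c * poly (g J) \<tau>) m" for m \<tau>
    using hom_mono_eval[OF comm_ring_hom_poly[of \<tau>], of "\<lambda>J. Polynomial.smult ?c (g J)" m] by simp
  have "poly (monom 1 a * Q) \<tau> = 0" for \<tau>
  proof -
    let ?x = "\<lambda>J. if J \<in> ideals then ?c * phat (?A \<tau>) J else 0"
    have x: "mono_eval ?x m = \<tau> ^ W m * mono_eval (\<lambda>J. ?c * poly (g J) \<tau>) m" if "m \<in> Poly_Mapping.keys f" for m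
    proof -
      have "Poly_Mapping.keys m \<subseteq> ideals" using that fI by (auto simp: mpolys_iff)
      then have "mono_eval ?x m = mono_eval (\<lambda>J. \<tau> ^ W0 J * (?c * poly (g J) \<tau>)) m"
        by (intro mono_eval_cong) (auto simp: g(2))
      also have "\<dots> = mono_eval (\<lambda>J. \<tau> ^ W0 J) m * mono_eval (\<lambda>J. ?c * poly (g J) \<tau>) m"
        by (rule mono_eval_scale)
      also have "mono_eval (\<lambda>J. \<tau> ^ W0 J) m = \<tau> ^ W m"
        by (simp add: mono_eval_def W_def power_sum flip: power_mult)
      finally show ?thesis .
    qed
    have "?x \<in> gr_points" unfolding gr_points_def by blast
    then have "0 = eval_at ?x f" using f by (simp add: van_iff)
    also have "\<dots> = (\<Sum>m\<in>Poly_Mapping.keys f. Poly_Mapping.lookup f m * (\<tau> ^ W m * mono_eval (\<lambda>J. ?c * poly (g J) \<tau>) m))"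
      unfolding subst_def' by (intro sum.cong refl) (simp add: x)
    also have "\<dots> = poly (monom 1 a * Q) \<tau>"
      unfolding Q_def poly_mult poly_sum poly_monom mev sum_distrib_left
    proof (rule sum.cong[OF refl])
      fix m assume "m \<in> Poly_Mapping.keys f"
      then have "\<tau> ^ W m = \<tau> ^ a * \<tau> ^ (W m - a)" using a by (simp flip: power_add)
      then show "Poly_Mapping.lookup f m * (\<tau> ^ W m * mono_eval (\<lambda>J. ?c * poly (g J) \<tau>) m)
        = 1 * \<tau> ^ a * (Poly_Mapping.lookup f m * \<tau> ^ (W m - a) * mono_eval (\<lambda>J. ?c * poly (g J) \<tau>) m)"
        by (simp only: mult_ac mult_1)
    qed
    finally show ?thesis by simp
  qed
  then have "monom 1 a * Q = 0" using poly_all_0_iff_0 by blast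
  then have "Q = 0" by (simp add: monom_eq_0_iff)
  then have "0 = poly Q 0" by simp
  also have "\<dots> = (\<Sum>m\<in>Poly_Mapping.keys f. Poly_Mapping.lookup (initial_form ?w f) m * mono_eval (\<lambda>J. ?c * (\<Prod>p\<in>mx J. ?y p)) m)"
    unfolding Q_def poly_sum poly_mult poly_monom mev
  proof (rule sum.cong[OF refl])
    fix m assume m: "m \<in> Poly_Mapping.keys f"
    then have "Poly_Mapping.keys m \<subseteq> ideals" using fI by (auto simp: mpolys_iff)
    then have "mono_eval (\<lambda>J. ?c * poly (g J) 0) m = mono_eval (\<lambda>J. ?c * (\<Prod>p\<in>mx J. ?y p)) m"
      by (intro mono_eval_cong) (auto simp: g(1))
    moreover have "W m - a = 0 \<longleftrightarrow> a = W m" using a[OF m] by auto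
    ultimately show "Poly_Mapping.lookup f m * 0 ^ (W m - a) * mono_eval (\<lambda>J. ?c * poly (g J) 0) m
      = Poly_Mapping.lookup (initial_form ?w f) m * mono_eval (\<lambda>J. ?c * (\<Prod>p\<in>mx J. ?y p)) m"
      using am[OF m] by (simp add: lookup_initial_form power_0_left)
  qed
  also have "\<dots> = eval_at (\<lambda>J. ?c * (\<Prod>p\<in>mx J. ?y p)) (initial_form ?w f)"
    by (rule subst_superset[symmetric]) (auto simp: keys_initial_form)
  also have "\<dots> = eval_at (torus_point ideals z) (initial_form ?w f)"
    by (rule subst_cong[OF mpolys_initial_form[OF fI]]) (simp add: torus_point_def)
  also have "\<dots> = eval_at z (relative_hibi_map (Pk_less k n) (initial_form ?w f))"
    unfolding eval_torus_point restrict_vars_id[OF mpolys_initial_form[OF fI]] ..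
  finally show "eval_at z (relative_hibi_map (Pk_less k n) (initial_form ?w f)) = 0" by simp
qed

text \<open>A relation among standard monomials would have a standard initial form in the Hibi
  kernel. Hence they are linearly independent on the cone over the Grassmannian.\<close>

lemma std_vanishing_gr:
  assumes f: "f \<in> van ideals gr_points" and s: "\<And>m. m \<in> Poly_Mapping.keys f \<Longrightarrow> std m"
  shows "f = 0"
proof -
  have "initial_form (\<lambda>J. real (W0 J)) f = 0"
    by (rule relative_hibi_map_std_inj[OF _ initial_form_gr_kernel[OF f]]) (use s in \<open>auto simp: keys_initial_form\<close>)
  then show ?thesis by (simp only: initial_form_eq_0_iff)
qed

lemma mono2_inj:
  assumes "(J, K) \<in> ideal_pairs" "(J', K') \<in> ideal_pairs" "mono2 J K = mono2 J' K'"
  shows "J = J' \<and> K = K'"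
proof -
  have "{J, K} = {J', K'}" using assms(3) keys_mono2 by metis
  then show ?thesis using assms(1,2) unfolding ideal_pairs_def by (auto simp: doubleton_eq_iff)
qed

lemma std_ideal_pair: "(J, K) \<in> ideal_pairs \<Longrightarrow> std (mono2 J K)"
  by (auto simp: ideal_pairs_def std_def keys_mono2)

lemma eval_mono2:
  "eval_at x (Poly_Mapping.single (mono2 J K) c) = c * (x J * x K)"
  by (simp add: subst_single mono_eval_add)

text \<open>Products along nested pairs are independent and at least as many as the tableau products
  that span, so they span as well. Expanding the product for \<open>J\<close>, \<open>K\<close> in
  them gives \<open>h\<close>, whose initial form is pinned down by the Hibi kernel.\<close>

lemma gr_relation:
  assumes kn: "k \<le> n" and JK: "incomp J K"
  obtains h where "h \<in> van ideals gr_points"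
    "initial_form (\<lambda>J. real (W0 J)) h = Poly_Mapping.single (mono2 J K) 1 - Poly_Mapping.single (mono2 (J \<union> K) (st J K)) 1"
    "\<And>m. m \<in> Poly_Mapping.keys h \<Longrightarrow> m = mono2 J K \<or> (\<exists>(A, B)\<in>ideal_pairs. m = mono2 A B)"
proof -
  have I: "J \<in> ideals" "K \<in> ideals" using JK by (auto simp: incomp_def)
  have span: "\<exists>c. \<forall>A. phat A J * phat A K = (\<Sum>z\<in>std_pairs k n. c z * (pl k A (fst z) * pl k A (snd z)))"
    if I: "J \<in> ideals" "K \<in> ideals" for J K
  proof -
    obtain e :: int where "\<forall>A. minor k A (alpha k n J) = of_int e * pl k A (aset J)"
      using minor_eq_pl[OF alpha_inj[OF I(1)]] unfolding aset_def by (rule exE)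
    note 1 = this[rule_format]
    obtain e' :: int where "\<forall>A. minor k A (alpha k n K) = of_int e' * pl k A (aset K)"
      using minor_eq_pl[OF alpha_inj[OF I(2)]] unfolding aset_def by (rule exE)
    note 2 = this[rule_format]
    have "in_std_span k n (\<lambda>A. (of_int e * of_int e') * (pl k A (aset J) * pl k A (aset K)))"
      by (intro in_std_span_scale straighten_minors aset_index kn I)
    moreover have "phat A J * phat A K = (of_int e * of_int e') * (pl k A (aset J) * pl k A (aset K))" for A
      unfolding phat_def 1 2 by (simp only: mult_ac)
    ultimately show ?thesis unfolding in_std_span_def by simp
  qed
  let ?E = "\<lambda>s A. phat A (fst s) * phat A (snd s)"
  have comb: "eval_at (\<lambda>J. if J \<in> ideals then c * phat A J else 0)
      (\<Sum>s\<in>ideal_pairs. Poly_Mapping.single (mono2 (fst s) (snd s)) (l s)) = c\<^sup>2 * (\<Sum>s\<in>ideal_pairs. l s * ?E s A)" for c A l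
    unfolding subst_sum[OF comm_ring_hom_id] eval_mono2 sum_distrib_left
    by (rule sum.cong) (auto simp: ideal_pairs_def power2_eq_square)
  have keys: "m \<in> (\<lambda>s. mono2 (fst s) (snd s)) ` ideal_pairs"
    if "m \<in> Poly_Mapping.keys (\<Sum>s\<in>ideal_pairs. Poly_Mapping.single (mono2 (fst s) (snd s)) (l s))" for m and l :: "_ \<Rightarrow> complex"
    using subsetD[OF keys_sum that] by (auto split: if_splits)
  have mp: "(\<Sum>s\<in>ideal_pairs. Poly_Mapping.single (mono2 (fst s) (snd s)) (l s)) \<in> mpolys ideals" for l :: "_ \<Rightarrow> complex"
    by (rule mpolys_sum) (auto simp: mpolys_single_iff keys_mono2 ideal_pairs_def)
  obtain l where l: "\<And>A. phat A J * phat A K = (\<Sum>s\<in>ideal_pairs. l s * ?E s A)"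
  proof (rule independent_family_spans[OF finite_ideal_pairs finite_std_pairs card_std_pairs_le, of ?E])
    show "\<exists>c. \<forall>A. ?E s A = (\<Sum>z\<in>std_pairs k n. c z * (pl k A (fst z) * pl k A (snd z)))" if "s \<in> ideal_pairs" for s
      using span[of "fst s" "snd s"] that by (auto simp: ideal_pairs_def)
    show "\<exists>c. \<forall>A. phat A J * phat A K = (\<Sum>z\<in>std_pairs k n. c z * (pl k A (fst z) * pl k A (snd z)))"
      by (rule span[OF I])
    show "\<forall>s\<in>ideal_pairs. l s = 0" if z: "\<forall>A. (\<Sum>s\<in>ideal_pairs. l s * ?E s A) = 0" for l
    proof -
      let ?s = "\<Sum>s\<in>ideal_pairs. Poly_Mapping.single (mono2 (fst s) (snd s)) (l s)"
      have "?s = 0"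
      proof (rule std_vanishing_gr)
        show "?s \<in> van ideals gr_points"
          unfolding van_iff using mp comb z by (auto simp: gr_points_def)
        show "std m" if "m \<in> Poly_Mapping.keys ?s" for m
          using keys[OF that] std_ideal_pair by auto
      qed
      show ?thesis
      proof
        fix t assume t: "t \<in> ideal_pairs"
        have "0 = Poly_Mapping.lookup ?s (mono2 (fst t) (snd t))" using \<open>?s = 0\<close> by simp
        also have "\<dots> = (\<Sum>s\<in>ideal_pairs. if s = t then l s else 0)"
          unfolding lookup_sum lookup_single
        proof (rule sum.cong[OF refl])
          fix s assume s: "s \<in> ideal_pairs"
          have "mono2 (fst s) (snd s) = mono2 (fst t) (snd t) \<longleftrightarrow> s = t"
            using mono2_inj[of "fst s" "snd s" "fst t" "snd t"] s t by (auto simp: prod_eq_iff)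
          then show "(l s when mono2 (fst s) (snd s) = mono2 (fst t) (snd t)) = (if s = t then l s else 0)"
            by (simp add: when_def)
        qed
        also have "\<dots> = l t" using t finite_ideal_pairs by (simp add: sum.delta)
        finally show "l t = 0" by simp
      qed
    qed
  qed blast
  let ?M = "mono2 J K" and ?s = "mono2 (J \<union> K) (st J K)" and ?w = "\<lambda>J. real (W0 J)"
  define S where "S = (\<Sum>s\<in>ideal_pairs. Poly_Mapping.single (mono2 (fst s) (snd s)) (l s))"
  define h where "h = Poly_Mapping.single ?M 1 - S"
  have stdS: "std m" if "m \<in> Poly_Mapping.keys S" for m
    using keys[OF that[unfolded S_def]] std_ideal_pair by auto
  have nM: "\<not> std ?M" using std_mono2_iff[OF I] JK by simp
  then have SM: "Poly_Mapping.lookup S ?M = 0" using stdS by (auto simp: in_keys_iff)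
  have hv: "h \<in> van ideals gr_points"
    unfolding van_iff
  proof (intro conjI ballI)
    show "h \<in> mpolys ideals" unfolding h_def S_def using I by (intro mpolys_diff mp) (auto simp: mpolys_single_iff keys_mono2)
    fix x assume "x \<in> gr_points"
    then obtain c A where x: "x = (\<lambda>J. if J \<in> ideals then c * phat A J else 0)" by (auto simp: gr_points_def)
    interpret e: comm_ring_hom "eval_at x" by (rule comm_ring_hom_subst[OF comm_ring_hom_id])
    have "eval_at x S = c\<^sup>2 * (phat A J * phat A K)" unfolding x S_def comb l ..
    moreover have "eval_at x (Poly_Mapping.single ?M 1) = c\<^sup>2 * (phat A J * phat A K)"
      unfolding eval_mono2 using I by (simp add: x power2_eq_square)
    ultimately show "eval_at x h = 0" by (simp add: h_def e.hom_minus)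
  qed
  have ker: "relative_hibi_map (Pk_less k n) (initial_form ?w h) = 0" by (rule initial_form_gr_kernel[OF hv])
  have hM: "Poly_Mapping.lookup h ?M = 1" by (simp add: h_def lookup_minus SM)
  have other: "std m" if "m \<in> Poly_Mapping.keys h" "m \<noteq> ?M" for m
    using that stdS[of m] by (auto simp: h_def in_keys_iff lookup_minus lookup_single when_def)
  \<comment> \<open>Without the nonstandard term the initial form would be standard and in the
    kernel, forcing \<open>h = 0\<close>.\<close>
  have iM: "Poly_Mapping.lookup (initial_form ?w h) ?M = 1"
  proof (rule ccontr)
    assume "\<not> ?thesis"
    then have "?M \<notin> Poly_Mapping.keys (initial_form ?w h)"
      by (auto simp: in_keys_iff lookup_initial_form hM split: if_splits)
    then have "std m" if "m \<in> Poly_Mapping.keys (initial_form ?w h)" for m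
      using other[of m] that by (cases "m = ?M") (auto simp: keys_initial_form)
    then have "initial_form ?w h = 0" using ker by (rule relative_hibi_map_std_inj)
    then have "h = 0" by (simp only: initial_form_eq_0_iff)
    with hM show False by simp
  qed
  let ?b = "Poly_Mapping.single ?M 1 - Poly_Mapping.single ?s 1 :: (_, complex) mpoly"
  \<comment> \<open>The nonstandard term cancels against that of the binomial; what remains is
    standard and in the kernel.\<close>
  have "initial_form ?w h - ?b = 0"
  proof (rule relative_hibi_map_std_inj)
    have "?M \<noteq> ?s" using nM std_un_st[OF I] by auto
    fix m assume m: "m \<in> Poly_Mapping.keys (initial_form ?w h - ?b)"
    then have "m \<noteq> ?M" using iM \<open>?M \<noteq> ?s\<close> by (auto simp: in_keys_iff lookup_minus lookup_single when_def)
    show "std m"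
    proof (cases "m = ?s")
      case True
      then show ?thesis using std_un_st[OF I] by simp
    next
      case False
      then have "m \<in> Poly_Mapping.keys (initial_form ?w h)"
        using m \<open>m \<noteq> ?M\<close> by (auto simp: in_keys_iff lookup_minus lookup_single when_def)
      then show ?thesis using other[of m] \<open>m \<noteq> ?M\<close> by (auto simp: keys_initial_form)
    qed
  next
    show "relative_hibi_map (Pk_less k n) (initial_form ?w h - ?b) = 0"
      using \<Phi>_un_st[OF I] by (simp add: rhm.hom_minus ker relative_hibi_map_single)
  qed
  then have init: "initial_form ?w h = ?b" by simp
  show ?thesis
  proof (rule that[OF hv init])
    fix m assume m: "m \<in> Poly_Mapping.keys h"
    show "m = ?M \<or> (\<exists>(A, B)\<in>ideal_pairs. m = mono2 A B)"
    proof (cases "m = ?M")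
      case False
      then have "m \<in> Poly_Mapping.keys S" using m by (auto simp: h_def in_keys_iff lookup_minus lookup_single when_def)
      then show ?thesis using keys[of m l] unfolding S_def by auto
    qed simp
  qed
qed

end

section \<open>The one-parameter family with the prescribed limit\<close>

section \<open>Integral weights\<close>

text \<open>Simultaneous Diophantine approximation preserves the finitely many equalities and strict
  inequalities between sums of two weights.\<close>

lemma ex_integral_weight:
  fixes w :: "'v \<Rightarrow> real"
  assumes L: "finite L"
  obtains u :: "'v \<Rightarrow> nat" where
    "\<And>a b c d. a \<in> L \<Longrightarrow> b \<in> L \<Longrightarrow> c \<in> L \<Longrightarrow> d \<in> L \<Longrightarrow> w a + w b = w c + w d \<Longrightarrow> u a + u b = u c + u d"
    "\<And>a b c d. a \<in> L \<Longrightarrow> b \<in> L \<Longrightarrow> c \<in> L \<Longrightarrow> d \<in> L \<Longrightarrow> w a + w b < w c + w d \<Longrightarrow> u c + u d < u a + u b"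
proof -
  define D where "D = {\<delta>. \<delta> > 0 \<and> (\<exists>a\<in>L. \<exists>b\<in>L. \<exists>c\<in>L. \<exists>d\<in>L. \<delta> = w c + w d - w a - w b)}"
  have "D \<subseteq> (\<lambda>(a, b, c, d). w c + w d - w a - w b) ` (L \<times> L \<times> L \<times> L)"
    unfolding D_def by force
  then have finD: "finite D" by (rule finite_subset) (use L in auto)
  \<comment> \<open>The least positive gap between sums of two weights, capped by 1 so that an
    approximated equality yields an integer of absolute value below 1, hence 0.\<close>
  define \<delta> where "\<delta> = Min (insert 1 D)"
  have \<delta>: "\<delta> > 0" "\<delta> \<le> 1" "\<And>e. e \<in> D \<Longrightarrow> \<delta> \<le> e"
    unfolding \<delta>_def using finD by (auto simp: D_def)
  \<comment> \<open>Four approximations enter each comparison, each with error below 1/N.\<close>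
  obtain N :: nat where N: "4 / \<delta> < real N" using reals_Archimedean2 by blast
  have "0 < 4 / \<delta>" using \<delta>(1) by simp
  then have N0: "N > 0" using N by (metis less_trans of_nat_0_less_iff)
  have N4: "4 / real N < \<delta>" using N N0 \<delta>(1) by (simp add: field_simps)
  obtain g :: "nat \<Rightarrow> 'v" where g: "bij_betw g {0..<card L} L" using ex_bij_betw_nat_finite[OF L] by blast
  obtain q and p :: "nat \<Rightarrow> int" where q: "0 < q"
    and p: "\<And>i. i < card L \<Longrightarrow> \<bar>of_int q * w (g i) - of_int (p i)\<bar> < 1 / real N"
    using Dirichlet_approx_simult[OF N0, of "card L" "\<lambda>i. w (g i)"] by blast
  define P where "P v = p (inv_into {0..<card L} g v)" for v
  have P: "\<bar>of_int q * w v - of_int (P v)\<bar> < 1 / real N" if "v \<in> L" for v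
  proof -
    have "v \<in> g ` {0..<card L}" using g that by (auto simp: bij_betw_def)
    then have "inv_into {0..<card L} g v \<in> {0..<card L}" "g (inv_into {0..<card L} g v) = v"
      by (rule inv_into_into, rule f_inv_into_f)
    then show ?thesis using p[of "inv_into {0..<card L} g v"] by (simp add: P_def)
  qed
  define B where "B = Max (insert 0 ((\<lambda>v. \<bar>P v\<bar>) ` L))"
  have B: "P v \<le> B" if "v \<in> L" for v
  proof -
    have "\<bar>P v\<bar> \<le> B" unfolding B_def using that L by (intro Max_ge) auto
    then show ?thesis by simp
  qed
  \<comment> \<open>The constant \<open>B\<close> makes the values natural numbers and cancels
    between sums of two; the minus sign reverses the inequalities.\<close>
  define u where "u v = nat (B - P v)" for v
  have u: "int (u v) = B - P v" if "v \<in> L" for v using B[OF that] by (simp add: u_def)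
  have approx: "\<bar>of_int q * (w c + w d - w a - w b) - real_of_int (P c + P d - P a - P b)\<bar> < 4 / real N"
    if "a \<in> L" "b \<in> L" "c \<in> L" "d \<in> L" for a b c d
    using P[OF that(1)] P[OF that(2)] P[OF that(3)] P[OF that(4)]
    by (simp add: algebra_simps)
  show ?thesis
  proof (rule that[of u])
    fix a b c d assume abcd: "a \<in> L" "b \<in> L" "c \<in> L" "d \<in> L"
    note uu = u[OF abcd(1)] u[OF abcd(2)] u[OF abcd(3)] u[OF abcd(4)]
    show "u a + u b = u c + u d" if "w a + w b = w c + w d"
    proof -
      have "w c + w d - w a - w b = 0" using that by simp
      then have "\<bar>real_of_int (P c + P d - P a - P b)\<bar> < 1"
        using approx[OF abcd] N4 \<delta>(2) by simp
      then have "\<bar>P c + P d - P a - P b\<bar> < 1" by linarith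
      then show ?thesis using uu by linarith
    qed
    show "u c + u d < u a + u b" if "w a + w b < w c + w d"
    proof -
      let ?e = "w c + w d - w a - w b"
      have "?e \<in> D" unfolding D_def using that abcd by auto
      then have e: "\<delta> \<le> ?e" by (rule \<delta>(3))
      have "1 \<le> real_of_int q" using q by simp
      then have "?e \<le> of_int q * ?e" using e \<delta>(1) mult_right_mono[of 1 "of_int q" ?e] by simp
      then have "0 < real_of_int (P c + P d - P a - P b)"
        using approx[OF abcd] N4 e by linarith
      then have "0 < P c + P d - P a - P b" by linarith
      then show ?thesis using uu by linarith
    qed
  qed
qed

context grassmann_poset
begin

section \<open>The degeneration of the Grassmannian\<close>

definition nwt :: "((nat \<times> nat) set \<Rightarrow> nat) \<Rightarrow> ((nat \<times> nat) set \<Rightarrow>\<^sub>0 nat) \<Rightarrow> nat" where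
  "nwt u m = (\<Sum>J\<in>Poly_Mapping.keys m. u J * Poly_Mapping.lookup m J)"

lemma nwt_superset: "finite S \<Longrightarrow> Poly_Mapping.keys m \<subseteq> S \<Longrightarrow> nwt u m = (\<Sum>J\<in>S. u J * Poly_Mapping.lookup m J)"
  unfolding nwt_def by (rule sum.mono_neutral_left) (auto simp: in_keys_iff)

lemma nwt_add: "nwt u (m + m') = nwt u m + nwt u m'"
proof -
  let ?S = "Poly_Mapping.keys m \<union> Poly_Mapping.keys m'"
  show ?thesis
    using nwt_superset[of ?S m u] nwt_superset[of ?S m' u] nwt_superset[of ?S "m + m'" u] keys_add[of m m']
    by (simp add: lookup_add sum.distrib algebra_simps)
qed

lemma nwt_single: "nwt u (Poly_Mapping.single J 1) = u J"
  by (simp add: nwt_def)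

lemma mono_eval_monom: "mono_eval (\<lambda>J. monom (x J) (u J)) m = monom (mono_eval x m) (nwt u m)"
proof -
  have "(\<Prod>J\<in>S. monom (x J) (u J) ^ Poly_Mapping.lookup m J) =
      monom (\<Prod>J\<in>S. x J ^ Poly_Mapping.lookup m J) (\<Sum>J\<in>S. u J * Poly_Mapping.lookup m J)" for S
    by (induction S rule: infinite_finite_induct) (auto simp: monom_power mult_monom monom_0 mult.commute simp flip: one_pCons)
  then show ?thesis by (simp add: mono_eval_def nwt_def)
qed

text \<open>Homogenization in the parameter: with \<open>N\<close> the largest weight occurring,
  setting the parameter to 0 keeps exactly the terms of weight \<open>N\<close>.\<close>

definition tlift :: "((nat \<times> nat) set \<Rightarrow> nat) \<Rightarrow> nat \<Rightarrow> ((nat \<times> nat) set, complex) mpoly \<Rightarrow> ((nat \<times> nat) set, complex poly) mpoly" where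
  "tlift u N h = (\<Sum>m\<in>Poly_Mapping.keys h. Poly_Mapping.single m (monom (Poly_Mapping.lookup h m) (N - nwt u m)))"

lemma lookup_tlift: "Poly_Mapping.lookup (tlift u N h) m = monom (Poly_Mapping.lookup h m) (N - nwt u m)"
  by (auto simp: tlift_def lookup_sum lookup_single when_def in_keys_iff if_distrib cong: if_cong)

lemma keys_tlift: "Poly_Mapping.keys (tlift u N h) = Poly_Mapping.keys h"
  by (auto simp: in_keys_iff lookup_tlift)

lemma tlift_in_family:
  assumes h: "h \<in> van ideals \<Omega>" and N: "\<And>m. m \<in> Poly_Mapping.keys h \<Longrightarrow> nwt u m \<le> N"
  shows "tlift u N h \<in> weight_family ideals \<Omega> u"
  unfolding weight_family_iff
proof (intro conjI ballI)
  show "tlift u N h \<in> mpolys ideals" using h by (auto simp: mpolys_iff keys_tlift van_iff)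
  fix x assume x: "x \<in> \<Omega>"
  have "subst (\<lambda>p. p) (\<lambda>J. monom (x J) (u J)) (tlift u N h)
      = (\<Sum>m\<in>Poly_Mapping.keys h. monom (Poly_Mapping.lookup h m * mono_eval x m) N)"
    unfolding subst_def' keys_tlift lookup_tlift mono_eval_monom mult_monom
    by (intro sum.cong refl) (simp add: N)
  also have "\<dots> = monom (eval_at x h) N" by (simp add: subst_def' monom_sum)
  also have "eval_at x h = 0" using h x by (simp add: van_iff)
  finally show "subst (\<lambda>p. p) (\<lambda>J. monom (x J) (u J)) (tlift u N h) = 0" by simp
qed

abbreviation special :: "((nat \<times> nat) set, complex poly) mpoly \<Rightarrow> ((nat \<times> nat) set, complex) mpoly" where
  "special \<equiv> subst (\<lambda>p. Const (poly p 0)) Var"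

lemma comm_ring_hom_special: "comm_ring_hom special"
  by (rule comm_ring_hom_subst[OF comm_ring_homs(4)])

sublocale sp: comm_ring_hom special by (rule comm_ring_hom_special)

lemma special_single: "special (Poly_Mapping.single m p) = Poly_Mapping.single m (poly p 0)"
  by (simp add: subst_single mono_eval_Var single_Const[symmetric])

lemma special_Const: "special (Const p) = Const (poly p 0)"
  by (simp add: subst_Const)

lemma lookup_special: "Poly_Mapping.lookup (special F) m = poly (Poly_Mapping.lookup F m) 0"
proof -
  have "special F = (\<Sum>m\<in>Poly_Mapping.keys F. Poly_Mapping.single m (poly (Poly_Mapping.lookup F m) 0))"
    unfolding subst_def' mono_eval_Var single_Const[symmetric] ..
  then show ?thesis
    by (auto simp: lookup_sum lookup_single when_def in_keys_iff if_distrib cong: if_cong)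
qed

lemma special_mpolys: "F \<in> mpolys V \<Longrightarrow> special F \<in> mpolys V"
  by (rule mpolys_subst) auto

text \<open>An admissible \<open>u\<close> is an integral version of \<open>- (C * W0 + w)\<close> for large \<open>C\<close>: the leading
  part degenerates to the Hibi-Li ideal, the correction \<open>w\<close> further to \<open>rel_ideal w\<close>. The sign
  is reversed because the fibre at 0 of a weight family retains the terms of largest weight.\<close>

definition admissible :: "((nat \<times> nat) set \<Rightarrow> real) \<Rightarrow> ((nat \<times> nat) set \<Rightarrow> nat) \<Rightarrow> bool" where
  "admissible w u \<longleftrightarrow> (\<forall>J K. incomp J K \<longrightarrow> (\<exists>h \<in> van ideals gr_points.
     Poly_Mapping.lookup h (mono2 J K) = 1 \<and>
     Poly_Mapping.lookup h (mono2 (J \<union> K) (st J K)) = -1 \<and>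
     nwt u (mono2 (J \<union> K) (st J K)) \<le> nwt u (mono2 J K) \<and>
     (nwt u (mono2 (J \<union> K) (st J K)) = nwt u (mono2 J K) \<longleftrightarrow> w J + w K = w (J \<union> K) + w (st J K)) \<and>
     (\<forall>m\<in>Poly_Mapping.keys h. mdeg m = 2 \<and>
        (m = mono2 J K \<or> m = mono2 (J \<union> K) (st J K) \<or> nwt u m < nwt u (mono2 J K)))))"

lemma ex_admissible:
  assumes kn: "k \<le> n" and w: "supermodular w"
  obtains u where "admissible w u"
proof -
  \<comment> \<open>Two sums of two values of \<open>w\<close> differ by at most
    \<open>C - 1\<close>, so a gap of 1 in \<open>W0\<close>, multiplied by \<open>C\<close>,
    decides the comparison.\<close>
  define C where "C = 1 + 4 * Max (insert 0 ((\<lambda>J. \<bar>w J\<bar>) ` ideals))"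
  define w' where "w' J = C * real (W0 J) + w J" for J
  have wb: "4 * \<bar>w J\<bar> \<le> C - 1" if "J \<in> ideals" for J
  proof -
    have "\<bar>w J\<bar> \<le> Max (insert 0 ((\<lambda>J. \<bar>w J\<bar>) ` ideals))"
      using that finite_ideals by (intro Max_ge) auto
    then show ?thesis by (simp add: C_def)
  qed
  have C1: "C \<ge> 1" using finite_ideals by (simp add: C_def)
  obtain u where u: "\<And>a b c d. a \<in> ideals \<Longrightarrow> b \<in> ideals \<Longrightarrow> c \<in> ideals \<Longrightarrow> d \<in> ideals \<Longrightarrow> w' a + w' b = w' c + w' d \<Longrightarrow> u a + u b = u c + u d"
    "\<And>a b c d. a \<in> ideals \<Longrightarrow> b \<in> ideals \<Longrightarrow> c \<in> ideals \<Longrightarrow> d \<in> ideals \<Longrightarrow> w' a + w' b < w' c + w' d \<Longrightarrow> u c + u d < u a + (u b :: nat)"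
    using ex_integral_weight[OF finite_ideals, of w'] by blast
  have nw: "nwt u (mono2 A B) = u A + u B" for A B by (simp add: nwt_add nwt_single)
  have "\<exists>h \<in> van ideals gr_points.
     Poly_Mapping.lookup h (mono2 J K) = 1 \<and>
     Poly_Mapping.lookup h (mono2 (J \<union> K) (st J K)) = -1 \<and>
     nwt u (mono2 (J \<union> K) (st J K)) \<le> nwt u (mono2 J K) \<and>
     (nwt u (mono2 (J \<union> K) (st J K)) = nwt u (mono2 J K) \<longleftrightarrow> w J + w K = w (J \<union> K) + w (st J K)) \<and>
     (\<forall>m\<in>Poly_Mapping.keys h. mdeg m = 2 \<and>
        (m = mono2 J K \<or> m = mono2 (J \<union> K) (st J K) \<or> nwt u m < nwt u (mono2 J K)))" if JK: "incomp J K" for J K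
  proof -
    let ?M = "mono2 J K" and ?s = "mono2 (J \<union> K) (st J K)" and ?w0 = "\<lambda>J. real (W0 J)"
    have I: "J \<in> ideals" "K \<in> ideals" "J \<union> K \<in> ideals" "st J K \<in> ideals"
      using JK by (auto simp: incomp_def ideals_un st_in_ideals)
    have ne: "?M \<noteq> ?s" using std_un_st[OF I(1,2)] std_mono2_iff[OF I(1,2)] JK by auto
    obtain h where h: "h \<in> van ideals gr_points"
      "initial_form ?w0 h = Poly_Mapping.single ?M 1 - Poly_Mapping.single ?s 1"
      "\<And>m. m \<in> Poly_Mapping.keys h \<Longrightarrow> m = ?M \<or> (\<exists>(A, B)\<in>ideal_pairs. m = mono2 A B)"
      using gr_relation[OF kn JK] by blast
    have ik: "Poly_Mapping.keys (initial_form ?w0 h) = {?M, ?s}"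
      unfolding h(2) using ne by (auto simp: in_keys_iff lookup_minus lookup_single when_def split: if_splits)
    then have kM: "?M \<in> Poly_Mapping.keys h" "?s \<in> Poly_Mapping.keys h"
      and min: "\<And>m. m \<in> Poly_Mapping.keys h \<Longrightarrow> wt ?w0 ?M \<le> wt ?w0 m"
      unfolding keys_initial_form by blast+
    have l1: "Poly_Mapping.lookup h ?M = 1" "Poly_Mapping.lookup h ?s = -1"
    proof -
      have "Poly_Mapping.lookup (initial_form ?w0 h) m = Poly_Mapping.lookup h m" if "m \<in> {?M, ?s}" for m
        using that unfolding ik[symmetric] by (auto simp: in_keys_iff lookup_initial_form split: if_splits)
      from this[of ?M] this[of ?s] show "Poly_Mapping.lookup h ?M = 1" "Poly_Mapping.lookup h ?s = -1"
        using ne unfolding h(2) by (simp_all add: lookup_minus lookup_single when_def)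
    qed
    have W0eq: "W0 (J \<union> K) + W0 (st J K) = W0 J + W0 K"
      unfolding W0_def using sum_mx[OF I(1,2)] .
    then have W0eq': "real (W0 (J \<union> K)) + real (W0 (st J K)) = real (W0 J) + real (W0 K)"
      by (metis of_nat_add)
    \<comment> \<open>\<open>W0\<close> is modular on every pair, so between a pair and its union
      and star only \<open>w\<close> decides.\<close>
    have w'eq: "w' (J \<union> K) + w' (st J K) - (w' J + w' K) = w (J \<union> K) + w (st J K) - (w J + w K)"
      unfolding w'_def using arg_cong[OF W0eq', of "\<lambda>x. C * x"] by (simp add: distrib_left)
    have le: "w J + w K \<le> w (J \<union> K) + w (st J K)" by (rule supermodularD[OF w I(1,2)])
    have s1: "u (J \<union> K) + u (st J K) = u J + u K" if "w J + w K = w (J \<union> K) + w (st J K)"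
      by (rule u(1)[OF I(3,4,1,2)]) (use that w'eq in simp)
    have s2: "u (J \<union> K) + u (st J K) < u J + u K" if "w J + w K < w (J \<union> K) + w (st J K)"
      by (rule u(2)[OF I(1,2,3,4)]) (use that w'eq in simp)
    have other: "nwt u m < nwt u ?M" if m: "m \<in> Poly_Mapping.keys h" "m \<noteq> ?M" "m \<noteq> ?s" for m
    proof -
      obtain A B where AB: "(A, B) \<in> ideal_pairs" "m = mono2 A B" using h(3)[OF m(1)] m(2) by blast
      then have ABI: "A \<in> ideals" "B \<in> ideals" by (auto simp: ideal_pairs_def)
      have "m \<notin> Poly_Mapping.keys (initial_form ?w0 h)" using ik m by simp
      then have "\<not> (\<forall>m'\<in>Poly_Mapping.keys h. wt ?w0 m \<le> wt ?w0 m')" using m(1) by (auto simp: keys_initial_form)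
      then have "wt ?w0 ?M < wt ?w0 m" using min by force
      then have "real (W0 J) + real (W0 K) < real (W0 A) + real (W0 B)" by (simp add: AB)
      then have "W0 J + W0 K + 1 \<le> W0 A + W0 B" by linarith
      then have "real (W0 J) + real (W0 K) + 1 \<le> real (W0 A) + real (W0 B)" by linarith
      then have "C * (real (W0 J) + real (W0 K) + 1) \<le> C * (real (W0 A) + real (W0 B))"
        using C1 by (intro mult_left_mono) auto
      then have "C * real (W0 J) + C * real (W0 K) + C \<le> C * real (W0 A) + C * real (W0 B)"
        by (simp add: distrib_left)
      moreover have "w J + w K < w A + w B + C"
        using wb[OF I(1)] wb[OF I(2)] wb[OF ABI(1)] wb[OF ABI(2)] by linarith
      ultimately have "w' J + w' K < w' A + w' B" unfolding w'_def by linarith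
      then show ?thesis using u(2)[OF I(1,2) ABI] by (simp add: AB nw)
    qed
    show ?thesis
    proof (intro bexI[OF _ h(1)] conjI ballI l1)
      show "nwt u ?s \<le> nwt u ?M" "nwt u ?s = nwt u ?M \<longleftrightarrow> w J + w K = w (J \<union> K) + w (st J K)"
        using s1 s2 le unfolding nw by linarith+
      fix m assume m: "m \<in> Poly_Mapping.keys h"
      show "mdeg m = 2" using h(3)[OF m] by auto
      show "m = ?M \<or> m = ?s \<or> nwt u m < nwt u ?M" using other[OF m] by blast
    qed
  qed
  then have "admissible w u" unfolding admissible_def by blast
  then show ?thesis by (rule that)
qed

text \<open>Lift the relation with exponent bound the weight of \<open>mono2 J K\<close>. Besides
  that monomial only union and star can reach this weight, and then with larger energy, which keeps
  the rewriting terminating.\<close>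

lemma ex_family_relation:
  assumes u: "admissible w u" and JK: "incomp J K"
  obtains H where "H \<in> weight_family ideals gr_points u" "Poly_Mapping.lookup H (mono2 J K) = 1"
    "special H = rel_poly w J K"
    "\<And>m. m \<in> Poly_Mapping.keys H \<Longrightarrow> mdeg m = 2 \<and>
        (m = mono2 J K \<or> nwt u m < nwt u (mono2 J K) \<or>
         nwt u m = nwt u (mono2 J K) \<and> energy (mono2 J K) < energy m)"
proof -
  let ?M = "mono2 J K" and ?s = "mono2 (J \<union> K) (st J K)"
  obtain h where h: "h \<in> van ideals gr_points" "Poly_Mapping.lookup h ?M = 1" "Poly_Mapping.lookup h ?s = -1"
     "nwt u ?s \<le> nwt u ?M" "nwt u ?s = nwt u ?M \<longleftrightarrow> w J + w K = w (J \<union> K) + w (st J K)"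
     "\<forall>m\<in>Poly_Mapping.keys h. mdeg m = 2 \<and> (m = ?M \<or> m = ?s \<or> nwt u m < nwt u ?M)"
    using u JK unfolding admissible_def by blast
  have ne: "?M \<noteq> ?s" using h(2,3) by force
  let ?H = "tlift u (nwt u ?M) h"
  have le: "nwt u m \<le> nwt u ?M" if "m \<in> Poly_Mapping.keys h" for m using h(4) h(6)[rule_format, OF that] by auto
  show ?thesis
  proof (rule that)
    show "?H \<in> weight_family ideals gr_points u" by (rule tlift_in_family[OF h(1) le])
    show "Poly_Mapping.lookup ?H ?M = 1" by (simp add: lookup_tlift h(2))
    show "special ?H = rel_poly w J K"
    proof (rule poly_mapping_eqI)
      fix m
      have "Poly_Mapping.lookup (special ?H) m = (if nwt u m \<ge> nwt u ?M then Poly_Mapping.lookup h m else 0)"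
        by (simp add: lookup_special lookup_tlift poly_monom power_0_left)
      moreover have "Poly_Mapping.lookup h m = 0" if "m \<noteq> ?M" "m \<noteq> ?s" "nwt u m \<ge> nwt u ?M"
        using h(6) that by (meson in_keys_iff leD)
      moreover have "nwt u ?s \<ge> nwt u ?M \<longleftrightarrow> w J + w K = w (J \<union> K) + w (st J K)" using h(4,5) by linarith
      ultimately show "Poly_Mapping.lookup (special ?H) m = Poly_Mapping.lookup (rel_poly w J K) m"
        using ne h(2,3) unfolding rel_poly_def Var_mult_Var
        by (cases "m = ?M"; cases "m = ?s") (auto simp: lookup_minus lookup_single when_def)
    qed
    fix m assume m: "m \<in> Poly_Mapping.keys ?H"
    then have "m \<in> Poly_Mapping.keys h" by (simp add: keys_tlift)
    then show "mdeg m = 2 \<and> (m = ?M \<or> nwt u m < nwt u ?M \<or> nwt u m = nwt u ?M \<and> energy ?M < energy m)"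
      using h(4,6) energy_un_st[OF JK] by (metis le_neq_implies_less)
  qed
qed

lemma ideal_family: "ideal (weight_family ideals \<Omega> u) (mpoly_ring ideals)"
  by (rule ideal_vanishing_ideal) (auto simp: weight_points_def comm_ring_hom_poly)

text \<open>Straightening over C[t]: the multiples of lifted relations are collected in
  \<open>Q\<close>, so that at parameter 0 they become elements of
  \<open>rel_ideal w\<close>.\<close>

lemma straighten_family:
  assumes u: "admissible w u" and m: "Poly_Mapping.keys m \<subseteq> ideals"
  shows "\<exists>Q S. Poly_Mapping.single m 1 = Q + S \<and> Q \<in> weight_family ideals gr_points u \<and>
    special Q \<in> rel_ideal w \<and> (\<forall>k\<in>Poly_Mapping.keys S. std k)"
  using m
\<comment> \<open>A lexicographic measure in one number: first the weight falls, then the energy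
  rises towards its bound. The multiplier exceeds every value of the second component.\<close>
proof (induction "nwt u m * (mdeg m * 3 ^ card (Pk k n) + 1) + (mdeg m * 3 ^ card (Pk k n) - energy m)"
    arbitrary: m rule: less_induct)
  case less
  let ?F = "weight_family ideals gr_points u"
  have F: "ideal ?F (mpoly_ring ideals)" by (rule ideal_family)
  have R: "ideal (rel_ideal w) (mpoly_ring ideals)" by (rule ideal_rel_ideal)
  show ?case
  proof (cases "std m")
    case True
    have "0 \<in> ?F" "0 \<in> rel_ideal w" using F R unfolding ideal_mpoly_ring_iff by blast+
    with True show ?thesis
      by (intro exI[of _ 0] exI[of _ "Poly_Mapping.single m 1"]) auto
  next
    case False
    then obtain J K m' where m: "incomp J K" "m = mono2 J K + m'" "Poly_Mapping.keys m' \<subseteq> ideals"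
      using nonstd_split less.prems by metis
    let ?M = "mono2 J K"
    obtain H where H: "H \<in> ?F" "Poly_Mapping.lookup H ?M = 1" "special H = rel_poly w J K"
      "\<And>m. m \<in> Poly_Mapping.keys H \<Longrightarrow> mdeg m = 2 \<and>
        (m = ?M \<or> nwt u m < nwt u ?M \<or> nwt u m = nwt u ?M \<and> energy ?M < energy m)"
      using ex_family_relation[OF u m(1)] by blast
    let ?T = "Poly_Mapping.keys H - {?M}"
    have step: "\<exists>Q S. Poly_Mapping.single (m' + s) 1 = Q + S \<and> Q \<in> ?F \<and> special Q \<in> rel_ideal w \<and> (\<forall>k\<in>Poly_Mapping.keys S. std k)"
      if s: "s \<in> ?T" for s
    proof (rule less.hyps)
      let ?C = "mdeg m * 3 ^ card (Pk k n)"
      have "Poly_Mapping.keys s \<subseteq> ideals"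
        using s vanishing_ideal_mpolys[OF H(1)] by (auto simp: mpolys_iff)
      then show kI: "Poly_Mapping.keys (m' + s) \<subseteq> ideals" using m(3) keys_add[of m' s] by blast
      have d: "mdeg (m' + s) = mdeg m" using H(4)[of s] s by (simp add: m(2))
      have e: "energy (m' + s) \<le> ?C" using energy_bound[OF kI] d by simp
      consider "nwt u (m' + s) + 1 \<le> nwt u m" | "nwt u (m' + s) = nwt u m" "energy m < energy (m' + s)"
        using H(4)[of s] s by (fastforce simp: m(2) nwt_add energy_add)
      then have "nwt u (m' + s) * (?C + 1) + (?C - energy (m' + s)) < nwt u m * (?C + 1) + (?C - energy m)"
      proof cases
        case 1
        then have "(nwt u (m' + s) + 1) * (?C + 1) \<le> nwt u m * (?C + 1)" by (rule mult_right_mono) simp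
        then show ?thesis by (simp add: distrib_right)
      next
        case 2
        then show ?thesis using e by simp
      qed
      then show "nwt u (m' + s) * (mdeg (m' + s) * 3 ^ card (Pk k n) + 1) + (mdeg (m' + s) * 3 ^ card (Pk k n) - energy (m' + s))
        < nwt u m * (?C + 1) + (?C - energy m)" unfolding d .
    qed
    then have "\<forall>s\<in>?T. \<exists>Q S. Poly_Mapping.single (m' + s) 1 = Q + S \<and> Q \<in> ?F \<and> special Q \<in> rel_ideal w \<and> (\<forall>k\<in>Poly_Mapping.keys S. std k)"
      by blast
    from bchoice[OF this] obtain Qs where "\<forall>s\<in>?T. \<exists>S. Poly_Mapping.single (m' + s) 1 = Qs s + S \<and> Qs s \<in> ?F
        \<and> special (Qs s) \<in> rel_ideal w \<and> (\<forall>k\<in>Poly_Mapping.keys S. std k)" by (rule exE)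
    from bchoice[OF this] obtain Ss where QS': "\<forall>s\<in>?T. Poly_Mapping.single (m' + s) 1 = Qs s + Ss s \<and> Qs s \<in> ?F
        \<and> special (Qs s) \<in> rel_ideal w \<and> (\<forall>k\<in>Poly_Mapping.keys (Ss s). std k)" by (rule exE)
    have QS: "Poly_Mapping.single (m' + s) 1 = Qs s + Ss s" "Qs s \<in> ?F" "special (Qs s) \<in> rel_ideal w"
      "k \<in> Poly_Mapping.keys (Ss s) \<Longrightarrow> std k" if "s \<in> ?T" for s k
      using QS' that by blast+
    define c :: "_ \<Rightarrow> ((nat \<times> nat) set, complex poly) mpoly" where "c s = Const (Poly_Mapping.lookup H s)" for s
    define Q where "Q = Poly_Mapping.single m' 1 * H - (\<Sum>s\<in>?T. c s * Qs s)"
    define S where "S = - (\<Sum>s\<in>?T. c s * Ss s)"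
    have M: "?M \<in> Poly_Mapping.keys H" using H(2) by (simp add: in_keys_iff)
    have "Poly_Mapping.single m' 1 * H = (\<Sum>s\<in>Poly_Mapping.keys H. c s * Poly_Mapping.single (m' + s) 1)"
      by (subst poly_mapping_as_sum[of H]) (simp add: sum_distrib_left mult_single c_def Const_mult_single)
    also have "\<dots> = c ?M * Poly_Mapping.single (m' + ?M) 1 + (\<Sum>s\<in>?T. c s * Poly_Mapping.single (m' + s) 1)"
      by (rule sum.remove[OF _ M]) simp
    also have "\<dots> = Poly_Mapping.single m 1 + ((\<Sum>s\<in>?T. c s * Qs s) + (\<Sum>s\<in>?T. c s * Ss s))"
      using QS(1) by (simp add: c_def H(2) Const_1 m(2) add.commute distrib_left sum.distrib)
    finally have eq: "Poly_Mapping.single m 1 = Q + S" by (simp add: Q_def S_def)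
    have m'I: "Poly_Mapping.single m' 1 \<in> mpolys ideals" using m(3) by (simp add: mpolys_single_iff)
    have "Poly_Mapping.single m' 1 * H \<in> ?F" using F H(1) m'I unfolding ideal_mpoly_ring_iff by blast
    moreover have "(\<Sum>s\<in>?T. c s * Qs s) \<in> ?F"
      unfolding c_def by (intro ideal_sum[OF F] ideal_Const_mult[OF F] QS(2))
    ultimately have QF: "Q \<in> ?F" unfolding Q_def by (rule ideal_diff[OF F])
    have "special (Poly_Mapping.single m' 1 * H) \<in> rel_ideal w"
      using R rel_poly_in[OF m(1)] special_mpolys[OF m'I] unfolding ideal_mpoly_ring_iff
      by (simp add: sp.hom_mult H(3))
    moreover have "special (\<Sum>s\<in>?T. c s * Qs s) \<in> rel_ideal w"
      unfolding c_def sp.hom_sum sp.hom_mult special_Const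
      by (intro ideal_sum[OF R] ideal_Const_mult[OF R] QS(3))
    ultimately have "special Q \<in> rel_ideal w" unfolding Q_def sp.hom_minus by (rule ideal_diff[OF R])
    moreover have "std k" if "k \<in> Poly_Mapping.keys S" for k
    proof -
      have "k \<in> Poly_Mapping.keys (\<Sum>s\<in>?T. c s * Ss s)" using that by (simp add: S_def in_keys_iff)
      then obtain s where "s \<in> ?T" "k \<in> Poly_Mapping.keys (c s * Ss s)" using keys_sum by fastforce
      then show ?thesis using QS(4) by (auto simp: c_def in_keys_iff lookup_Const_mult)
    qed
    ultimately show ?thesis using eq QF by blast
  qed
qed

text \<open>For each nonzero parameter value, \<open>S\<close> specializes to a standard relation on
  the Grassmannian, hence to 0. Coefficients with infinitely many roots vanish.\<close>

lemma std_in_family: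
  assumes S: "S \<in> weight_family ideals gr_points u" and std: "\<And>m. m \<in> Poly_Mapping.keys S \<Longrightarrow> std m"
  shows "S = 0"
proof (rule poly_mapping_eqI)
  fix m
  have "poly (Poly_Mapping.lookup S m) a = 0" if a: "a \<noteq> 0" for a
  proof -
    \<comment> \<open>The powers of \<open>a\<close> transfer the diagonal action from the points to
      the coefficients.\<close>
    define s where "s = (\<Sum>m\<in>Poly_Mapping.keys S. Poly_Mapping.single m (poly (Poly_Mapping.lookup S m) a * a ^ nwt u m))"
    have ls: "Poly_Mapping.lookup s m = poly (Poly_Mapping.lookup S m) a * a ^ nwt u m" for m
      by (auto simp: s_def lookup_sum lookup_single when_def in_keys_iff if_distrib cong: if_cong)
    then have ks: "Poly_Mapping.keys s \<subseteq> Poly_Mapping.keys S" by (auto simp: in_keys_iff)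
    have "s = 0"
    proof (rule std_vanishing_gr)
      show "s \<in> van ideals gr_points"
        unfolding van_iff
      proof (intro conjI ballI)
        show "s \<in> mpolys ideals" using ks vanishing_ideal_mpolys[OF S] by (auto simp: mpolys_iff)
        fix x assume "x \<in> gr_points"
        then have "0 = subst (\<lambda>p. poly p a) (\<lambda>J. a ^ u J * x J) S"
          using vanishing_idealD[OF S weight_pointsI] by simp
        also have "\<dots> = (\<Sum>m\<in>Poly_Mapping.keys S. Poly_Mapping.lookup s m * mono_eval x m)"
          unfolding subst_def' ls
          by (intro sum.cong refl)
            (simp add: mono_eval_scale[of "\<lambda>J. a ^ u J"] mono_eval_def[of "\<lambda>J. a ^ u J"] nwt_def power_sum flip: power_mult)
        also have "\<dots> = eval_at x s" by (rule subst_superset[symmetric]) (use ks in auto)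
        finally show "eval_at x s = 0" by simp
      qed
      show "std m" if "m \<in> Poly_Mapping.keys s" for m using std ks that by blast
    qed
    then show ?thesis using ls[of m] a by simp
  qed
  then have "infinite {a. poly (Poly_Mapping.lookup S m) a = 0}"
    using infinite_super[of "UNIV - {0}" "{a. poly (Poly_Mapping.lookup S m) a = 0}"]
      infinite_remove[OF infinite_UNIV_char_0[where 'a=complex], of 0] by auto
  then show "Poly_Mapping.lookup S m = Poly_Mapping.lookup 0 m"
    using poly_roots_finite by auto
qed

text \<open>A member of the family is a combination of lifted relations plus a standard remainder;
  the remainder is again in the family and so is 0. Conversely each generator lifts.\<close>

lemma fibre_eq_rel_ideal:
  assumes u: "admissible w u"
  shows "fibre_ideal 0 (weight_family ideals gr_points u) = rel_ideal w"
proof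
  let ?F = "weight_family ideals gr_points u"
  have F: "ideal ?F (mpoly_ring ideals)" by (rule ideal_family)
  have R: "ideal (rel_ideal w) (mpoly_ring ideals)" by (rule ideal_rel_ideal)
  show "fibre_ideal 0 ?F \<subseteq> rel_ideal w"
  proof
    fix f assume "f \<in> fibre_ideal 0 ?F"
    then obtain G where G: "G \<in> ?F" "f = special G" by (auto simp: fibre_ideal_def)
    let ?K = "Poly_Mapping.keys G"
    have "Poly_Mapping.keys m \<subseteq> ideals" if "m \<in> ?K" for m
      using that vanishing_ideal_mpolys[OF G(1)] by (auto simp: mpolys_iff)
    then have "\<forall>m\<in>?K. \<exists>Q S. Poly_Mapping.single m 1 = Q + S \<and> Q \<in> ?F \<and> special Q \<in> rel_ideal w \<and> (\<forall>k\<in>Poly_Mapping.keys S. std k)"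
      using straighten_family[OF u] by blast
    from bchoice[OF this] obtain Qs where "\<forall>m\<in>?K. \<exists>S. Poly_Mapping.single m 1 = Qs m + S \<and> Qs m \<in> ?F
        \<and> special (Qs m) \<in> rel_ideal w \<and> (\<forall>k\<in>Poly_Mapping.keys S. std k)" by (rule exE)
    from bchoice[OF this] obtain Ss where QS': "\<forall>m\<in>?K. Poly_Mapping.single m 1 = Qs m + Ss m \<and> Qs m \<in> ?F
        \<and> special (Qs m) \<in> rel_ideal w \<and> (\<forall>k\<in>Poly_Mapping.keys (Ss m). std k)" by (rule exE)
    have QS: "Poly_Mapping.single m 1 = Qs m + Ss m" "Qs m \<in> ?F" "special (Qs m) \<in> rel_ideal w"
      "k \<in> Poly_Mapping.keys (Ss m) \<Longrightarrow> std k" if "m \<in> ?K" for m k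
      using QS' that by blast+
    define c :: "_ \<Rightarrow> ((nat \<times> nat) set, complex poly) mpoly" where "c m = Const (Poly_Mapping.lookup G m)" for m
    define Q where "Q = (\<Sum>m\<in>?K. c m * Qs m)"
    define S where "S = (\<Sum>m\<in>?K. c m * Ss m)"
    have "G = (\<Sum>m\<in>?K. c m * Poly_Mapping.single m 1)"
      by (subst poly_mapping_as_sum[of G]) (simp add: c_def Const_mult_single)
    also have "\<dots> = Q + S" using QS(1) by (simp add: Q_def S_def distrib_left sum.distrib)
    finally have GQS: "G = Q + S" .
    have "Q \<in> ?F" unfolding Q_def c_def by (intro ideal_sum[OF F] ideal_Const_mult[OF F] QS(2))
    then have "G - Q \<in> ?F" by (rule ideal_diff[OF F G(1)])
    then have "S \<in> ?F" by (simp add: GQS)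
    moreover have "std k" if kS: "k \<in> Poly_Mapping.keys S" for k
    proof -
      obtain m where "m \<in> ?K" "k \<in> Poly_Mapping.keys (c m * Ss m)"
        using subsetD[OF keys_sum kS[unfolded S_def]] by blast
      then show ?thesis using QS(4) by (auto simp: c_def in_keys_iff lookup_Const_mult)
    qed
    ultimately have "S = 0" by (rule std_in_family)
    then have "f = special Q" using GQS G(2) by simp
    also have "\<dots> \<in> rel_ideal w"
      unfolding Q_def c_def sp.hom_sum sp.hom_mult special_Const
      by (intro ideal_sum[OF R] ideal_Const_mult[OF R] QS(3))
    finally show "f \<in> rel_ideal w" .
  qed
  have "ideal (fibre_ideal 0 ?F) (mpoly_ring ideals)"
    unfolding ideal_mpoly_ring_iff fibre_ideal_def
  proof (intro conjI ballI)
    show "special ` ?F \<subseteq> mpolys ideals" using special_mpolys vanishing_ideal_mpolys by blast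
    show "0 \<in> special ` ?F" using F sp.hom_zero unfolding ideal_mpoly_ring_iff by (metis imageI)
    fix f assume "f \<in> special ` ?F"
    then obtain G where G: "G \<in> ?F" "f = special G" by blast
    show "f + g \<in> special ` ?F" if g: "g \<in> special ` ?F" for g
    proof -
      obtain G' where G': "G' \<in> ?F" "g = special G'" using g by blast
      have "G + G' \<in> ?F" using F G G' unfolding ideal_mpoly_ring_iff by blast
      then show ?thesis unfolding G(2) G'(2) sp.hom_add[symmetric] by blast
    qed
    show "g * f \<in> special ` ?F" if g: "g \<in> mpolys ideals" for g
    proof -
      \<comment> \<open>Lifting coefficients to constant polynomials shows that specialization is
        onto, so the image of the family is an ideal.\<close>
      define g' where "g' = (\<Sum>m\<in>Poly_Mapping.keys g. Poly_Mapping.single m [:Poly_Mapping.lookup g m:])"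
      have "special g' = g"
        unfolding g'_def sp.hom_sum special_single by (simp add: poly_mapping_as_sum[symmetric])
      moreover have "g' \<in> mpolys ideals"
        unfolding g'_def using g by (intro mpolys_sum) (auto simp: mpolys_single_iff mpolys_iff[of g])
      then have "g' * G \<in> ?F" using F G unfolding ideal_mpoly_ring_iff by blast
      ultimately show ?thesis by (intro image_eqI[of _ _ "g' * G"]) (simp_all add: sp.hom_mult G(2))
    qed
  qed
  then show "rel_ideal w \<subseteq> fibre_ideal 0 ?F"
    unfolding rel_ideal_def
  proof (rule genideal_least)
    show "{rel_poly w J K |J K. incomp J K} \<subseteq> fibre_ideal 0 ?F"
    proof
      fix f assume "f \<in> {rel_poly w J K |J K. incomp J K}"
      then obtain J K where "incomp J K" "f = rel_poly w J K" by blast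
      moreover obtain H where "H \<in> ?F" "special H = rel_poly w J K"
        using ex_family_relation[OF u \<open>incomp J K\<close>] by blast
      ultimately show "f \<in> fibre_ideal 0 ?F"
        unfolding fibre_ideal_def by (intro image_eqI[of _ _ H]) simp_all
    qed
  qed
qed

end

hide_const (open) Finite_Cartesian_Product.vec Finite_Cartesian_Product.mat Finite_Cartesian_Product.row
no_notation Finite_Cartesian_Product.vec_nth (infixl "$" 90)

section \<open>Closedness of the Grassmannian in the Pluecker embedding\<close>

section \<open>The Grassmannian as a zero set\<close>

lemma det_mat_ldet:
  "det (mat k k (\<lambda>(i, j). f (Suc i) (Suc j))) = ldet {1..k} f"
proof -
  let ?M = "mat k k (\<lambda>(i, j). f (Suc i) (Suc j))"
  have S: "bij_betw Suc {0..<k} {1..k}"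
    by (rule bij_betw_byWitness[where f'="\<lambda>q. q - 1"]) auto
  have P: "bij_betw Suc {0..<k} {1..k}" "inj_on Suc {0..<k}" using S by (auto simp: bij_betw_def)
  have "bij_betw (map_permutation {0..<k} Suc) {\<pi>. \<pi> permutes {0..<k}} {\<pi>. \<pi> permutes {1..k}}"
  proof (rule bij_betw_byWitness[where f'="map_permutation {1..k} (inv_into {0..<k} Suc)"])
    show "\<forall>\<pi>\<in>{\<pi>. \<pi> permutes {0..<k}}. map_permutation {1..k} (inv_into {0..<k} Suc) (map_permutation {0..<k} Suc \<pi>) = \<pi>"
      using map_permutation_compose_inv[OF S, of _ "inv_into {0..<k} Suc"] P(2) by simp
    show "\<forall>\<pi>\<in>{\<pi>. \<pi> permutes {1..k}}. map_permutation {0..<k} Suc (map_permutation {1..k} (inv_into {0..<k} Suc) \<pi>) = \<pi>"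
      using map_permutation_compose_inv[OF bij_betw_inv_into[OF S], of _ Suc] S
      by (auto simp: bij_betw_def f_inv_into_f)
    show "map_permutation {0..<k} Suc ` {\<pi>. \<pi> permutes {0..<k}} \<subseteq> {\<pi>. \<pi> permutes {1..k}}"
      using map_permutation_permutes[OF S] by auto
    show "map_permutation {1..k} (inv_into {0..<k} Suc) ` {\<pi>. \<pi> permutes {1..k}} \<subseteq> {\<pi>. \<pi> permutes {0..<k}}"
      using map_permutation_permutes[OF bij_betw_inv_into[OF S]] by auto
  qed
  then have "ldet {1..k} f = (\<Sum>\<pi> | \<pi> permutes {0..<k}. of_int (sign (map_permutation {0..<k} Suc \<pi>)) *
      (\<Prod>j\<in>{1..k}. f (map_permutation {0..<k} Suc \<pi> j) j))"
    unfolding ldet_def by (rule sum.reindex_bij_betw[symmetric])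
  also have "\<dots> = (\<Sum>\<pi> | \<pi> permutes {0..<k}. signof \<pi> * (\<Prod>j = 0..<k. ?M $$ (\<pi> j, j)))"
  proof (rule sum.cong[OF refl])
    fix \<pi> assume "\<pi> \<in> {\<pi>. \<pi> permutes {0..<k}}"
    then have \<pi>: "\<pi> permutes {0..<k}" by simp
    have "(\<Prod>j\<in>{1..k}. f (map_permutation {0..<k} Suc \<pi> j) j)
        = (\<Prod>j = 0..<k. f (map_permutation {0..<k} Suc \<pi> (Suc j)) (Suc j))"
      by (rule prod.reindex_bij_betw[OF S, symmetric])
    also have "\<dots> = (\<Prod>j = 0..<k. ?M $$ (\<pi> j, j))"
    proof (rule prod.cong[OF refl])
      fix j assume j: "j \<in> {0..<k}"
      then have "\<pi> j \<in> {0..<k}" using permutes_in_image[OF \<pi>] by blast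
      then show "f (map_permutation {0..<k} Suc \<pi> (Suc j)) (Suc j) = ?M $$ (\<pi> j, j)"
        using j map_permutation_apply[OF P(2) j, of \<pi>] by simp
    qed
    finally show "of_int (sign (map_permutation {0..<k} Suc \<pi>)) * (\<Prod>j\<in>{1..k}. f (map_permutation {0..<k} Suc \<pi> j) j)
        = signof \<pi> * (\<Prod>j = 0..<k. ?M $$ (\<pi> j, j))"
      using sign_map_permutation[OF P(2) \<pi>] by simp
  qed
  also have "\<dots> = det ?M" by (subst mat_det_left_def[of _ k]) auto
  finally show ?thesis ..
qed

definition entries :: "complex mat \<Rightarrow> nat \<Rightarrow> nat \<Rightarrow> complex" where
  "entries A i c = A $$ (i - 1, c - 1)"

lemma pluecker_vector_pl:
  "pluecker_vector k n A a = (if a \<in> pluecker_indices k n then pl k (entries A) a else 0)"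
  unfolding pluecker_vector_def pl_def det_mat_ldet[symmetric]
  by (simp add: enum_def entries_def)

lemma ldet_hom:
  assumes "comm_ring_hom h"
  shows "h (ldet S f) = ldet S (\<lambda>i j. h (f i j))"
proof -
  interpret comm_ring_hom h by fact
  show ?thesis by (simp add: ldet_def hom_distribs)
qed

lemma ldet_scale: "ldet S (\<lambda>i j. c * f i j) = c ^ card S * ldet S f"
  by (simp add: ldet_def sum_distrib_left prod.distrib mult.left_commute)

text \<open>Cramer's rule: the minors on the left are the entries of \<open>adj M * B\<close> for the
  submatrices \<open>M\<close> and \<open>B\<close> with columns \<open>a\<close> and \<open>b\<close>.\<close>

lemma minor_exchange:
  "minor k A a * ldet {1..k} (\<lambda>i j. minor k A (a(i := b j))) = minor k A a ^ k * minor k A b"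
proof (cases "minor k A a = 0")
  case True
  have "k \<noteq> 0"
  proof
    assume "k = 0"
    then have "minor k A a = 1" by (simp add: ldet_def)
    with True show False by simp
  qed
  then show ?thesis using True by simp
next
  case False
  define M where "M = mat k k (\<lambda>(i, j). A (Suc i) (a (Suc j)))"
  define B where "B = mat k k (\<lambda>(i, j). A (Suc i) (b (Suc j)))"
  have c: "M \<in> carrier_mat k k" "B \<in> carrier_mat k k" "adj_mat M \<in> carrier_mat k k"
    "M * adj_mat M = det M \<cdot>\<^sub>m 1\<^sub>m k"
    using adj_mat[of M k] by (auto simp: M_def B_def)
  have dM: "det M = minor k A a" and dB: "det B = minor k A b"
    unfolding M_def B_def using det_mat_ldet[of k "\<lambda>i j. A i (a j)"] det_mat_ldet[of k "\<lambda>i j. A i (b j)"] by simp_all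
  define X where "X = adj_mat M * B"
  have X: "X \<in> carrier_mat k k" using c by (simp add: X_def)
  have MX: "M * X = det M \<cdot>\<^sub>m B"
    unfolding X_def using c by (simp add: assoc_mult_mat[symmetric, of _ k k _ k _ k] mult_smult_assoc_mat[of _ k k _ k])
  have e: "minor k A (a(Suc i := b (Suc j))) = X $$ (i, j)" if ij: "i < k" "j < k" for i j
  proof -
    have x: "col X j \<in> carrier_vec k" using X ij by auto
    have "M *\<^sub>v col X j = det M \<cdot>\<^sub>v col B j"
      using col_mult2[OF c(1) X ij(2)] MX c(2) ij by (metis col_smult carrier_matD(2))
    \<comment> \<open>The replaced column is \<open>det M\<close> times a column of
      \<open>B\<close>. Cramer's rule then yields \<open>det M\<close> on both sides, which
      cancels.\<close>
    then have "replace_col M (M *\<^sub>v col X j) i = mat k k (\<lambda>(r, q). (if q = i then det M else 1) * A (Suc r) ((a(Suc i := b (Suc j))) (Suc q)))"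
      using ij by (intro eq_matI) (auto simp: replace_col_def M_def B_def)
    then have "X $$ (i, j) * det M = det (mat k k (\<lambda>(r, q). (if q = i then det M else 1) * A (Suc r) ((a(Suc i := b (Suc j))) (Suc q))))"
      using cramer_lemma_mat[OF c(1) x ij(1)] X ij by simp
    also have "\<dots> = det (mat k k (\<lambda>(r, q). (\<lambda>r q. (if q = Suc i then det M else 1) * A r ((a(Suc i := b (Suc j))) q)) (Suc r) (Suc q)))"
      by simp
    also have "\<dots> = ldet {1..k} (\<lambda>r q. (if q = Suc i then det M else 1) * A r ((a(Suc i := b (Suc j))) q))"
      by (rule det_mat_ldet)
    also have "\<dots> = (\<Sum>\<pi> | \<pi> permutes {1..k}. det M * (of_int (sign \<pi>) * (\<Prod>q\<in>{1..k}. A (\<pi> q) ((a(Suc i := b (Suc j))) q))))"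
      unfolding ldet_def prod.distrib using ij by (simp add: prod.delta mult_ac)
    also have "\<dots> = det M * minor k A (a(Suc i := b (Suc j)))"
      unfolding ldet_def by (simp add: sum_distrib_left)
    finally show ?thesis using False dM by simp
  qed
  have "ldet {1..k} (\<lambda>i j. minor k A (a(i := b j))) = det X"
  proof -
    have "X = mat k k (\<lambda>(i, j). minor k A (a(Suc i := b (Suc j))))"
      using e X by (intro eq_matI) (auto simp del: fun_upd_apply)
    then show ?thesis using det_mat_ldet[of k "\<lambda>i j. minor k A (a(i := b j))"] by (simp del: fun_upd_apply)
  qed
  then have "minor k A a * ldet {1..k} (\<lambda>i j. minor k A (a(i := b j))) = det (M * X)"
    using det_mult[OF c(1) X] dM by simp
  also have "\<dots> = minor k A a ^ k * minor k A b"
    unfolding MX using c(2) dM dB by (simp add: det_smult)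
  finally show ?thesis .
qed

text \<open>Chosen independently of the matrix, so it can serve as a coefficient of a
  polynomial.\<close>

definition tsgn :: "nat \<Rightarrow> (nat \<Rightarrow> nat) \<Rightarrow> int" where
  "tsgn k t = (SOME e. \<forall>A. minor k A t = of_int e * pl k A (t ` {1..k}))"

lemma tsgn: "inj_on t {1..k} \<Longrightarrow> minor k A t = of_int (tsgn k t) * pl k A (t ` {1..k})"
  using someI_ex[OF minor_eq_pl[of t k]] unfolding tsgn_def by blast

text \<open>Antisymmetry: a repeated column index gives the zero polynomial, matching the vanishing
  minor.\<close>

definition tuple_var :: "nat \<Rightarrow> (nat \<Rightarrow> nat) \<Rightarrow> (nat set, complex) mpoly" where
  "tuple_var k t = (if inj_on t {1..k} then Const (of_int (tsgn k t)) * Var (t ` {1..k}) else 0)"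

definition grV :: "nat \<Rightarrow> nat \<Rightarrow> (nat set \<Rightarrow> complex) set" where
  "grV k n = {\<lambda>a. if a \<in> pluecker_indices k n then c * pl k A a else 0 | c A. True}"

lemma vcone_grV: "vcone (grV k n)"
  unfolding vcone_def
proof (intro ballI allI)
  fix x c assume "x \<in> grV k n"
  then obtain d A where "x = (\<lambda>a. if a \<in> pluecker_indices k n then d * pl k A a else 0)" by (auto simp: grV_def)
  then have "(\<lambda>v. c * x v) = (\<lambda>a. if a \<in> pluecker_indices k n then (c * d) * pl k A a else 0)" by auto
  then show "(\<lambda>v. c * x v) \<in> grV k n" unfolding grV_def by blast
qed

lemma tuple_in_indices: "inj_on t {1..k} \<Longrightarrow> t ` {1..k} \<subseteq> {1..n} \<Longrightarrow> t ` {1..k} \<in> pluecker_indices k n"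
  by (simp add: pluecker_indices_def card_image)

lemma eval_Const_mult: "eval_at x (Const c * f) = c * eval_at x f"
  by (simp add: subst_mult[OF comm_ring_hom_id] subst_Const)

lemma eval_tuple_var:
  assumes t: "t ` {1..k} \<subseteq> {1..n}"
  shows "eval_at (\<lambda>a. if a \<in> pluecker_indices k n then c * pl k A a else 0) (tuple_var k t) = c * minor k A t"
proof (cases "inj_on t {1..k}")
  case True
  then show ?thesis
    using tuple_in_indices[OF True t] tsgn[OF True] by (simp add: tuple_var_def eval_Const_mult subst_Var)
next
  case False
  then show ?thesis using minor_not_inj[OF False] by (simp add: tuple_var_def)
qed

lemma tuple_var_mpolys: "t ` {1..k} \<subseteq> {1..n} \<Longrightarrow> tuple_var k t \<in> mpolys (pluecker_indices k n)"
  using tuple_in_indices[of t k n] by (auto simp: tuple_var_def)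

lemma pluecker_enum: "X \<in> pluecker_indices k n \<Longrightarrow> bij_betw (enum X) {1..k} X \<and> X \<subseteq> {1..n}"
  using enum_bij[of X] finite_subset[of X "{1..n}"] by (auto simp: pluecker_indices_def)

lemma enum_in_range: "X \<in> pluecker_indices k n \<Longrightarrow> q \<in> {1..k} \<Longrightarrow> enum X q \<in> {1..n}"
  using pluecker_enum[of X k n] bij_betwE by blast

text \<open>\<open>minor_exchange\<close> as a polynomial relation. Where the coordinate
  \<open>a\<close> is nonzero it determines all others from those indexed by tuples differing from
  \<open>a\<close> in one position.\<close>

definition exchange_poly :: "nat \<Rightarrow> nat set \<Rightarrow> nat set \<Rightarrow> (nat set, complex) mpoly" where
  "exchange_poly k a b = Var a ^ k * Var b -
     Var a * ldet {1..k} (\<lambda>i j. tuple_var k ((enum a)(i := enum b j)))"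

lemma exchange_tuple_range:
  assumes "a \<in> pluecker_indices k n" "c \<in> {1..n}"
  shows "((enum a)(i := c)) ` {1..k} \<subseteq> {1..n}"
  using enum_in_range[OF assms(1)] assms(2) by auto

lemma eval_exchange_poly:
  "eval_at x (exchange_poly k a b) = x a ^ k * x b -
     x a * ldet {1..k} (\<lambda>i j. eval_at x (tuple_var k ((enum a)(i := enum b j))))"
proof -
  interpret e: comm_ring_hom "eval_at x" by (rule comm_ring_hom_subst[OF comm_ring_hom_id])
  show ?thesis
    unfolding exchange_poly_def
    by (simp add: e.hom_minus e.hom_mult e.hom_power ldet_hom[OF e.comm_ring_hom_axioms] subst_Var)
qed

lemma exchange_poly_in:
  assumes a: "a \<in> pluecker_indices k n" and b: "b \<in> pluecker_indices k n"
  shows "exchange_poly k a b \<in> van (pluecker_indices k n) (grV k n)"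
  unfolding van_iff
proof (intro conjI ballI)
  have bj: "enum b j \<in> {1..n}" if "j \<in> {1..k}" for j
    using enum_in_range[OF b that] .
  have "ldet {1..k} (\<lambda>i j. tuple_var k ((enum a)(i := enum b j))) \<in> mpolys (pluecker_indices k n)"
    unfolding ldet_def
  proof (intro mpolys_sum mpolys_mult mpolys_prod)
    show "of_int (sign \<pi>) \<in> mpolys (pluecker_indices k n)" for \<pi> :: "nat \<Rightarrow> nat"
      by (simp add: sign_def)
    show "tuple_var k ((enum a)(\<pi> j := enum b j)) \<in> mpolys (pluecker_indices k n)" if "j \<in> {1..k}" for \<pi> j
      by (intro tuple_var_mpolys exchange_tuple_range[OF a] bj that)
  qed
  then show "exchange_poly k a b \<in> mpolys (pluecker_indices k n)"
    using a b by (simp add: exchange_poly_def)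
  fix x assume "x \<in> grV k n"
  then obtain c A where x: "x = (\<lambda>a. if a \<in> pluecker_indices k n then c * pl k A a else 0)" by (auto simp: grV_def)
  have "ldet {1..k} (\<lambda>i j. eval_at x (tuple_var k ((enum a)(i := enum b j))))
      = ldet {1..k} (\<lambda>i j. c * minor k A ((enum a)(i := enum b j)))"
    unfolding x by (intro ldet_cong eval_tuple_var exchange_tuple_range[OF a] bj)
  also have "\<dots> = c ^ k * ldet {1..k} (\<lambda>i j. minor k A ((enum a)(i := enum b j)))"
    by (simp add: ldet_scale)
  finally have "eval_at x (exchange_poly k a b) = (c * pl k A a) ^ k * (c * pl k A b) -
      c * c ^ k * (pl k A a * ldet {1..k} (\<lambda>i j. minor k A ((enum a)(i := enum b j))))"
    unfolding eval_exchange_poly using a b by (simp add: x mult_ac)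
  also have "\<dots> = 0"
    unfolding pl_def minor_exchange by (simp add: power_mult_distrib mult_ac)
  finally show "eval_at x (exchange_poly k a b) = 0" .
qed

lemma zero_set_grV:
  "zero_set (pluecker_indices k n) (van (pluecker_indices k n) (grV k n)) = lines (grV k n)"
proof (intro equalityI subsetI)
  let ?V = "pluecker_indices k n"
  fix L assume "L \<in> zero_set ?V (van ?V (grV k n))"
  then obtain x a where x: "L = line x" "\<And>v. v \<notin> ?V \<Longrightarrow> x v = 0" "x a \<noteq> 0"
    "\<And>f. f \<in> van ?V (grV k n) \<Longrightarrow> eval_at x f = 0"
    unfolding zero_set_vanishing_ideal[OF vcone_grV] by blast
  have a: "a \<in> ?V" using x(2,3) by blast
  \<comment> \<open>The matrix of the affine chart where the coordinate \<open>a\<close> is nonzero;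
    the exchange relations say that its minors, times \<open>x a\<close>, are the coordinates of
    \<open>x\<close>.\<close>
  define A where "A i c = eval_at x (tuple_var k ((enum a)(i := c))) / x a" for i c
  have "x b = x a * pl k A b" if b: "b \<in> ?V" for b
  proof -
    have "0 = eval_at x (exchange_poly k a b)" using x(4)[OF exchange_poly_in[OF a b]] by simp
    also have "\<dots> = x a ^ k * x b - x a * ldet {1..k} (\<lambda>i j. x a * A i (enum b j))"
      unfolding eval_exchange_poly A_def using x(3) by simp
    also have "\<dots> = x a ^ k * (x b - x a * pl k A b)"
      by (simp add: ldet_scale pl_def algebra_simps)
    finally show ?thesis using x(3) by simp
  qed
  then have "x = (\<lambda>b. if b \<in> ?V then x a * pl k A b else 0)" using x(2) by auto
  then have "x \<in> grV k n" unfolding grV_def by blast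
  then show "L \<in> lines (grV k n)" using x(1,3) by (auto simp: lines_def)
next
  fix L assume "L \<in> lines (grV k n)"
  then obtain x u where x: "L = line x" "x \<in> grV k n" "x u \<noteq> 0" by (auto simp: lines_def)
  show "L \<in> zero_set (pluecker_indices k n) (van (pluecker_indices k n) (grV k n))"
    unfolding x(1)
  proof (rule line_in_zero_set_van[where u = u, OF vcone_grV])
    show "x u \<noteq> 0" by (rule x(3))
    show "x v = 0" if "v \<notin> pluecker_indices k n" for v using x(2) that by (auto simp: grV_def)
    show "eval_at x f = 0" if "f \<in> van (pluecker_indices k n) (grV k n)" for f
      using that x(2) by (simp add: van_iff)
  qed
qed

section \<open>Rank and maximal minors\<close>

text \<open>Linear independence is stated for the set of columns, so repeated columns are excluded
  first: by the rank bound in one direction, by a difference of unit vectors in the other.\<close>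

lemma (in vec_space) rank_full_iff_kernel:
  assumes A: "A \<in> carrier_mat n nc"
  shows "rank A = nc \<longleftrightarrow> (\<forall>v\<in>carrier_vec nc. A *\<^sub>v v = 0\<^sub>v n \<longrightarrow> v = 0\<^sub>v nc)"
proof
  assume r: "rank A = nc"
  have "distinct (cols A)"
  proof -
    let ?B = "mat_of_cols n (remdups (cols A))"
    have cB: "set (cols A) \<subseteq> carrier_vec n" using cols_dim[of A] A by simp
    then have "cols ?B = remdups (cols A)" by (intro cols_mat_of_cols) simp
    then have "rank ?B = rank A" by (simp add: rank_def)
    moreover have "rank ?B \<le> length (remdups (cols A))" by (rule rank_le_nc) simp
    ultimately have "length (cols A) \<le> card (set (cols A))" using r A by (simp add: length_remdups_card_conv)
    then show ?thesis using card_length[of "cols A"] by (intro card_distinct) simp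
  qed
  then show "\<forall>v\<in>carrier_vec nc. A *\<^sub>v v = 0\<^sub>v n \<longrightarrow> v = 0\<^sub>v nc"
    using full_rank_lin_indpt[OF A r] lin_depI[OF A] by blast
next
  assume ker: "\<forall>v\<in>carrier_vec nc. A *\<^sub>v v = 0\<^sub>v n \<longrightarrow> v = 0\<^sub>v nc"
  have d: "distinct (cols A)"
    unfolding distinct_conv_nth
  proof (intro allI impI)
    fix i j assume ij: "i < length (cols A)" "j < length (cols A)" "i \<noteq> j"
    then have ij': "i < nc" "j < nc" using A by simp_all
    show "cols A ! i \<noteq> cols A ! j"
    proof
      assume "cols A ! i = cols A ! j"
      then have eq: "col A i = col A j" using ij' A by simp
      let ?v = "unit_vec nc i - unit_vec nc j :: 'a Matrix.vec"
      have "A *\<^sub>v ?v = 0\<^sub>v n"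
      proof (rule eq_vecI)
        fix r assume "r < dim_vec (0\<^sub>v n)"
        then have r: "r < n" by simp
        have "scalar_prod (Matrix.row A r) ?v = scalar_prod (Matrix.row A r) (unit_vec nc i) - scalar_prod (Matrix.row A r) (unit_vec nc j)"
          using A r by (intro scalar_prod_minus_distrib[of _ nc]) auto
        also have "\<dots> = A $$ (r, i) - A $$ (r, j)" using A r ij' by simp
        also have "\<dots> = col A i $ r - col A j $ r" using A r ij' by simp
        finally show "(A *\<^sub>v ?v) $ r = 0\<^sub>v n $ r" using A r eq by simp
      qed (use A in simp)
      then have "?v = 0\<^sub>v nc" using ker by simp
      then have "?v $ i = 0" using ij' by simp
      then show False using ij' ij(3) by simp
    qed
  qed
  have "lin_indpt (set (cols A))" using lin_depE[OF A _ d] ker by blast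
  then show "rank A = nc" by (rule lin_indpt_full_rank[OF A d])
qed

text \<open>Multilinearity in the columns: the Cauchy-Binet formula before tuples with the same set
  of columns are collected.\<close>

lemma ldet_product_expand:
  fixes A :: "nat \<Rightarrow> nat \<Rightarrow> complex"
  shows "ldet {1..k} (\<lambda>i j. \<Sum>c\<in>{1..n}. A i c * B j c) =
    (\<Sum>f\<in>{1..k} \<rightarrow>\<^sub>E {1..n}. (\<Prod>j\<in>{1..k}. B j (f j)) * minor k A f)"
proof -
  have "ldet {1..k} (\<lambda>i j. \<Sum>c\<in>{1..n}. A i c * B j c) = (\<Sum>\<pi> | \<pi> permutes {1..k}. of_int (sign \<pi>) *
      (\<Sum>f\<in>{1..k} \<rightarrow>\<^sub>E {1..n}. \<Prod>j\<in>{1..k}. A (\<pi> j) (f j) * B j (f j)))"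
    unfolding ldet_def by (subst prod_sum_PiE) auto
  also have "\<dots> = (\<Sum>f\<in>{1..k} \<rightarrow>\<^sub>E {1..n}. \<Sum>\<pi> | \<pi> permutes {1..k}. of_int (sign \<pi>) *
      (\<Prod>j\<in>{1..k}. A (\<pi> j) (f j) * B j (f j)))"
    unfolding sum_distrib_left by (rule sum.swap)
  finally show ?thesis
    unfolding ldet_def by (simp add: prod.distrib sum_distrib_left mult_ac)
qed

text \<open>If the rows of \<open>A\<close> are independent, the Gram matrix of \<open>A\<close> is invertible, and
  by the Cauchy--Binet expansion some maximal minor does not vanish.\<close>

lemma ex_nonzero_minor:
  assumes A: "A \<in> carrier_mat k n" and ker: "\<forall>v\<in>carrier_vec k. A\<^sup>T *\<^sub>v v = 0\<^sub>v n \<longrightarrow> v = 0\<^sub>v k"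
  shows "\<exists>a\<in>pluecker_indices k n. pl k (entries A) a \<noteq> 0"
proof -
  define G where "G = mat k k (\<lambda>(i, j). \<Sum>c\<in>{1..n}. entries A (Suc i) c * cnj (entries A (Suc j) c))"
  have G: "G \<in> carrier_mat k k" by (simp add: G_def)
  have Gij: "G $$ (i, j) = (\<Sum>c<n. A $$ (i, c) * cnj (A $$ (j, c)))" if "i < k" "j < k" for i j
    using that unfolding G_def entries_def
    by (simp, intro sum.reindex_bij_witness[of _ Suc "\<lambda>c. c - 1"]) auto
  have "det G \<noteq> 0"
  proof
    assume "det G = 0"
    then obtain v where v: "v \<in> carrier_vec k" "v \<noteq> 0\<^sub>v k" "G *\<^sub>v v = 0\<^sub>v k"
      using det_0_iff_vec_prod_zero_field[OF G] by auto
    \<comment> \<open>The conjugate transpose of \<open>A\<close> applied to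
      \<open>v\<close>.\<close>
    define y where "y c = (\<Sum>j<k. cnj (A $$ (j, c)) * v $ j)" for c
    have "(\<Sum>c<n. A $$ (i, c) * y c) = 0" if i: "i < k" for i
    proof -
      have "(\<Sum>c<n. A $$ (i, c) * y c) = (\<Sum>j<k. \<Sum>c<n. A $$ (i, c) * cnj (A $$ (j, c)) * v $ j)"
        unfolding y_def sum_distrib_left by (subst sum.swap) (simp add: mult.assoc)
      also have "\<dots> = (\<Sum>j<k. G $$ (i, j) * v $ j)" using Gij i by (simp add: sum_distrib_right)
      also have "\<dots> = (G *\<^sub>v v) $ i"
        using G v(1) i by (simp add: scalar_prod_def lessThan_atLeast0)
      finally show ?thesis using v(3) i by simp
    qed
    \<comment> \<open>The Hermitian form of \<open>G\<close> at \<open>v\<close> is the squared norm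
      of \<open>y\<close>, so \<open>y = 0\<close>; conjugating gives a kernel vector of the
      transpose of \<open>A\<close>.\<close>
    then have "0 = (\<Sum>i<k. cnj (v $ i) * (\<Sum>c<n. A $$ (i, c) * y c))" by simp
    also have "\<dots> = (\<Sum>c<n. cnj (y c) * y c)"
    proof -
      have "cnj (y c) = (\<Sum>i<k. A $$ (i, c) * cnj (v $ i))" for c
        by (simp add: y_def)
      then show ?thesis
        unfolding sum_distrib_left sum_distrib_right by (subst sum.swap) (simp add: mult_ac sum_distrib_left)
    qed
    also have "\<dots> = of_real (\<Sum>c<n. (cmod (y c))\<^sup>2)"
      unfolding of_real_sum complex_norm_square by (simp add: mult.commute)
    finally have "(\<Sum>c<n. (cmod (y c))\<^sup>2) = 0" by (metis of_real_eq_0_iff)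
    then have y0: "y c = 0" if "c < n" for c using that by (subst (asm) sum_nonneg_eq_0_iff) auto
    let ?w = "vec k (\<lambda>j. cnj (v $ j))"
    have "A\<^sup>T *\<^sub>v ?w = 0\<^sub>v n"
    proof (rule eq_vecI)
      fix c assume "c < dim_vec (0\<^sub>v n)"
      then have c: "c < n" by simp
      then have "(A\<^sup>T *\<^sub>v ?w) $ c = cnj (y c)"
        using A by (simp add: scalar_prod_def y_def lessThan_atLeast0)
      then show "(A\<^sup>T *\<^sub>v ?w) $ c = 0\<^sub>v n $ c" using y0 c by simp
    qed (use A in simp)
    then have "?w = 0\<^sub>v k" using ker by simp
    have "v = 0\<^sub>v k"
    proof (rule eq_vecI)
      fix j assume "j < dim_vec (0\<^sub>v k)"
      then have "j < k" by simp
      then have "cnj (v $ j) = 0" using arg_cong[OF \<open>?w = 0\<^sub>v k\<close>, of "\<lambda>u. u $ j"] by simp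
      then show "v $ j = 0\<^sub>v k $ j" using \<open>j < k\<close> by simp
    qed (use v in simp)
    with v(2) show False by simp
  qed
  moreover have "det G = (\<Sum>f\<in>{1..k} \<rightarrow>\<^sub>E {1..n}. (\<Prod>j\<in>{1..k}. cnj (entries A j (f j))) * minor k (entries A) f)"
    unfolding G_def
    by (rule trans[OF det_mat_ldet[of k "\<lambda>i j. \<Sum>c\<in>{1..n}. entries A i c * cnj (entries A j c)"] ldet_product_expand])
  ultimately obtain f where f: "f \<in> {1..k} \<rightarrow>\<^sub>E {1..n}" "minor k (entries A) f \<noteq> 0"
    by (metis (no_types, lifting) mult_zero_right sum.neutral)
  then have inj: "inj_on f {1..k}" using minor_not_inj by blast
  then have "f ` {1..k} \<in> pluecker_indices k n" using f(1) by (intro tuple_in_indices) auto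
  moreover have "pl k (entries A) (f ` {1..k}) \<noteq> 0" using f(2) tsgn[OF inj, of "entries A"] by auto
  ultimately show ?thesis by blast
qed

text \<open>The transpose of the square submatrix on the columns \<open>a\<close> kills
  \<open>v\<close>, and its determinant is the given minor.\<close>

lemma kernel_trivial_of_minor:
  assumes A: "A \<in> carrier_mat k n" and a: "a \<in> pluecker_indices k n" and nz: "pl k (entries A) a \<noteq> 0"
    and v: "v \<in> carrier_vec k" "A\<^sup>T *\<^sub>v v = 0\<^sub>v n"
  shows "v = 0\<^sub>v k"
proof (rule ccontr)
  assume v0: "v \<noteq> 0\<^sub>v k"
  define B where "B = mat k k (\<lambda>(i, j). entries A (Suc i) (enum a (Suc j)))"
  have B: "B \<in> carrier_mat k k" "B\<^sup>T \<in> carrier_mat k k" by (simp_all add: B_def)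
  have "B\<^sup>T *\<^sub>v v = 0\<^sub>v k"
  proof (rule eq_vecI)
    fix j assume "j < dim_vec (0\<^sub>v k)"
    then have j: "j < k" by simp
    have "enum a (Suc j) \<in> {1..n}" using enum_in_range[OF a] j by simp
    then have c: "enum a (Suc j) - 1 < n" by auto
    have "(B\<^sup>T *\<^sub>v v) $ j = (A\<^sup>T *\<^sub>v v) $ (enum a (Suc j) - 1)"
      using j c A v(1) by (simp add: B_def entries_def scalar_prod_def)
    then show "(B\<^sup>T *\<^sub>v v) $ j = 0\<^sub>v k $ j" using v(2) c j by simp
  qed (simp add: B_def)
  then have "det (B\<^sup>T) = 0" using det_0_iff_vec_prod_zero_field[OF B(2)] v(1) v0 by blast
  moreover have "det B = pl k (entries A) a" unfolding B_def pl_def by (rule det_mat_ldet[of k "\<lambda>i j. entries A i (enum a j)"])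
  ultimately show False using nz det_transpose[OF B(1)] by simp
qed

lemma dim_row_space_iff:
  assumes A: "A \<in> carrier_mat k n"
  shows "vec_space.row_space n A \<in> grassmannian k n \<longleftrightarrow> (\<exists>a\<in>pluecker_indices k n. pl k (entries A) a \<noteq> 0)"
proof -
  interpret vec_space "TYPE(complex)" n .
  have AT: "A\<^sup>T \<in> carrier_mat n k" using A by simp
  have "VectorSpace.subspace class_ring (row_space A) V"
    unfolding row_space_def by (rule span_is_subspace) (use A rows_carrier[of A] in auto)
  then have "row_space A \<in> grassmannian k n \<longleftrightarrow> rank A\<^sup>T = k"
    unfolding grassmannian_def rank_def row_space_def by simp
  also have "\<dots> \<longleftrightarrow> (\<forall>v\<in>carrier_vec k. A\<^sup>T *\<^sub>v v = 0\<^sub>v n \<longrightarrow> v = 0\<^sub>v k)" by (rule rank_full_iff_kernel[OF AT])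
  also have "\<dots> \<longleftrightarrow> (\<exists>a\<in>pluecker_indices k n. pl k (entries A) a \<noteq> 0)"
    using ex_nonzero_minor[OF A] kernel_trivial_of_minor[OF A] by blast
  finally show ?thesis .
qed

lemma pl_cong: "a \<in> pluecker_indices k n \<Longrightarrow> (\<And>i c. i \<in> {1..k} \<Longrightarrow> c \<in> {1..n} \<Longrightarrow> A i c = B i c) \<Longrightarrow> pl k A a = pl k B a"
  unfolding pl_def using enum_in_range[of a k n] by (intro ldet_cong) blast

lemma grassmannian_variety_lines: "grassmannian_variety k n = lines (grV k n)"
proof (intro equalityI subsetI)
  fix L assume "L \<in> grassmannian_variety k n"
  then obtain A where A: "A \<in> carrier_mat k n" "vec_space.row_space n A \<in> grassmannian k n" "L = line (pluecker_vector k n A)"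
    by (auto simp: grassmannian_variety_def)
  then obtain a where a: "a \<in> pluecker_indices k n" "pl k (entries A) a \<noteq> 0" using dim_row_space_iff by blast
  have "pluecker_vector k n A = (\<lambda>a. if a \<in> pluecker_indices k n then 1 * pl k (entries A) a else 0)"
    by (auto simp: pluecker_vector_pl)
  then have "pluecker_vector k n A \<in> grV k n" unfolding grV_def by blast
  moreover have "pluecker_vector k n A a \<noteq> 0" using a by (simp add: pluecker_vector_pl)
  ultimately show "L \<in> lines (grV k n)" using A(3) by (auto simp: lines_def)
next
  fix L assume "L \<in> lines (grV k n)"
  then obtain c A u where L: "L = line (\<lambda>a. if a \<in> pluecker_indices k n then c * pl k A a else 0)"
    and u: "(if u \<in> pluecker_indices k n then c * pl k A u else 0) \<noteq> 0"
    by (auto simp: lines_def grV_def)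
  define M where "M = mat k n (\<lambda>(i, j). A (Suc i) (Suc j))"
  have M: "M \<in> carrier_mat k n" by (simp add: M_def)
  have pm: "pl k (entries M) a = pl k A a" if "a \<in> pluecker_indices k n" for a
    by (rule pl_cong[OF that]) (auto simp: entries_def M_def)
  have u': "u \<in> pluecker_indices k n" "c \<noteq> 0" "pl k A u \<noteq> 0" using u by (auto split: if_splits)
  have "(\<lambda>a. if a \<in> pluecker_indices k n then c * pl k A a else 0) = (\<lambda>a. c * pluecker_vector k n M a)"
    using pm by (auto simp: pluecker_vector_pl)
  then have "L = line (pluecker_vector k n M)" unfolding L using line_scale[OF u'(2)] by simp
  moreover have "vec_space.row_space n M \<in> grassmannian k n"
    unfolding dim_row_space_iff[OF M] using u' pm[OF u'(1)] by (intro bexI[of _ u]) simp_all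
  ultimately show "L \<in> grassmannian_variety k n" using M unfolding grassmannian_variety_def by blast
qed

section \<open>Transport between ideal variables and Pluecker variables\<close>

section \<open>Relabelling variables\<close>

definition relab :: "('v \<Rightarrow> 'w) \<Rightarrow> ('v \<Rightarrow> int) \<Rightarrow> ('v, 'a::comm_ring_1) mpoly \<Rightarrow> ('w, 'a) mpoly" where
  "relab \<beta> s = subst Const (\<lambda>v. Const (of_int (s v)) * Var (\<beta> v))"

text \<open>The transpose of \<open>relab\<close> on points. Coordinates outside \<open>L\<close>
  are 0, as \<open>proj_space\<close> requires.\<close>

definition pull :: "'v set \<Rightarrow> ('v \<Rightarrow> 'w) \<Rightarrow> ('v \<Rightarrow> int) \<Rightarrow> ('w \<Rightarrow> complex) \<Rightarrow> 'v \<Rightarrow> complex" where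
  "pull L \<beta> s x v = (if v \<in> L then of_int (s v) * x (\<beta> v) else 0)"

definition pmap :: "('v \<Rightarrow> 'w) \<Rightarrow> ('v \<Rightarrow>\<^sub>0 nat) \<Rightarrow> ('w \<Rightarrow>\<^sub>0 nat)" where
  "pmap \<beta> m = (\<Sum>v\<in>Poly_Mapping.keys m. Poly_Mapping.single (\<beta> v) (Poly_Mapping.lookup m v))"

lemma comm_ring_hom_relab: "comm_ring_hom (relab \<beta> s)"
  unfolding relab_def by (rule comm_ring_hom_subst[OF comm_ring_hom_Const])

lemma hom_of_int':
  assumes "comm_ring_hom h"
  shows "h (of_int i) = of_int i"
proof -
  interpret comm_ring_hom h by fact
  show ?thesis by (rule hom_of_int)
qed

lemma subst_relab:
  assumes "comm_ring_hom h"
  shows "subst h x (relab \<beta> s f) = subst h (\<lambda>v. of_int (s v) * x (\<beta> v)) f"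
proof -
  interpret comm_ring_hom h by fact
  show ?thesis
    unfolding relab_def subst_subst_Const[OF assms]
    by (simp add: subst_mult[OF assms] subst_Const subst_Var hom_of_int'[OF assms])
qed

lemma relab_Var: "relab \<beta> s (Var v) = Const (of_int (s v)) * Var (\<beta> v)"
  by (simp add: relab_def subst_Var Const_1)

lemma relab_Const: "relab \<beta> s (Const c) = Const c"
  by (simp add: relab_def subst_Const)

lemma relab_fibre:
  "subst (\<lambda>p. Const (poly p 0)) Var (relab \<beta> s F) = relab \<beta> s (subst (\<lambda>p. Const (poly p 0)) Var F)"
proof -
  have h: "comm_ring_hom (\<lambda>p. Const (poly p 0))" by (rule comm_ring_homs(4))
  have "relab \<beta> s (subst (\<lambda>p. Const (poly p 0)) Var F) = subst (\<lambda>p. Const (poly p 0)) (\<lambda>v. Const (of_int (s v)) * Var (\<beta> v)) F"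
    unfolding hom_subst[OF comm_ring_hom_relab] relab_Var relab_Const ..
  then show ?thesis
    unfolding subst_relab[OF h] hom_of_int'[OF comm_ring_hom_Const] by simp
qed

lemma pmap_weight: "monomial_weight w (pmap \<beta> m) = monomial_weight (\<lambda>v. w (\<beta> v)) m"
proof -
  have "monomial_weight w (\<Sum>v\<in>S. Poly_Mapping.single (\<beta> v) (Poly_Mapping.lookup m v))
      = (\<Sum>v\<in>S. w (\<beta> v) * real (Poly_Mapping.lookup m v))" for S
    by (induction S rule: infinite_finite_induct) auto
  then show ?thesis by (simp add: pmap_def monomial_weight_def[of _ m])
qed

lemma pmap_mdeg: "mdeg (pmap \<beta> m) = mdeg m"
proof -
  have "mdeg (\<Sum>v\<in>S. Poly_Mapping.single (\<beta> v) (Poly_Mapping.lookup m v)) = (\<Sum>v\<in>S. Poly_Mapping.lookup m v)" for S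
    by (induction S rule: infinite_finite_induct) auto
  then show ?thesis by (simp add: pmap_def mdeg_def[of m])
qed

lemma relab_single:
  fixes c :: "'a::comm_ring_1"
  shows "relab \<beta> s (Poly_Mapping.single m c) = Poly_Mapping.single (pmap \<beta> m) (c * of_int (mono_eval s m))"
proof -
  have h: "comm_ring_hom (of_int :: int \<Rightarrow> 'a)" by unfold_locales auto
  have 1: "mono_eval (\<lambda>v. Const (of_int (s v)) * Var (\<beta> v)) m = Const (mono_eval (\<lambda>v. of_int (s v)) m) * mono_eval (\<lambda>v. Var (\<beta> v)) m"
    unfolding mono_eval_scale hom_mono_eval[OF comm_ring_hom_Const] ..
  have 2: "(\<Prod>v\<in>S. Var (\<beta> v) ^ Poly_Mapping.lookup m v)
    = Poly_Mapping.single (\<Sum>v\<in>S. Poly_Mapping.single (\<beta> v) (Poly_Mapping.lookup m v)) (1::'a)" for S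
  proof (induction S rule: infinite_finite_induct)
    case (insert v S)
    have "Var (\<beta> v) ^ j = Poly_Mapping.single (Poly_Mapping.single (\<beta> v) j) (1::'a)" for j
      using mono_eval_Var[of "Poly_Mapping.single (\<beta> v) j"] by simp
    with insert show ?case by (simp add: mult_single)
  qed auto
  have "mono_eval (\<lambda>v. Var (\<beta> v)) m = Poly_Mapping.single (pmap \<beta> m) (1::'a)"
    unfolding mono_eval_def pmap_def by (rule 2)
  then show ?thesis
    unfolding relab_def subst_single[of Const, OF Const_0] 1
    by (simp add: Const_mult_single hom_mono_eval[OF h])
qed

lemma line_range: "line x = range (\<lambda>c v. c * x v)"
  by (auto simp: line_def)

text \<open>The signs square to 1, so the inverse data again form a relabelling; the converse
  inclusions below come from this symmetry.\<close>

locale relabelling =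
  fixes L :: "'v set" and V :: "'w set" and \<beta> :: "'v \<Rightarrow> 'w" and \<gamma> :: "'w \<Rightarrow> 'v" and s :: "'v \<Rightarrow> int"
  assumes \<beta>: "v \<in> L \<Longrightarrow> \<beta> v \<in> V" and \<gamma>: "a \<in> V \<Longrightarrow> \<gamma> a \<in> L"
    and \<gamma>\<beta>: "v \<in> L \<Longrightarrow> \<gamma> (\<beta> v) = v" and \<beta>\<gamma>: "a \<in> V \<Longrightarrow> \<beta> (\<gamma> a) = a"
    and ss: "v \<in> L \<Longrightarrow> s v * s v = 1"
begin

lemma inverse: "relabelling V L \<gamma> \<beta> (\<lambda>a. s (\<gamma> a))"
  by unfold_locales (simp_all add: \<beta> \<gamma> \<gamma>\<beta> \<beta>\<gamma> ss)

lemma relab_mpolys: "f \<in> mpolys L \<Longrightarrow> relab \<beta> s f \<in> mpolys V"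
  unfolding relab_def by (rule mpolys_subst) (auto simp: \<beta>)

lemma relab_inverse:
  assumes f: "f \<in> mpolys L"
  shows "relab \<gamma> (\<lambda>a. s (\<gamma> a)) (relab \<beta> s f) = f"
proof -
  have "relab \<gamma> (\<lambda>a. s (\<gamma> a)) (relab \<beta> s f)
      = subst Const (\<lambda>v. Const (of_int (s v)) * (Const (of_int (s (\<gamma> (\<beta> v)))) * Var (\<gamma> (\<beta> v)))) f"
    unfolding relab_def[of \<gamma>] subst_relab[OF comm_ring_hom_Const] hom_of_int'[OF comm_ring_hom_Const] ..
  also have "\<dots> = subst Const Var f"
  proof (rule subst_cong[OF f])
    fix v assume v: "v \<in> L"
    interpret c: comm_ring_hom "Const :: 'a \<Rightarrow> ('v, 'a) mpoly" by (rule comm_ring_hom_Const)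
    have "Const (of_int (s v)) * Const (of_int (s v)) = (Const (of_int (s v * s v)) :: ('v, 'a) mpoly)"
      unfolding of_int_mult c.hom_mult ..
    also have "\<dots> = 1" using ss[OF v] by (simp add: Const_1)
    finally show "Const (of_int (s v)) * (Const (of_int (s (\<gamma> (\<beta> v)))) * Var (\<gamma> (\<beta> v))) = (Var v :: ('v, 'a) mpoly)"
      using v by (simp add: \<gamma>\<beta> mult.assoc[symmetric])
  qed
  finally show ?thesis by (simp add: subst_Const_Var)
qed

lemma relab_inverse':
  assumes g: "g \<in> mpolys V"
  shows "relab \<beta> s (relab \<gamma> (\<lambda>a. s (\<gamma> a)) g) = g"
proof -
  interpret inv: relabelling V L \<gamma> \<beta> "\<lambda>a. s (\<gamma> a)" by (rule inverse)
  have "relab \<beta> s f = relab \<beta> (\<lambda>v. s (\<gamma> (\<beta> v))) f" if "f \<in> mpolys L" for f :: "('v, 'a) mpoly"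
    unfolding relab_def by (rule subst_cong[OF that]) (simp add: \<gamma>\<beta>)
  then show ?thesis using inv.relab_inverse[OF g] inv.relab_mpolys[OF g] by simp
qed

lemma inv_relab_mpolys: "g \<in> mpolys V \<Longrightarrow> relab \<gamma> (\<lambda>a. s (\<gamma> a)) g \<in> mpolys L"
  by (rule relabelling.relab_mpolys[OF inverse])

lemma eval_relab:
  assumes "f \<in> mpolys L"
  shows "eval_at x (relab \<beta> s f) = eval_at (pull L \<beta> s x) f"
  unfolding subst_relab[OF comm_ring_hom_id] by (rule subst_cong[OF assms]) (simp add: pull_def)

lemma pull_inverse: "(\<And>v. v \<notin> L \<Longrightarrow> y v = 0) \<Longrightarrow> pull L \<beta> s (pull V \<gamma> (\<lambda>a. s (\<gamma> a)) y) = y"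
proof
  fix v assume y: "\<And>v. v \<notin> L \<Longrightarrow> y v = 0"
  show "pull L \<beta> s (pull V \<gamma> (\<lambda>a. s (\<gamma> a)) y) v = y v"
  proof (cases "v \<in> L")
    case True
    have "of_int (s v) * (of_int (s v) * y v) = of_int (s v * s v) * y v" by simp
    then show ?thesis using True ss[OF True] by (simp add: pull_def \<beta> \<gamma>\<beta>)
  next
    case False
    then show ?thesis using y by (simp add: pull_def)
  qed
qed

lemma pull_inverse':
  assumes "\<And>a. a \<notin> V \<Longrightarrow> x a = 0"
  shows "pull V \<gamma> (\<lambda>a. s (\<gamma> a)) (pull L \<beta> s x) = x"
proof
  fix a
  show "pull V \<gamma> (\<lambda>a. s (\<gamma> a)) (pull L \<beta> s x) a = x a"
  proof (cases "a \<in> V")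
    case True
    have "of_int (s (\<gamma> a)) * (of_int (s (\<gamma> a)) * x a) = of_int (s (\<gamma> a) * s (\<gamma> a)) * x a" by simp
    then show ?thesis using True ss[OF \<gamma>[OF True]] by (simp add: pull_def \<gamma> \<beta>\<gamma>)
  next
    case False
    then show ?thesis using assms by (simp add: pull_def)
  qed
qed

lemma relab_van: "relab \<beta> s ` van L (pull L \<beta> s ` \<Omega>) = van V \<Omega>"
proof (intro equalityI subsetI)
  fix g assume "g \<in> relab \<beta> s ` van L (pull L \<beta> s ` \<Omega>)"
  then show "g \<in> van V \<Omega>" by (auto simp: van_iff relab_mpolys eval_relab)
next
  fix g assume g: "g \<in> van V \<Omega>"
  let ?f = "relab \<gamma> (\<lambda>a. s (\<gamma> a)) g"
  have gV: "g \<in> mpolys V" using g by (simp add: van_iff)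
  then have f: "?f \<in> mpolys L" "relab \<beta> s ?f = g" by (simp_all add: inv_relab_mpolys relab_inverse')
  then have "?f \<in> van L (pull L \<beta> s ` \<Omega>)" using g by (auto simp: van_iff simp flip: eval_relab)
  then show "g \<in> relab \<beta> s ` van L (pull L \<beta> s ` \<Omega>)" using f(2) by (metis imageI)
qed

lemma relab_weight_family:
  "relab \<beta> s ` weight_family L (pull L \<beta> s ` \<Omega>) u = weight_family V \<Omega> (\<lambda>a. u (\<gamma> a))"
proof -
  have iff: "relab \<beta> s F \<in> weight_family V \<Omega> (\<lambda>a. u (\<gamma> a)) \<longleftrightarrow> F \<in> weight_family L (pull L \<beta> s ` \<Omega>) u"
    if F: "F \<in> mpolys L" for F
  proof -
    have "subst (\<lambda>p. p) (\<lambda>a. monom (x a) (u (\<gamma> a))) (relab \<beta> s F)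
        = subst (\<lambda>p. p) (\<lambda>v. monom (pull L \<beta> s x v) (u v)) F" for x
      unfolding subst_relab[OF comm_ring_hom_id]
    proof (rule subst_cong[OF F])
      fix v assume v: "v \<in> L"
      show "of_int (s v) * monom (x (\<beta> v)) (u (\<gamma> (\<beta> v))) = monom (pull L \<beta> s x v) (u v)"
        using v by (simp add: pull_def \<gamma>\<beta> of_int_poly smult_monom)
    qed
    then show ?thesis using F by (simp add: weight_family_iff relab_mpolys)
  qed
  show ?thesis
  proof (intro equalityI subsetI)
    fix G assume "G \<in> relab \<beta> s ` weight_family L (pull L \<beta> s ` \<Omega>) u"
    then show "G \<in> weight_family V \<Omega> (\<lambda>a. u (\<gamma> a))" using iff vanishing_ideal_mpolys by blast
  next
    fix G assume G: "G \<in> weight_family V \<Omega> (\<lambda>a. u (\<gamma> a))"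
    let ?F = "relab \<gamma> (\<lambda>a. s (\<gamma> a)) G"
    have "?F \<in> mpolys L" "relab \<beta> s ?F = G"
      using vanishing_ideal_mpolys[OF G] by (simp_all add: inv_relab_mpolys relab_inverse')
    then show "G \<in> relab \<beta> s ` weight_family L (pull L \<beta> s ` \<Omega>) u" using iff G by (metis imageI)
  qed
qed

lemma relab_fibre_ideal:
  "fibre_ideal 0 (weight_family V \<Omega> (\<lambda>a. u (\<gamma> a))) = relab \<beta> s ` fibre_ideal 0 (weight_family L (pull L \<beta> s ` \<Omega>) u)"
  unfolding fibre_ideal_def relab_weight_family[symmetric] image_image relab_fibre ..

lemma pmap_inj:
  assumes "Poly_Mapping.keys m \<subseteq> L" "Poly_Mapping.keys m' \<subseteq> L" "pmap \<beta> m = pmap \<beta> m'"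
  shows "m = m'"
proof (rule poly_mapping_eqI)
  have l: "Poly_Mapping.lookup (pmap \<beta> m) (\<beta> v) = Poly_Mapping.lookup m v"
    if m: "Poly_Mapping.keys m \<subseteq> L" and v: "v \<in> L" for m v
  proof -
    have "Poly_Mapping.lookup (pmap \<beta> m) (\<beta> v) = (\<Sum>u\<in>Poly_Mapping.keys m. if u = v then Poly_Mapping.lookup m u else 0)"
      unfolding pmap_def lookup_sum lookup_single
    proof (rule sum.cong[OF refl])
      fix u assume "u \<in> Poly_Mapping.keys m"
      then have "\<beta> u = \<beta> v \<longleftrightarrow> u = v" using m v \<gamma>\<beta> by (metis subsetD)
      then show "(Poly_Mapping.lookup m u when \<beta> u = \<beta> v) = (if u = v then Poly_Mapping.lookup m u else 0)"
        by (simp add: when_def)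
    qed
    also have "\<dots> = Poly_Mapping.lookup m v" by (simp add: in_keys_iff)
    finally show ?thesis .
  qed
  fix v
  show "Poly_Mapping.lookup m v = Poly_Mapping.lookup m' v"
  proof (cases "v \<in> L")
    case True
    then show ?thesis using l assms by metis
  next
    case False
    then show ?thesis using assms(1,2) by (metis in_keys_iff subsetD)
  qed
qed

lemma unit_sign: "Poly_Mapping.keys m \<subseteq> L \<Longrightarrow> mono_eval s m * mono_eval s m = 1"
proof -
  assume m: "Poly_Mapping.keys m \<subseteq> L"
  have "mono_eval s m * mono_eval s m = mono_eval (\<lambda>v. s v * s v) m" by (simp add: mono_eval_scale)
  also have "\<dots> = mono_eval (\<lambda>_. 1) m" using m ss by (intro mono_eval_cong) auto
  finally show ?thesis by (simp add: mono_eval_def)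
qed

lemma lookup_relab:
  assumes f: "f \<in> mpolys L" and m: "Poly_Mapping.keys m \<subseteq> L"
  shows "Poly_Mapping.lookup (relab \<beta> s f) (pmap \<beta> m) = Poly_Mapping.lookup f m * of_int (mono_eval s m)"
proof -
  interpret r: comm_ring_hom "relab \<beta> s :: ('v, 'a) mpoly \<Rightarrow> ('w, 'a) mpoly" by (rule comm_ring_hom_relab)
  have "relab \<beta> s f = (\<Sum>k\<in>Poly_Mapping.keys f. Poly_Mapping.single (pmap \<beta> k) (Poly_Mapping.lookup f k * of_int (mono_eval s k)))"
    by (subst poly_mapping_as_sum[of f]) (simp add: r.hom_sum relab_single)
  then have "Poly_Mapping.lookup (relab \<beta> s f) (pmap \<beta> m) =
      (\<Sum>k\<in>Poly_Mapping.keys f. Poly_Mapping.lookup f k * of_int (mono_eval s k) when pmap \<beta> k = pmap \<beta> m)"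
    by (simp add: lookup_sum lookup_single)
  also have "\<dots> = (\<Sum>k\<in>Poly_Mapping.keys f. if k = m then Poly_Mapping.lookup f k * of_int (mono_eval s k) else 0)"
  proof (rule sum.cong[OF refl])
    fix k assume "k \<in> Poly_Mapping.keys f"
    then have "Poly_Mapping.keys k \<subseteq> L" using f by (auto simp: mpolys_iff)
    then have "pmap \<beta> k = pmap \<beta> m \<longleftrightarrow> k = m" using pmap_inj m by blast
    then show "(Poly_Mapping.lookup f k * of_int (mono_eval s k) when pmap \<beta> k = pmap \<beta> m)
      = (if k = m then Poly_Mapping.lookup f k * of_int (mono_eval s k) else 0)" by (simp add: when_def)
  qed
  also have "\<dots> = Poly_Mapping.lookup f m * of_int (mono_eval s m)" by (simp add: in_keys_iff)
  finally show ?thesis .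
qed

lemma keys_relab_subset: "Poly_Mapping.keys (relab \<beta> s f) \<subseteq> pmap \<beta> ` Poly_Mapping.keys f"
proof -
  interpret r: comm_ring_hom "relab \<beta> s :: ('v, 'a) mpoly \<Rightarrow> ('w, 'a) mpoly" by (rule comm_ring_hom_relab)
  have "relab \<beta> s f = (\<Sum>k\<in>Poly_Mapping.keys f. Poly_Mapping.single (pmap \<beta> k) (Poly_Mapping.lookup f k * of_int (mono_eval s k)))"
    by (subst poly_mapping_as_sum[of f]) (simp add: r.hom_sum relab_single)
  then have "Poly_Mapping.keys (relab \<beta> s f) \<subseteq> (\<Union>k\<in>Poly_Mapping.keys f. Poly_Mapping.keys (Poly_Mapping.single (pmap \<beta> k) (Poly_Mapping.lookup f k * of_int (mono_eval s k))))"
    using keys_sum by metis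
  then show ?thesis by (auto split: if_splits)
qed

lemma keys_relab:
  assumes f: "f \<in> mpolys L"
  shows "Poly_Mapping.keys (relab \<beta> s f) = pmap \<beta> ` Poly_Mapping.keys f"
proof (intro equalityI keys_relab_subset subsetI)
  fix k assume "k \<in> pmap \<beta> ` Poly_Mapping.keys f"
  then obtain m where m: "m \<in> Poly_Mapping.keys f" "k = pmap \<beta> m" by blast
  then have mL: "Poly_Mapping.keys m \<subseteq> L" using f by (auto simp: mpolys_iff)
  have "of_int (mono_eval s m) * of_int (mono_eval s m) = (1 :: 'a)"
    using unit_sign[OF mL] by (metis of_int_1 of_int_mult)
  then have "Poly_Mapping.lookup f m = Poly_Mapping.lookup f m * of_int (mono_eval s m) * of_int (mono_eval s m)"
    by (simp add: mult.assoc)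
  then have "Poly_Mapping.lookup f m * of_int (mono_eval s m) \<noteq> 0"
    using m(1) by (metis in_keys_iff mult_zero_left)
  then show "k \<in> Poly_Mapping.keys (relab \<beta> s f)"
    unfolding m(2) in_keys_iff lookup_relab[OF f mL] .
qed

lemma homogeneous_relab: "homogeneous d f \<Longrightarrow> homogeneous d (relab \<beta> s f)"
  unfolding homogeneous_iff using keys_relab_subset pmap_mdeg by fastforce

lemma initial_form_relab:
  assumes f: "f \<in> mpolys L"
  shows "initial_form w (relab \<beta> s f) = relab \<beta> s (initial_form (\<lambda>v. w (\<beta> v)) f)"
proof (rule poly_mapping_eqI)
  fix k
  let ?i = "initial_form (\<lambda>v. w (\<beta> v)) f"
  have i: "?i \<in> mpolys L" by (rule mpolys_initial_form[OF f])
  show "Poly_Mapping.lookup (initial_form w (relab \<beta> s f)) k = Poly_Mapping.lookup (relab \<beta> s ?i) k"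
  proof (cases "k \<in> pmap \<beta> ` Poly_Mapping.keys f")
    case True
    then obtain m where m: "m \<in> Poly_Mapping.keys f" "k = pmap \<beta> m" by blast
    then have mL: "Poly_Mapping.keys m \<subseteq> L" using f by (auto simp: mpolys_iff)
    show ?thesis
      unfolding m(2) lookup_relab[OF i mL] lookup_initial_form keys_relab[OF f] lookup_relab[OF f mL]
      by (simp add: pmap_weight)
  next
    case False
    then have 1: "Poly_Mapping.lookup (relab \<beta> s f) k = 0"
      using keys_relab[OF f] by (auto simp: in_keys_iff)
    have "k \<notin> Poly_Mapping.keys (relab \<beta> s ?i)"
      using False keys_relab_subset[of ?i] by (auto simp: keys_initial_form)
    then show ?thesis using 1 by (simp add: lookup_initial_form in_keys_iff)
  qed
qed

lemma mspan_relab: "mspan (relab \<beta> s ` S) = relab \<beta> s ` mspan S"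
proof -
  interpret r: comm_ring_hom "relab \<beta> s :: ('v, complex) mpoly \<Rightarrow> ('w, complex) mpoly" by (rule comm_ring_hom_relab)
  show ?thesis
  proof (rule equalityI)
    show "mspan (relab \<beta> s ` S) \<subseteq> relab \<beta> s ` mspan S"
    proof (rule mspan_least)
      show "relab \<beta> s ` S \<subseteq> relab \<beta> s ` mspan S" using mspan_superset by blast
      show "0 \<in> relab \<beta> s ` mspan S" using mspan_zero r.hom_zero by (metis imageI)
      show "f + g \<in> relab \<beta> s ` mspan S" if fg: "f \<in> relab \<beta> s ` mspan S" "g \<in> relab \<beta> s ` mspan S" for f g
      proof -
        obtain f' g' where "f' \<in> mspan S" "g' \<in> mspan S" "f = relab \<beta> s f'" "g = relab \<beta> s g'" using fg by blast
        then show ?thesis by (intro image_eqI[of _ _ "f' + g'"]) (simp_all add: r.hom_add mspan_add)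
      qed
      show "Const c * f \<in> relab \<beta> s ` mspan S" if fg: "f \<in> relab \<beta> s ` mspan S" for c f
      proof -
        obtain f' where "f' \<in> mspan S" "f = relab \<beta> s f'" using fg by blast
        then show ?thesis by (intro image_eqI[of _ _ "Const c * f'"]) (simp_all add: r.hom_mult relab_Const mspan_scale)
      qed
    qed
    have "mspan S \<subseteq> {f. relab \<beta> s f \<in> mspan (relab \<beta> s ` S)}"
    proof (rule mspan_least)
      show "S \<subseteq> {f. relab \<beta> s f \<in> mspan (relab \<beta> s ` S)}"
        using mspan_superset[of "relab \<beta> s ` S"] unfolding image_subset_iff by auto
      show "0 \<in> {f. relab \<beta> s f \<in> mspan (relab \<beta> s ` S)}" by (simp add: mspan_zero)
      show "f + g \<in> {f. relab \<beta> s f \<in> mspan (relab \<beta> s ` S)}"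
        if "f \<in> {f. relab \<beta> s f \<in> mspan (relab \<beta> s ` S)}" "g \<in> {f. relab \<beta> s f \<in> mspan (relab \<beta> s ` S)}" for f g
        using that mspan_add unfolding mem_Collect_eq r.hom_add by blast
      show "Const c * f \<in> {f. relab \<beta> s f \<in> mspan (relab \<beta> s ` S)}"
        if "f \<in> {f. relab \<beta> s f \<in> mspan (relab \<beta> s ` S)}" for c f
        using that mspan_scale unfolding mem_Collect_eq r.hom_mult relab_Const by blast
    qed
    then show "relab \<beta> s ` mspan S \<subseteq> mspan (relab \<beta> s ` S)" by (auto dest: subsetD)
  qed
qed

lemma is_initial_ideal_relab:
  assumes H: "H \<subseteq> mpolys L" and J: "is_initial_ideal J (relab \<beta> s ` H)"
  shows "\<exists>w. J = relab \<beta> s ` mspan (initial_form w ` H)"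
proof -
  obtain w where w: "J = mspan (initial_form w ` relab \<beta> s ` H)" using J by (auto simp: is_initial_ideal_def)
  have "initial_form w ` relab \<beta> s ` H = relab \<beta> s ` initial_form (\<lambda>v. w (\<beta> v)) ` H"
    unfolding image_image by (rule image_cong[OF refl]) (use H initial_form_relab in auto)
  then show ?thesis unfolding w by (auto simp: mspan_relab)
qed

lemma relab_image_inj: "A \<subseteq> mpolys L \<Longrightarrow> B \<subseteq> mpolys L \<Longrightarrow> relab \<beta> s ` A = relab \<beta> s ` B \<Longrightarrow> A = B"
  by (rule inj_on_image_eq_iff[THEN iffD1, of "relab \<beta> s" "mpolys L"])
    (auto intro!: inj_on_inverseI[of _ "relab \<gamma> (\<lambda>a. s (\<gamma> a))"] relab_inverse)

lemma pull_line: "pull L \<beta> s ` line x = line (pull L \<beta> s x)"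
proof -
  have "pull L \<beta> s (\<lambda>a. c * x a) = (\<lambda>v. c * pull L \<beta> s x v)" for c
    by (auto simp: pull_def)
  then show ?thesis by (simp add: line_range image_image)
qed

lemma pull_proj_space:
  assumes "M \<in> proj_space V"
  shows "pull L \<beta> s ` M \<in> proj_space L" "pull V \<gamma> (\<lambda>a. s (\<gamma> a)) ` pull L \<beta> s ` M = M"
proof -
  obtain x a where x: "M = line x" "\<And>a. a \<notin> V \<Longrightarrow> x a = 0" "x a \<noteq> 0" using assms by (auto simp: proj_space_def)
  have bk: "pull V \<gamma> (\<lambda>a. s (\<gamma> a)) (pull L \<beta> s x) = x" by (rule pull_inverse'[OF x(2)])
  have "pull L \<beta> s x \<noteq> (\<lambda>_. 0)"
  proof
    assume "pull L \<beta> s x = (\<lambda>_. 0)"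
    then have "x a = pull V \<gamma> (\<lambda>a. s (\<gamma> a)) (\<lambda>_. 0) a" using bk by simp
    then show False using x(3) by (cases "a \<in> V") (simp_all add: pull_def)
  qed
  then obtain v where "pull L \<beta> s x v \<noteq> 0" by auto
  then show "pull L \<beta> s ` M \<in> proj_space L"
    unfolding x(1) pull_line by (rule line_in_proj_space[rotated]) (simp add: pull_def)
  show "pull V \<gamma> (\<lambda>a. s (\<gamma> a)) ` pull L \<beta> s ` M = M"
    unfolding x(1) pull_line relabelling.pull_line[OF inverse] bk ..
qed

lemma pull_zero_set:
  assumes F: "F \<subseteq> mpolys L" and M: "M \<in> proj_space V"
  shows "pull L \<beta> s ` M \<in> zero_set L F \<longleftrightarrow> M \<in> zero_set V (relab \<beta> s ` F)"
  using F M pull_proj_space(1)[OF M] eval_relab unfolding zero_set_def by (auto simp: subset_iff)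

lemma pull_image_zero_set:
  assumes F: "F \<subseteq> mpolys L"
  shows "(`) (pull L \<beta> s) ` zero_set V (relab \<beta> s ` F) = zero_set L F"
proof (intro equalityI subsetI)
  fix N assume "N \<in> (`) (pull L \<beta> s) ` zero_set V (relab \<beta> s ` F)"
  then show "N \<in> zero_set L F" using pull_zero_set[OF F] proj_space_zero_set by blast
next
  fix N assume N: "N \<in> zero_set L F"
  interpret inv: relabelling V L \<gamma> \<beta> "\<lambda>a. s (\<gamma> a)" by (rule inverse)
  let ?M = "pull V \<gamma> (\<lambda>a. s (\<gamma> a)) ` N"
  have NL: "N \<in> proj_space L" using N by (auto simp: zero_set_def)
  then have MV: "?M \<in> proj_space V" by (rule inv.pull_proj_space(1))
  have "pull L \<beta> s ` ?M = N"
  proof -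
    have "pull L \<beta> s (pull V \<gamma> (\<lambda>a. s (\<gamma> a)) y) = y" if "y \<in> N" for y
      using proj_space_support[OF NL that] by (rule pull_inverse)
    then show ?thesis by (force simp: image_image)
  qed
  then show "N \<in> (`) (pull L \<beta> s) ` zero_set V (relab \<beta> s ` F)"
    using pull_zero_set[OF F MV] N by (metis imageI)
qed

lemma pull_zariski_closed:
  assumes "zariski_closed V A"
  shows "zariski_closed L ((`) (pull L \<beta> s) ` A)"
proof -
  interpret inv: relabelling V L \<gamma> \<beta> "\<lambda>a. s (\<gamma> a)" by (rule inverse)
  obtain S where S: "S \<subseteq> mpolys V" "\<forall>f\<in>S. \<exists>d. homogeneous d f" "A = zero_set V S"
    using assms unfolding zariski_closed_def by blast
  let ?F = "relab \<gamma> (\<lambda>a. s (\<gamma> a)) ` S"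
  have F: "?F \<subseteq> mpolys L" using S(1) inv_relab_mpolys by blast
  have "relab \<beta> s ` ?F = S" using S(1) relab_inverse' by (force simp: image_image)
  then have "(`) (pull L \<beta> s) ` A = zero_set L ?F" using pull_image_zero_set[OF F] S(3) by simp
  moreover have "\<forall>f\<in>?F. \<exists>d. homogeneous d f" using S(2) inv.homogeneous_relab by blast
  ultimately show ?thesis using F unfolding zariski_closed_def by blast
qed

lemma pull_irreducible:
  assumes Z: "Z \<subseteq> proj_space V" and irr: "zariski_irreducible L ((`) (pull L \<beta> s) ` Z)"
  shows "zariski_irreducible V Z"
  unfolding zariski_irreducible_def
proof (intro conjI allI impI)
  let ?p = "(`) (pull L \<beta> s)"
  show "Z \<noteq> {}" using irr by (auto simp: zariski_irreducible_def)
  fix A B assume AB: "zariski_closed V A \<and> zariski_closed V B \<and> Z \<subseteq> A \<union> B"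
  have sub: "A \<subseteq> proj_space V" "B \<subseteq> proj_space V" using AB proj_space_zero_set unfolding zariski_closed_def by blast+
  have inj: "inj_on ?p (proj_space V)" by (rule inj_on_inverseI[of _ "(`) (pull V \<gamma> (\<lambda>a. s (\<gamma> a)))"]) (rule pull_proj_space(2))
  have "?p ` Z \<subseteq> ?p ` A \<union> ?p ` B" using AB by blast
  then have "?p ` Z \<subseteq> ?p ` A \<or> ?p ` Z \<subseteq> ?p ` B"
    using irr pull_zariski_closed[of A] pull_zariski_closed[of B] AB unfolding zariski_irreducible_def by simp
  moreover have "Z \<subseteq> C" if C: "?p ` Z \<subseteq> ?p ` C" "C \<subseteq> proj_space V" for C
  proof
    fix M assume M: "M \<in> Z"
    then have "?p M \<in> ?p ` C" using C(1) by blast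
    moreover have "M \<in> proj_space V" using M Z by blast
    ultimately show "M \<in> C" using inj_on_image_mem_iff[OF inj _ C(2)] by simp
  qed
  ultimately show "Z \<subseteq> A \<or> Z \<subseteq> B" using sub by metis
qed

end

section \<open>Irreducible components\<close>

text \<open>Products of equations cut out the union; homogeneity lets vanishing on a line be tested
  at one representative.\<close>

lemma zariski_closed_Un:
  fixes A B :: "'v point set"
  assumes A: "zariski_closed V A" and B: "zariski_closed V B"
  shows "zariski_closed V (A \<union> B)"
proof -
  obtain S T where S: "S \<subseteq> mpolys V" "\<forall>f\<in>S. \<exists>d. homogeneous d f" "A = zero_set V S"
    and T: "T \<subseteq> mpolys V" "\<forall>f\<in>T. \<exists>d. homogeneous d f" "B = zero_set V T"
    using A B unfolding zariski_closed_def by blast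
  define U where "U = {f * g | f g. f \<in> S \<and> g \<in> T}"
  have ev: "eval_at x (f * g) = eval_at x f * eval_at x g" for x :: "'v \<Rightarrow> complex" and f g
    by (rule subst_mult[OF comm_ring_hom_id])
  have sc: "eval_at (\<lambda>v. c * x v) f = c ^ d * eval_at x f" if "homogeneous d f" for c d and x :: "'v \<Rightarrow> complex" and f
    unfolding subst_def' sum_distrib_left
  proof (rule sum.cong[OF refl])
    fix m assume "m \<in> Poly_Mapping.keys f"
    then have "mdeg m = d" using that by (simp add: homogeneous_iff)
    then have "mono_eval (\<lambda>_. c) m = c ^ d" by (simp add: mono_eval_def mdeg_def flip: power_sum)
    then show "Poly_Mapping.lookup f m * mono_eval (\<lambda>v. c * x v) m = c ^ d * (Poly_Mapping.lookup f m * mono_eval x m)"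
      by (simp add: mono_eval_scale mult.left_commute)
  qed
  have line0: "eval_at y f = 0" if "\<exists>d. homogeneous d f" "eval_at x f = 0" "y \<in> line x" for x y :: "'v \<Rightarrow> complex" and f
    using that sc by (auto simp: line_def)
  have "A \<union> B = zero_set V U"
  proof (intro equalityI subsetI)
    fix M assume "M \<in> A \<union> B"
    then show "M \<in> zero_set V U" unfolding S(3) T(3) U_def zero_set_def by (auto simp: ev)
  next
    fix M assume M: "M \<in> zero_set V U"
    then obtain x where x: "M = line x" by (auto simp: zero_set_def proj_space_def)
    have fg: "eval_at x f = 0 \<or> eval_at x g = 0" if "f \<in> S" "g \<in> T" for f g
    proof -
      have "f * g \<in> U" using that unfolding U_def by blast
      then have "eval_at x (f * g) = 0" using M mem_line[of x] unfolding zero_set_def x by blast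
      then show ?thesis by (simp add: ev)
    qed
    show "M \<in> A \<union> B"
    proof (cases "\<forall>f\<in>S. eval_at x f = 0")
      case True
      then have "M \<in> zero_set V S" using M S(2) line0 unfolding zero_set_def x by blast
      then show ?thesis unfolding S(3) by blast
    next
      case False
      then have "\<forall>g\<in>T. eval_at x g = 0" using fg by blast
      then have "M \<in> zero_set V T" using M T(2) line0 unfolding zero_set_def x by blast
      then show ?thesis unfolding T(3) by blast
    qed
  qed
  moreover have "U \<subseteq> mpolys V" using S(1) T(1) mpolys_mult unfolding U_def by blast
  moreover have "\<exists>d. homogeneous d h" if h: "h \<in> U" for h
  proof -
    obtain f g where fg: "h = f * g" "f \<in> S" "g \<in> T" using h by (auto simp: U_def)
    obtain d e where "homogeneous d f" "homogeneous e g" using S(2) T(2) fg by blast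
    then have "homogeneous (d + e) h"
      unfolding homogeneous_iff fg(1) using keys_mult[of f g] by fastforce
    then show ?thesis by blast
  qed
  ultimately show ?thesis unfolding zariski_closed_def by blast
qed

lemma irreducible_subset_finite_union:
  assumes "finite F" and "\<And>C. C \<in> F \<Longrightarrow> zariski_closed V C" and "zariski_irreducible V Z" and "Z \<subseteq> \<Union>F"
  shows "\<exists>C\<in>F. Z \<subseteq> C"
proof -
  have cl: "zariski_closed V (\<Union>F)" if "finite F" "\<And>C. C \<in> F \<Longrightarrow> zariski_closed V C" for F
    using that by (induction F) (auto simp: zariski_closed_empty intro: zariski_closed_Un)
  show ?thesis using assms(1,2,4)
  proof (induction F)
    case empty
    then show ?case using assms(3) by (auto simp: zariski_irreducible_def)
  next
    case (insert C F)
    have C: "zariski_closed V C" and F: "\<And>C. C \<in> F \<Longrightarrow> zariski_closed V C" using insert.prems(1) by blast+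
    have "zariski_closed V (\<Union>F)" by (rule cl[OF insert.hyps(1) F])
    moreover have "Z \<subseteq> C \<union> \<Union>F" using insert.prems(2) by simp
    ultimately consider "Z \<subseteq> C" | "Z \<subseteq> \<Union>F" using assms(3) C unfolding zariski_irreducible_def by metis
    then show ?case
    proof cases
      case 2
      then show ?thesis using insert.IH[OF F] by blast
    qed blast
  qed
qed

context finite_poset
begin

text \<open>Viewed in the larger space, the variety is the zero set of the vanishing ideal of the
  extended torus points, which contains the variables outside \<sigma>.\<close>

lemma zariski_closed_kernel_on:
  assumes \<sigma>: "\<sigma> \<subseteq> ideals"
  shows "zariski_closed ideals (zero_set \<sigma> (kernel_on \<sigma>))"
proof -
  let ?\<Theta> = "range (torus_point \<sigma>)"
  have vc: "vcone ?\<Theta>"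
    unfolding vcone_def
  proof (intro ballI allI)
    fix x c assume "x \<in> ?\<Theta>"
    then obtain z where "x = torus_point \<sigma> z" by blast
    then have "(\<lambda>J. c * x J) = torus_point \<sigma> (z(None := c * z None))" by (auto simp: torus_point_def fun_eq_iff)
    then show "(\<lambda>J. c * x J) \<in> ?\<Theta>" by blast
  qed
  have ker: "f \<in> kernel_on \<sigma> \<longleftrightarrow> f \<in> mpolys \<sigma> \<and> (\<forall>z. eval_at (torus_point \<sigma> z) f = 0)" for f
    unfolding kernel_on_def using eval_all_0_imp_0[of "relative_hibi_map r f"]
    by (auto simp: eval_torus_point restrict_vars_id)
  have "zero_set \<sigma> (kernel_on \<sigma>) = zero_set ideals (van ideals ?\<Theta>)"
  proof (intro equalityI subsetI)
    fix M assume M: "M \<in> zero_set \<sigma> (kernel_on \<sigma>)"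
    then have Ms: "M \<in> proj_space \<sigma>" by (simp add: zero_set_def)
    then have "M \<in> proj_space ideals" using \<sigma> unfolding proj_space_def by blast
    moreover have "eval_at x f = 0" if f: "f \<in> van ideals ?\<Theta>" and x: "x \<in> M" for x f
    proof -
      have xs: "x = (\<lambda>J. if J \<in> \<sigma> then x J else 0)" using proj_space_support[OF Ms x] by auto
      have ts: "torus_point \<sigma> z = (\<lambda>J. if J \<in> \<sigma> then torus_point \<sigma> z J else 0)" for z by (auto simp: torus_point_def)
      have "eval_at (torus_point \<sigma> z) (restrict_vars \<sigma> f) = 0" for z
        unfolding eval_restrict_vars ts[symmetric] using f by (simp add: van_iff)
      then have "restrict_vars \<sigma> f \<in> kernel_on \<sigma>" unfolding ker using restrict_vars_mpolys by blast
      then have "eval_at x (restrict_vars \<sigma> f) = 0" using M x by (simp add: zero_set_def)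
      then show ?thesis unfolding eval_restrict_vars xs[symmetric] .
    qed
    ultimately show "M \<in> zero_set ideals (van ideals ?\<Theta>)" by (simp add: zero_set_def)
  next
    fix M assume M: "M \<in> zero_set ideals (van ideals ?\<Theta>)"
    then have z: "eval_at x f = 0" if "f \<in> van ideals ?\<Theta>" "x \<in> M" for x f using that by (simp add: zero_set_def)
    obtain x u where x: "M = line x" "\<And>J. J \<notin> ideals \<Longrightarrow> x J = 0" "x u \<noteq> 0"
      using M by (auto simp: zero_set_def proj_space_def)
    have "x J = 0" if "J \<notin> \<sigma>" for J
    proof (cases "J \<in> ideals")
      case True
      then have "Var J \<in> van ideals ?\<Theta>" using that by (auto simp: van_iff subst_Var torus_point_def)
      then have "eval_at x (Var J) = 0" using z mem_line unfolding x(1) by blast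
      then show ?thesis by (simp add: subst_Var)
    qed (rule x(2))
    then have "M \<in> proj_space \<sigma>" unfolding x(1) using x(3) by (rule line_in_proj_space)
    moreover have "f \<in> van ideals ?\<Theta>" if "f \<in> kernel_on \<sigma>" for f
      using that mpolys_mono[OF \<sigma>] unfolding ker van_iff by blast
    ultimately show "M \<in> zero_set \<sigma> (kernel_on \<sigma>)" using z unfolding zero_set_def by blast
  qed
  then show ?thesis using zariski_closed_zero_set_van[OF vc] by simp
qed

end

context grassmann_poset
begin

lemma sorting_permutation:
  assumes c: "inj_on c {1..k}"
  defines "\<sigma> \<equiv> THE \<sigma>. \<sigma> permutes {1..k} \<and> strict_mono_on {1..k} (c \<circ> \<sigma>)"
  shows "\<sigma> permutes {1..k}" "q \<in> {1..k} \<Longrightarrow> c (\<sigma> q) = enum (c ` {1..k}) q"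
proof -
  let ?X = "c ` {1..k}"
  have card: "card ?X = k" using c by (simp add: card_image)
  have e: "bij_betw (enum ?X) {1..k} ?X" using enum_bij[of ?X] card by simp
  define \<rho> where "\<rho> q = (if q \<in> {1..k} then inv_into {1..k} c (enum ?X q) else q)" for q
  have "bij_betw (inv_into {1..k} c) ?X {1..k}" by (intro bij_betw_inv_into) (use c in \<open>simp add: bij_betw_def\<close>)
  with e have "bij_betw (inv_into {1..k} c \<circ> enum ?X) {1..k} {1..k}" by (rule bij_betw_trans)
  then have "bij_betw \<rho> {1..k} {1..k}" by (rule bij_betw_cong[THEN iffD1, rotated]) (simp add: \<rho>_def)
  then have \<rho>: "\<rho> permutes {1..k}" by (intro bij_imp_permutes) (auto simp: \<rho>_def)
  have cq: "c (\<rho> q) = enum ?X q" if "q \<in> {1..k}" for q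
  proof -
    have "enum ?X q \<in> ?X" using bij_betwE[OF e] that by blast
    then show ?thesis using that by (simp add: \<rho>_def f_inv_into_f)
  qed
  have mono: "strict_mono_on {1..k} (c \<circ> \<rho>)"
    using enum_less[of ?X] card by (intro strict_mono_onI) (auto simp: cq)
  have "\<sigma> = \<rho>"
    unfolding \<sigma>_def
  proof (rule the_equality)
    show "\<rho> permutes {1..k} \<and> strict_mono_on {1..k} (c \<circ> \<rho>)" using \<rho> mono by blast
    fix \<tau> assume \<tau>: "\<tau> permutes {1..k} \<and> strict_mono_on {1..k} (c \<circ> \<tau>)"
    \<comment> \<open>Subtracting from the maximum turns increasing sequences into decreasing ones,
      so \<open>decreasing_bij_unique\<close> applies; no value exceeds the maximum, so the
      truncated subtraction loses nothing.\<close>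
    have im: "(\<lambda>q. Max ?X - c (\<pi> q)) ` {1..k} = (\<lambda>x. Max ?X - x) ` ?X" if "\<pi> permutes {1..k}" for \<pi>
      using permutes_image[OF that] by (metis image_image)
    have mx: "c (\<pi> q) \<in> ?X \<and> c (\<pi> q) \<le> Max ?X" if "\<pi> permutes {1..k}" "q \<in> {1..k}" for \<pi> q
      using permutes_in_image[OF that(1), of q] that(2) by (intro conjI Max_ge) auto
    have dec: "Max ?X - c (\<pi> j) < Max ?X - c (\<pi> i)"
      if "\<pi> permutes {1..k}" "strict_mono_on {1..k} (c \<circ> \<pi>)" "i \<in> {1..k}" "j \<in> {1..k}" "i < j" for \<pi> i j
    proof -
      have "c (\<pi> i) < c (\<pi> j)" using strict_mono_onD[OF that(2-5)] by simp
      then show ?thesis using mx[OF that(1,4)] by linarith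
    qed
    show "\<tau> = \<rho>"
    proof
      fix q
      show "\<tau> q = \<rho> q"
      proof (cases "q \<in> {1..k}")
        case True
        have "Max ?X - c (\<tau> q) = Max ?X - c (\<rho> q)"
        proof (rule decreasing_bij_unique[of "{1..k}" "\<lambda>q. Max ?X - c (\<tau> q)" "\<lambda>q. Max ?X - c (\<rho> q)" q])
          show "(\<lambda>q. Max ?X - c (\<tau> q)) ` {1..k} = (\<lambda>q. Max ?X - c (\<rho> q)) ` {1..k}"
            using im[of \<tau>] im[OF \<rho>] \<tau> by simp
        qed (use dec \<tau> \<rho> mono True in auto)
        then have "c (\<tau> q) = c (\<rho> q)" using mx[OF _ True, of \<tau>] mx[OF \<rho> True] \<tau> by linarith
        then show ?thesis
          using inj_onD[OF c] permutes_in_image[of \<tau> "{1..k}" q] permutes_in_image[OF \<rho>, of q] \<tau> True by blast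
      next
        case False
        then show ?thesis using permutes_not_in \<tau> \<rho> by metis
      qed
    qed
  qed
  then show "\<sigma> permutes {1..k}" "q \<in> {1..k} \<Longrightarrow> c (\<sigma> q) = enum (c ` {1..k}) q" using \<rho> cq by auto
qed

definition sg :: "(nat \<times> nat) set \<Rightarrow> int" where
  "sg J = sign (THE \<sigma>. \<sigma> permutes {1..k} \<and> strict_mono_on {1..k} (alpha k n J \<circ> \<sigma>))"

lemma sg_sq: "sg J * sg J = 1"
  by (simp add: sg_def sign_def)

lemma psi_relab: "psi_C_inv k n = relab aset sg"
  unfolding psi_C_inv_def relab_def pluecker_var_def aset_def sg_def ..

text \<open>The sign in \<open>pluecker_var\<close> is the one relating the unsorted minor to the
  sorted one, so \<open>psi_C_inv\<close> matches the two descriptions of the Grassmannian.\<close>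

lemma phat_eq_pl:
  assumes J: "J \<in> ideals"
  shows "phat A J = of_int (sg J) * pl k A (aset J)"
proof -
  let ?c = "alpha k n J"
  define \<sigma> where "\<sigma> = (THE \<sigma>. \<sigma> permutes {1..k} \<and> strict_mono_on {1..k} (?c \<circ> \<sigma>))"
  note \<sigma> = sorting_permutation[OF alpha_inj[OF J], folded \<sigma>_def]
  have "pl k A (aset J) = ldet {1..k} (\<lambda>i q. A i (?c (\<sigma> q)))"
    unfolding pl_def aset_def by (rule ldet_cong) (simp add: \<sigma>(2))
  also have "\<dots> = of_int (sg J) * phat A J"
    unfolding phat_def sg_def \<sigma>_def[symmetric] by (rule ldet_permute_cols[OF _ \<sigma>(1)]) simp
  finally have "of_int (sg J) * pl k A (aset J) = of_int (sg J * sg J) * phat A J" by simp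
  then show ?thesis by (simp add: sg_sq)
qed

lemma relabelling_aset:
  assumes "k \<le> n"
  shows "relabelling ideals (pluecker_indices k n) aset (inv_into ideals aset) sg"
proof
  note b = aset_bij[OF assms]
  show "aset J \<in> pluecker_indices k n" if "J \<in> ideals" for J using bij_betwE[OF b] that by blast
  show "inv_into ideals aset a \<in> ideals" if "a \<in> pluecker_indices k n" for a
    using bij_betwE[OF bij_betw_inv_into[OF b]] that by blast
  show "inv_into ideals aset (aset J) = J" if "J \<in> ideals" for J using b that by (simp add: bij_betw_def)
  show "aset (inv_into ideals aset a) = a" if "a \<in> pluecker_indices k n" for a
    using b that by (simp add: bij_betw_def f_inv_into_f)
  show "sg J * sg J = 1" for J by (rule sg_sq)
qed

lemma pull_grV:
  assumes "k \<le> n"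
  shows "pull ideals aset sg ` grV k n = gr_points"
proof -
  have "pull ideals aset sg (\<lambda>a. if a \<in> pluecker_indices k n then c * pl k A a else 0)
      = (\<lambda>J. if J \<in> ideals then c * phat A J else 0)" for c A
    using aset_index[OF assms] phat_eq_pl by (auto simp: pull_def)
  then show ?thesis unfolding grV_def gr_points_def by (auto simp: image_iff) metis+
qed

lemma eval_Var: "eval_at x (Var v) = x v"
  by (rule subst_Var) simp_all

lemma psi_C_point_pull: "psi_C_point k n M = pull ideals aset sg ` M"
  unfolding psi_C_point_def psi_relab subst_relab[OF comm_ring_hom_id] pull_def[abs_def] eval_Var ..

text \<open>Both hypotheses are pulled back along the signed relabelling to the ideal variables,
  where \<open>I\<close> becomes \<open>rel_ideal w\<close>; the family and its limit are then
  pushed forward again.\<close>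

lemma degeneration:
  fixes I :: "(nat set, complex) mpoly set"
  assumes kn: "k \<le> n"
    and I: "is_initial_ideal I (psi_C_inv k n ` hibi_li_ideal (Pk k n) (Pk_less k n))"
    and M: "is_initial_ideal (psi_C_inv k n ` incomparable_ideal (Pk k n) (Pk_less k n)) I"
  shows "flat_degeneration (pluecker_indices k n) (zero_set (pluecker_indices k n) I) (grassmannian_variety k n)"
    and "Z \<in> irreducible_components (pluecker_indices k n) (zero_set (pluecker_indices k n) I) \<Longrightarrow>
      \<exists>r'. star_closed_extension (Pk k n) r' (Pk_less k n) \<and>
        psi_C_point k n ` Z = relative_hibi_variety (Pk k n) r' (Pk_less k n)"
proof -
  let ?V = "pluecker_indices k n" and ?\<gamma> = "inv_into ideals aset"
  let ?s = "\<lambda>a. sg (?\<gamma> a)" and ?\<Psi> = "relab aset sg :: ((nat \<times> nat) set, complex) mpoly \<Rightarrow> _"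
  let ?H = "hibi_li_ideal (Pk k n) (Pk_less k n)" and ?M = "incomparable_ideal (Pk k n) (Pk_less k n)"
  interpret R: relabelling ideals ?V aset ?\<gamma> sg by (rule relabelling_aset[OF kn])
  interpret inv: relabelling ?V ideals ?\<gamma> aset ?s by (rule R.inverse)
  have "ideal ?H (mpoly_ring ideals)"
    unfolding hibi_li_ideal_def
    by (rule ideal_genideal) (auto intro!: mpolys_diff mpolys_mult mpolys_Var simp: ideals_un st_in_ideals)
  moreover have "ideal ?M (mpoly_ring ideals)"
    unfolding incomparable_ideal_def by (rule ideal_genideal) (auto intro!: mpolys_mult mpolys_Var)
  ultimately have H: "ideal ?H (mpoly_ring ideals)" "?H \<subseteq> mpolys ideals" "?M \<subseteq> mpolys ideals"
    by (auto simp: ideal_mpoly_ring_iff)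
  obtain w1 where w1: "I = ?\<Psi> ` mspan (initial_form w1 ` ?H)"
    using R.is_initial_ideal_relab[OF H(2) I[unfolded psi_relab]] by blast
  define IJ where "IJ = mspan (initial_form w1 ` ?H)"
  have "ideal IJ (mpoly_ring ideals)" unfolding IJ_def by (rule ideal_mspan_initial_forms[OF H(1)])
  moreover from this have "ideal (mspan (initial_form w ` IJ)) (mpoly_ring ideals)" for w by (rule ideal_mspan_initial_forms)
  ultimately have IJ: "IJ \<subseteq> mpolys ideals" "mspan (initial_form w ` IJ) \<subseteq> mpolys ideals" for w
    by (auto simp: ideal_mpoly_ring_iff)
  have I_eq: "I = ?\<Psi> ` IJ" unfolding IJ_def w1 ..
  obtain w2 where "?\<Psi> ` ?M = ?\<Psi> ` mspan (initial_form w2 ` IJ)"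
    using R.is_initial_ideal_relab[OF IJ(1) M[unfolded psi_relab I_eq]] by blast
  then have "?M = mspan (initial_form w2 ` IJ)" by (rule R.relab_image_inj[OF H(3) IJ(2)])
  then have "is_initial_ideal ?M IJ" "is_initial_ideal IJ ?H"
    unfolding is_initial_ideal_def IJ_def by blast+
  then obtain w where w: "supermodular w" "IJ = rel_ideal w"
    using initial_ideal_eq_rel_ideal by blast
  obtain u where u: "admissible w u" using ex_admissible[OF kn w(1)] .
  let ?Y = "pull ?V ?\<gamma> ?s ` cell_points w"
  have supp: "y J = 0" if y: "y \<in> cell_points w" and J: "J \<notin> ideals" for y J
  proof -
    obtain \<sigma> z ps where "y = torus_point \<sigma> z" "cell w ps \<sigma>" using y by (auto simp: cell_points_def)
    moreover from this have "J \<notin> \<sigma>" using cell_sub_ideals J by blast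
    ultimately show ?thesis by (simp add: torus_point_def)
  qed
  have Y: "pull ideals aset sg ` ?Y = cell_points w"
  proof -
    have "pull ideals aset sg (pull ?V ?\<gamma> ?s y) = y" if "y \<in> cell_points w" for y
      using supp[OF that] by (rule R.pull_inverse)
    then show ?thesis by (force simp: image_image)
  qed
  have IV: "I = van ?V ?Y"
    using R.relab_van[of ?Y] unfolding Y I_eq w(2) rel_ideal_eq_van[OF w(1)] .
  have vY: "vcone ?Y"
    unfolding vcone_def
  proof (intro ballI allI)
    fix x c assume "x \<in> ?Y"
    then obtain y where y: "y \<in> cell_points w" "x = pull ?V ?\<gamma> ?s y" by blast
    have "(\<lambda>J. c * y J) \<in> cell_points w" using vcone_cell_points y(1) unfolding vcone_def by blast
    moreover have "(\<lambda>a. c * x a) = pull ?V ?\<gamma> ?s (\<lambda>J. c * y J)" by (auto simp: y(2) pull_def)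
    ultimately show "(\<lambda>a. c * x a) \<in> ?Y" by blast
  qed
  have fib: "fibre_ideal 0 (weight_family ?V (grV k n) (\<lambda>a. u (?\<gamma> a))) = van ?V ?Y"
    unfolding R.relab_fibre_ideal pull_grV[OF kn] fibre_eq_rel_ideal[OF u] IV[symmetric] I_eq w(2) ..
  show "flat_degeneration ?V (zero_set ?V I) (grassmannian_variety k n)"
    unfolding grassmannian_variety_lines IV
    by (rule flat_degenerationI[OF vcone_grV zero_set_grV fib vY])
  let ?p = "(`) (pull ideals aset sg) :: nat set point \<Rightarrow> _" and ?q = "(`) (pull ?V ?\<gamma> ?s) :: (nat \<times> nat) set point \<Rightarrow> _"
  let ?\<Sigma> = "{\<sigma>. \<exists>ps. cell w ps \<sigma>}" and ?H = "\<lambda>\<sigma>. zero_set \<sigma> (kernel_on \<sigma>)"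
  have rel: "rel_ideal w \<subseteq> mpolys ideals" using IJ(1) w(2) by simp
  have un: "?p ` zero_set ?V I = (\<Union>\<sigma>\<in>?\<Sigma>. ?H \<sigma>)"
    unfolding I_eq w(2) R.pull_image_zero_set[OF rel] zero_set_rel_ideal[OF w(1)] ..
  have qp: "?q (?p M) = M" if "M \<in> zero_set ?V I" for M
    using that proj_space_zero_set by (intro R.pull_proj_space(2)) blast
  have XV: "zero_set ?V I = (\<Union>\<sigma>\<in>?\<Sigma>. ?q ` ?H \<sigma>)"
  proof -
    have "(\<lambda>M. ?q (?p M)) ` zero_set ?V I = (\<lambda>M. M) ` zero_set ?V I" by (rule image_cong[OF refl qp])
    then have "zero_set ?V I = ?q ` ?p ` zero_set ?V I" by (simp add: image_comp o_def)
    then show ?thesis unfolding un image_UN .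
  qed
  have sub: "?H \<sigma> \<subseteq> proj_space ideals" if "\<sigma> \<in> ?\<Sigma>" for \<sigma>
    using that cell_sub_ideals unfolding zero_set_def proj_space_def by blast
  have pq: "?p ` ?q ` ?H \<sigma> = ?H \<sigma>" if "\<sigma> \<in> ?\<Sigma>" for \<sigma>
  proof -
    have "?p (?q N) = N" if N: "N \<in> ?H \<sigma>" for N
    proof -
      have NI: "N \<in> proj_space ideals" using sub[OF \<open>\<sigma> \<in> ?\<Sigma>\<close>] N by blast
      have "pull ideals aset sg (pull ?V ?\<gamma> ?s y) = y" if "y \<in> N" for y
        using proj_space_support[OF NI that] by (rule R.pull_inverse)
      then show ?thesis by (force simp: image_image)
    qed
    then show ?thesis by (force simp: image_image)
  qed
  have fin: "finite ?\<Sigma>"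
    by (rule finite_subset[of _ "Pow ideals"]) (use cell_sub_ideals finite_ideals in auto)
  assume Z: "Z \<in> irreducible_components ?V (zero_set ?V I)"
  have "\<exists>C\<in>(\<lambda>\<sigma>. ?q ` ?H \<sigma>) ` ?\<Sigma>. Z \<subseteq> C"
  proof (rule irreducible_subset_finite_union)
    show "finite ((\<lambda>\<sigma>. ?q ` ?H \<sigma>) ` ?\<Sigma>)" using fin by simp
    show "zariski_closed ?V C" if C: "C \<in> (\<lambda>\<sigma>. ?q ` ?H \<sigma>) ` ?\<Sigma>" for C
    proof -
      obtain \<sigma> ps where \<sigma>: "cell w ps \<sigma>" "C = ?q ` ?H \<sigma>" using C by blast
      show ?thesis
        unfolding \<sigma>(2) by (rule inv.pull_zariski_closed[OF zariski_closed_kernel_on[OF cell_sub_ideals[OF \<sigma>(1)]]])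
    qed
    show "zariski_irreducible ?V Z" using Z by (simp add: irreducible_components_def)
    show "Z \<subseteq> \<Union>((\<lambda>\<sigma>. ?q ` ?H \<sigma>) ` ?\<Sigma>)" using Z XV by (simp add: irreducible_components_def)
  qed
  \<comment> \<open>The component lies in one of finitely many closed pieces; that piece is
    irreducible and inside the zero set, so maximality of the component gives equality.\<close>
  then obtain \<sigma> ps where \<sigma>: "cell w ps \<sigma>" "Z \<subseteq> ?q ` ?H \<sigma>" by blast
  then have \<sigma>': "\<sigma> \<in> ?\<Sigma>" by blast
  have CX: "?q ` ?H \<sigma> \<subseteq> zero_set ?V I" using XV \<sigma>' by blast
  have "zariski_irreducible ?V (?q ` ?H \<sigma>)"
  proof (rule R.pull_irreducible)
    show "?q ` ?H \<sigma> \<subseteq> proj_space ?V" using CX proj_space_zero_set by blast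
    show "zariski_irreducible ideals (?p ` ?q ` ?H \<sigma>)"
      unfolding pq[OF \<sigma>'] by (rule zariski_irreducible_cell[OF w(1) \<sigma>(1)])
  qed
  then have "?q ` ?H \<sigma> = Z" using Z \<sigma>(2) CX unfolding irreducible_components_def by blast
  then have "?p ` Z = ?H \<sigma>" using pq[OF \<sigma>'] by blast
  then have "psi_C_point k n ` Z = relative_hibi_variety (Pk k n) (cell_order \<sigma>) (Pk_less k n)"
    unfolding relative_hibi_variety_cell[OF w(1) \<sigma>(1)] psi_C_point_pull[abs_def] .
  then show "\<exists>r'. star_closed_extension (Pk k n) r' (Pk_less k n) \<and>
      psi_C_point k n ` Z = relative_hibi_variety (Pk k n) r' (Pk_less k n)"
    using cell_order_props(2)[OF w(1) \<sigma>(1)] by blast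
qed

end

theorem theorem2p4p7:
  fixes k n :: nat and I :: "(nat set, complex) mpoly set"
  assumes "k \<le> n"
    and "is_initial_ideal I (psi_C_inv k n ` hibi_li_ideal (Pk k n) (Pk_less k n))"
    and "is_initial_ideal (psi_C_inv k n ` incomparable_ideal (Pk k n) (Pk_less k n)) I"
  shows "flat_degeneration (pluecker_indices k n)
           (zero_set (pluecker_indices k n) I) (grassmannian_variety k n) \<and>
         (\<forall>Z \<in> irreducible_components (pluecker_indices k n) (zero_set (pluecker_indices k n) I).
            \<exists>r'. star_closed_extension (Pk k n) r' (Pk_less k n) \<and>
              psi_C_point k n ` Z = relative_hibi_variety (Pk k n) r' (Pk_less k n))"
  using grassmann_poset.degeneration[OF assms] by blast

end
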